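(* Let $G$ be a topological groupoid, $A$ a $G$-module, and $\mathcal{A}^\bullet$ the associated sheaf over $G_\bullet$. (a) For each open cover $\mathcal{U}_\bullet$ of $G_\bullet$, there is a canonical group isomorphism $$\mathrm{ext}_{\mathcal{U}}(G[\mathcal{U}_0],A[\mathcal{U}_0])\cong H^2(\mathcal{U}_\bullet;\mathcal{A}^\bullet),$$ where $\mathrm{ext}_{\mathcal{U}}(G[\mathcal{U}_0],A[\mathcal{U}_0])$ denotes the subgroup of $\mathrm{ext}(G[\mathcal{U}_0],A[\mathcal{U}_0])$ consisting of the extensions $A[\mathcal{U}_0]\to E\xrightarrow{\pi}G[\mathcal{U}_0]$ such that $\pi$ admits a continuous lifting over each open set $U^1_\lambda\subset G_1$ ($\lambda\in\Lambda_1$). (b) The isomorphisms in (a) induce an isomorphism $\mathrm{Ext}(G,A)\cong\check{H}^2(G_\bullet;\mathcal{A}^\bullet)$.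
   Context: **Simplicial notions.** $\Delta$ (resp. $\Delta'$) is the category with objects the nonnegative integers and morphisms $k\to n$ the nondecreasing (resp. strictly increasing) maps $[k]\to[n]$, $[n]=\{0,\dots,n\}$; $\Delta^{(N)}$ is the full subcategory of $\Delta$ on integers $\le N$. Simplicial, semi-simplicial, $N$-simplicial objects are contravariant functors from $\Delta,\Delta',\Delta^{(N)}$; the map induced by $f:[k]\to[n]$ is $\tilde f:M_n\to M_k$. $\varepsilon_i:[n-1]\to[n]$ is the increasing map avoiding $i$. An abelian sheaf $\mathcal{A}^\bullet$ on a simplicial space $M_\bullet$ is a sequence of abelian sheaves $\mathcal{A}^n$ on $M_n$ with compatible restriction maps $\tilde f^*:\mathcal{A}^k(V)\to\mathcal{A}^n(U)$ whenever $\tilde f(U)\subset V$, satisfying $\tilde f^*\tilde g^*=\widetilde{f\circ g}^*$. **Groupoids and modules.** A topological groupoid $G$ has unit space $G_0$, range and source maps $r,s$. $G_\bullet$ is its nerve: $G_n$ is the space of composable $(g_1,\dots,g_n)$ (so $G_1=G$), identified with classes $[\gamma_0,\dots,\gamma_n]$ of tuples with equal ranges modulo left multiplication via $g_i=\gamma_{i-1}^{-1}\gamma_i$; $\tilde f[\gamma_0,\dots,\gamma_n]=[\gamma_{f(0)},\dots,\gamma_{f(k)}]$. A $G$-module is a topological groupoid $A$ with unit space $G_0$, source and range both equal to $p:A\to G_0$, fibers $A_x$ abelian groups, with a continuous action $G\times_{s,p}A\to A$ such that each $A_{s(g)}\to A_{r(g)}$ is a group morphism. The associated sheaf: $\mathcal{A}^n(U)$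 is the group of continuous $\varphi:U\to A$ with $\varphi(g_1,\dots,g_n)\in A_{s(g_n)}$, and $(\tilde f^*\varphi)([\gamma_0,\dots,\gamma_n])=\gamma_n^{-1}\gamma_{f(k)}\varphi(\tilde f[\gamma_0,\dots,\gamma_n])$. **Čech cohomology.** An open cover $\mathcal{U}_\bullet$ of $M_\bullet$ is a sequence of open covers $\mathcal{U}_n=(U^n_i)_{i\in I_n}$ of $M_n$. Its $N$-skeleton admits an $N$-simplicial structure if $(I_n)_{n\le N}$ can be made an $N$-simplicial set with $\tilde f(U^n_i)\subset U^k_{\tilde f(i)}$ for all $f\in\mathrm{Hom}_\Delta(k,n)$, $k,n\le N$. Let $\mathcal{P}^k_n=\mathrm{Hom}_{\Delta'}(k,n)$, $\mathcal{P}_n=\bigcup_{k\le n}\mathcal{P}^k_n$ (identified with the nonempty subsets of $[n]$), $\Lambda_n$ the set of maps $\lambda:\mathcal{P}_n\to\bigcup_kI_k$ with $\lambda(\mathcal{P}_n^k)\subset I_k$, $U^n_\lambda=\bigcap_{k\le n}\bigcap_{f\in\mathcal{P}^k_n}\tilde f^{-1}(U^k_{\lambda(f)})$, and $(\tilde g\lambda')(f)=\lambda'(g\circ f)$. $C^n(\mathcal{U}_\bullet;\mathcal{A}^\bullet)=\prod_{\lambda\in\Lambda_n}\mathcal{A}^n(U^n_\lambda)$ with $(dc)_\lambda=\sum_{k=0}^{n+1}(-1)^k\tilde\varepsilon_k^*c_{\tilde\varepsilon_k(\lambda)}$; $H^n(\mathcal{U}_\bullet;\mathcal{A}^\bullet)$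 is its cohomology. $\mathcal{V}_\bullet=(V^n_j)_{j\in J_n}$ is finer than $\mathcal{U}_\bullet$ if there are $\theta_n:J_n\to I_n$ with $V^n_j\subset U^n_{\theta_n(j)}$; then $(\theta^*\varphi)_\lambda=$ restriction of $\varphi_{\theta\circ\lambda}$. On $H^n$ this is independent of $\theta$ if the $N$-skeleton of $\mathcal{V}_\bullet$ admits an $N$-simplicial structure with $N\ge n+1$, and $\check{H}^n(M_\bullet;\mathcal{A}^\bullet)=\varinjlim H^n(\mathcal{U}_\bullet;\mathcal{A}^\bullet)$ over open covers whose $N$-skeleton admits an $N$-simplicial structure for some $N\ge n+1$. For $M_\bullet=G_\bullet$ an element $\lambda\in\Lambda_1$ is a triple $(\lambda_0,\lambda_1,\lambda_{01})\in I_0\times I_0\times I_1$ and $U^1_\lambda=\{g\in G: r(g)\in U^0_{\lambda_0},\ s(g)\in U^0_{\lambda_1},\ g\in U^1_{\lambda_{01}}\}$, viewed inside $G[\mathcal{U}_0]$ as $\{(\lambda_0,g,\lambda_1): g\in U^1_\lambda\}$. **Cover groupoid.** For an open cover $\mathcal{U}=(U_i)_{i\in I}$ of $G_0$, $G[\mathcal{U}]=\{(i,g,j)\in I\times G\times I: r(g)\in U_i,\ s(g)\in U_j\}$, with unit space $\{(i,x):x\in U_i\}$, $s(i,g,j)=(j,s(g))$, $r(i,g,j)=(i,r(g))$, $(i,g,j)(j,h,k)=(i,gh,k)$. $A[\mathcal{U}]$ is the pull-back of $A$ along the canonical morphism $G[\mathcal{U}]\to G$, i.e. the $G[\mathcal{U}]$-module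 $\{(i,a)\in I\times A:p(a)\in U_i\}$. **Extensions.** $\mathrm{ext}(G,A)$ is the set of (equivalence classes of) extensions of groupoids of the form $A\overset{i}{\hookrightarrow}E\overset{\pi}{\twoheadrightarrow}G$ such that the unit spaces of the groupoids $A$, $E$ and $G$ are all equal to $G_0$, the maps $i$ and $\pi$ are the identity map on $G_0$, and $\gamma a\gamma^{-1}=\pi(\gamma)\cdot a$ for all $\gamma\in E$ and all $a\in A_{s(\gamma)}$, where the dot denotes the action of $G$ on $A$. Two such extensions $E,E'$ are considered equivalent if there is a groupoid isomorphism $E\to E'$ commuting with the maps from $A$ and to $G$ (with the identity on $A$ and on $G$). It is an abelian group under the Baer sum: $E_1\oplus E_2=\{(\gamma_1,\gamma_2)\in E_1\times E_2:\pi_1(\gamma_1)=\pi_2(\gamma_2)\}/\!\sim$ with $(a\gamma_1,\gamma_2)\sim(\gamma_1,a\gamma_2)$ for $p(a)=r(\gamma_1)$. It is contravariant by pull-back along groupoid morphisms, and $\mathrm{Ext}(G,A)=\varinjlim_{\mathcal{U}}\mathrm{ext}(G[\mathcal{U}],A[\mathcal{U}])$, over open covers $\mathcal{U}$ of $G_0$.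
   Formalization: Here ext consists of locally split extensions: each g in G has a neighbourhood over whose inverse image in G[U] the projection lifts continuously; (a) is unaffected, but without this (b) fails, e.g. for the squaring map on an infinite product of circles. *)

theory Defs
  imports
    "HOL-Analysis.Function_Topology"
    "HOL-Analysis.Product_Topology"
    "HOL-Algebra.Product_Groups"
    "HOL-Algebra.FiniteProduct"
begin

section \<open>Topological groupoids, modules, extensions\<close>

text \<open>
  Spaces are abstract topologies, so the elements of a space are those of its
  \<open>topspace\<close>; no separation, countability or openness condition is imposed.
  The unit space \<open>obj\<close> is kept separate from the space of arrows, which makes
  it meaningful to say that several groupoids have the same unit space.
  \<open>cmp G g h\<close> is the product $gh$, defined when $s(g) = r(h)$.
\<close>

record ('x, 'g) topgpd =
  obj :: "'x topology"
  arr :: "'g topology"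
  src :: "'g \<Rightarrow> 'x"
  rng :: "'g \<Rightarrow> 'x"
  idn :: "'x \<Rightarrow> 'g"
  cmp :: "'g \<Rightarrow> 'g \<Rightarrow> 'g"
  ginv :: "'g \<Rightarrow> 'g"

abbreviation Ob :: "('x, 'g, 'z) topgpd_scheme \<Rightarrow> 'x set"
  where "Ob G \<equiv> topspace (obj G)"

abbreviation Ar :: "('x, 'g, 'z) topgpd_scheme \<Rightarrow> 'g set"
  where "Ar G \<equiv> topspace (arr G)"

definition topological_groupoid :: "('x, 'g, 'z) topgpd_scheme \<Rightarrow> bool" where
  "topological_groupoid G \<longleftrightarrow>
     continuous_map (arr G) (obj G) (src G) \<and>
     continuous_map (arr G) (obj G) (rng G) \<and>
     continuous_map (obj G) (arr G) (idn G) \<and>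
     continuous_map (arr G) (arr G) (ginv G) \<and>
     continuous_map (subtopology (prod_topology (arr G) (arr G)) {(g, h). src G g = rng G h})
       (arr G) (\<lambda>(g, h). cmp G g h) \<and>
     (\<forall>x\<in>Ob G. src G (idn G x) = x \<and> rng G (idn G x) = x) \<and>
     (\<forall>g\<in>Ar G. cmp G (idn G (rng G g)) g = g \<and> cmp G g (idn G (src G g)) = g) \<and>
     (\<forall>g\<in>Ar G. src G (ginv G g) = rng G g \<and> rng G (ginv G g) = src G g \<and>
        cmp G (ginv G g) g = idn G (src G g) \<and> cmp G g (ginv G g) = idn G (rng G g)) \<and>
     (\<forall>g\<in>Ar G. \<forall>h\<in>Ar G. src G g = rng G h \<longrightarrow>
        src G (cmp G g h) = src G h \<and> rng G (cmp G g h) = rng G g) \<and>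
     (\<forall>g\<in>Ar G. \<forall>h\<in>Ar G. \<forall>k\<in>Ar G. src G g = rng G h \<longrightarrow> src G h = rng G k \<longrightarrow>
        cmp G (cmp G g h) k = cmp G g (cmp G h k))"

text \<open>In a \<open>G\<close>-module, \<open>src A = rng A\<close> is the projection $p$, and \<open>cmp A\<close>, \<open>idn A\<close>,
  \<open>ginv A\<close> are the addition, zero section and negation of the fibres.\<close>

record ('x, 'a, 'g) gmod = "('x, 'a) topgpd" +
  act :: "'g \<Rightarrow> 'a \<Rightarrow> 'a"

definition G_module :: "('x, 'g) topgpd \<Rightarrow> ('x, 'a, 'g) gmod \<Rightarrow> bool" where
  "G_module G A \<longleftrightarrow>
     topological_groupoid A \<and> obj A = obj G \<and>
     (\<forall>a\<in>Ar A. rng A a = src A a) \<and>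
     (\<forall>a\<in>Ar A. \<forall>b\<in>Ar A. src A a = src A b \<longrightarrow> cmp A a b = cmp A b a) \<and>
     continuous_map (subtopology (prod_topology (arr G) (arr A)) {(g, a). src G g = src A a})
       (arr A) (\<lambda>(g, a). act A g a) \<and>
     (\<forall>g\<in>Ar G. \<forall>a\<in>Ar A. src G g = src A a \<longrightarrow> src A (act A g a) = rng G g) \<and>
     (\<forall>a\<in>Ar A. act A (idn G (src A a)) a = a) \<and>
     (\<forall>g\<in>Ar G. \<forall>h\<in>Ar G. \<forall>a\<in>Ar A. src G g = rng G h \<longrightarrow> src G h = src A a \<longrightarrow>
        act A (cmp G g h) a = act A g (act A h a)) \<and>
     (\<forall>g\<in>Ar G. \<forall>a\<in>Ar A. \<forall>b\<in>Ar A. src G g = src A a \<longrightarrow> src G g = src A b \<longrightarrow>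
        act A g (cmp A a b) = cmp A (act A g a) (act A g b))"

record ('x, 'b, 'h, 'e) extn =
  tot :: "('x, 'e) topgpd"
  inc :: "'b \<Rightarrow> 'e"
  prj :: "'e \<Rightarrow> 'h"

text \<open>Topologically, $B \hookrightarrow E$ is an embedding and $E \twoheadrightarrow H$ an
  identification map.\<close>

definition extension ::
    "('x, 'h) topgpd \<Rightarrow> ('x, 'b, 'h) gmod \<Rightarrow> ('x, 'b, 'h, 'e) extn \<Rightarrow> bool" where
  "extension H B X \<longleftrightarrow> (let E = tot X; i = inc X; \<pi> = prj X in
     topological_groupoid E \<and> obj E = obj H \<and>
     embedding_map (arr B) (arr E) i \<and>
     (\<forall>b\<in>Ar B. src E (i b) = src B b \<and> rng E (i b) = src B b) \<and>
     (\<forall>b\<in>Ar B. \<forall>b'\<in>Ar B. src B b = src B b' \<longrightarrow> i (cmp B b b') = cmp E (i b) (i b')) \<and>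
     quotient_map (arr E) (arr H) \<pi> \<and>
     (\<forall>\<gamma>\<in>Ar E. src H (\<pi> \<gamma>) = src E \<gamma> \<and> rng H (\<pi> \<gamma>) = rng E \<gamma>) \<and>
     (\<forall>\<gamma>\<in>Ar E. \<forall>\<delta>\<in>Ar E. src E \<gamma> = rng E \<delta> \<longrightarrow> \<pi> (cmp E \<gamma> \<delta>) = cmp H (\<pi> \<gamma>) (\<pi> \<delta>)) \<and>
     i ` Ar B = {\<gamma>\<in>Ar E. \<pi> \<gamma> \<in> idn H ` Ob H} \<and>
     (\<forall>\<gamma>\<in>Ar E. \<forall>b\<in>Ar B. src B b = src E \<gamma> \<longrightarrow>
        cmp E (cmp E \<gamma> (i b)) (ginv E \<gamma>) = i (act B (\<pi> \<gamma>) b)))"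

definition ext_equiv ::
    "('x, 'b, 'h) gmod \<Rightarrow> ('x, 'b, 'h, 'e) extn \<Rightarrow> ('x, 'b, 'h, 'f) extn \<Rightarrow> bool" where
  "ext_equiv B X Y \<longleftrightarrow> (\<exists>\<phi>.
     homeomorphic_map (arr (tot X)) (arr (tot Y)) \<phi> \<and>
     (\<forall>\<gamma>\<in>Ar (tot X). src (tot Y) (\<phi> \<gamma>) = src (tot X) \<gamma> \<and> rng (tot Y) (\<phi> \<gamma>) = rng (tot X) \<gamma>) \<and>
     (\<forall>\<gamma>\<in>Ar (tot X). \<forall>\<delta>\<in>Ar (tot X). src (tot X) \<gamma> = rng (tot X) \<delta> \<longrightarrow>
        \<phi> (cmp (tot X) \<gamma> \<delta>) = cmp (tot Y) (\<phi> \<gamma>) (\<phi> \<delta>)) \<and>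
     (\<forall>b\<in>Ar B. \<phi> (inc X b) = inc Y b) \<and>
     (\<forall>\<gamma>\<in>Ar (tot X). prj Y (\<phi> \<gamma>) = prj X \<gamma>))"

text \<open>
  The arrows of an extension of \<open>H\<close> by \<open>B\<close> are in bijection with the pairs $(b, h)$ such that
  $p(b) = r(h)$, by a set-theoretic section. Hence every extension, whatever the type of its
  arrows, is equivalent to one whose arrows are taken from the type \<open>'b \<times> 'h\<close>, and an
  equivalence class is represented by its members of that form.
\<close>

definition ext_class ::
    "('x, 'h) topgpd \<Rightarrow> ('x, 'b, 'h) gmod \<Rightarrow> ('x, 'b, 'h, 'e) extn
      \<Rightarrow> ('x, 'b, 'h, 'b \<times> 'h) extn set" where
  "ext_class H B X = {Y. extension H B Y \<and> ext_equiv B X Y}"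

text \<open>The semidirect product, which represents the neutral element for the Baer sum.\<close>

definition split_ext :: "('x, 'h) topgpd \<Rightarrow> ('x, 'b, 'h) gmod \<Rightarrow> ('x, 'b, 'h, 'b \<times> 'h) extn" where
  "split_ext H B =
     \<lparr>tot =
        \<lparr>obj = obj H,
         arr = subtopology (prod_topology (arr B) (arr H)) {(b, h). src B b = rng H h},
         src = (\<lambda>(b, h). src H h),
         rng = (\<lambda>(b, h). rng H h),
         idn = (\<lambda>x. (idn B x, idn H x)),
         cmp = (\<lambda>(b, h) (b', h'). (cmp B b (act B h b'), cmp H h h')),
         ginv = (\<lambda>(b, h). (act B (ginv H h) (ginv B b), ginv H h))\<rparr>,
      inc = (\<lambda>b. (b, idn H (src B b))),
      prj = snd\<rparr>"

definition quot_topology :: "'p topology \<Rightarrow> ('p \<times> 'p) set \<Rightarrow> 'p set topology" where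
  "quot_topology P R = topology (\<lambda>V. V \<subseteq> topspace P // R \<and> openin P (\<Union>V))"

definition baer_space ::
    "('x, 'b, 'h, 'e) extn \<Rightarrow> ('x, 'b, 'h, 'f) extn \<Rightarrow> ('e \<times> 'f) topology" where
  "baer_space X Y =
     subtopology (prod_topology (arr (tot X)) (arr (tot Y))) {(\<gamma>, \<delta>). prj X \<gamma> = prj Y \<delta>}"

text \<open>As the fibres of \<open>B\<close> are abelian groups, this is already an equivalence relation.\<close>

definition baer_rel ::
    "('x, 'b, 'h) gmod \<Rightarrow> ('x, 'b, 'h, 'e) extn \<Rightarrow> ('x, 'b, 'h, 'f) extn
      \<Rightarrow> (('e \<times> 'f) \<times> ('e \<times> 'f)) set" where
  "baer_rel B X Y =
     {((cmp (tot X) (inc X b) \<gamma>, \<delta>), (\<gamma>, cmp (tot Y) (inc Y b) \<delta>)) | b \<gamma> \<delta>.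
        b \<in> Ar B \<and> (\<gamma>, \<delta>) \<in> topspace (baer_space X Y) \<and> src B b = rng (tot X) \<gamma>}"

definition baer_sum ::
    "('x, 'b, 'h) gmod \<Rightarrow> ('x, 'b, 'h, 'e) extn \<Rightarrow> ('x, 'b, 'h, 'f) extn
      \<Rightarrow> ('x, 'b, 'h, ('e \<times> 'f) set) extn" where
  "baer_sum B X Y = (let E = tot X; F = tot Y; R = baer_rel B X Y in
     \<lparr>tot =
        \<lparr>obj = obj E,
         arr = quot_topology (baer_space X Y) R,
         src = (\<lambda>C. src E (fst (SOME z. z \<in> C))),
         rng = (\<lambda>C. rng E (fst (SOME z. z \<in> C))),
         idn = (\<lambda>x. R `` {(idn E x, idn F x)}),
         cmp = (\<lambda>C D. \<Union>(\<gamma>, \<delta>)\<in>C. \<Union>(\<gamma>', \<delta>')\<in>D. R `` {(cmp E \<gamma> \<gamma>', cmp F \<delta> \<delta>')}),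
         ginv = (\<lambda>C. \<Union>(\<gamma>, \<delta>)\<in>C. R `` {(ginv E \<gamma>, ginv F \<delta>)})\<rparr>,
      inc = (\<lambda>b. R `` {(inc X b, idn F (src B b))}),
      prj = (\<lambda>C. prj X (fst (SOME z. z \<in> C)))\<rparr>)"

text \<open>Pull-back of an extension along a morphism \<open>H' \<rightarrow> H\<close> given by \<open>f\<^sub>0\<close> on units and \<open>f\<close> on
  arrows; \<open>\<beta> : B' \<rightarrow> B\<close> identifies the \<open>H'\<close>-module \<open>B'\<close> with the pull-back of \<open>B\<close>.\<close>

definition pull_ext ::
    "('y, 'k) topgpd \<Rightarrow> ('y, 'c, 'k) gmod \<Rightarrow> ('y \<Rightarrow> 'x) \<Rightarrow> ('k \<Rightarrow> 'h) \<Rightarrow> ('c \<Rightarrow> 'b)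
      \<Rightarrow> ('x, 'b, 'h, 'e) extn \<Rightarrow> ('y, 'c, 'k, 'e \<times> 'k) extn" where
  "pull_ext H' B' f\<^sub>0 f \<beta> X = (let E = tot X in
     \<lparr>tot =
        \<lparr>obj = obj H',
         arr = subtopology (prod_topology (arr E) (arr H')) {(\<gamma>, k). prj X \<gamma> = f k},
         src = (\<lambda>(\<gamma>, k). src H' k),
         rng = (\<lambda>(\<gamma>, k). rng H' k),
         idn = (\<lambda>y. (idn E (f\<^sub>0 y), idn H' y)),
         cmp = (\<lambda>(\<gamma>, k) (\<gamma>', k'). (cmp E \<gamma> \<gamma>', cmp H' k k')),
         ginv = (\<lambda>(\<gamma>, k). (ginv E \<gamma>, ginv H' k))\<rparr>,
      inc = (\<lambda>c. (inc X (\<beta> c), idn H' (src B' c))),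
      prj = snd\<rparr>)"

text \<open>\<open>\<pi>\<close> admits a continuous lifting over the subspace \<open>W\<close> of \<open>H\<close>.\<close>

definition is_lifting ::
    "('x, 'h) topgpd \<Rightarrow> ('x, 'b, 'h, 'e) extn \<Rightarrow> 'h set \<Rightarrow> ('h \<Rightarrow> 'e) \<Rightarrow> bool" where
  "is_lifting H X W \<sigma> \<longleftrightarrow>
     continuous_map (subtopology (arr H) W) (arr (tot X)) \<sigma> \<and> (\<forall>h \<in> Ar H \<inter> W. prj X (\<sigma> h) = h)"


section \<open>Covers and cover groupoids\<close>

type_synonym ('m, 'i) cov = "'i set \<times> ('i \<Rightarrow> 'm set)"

definition open_cover :: "'m topology \<Rightarrow> ('m, 'i) cov \<Rightarrow> bool" where
  "open_cover T C \<longleftrightarrow>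
     (\<forall>i\<in>fst C. openin T (snd C i)) \<and> (\<Union>i\<in>fst C. snd C i) = topspace T"

definition refines :: "('j \<Rightarrow> 'i) \<Rightarrow> ('m, 'j) cov \<Rightarrow> ('m, 'i) cov \<Rightarrow> bool" where
  "refines \<theta> D C \<longleftrightarrow> (\<forall>j\<in>fst D. \<theta> j \<in> fst C \<and> snd D j \<subseteq> snd C (\<theta> j))"

definition cover_gpd :: "('x, 'g) topgpd \<Rightarrow> ('x, 'i) cov \<Rightarrow> ('i \<times> 'x, 'i \<times> 'g \<times> 'i) topgpd" where
  "cover_gpd G C =
     \<lparr>obj = subtopology (prod_topology (discrete_topology (fst C)) (obj G))
              {(i, x). x \<in> snd C i},
      arr = subtopology (prod_topology (discrete_topology (fst C))
                (prod_topology (arr G) (discrete_topology (fst C))))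
              {(i, g, j). rng G g \<in> snd C i \<and> src G g \<in> snd C j},
      src = (\<lambda>(i, g, j). (j, src G g)),
      rng = (\<lambda>(i, g, j). (i, rng G g)),
      idn = (\<lambda>(i, x). (i, idn G x, i)),
      cmp = (\<lambda>(i, g, j) (j', h, k). (i, cmp G g h, k)),
      ginv = (\<lambda>(i, g, j). (j, ginv G g, i))\<rparr>"

definition cover_mod ::
    "('x, 'a, 'g) gmod \<Rightarrow> ('x, 'i) cov \<Rightarrow> ('i \<times> 'x, 'i \<times> 'a, 'i \<times> 'g \<times> 'i) gmod" where
  "cover_mod A C =
     \<lparr>obj = subtopology (prod_topology (discrete_topology (fst C)) (obj A))
              {(i, x). x \<in> snd C i},
      arr = subtopology (prod_topology (discrete_topology (fst C)) (arr A))
              {(i, a). src A a \<in> snd C i},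
      src = (\<lambda>(i, a). (i, src A a)),
      rng = (\<lambda>(i, a). (i, rng A a)),
      idn = (\<lambda>(i, x). (i, idn A x)),
      cmp = (\<lambda>(i, a) (j, b). (i, cmp A a b)),
      ginv = (\<lambda>(i, a). (i, ginv A a)),
      act = (\<lambda>(i, g, j) (j', a). (i, act A g a))\<rparr>"

type_synonym ('x, 'a, 'g, 'i) cover_extn =
  "('i \<times> 'x, 'i \<times> 'a, 'i \<times> 'g \<times> 'i, ('i \<times> 'a) \<times> ('i \<times> 'g \<times> 'i)) extn"

text \<open>
  Extensions are understood to be locally split: each point of $G$ has a neighbourhood \<open>W\<close> such
  that the projection has a continuous lifting over the inverse image of \<open>W\<close> under
  $G[\mathcal{U}] \to G$. For the cover of $G_0$ by itself this means that $E \to G$ admits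
  continuous local sections. Two weaker readings make the comparison with Cech cohomology fail:
  without any local splitting, topological group extensions which have no local sections would
  count; and if \<open>W\<close> were allowed to depend on \<open>(i, j)\<close>, then for \<open>G = G\<^sub>0 = X\<close> the direct limit
  of the extension groups would be the sheaf cohomology of $X$ in degree 2, which can differ from its
  Cech cohomology when $X$ is not paracompact.
\<close>

definition locally_split ::
    "('x, 'g) topgpd \<Rightarrow> ('x, 'i) cov \<Rightarrow> ('i \<times> 'x, 'b, 'i \<times> 'g \<times> 'i, 'e) extn \<Rightarrow> bool" where
  "locally_split G C X \<longleftrightarrow>
     (\<forall>g\<in>Ar G. \<exists>W. openin (arr G) W \<and> g \<in> W \<and>
        (\<exists>\<sigma>. is_lifting (cover_gpd G C) X {(i, h, j). h \<in> W} \<sigma>))"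

text \<open>$\mathrm{ext}(G[\mathcal{U}], A[\mathcal{U}])$ with the Baer sum.\<close>

definition ext_group ::
    "('x, 'g) topgpd \<Rightarrow> ('x, 'a, 'g) gmod \<Rightarrow> ('x, 'i) cov
      \<Rightarrow> ('x, 'a, 'g, 'i) cover_extn set monoid" where
  "ext_group G A C = (let H = cover_gpd G C; B = cover_mod A C in
     \<lparr>carrier = {ext_class H B X | X :: ('x, 'a, 'g, 'i) cover_extn.
                   extension H B X \<and> locally_split G C X},
      mult = (\<lambda>P Q. \<Union>X\<in>P. \<Union>Y\<in>Q. ext_class H B (baer_sum B X Y)),
      one = ext_class H B (split_ext H B)\<rparr>)"

definition ext_pull ::
    "('x, 'g) topgpd \<Rightarrow> ('x, 'a, 'g) gmod \<Rightarrow> ('j \<Rightarrow> 'i) \<Rightarrow> ('x, 'j) cov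
      \<Rightarrow> ('x, 'a, 'g, 'i) cover_extn set \<Rightarrow> ('x, 'a, 'g, 'j) cover_extn set" where
  "ext_pull G A \<theta> D P = (let H' = cover_gpd G D; B' = cover_mod A D in
     \<Union>X\<in>P. ext_class H' B'
       (pull_ext H' B' (\<lambda>(j, x). (\<theta> j, x)) (\<lambda>(j, g, k). (\<theta> j, g, \<theta> k)) (\<lambda>(j, a). (\<theta> j, a)) X))"


section \<open>Direct limits of groups\<close>

text \<open>
  Direct limit of the groups \<open>F u\<close>, $u \in$ \<open>Ix\<close>, along the transition maps \<open>T u v\<close> (a set of maps
  \<open>F u \<rightarrow> F v\<close>, since a refinement of covers may be realised by several maps of index sets).
  The underlying set is the set-theoretic colimit; two classes are multiplied by means of
  representatives in a common \<open>F w\<close>.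
\<close>

definition colim_set :: "'u set \<Rightarrow> ('u \<Rightarrow> 'h monoid) \<Rightarrow> ('u \<times> 'h) set" where
  "colim_set Ix F = Sigma Ix (\<lambda>u. carrier (F u))"

definition colim_rel ::
    "'u set \<Rightarrow> ('u \<Rightarrow> 'h monoid) \<Rightarrow> ('u \<Rightarrow> 'u \<Rightarrow> ('h \<Rightarrow> 'h) set) \<Rightarrow> (('u \<times> 'h) \<times> ('u \<times> 'h)) set" where
  "colim_rel Ix F T =
     (let R = {((u, x), (v, t x)) | u v x t. u \<in> Ix \<and> v \<in> Ix \<and> x \<in> carrier (F u) \<and> t \<in> T u v}
      in (R \<union> R\<inverse>)\<^sup>* \<inter> colim_set Ix F \<times> colim_set Ix F)"

definition colim_class ::
    "'u set \<Rightarrow> ('u \<Rightarrow> 'h monoid) \<Rightarrow> ('u \<Rightarrow> 'u \<Rightarrow> ('h \<Rightarrow> 'h) set) \<Rightarrow> 'u \<Rightarrow> 'h \<Rightarrow> ('u \<times> 'h) set" where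
  "colim_class Ix F T u x = colim_rel Ix F T `` {(u, x)}"

definition colim_group ::
    "'u set \<Rightarrow> ('u \<Rightarrow> 'h monoid) \<Rightarrow> ('u \<Rightarrow> 'u \<Rightarrow> ('h \<Rightarrow> 'h) set) \<Rightarrow> ('u \<times> 'h) set monoid" where
  "colim_group Ix F T =
     \<lparr>carrier = colim_set Ix F // colim_rel Ix F T,
      mult = (\<lambda>P Q. \<Union>{colim_class Ix F T w (x \<otimes>\<^bsub>F w\<^esub> y) | w x y. (w, x) \<in> P \<and> (w, y) \<in> Q}),
      one = (\<Union>u\<in>Ix. colim_class Ix F T u \<one>\<^bsub>F u\<^esub>)\<rparr>"

definition ext_trans ::
    "('x, 'g) topgpd \<Rightarrow> ('x, 'a, 'g) gmod \<Rightarrow> ('x, 'i) cov \<Rightarrow> ('x, 'i) cov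
      \<Rightarrow> (('x, 'a, 'g, 'i) cover_extn set \<Rightarrow> ('x, 'a, 'g, 'i) cover_extn set) set" where
  "ext_trans G A C D = {ext_pull G A \<theta> D | \<theta>. refines \<theta> D C}"

definition Ext_group ::
    "('x, 'g) topgpd \<Rightarrow> ('x, 'a, 'g) gmod
      \<Rightarrow> (('x, 'i) cov \<times> ('x, 'a, 'g, 'i) cover_extn set) set monoid" where
  "Ext_group G A = colim_group {C. open_cover (obj G) C} (ext_group G A) (ext_trans G A)"

definition Ext_class ::
    "('x, 'g) topgpd \<Rightarrow> ('x, 'a, 'g) gmod \<Rightarrow> ('x, 'i) cov \<Rightarrow> ('x, 'a, 'g, 'i) cover_extn set
      \<Rightarrow> (('x, 'i) cov \<times> ('x, 'a, 'g, 'i) cover_extn set) set" where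
  "Ext_class G A = colim_class {C. open_cover (obj G) C} (ext_group G A) (ext_trans G A)"


section \<open>Cech cohomology of simplicial spaces\<close>

text \<open>Morphisms $k \to n$ of $\Delta$; extensionality makes them determined by their values on $[k]$.\<close>

definition Delta_hom :: "nat \<Rightarrow> nat \<Rightarrow> (nat \<Rightarrow> nat) set" where
  "Delta_hom k n = {f \<in> {..k} \<rightarrow>\<^sub>E {..n}. mono_on {..k} f}"

definition coface :: "nat \<Rightarrow> nat \<Rightarrow> nat \<Rightarrow> nat" where
  "coface n i = (\<lambda>j\<in>{..n - 1}. if j < i then j else Suc j)"

text \<open>\<open>smap M k n f\<close> is the map $\tilde f : M_n \to M_k$ for $f \in \mathrm{Hom}_\Delta(k, n)$.\<close>

record 'm simp_space =
  spc :: "nat \<Rightarrow> 'm topology"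
  smap :: "nat \<Rightarrow> nat \<Rightarrow> (nat \<Rightarrow> nat) \<Rightarrow> 'm \<Rightarrow> 'm"

text \<open>\<open>sec S n U\<close> is the group $\mathcal{A}^n(U)$; \<open>pull S k n f V U\<close> is the map
  $\tilde f^* : \mathcal{A}^k(V) \to \mathcal{A}^n(U)$ for $\tilde f(U) \subset V$
  (for \<open>f = id\<close>, the restriction from \<open>V\<close> to \<open>U\<close>).\<close>

record ('m, 's) simp_sheaf =
  sec :: "nat \<Rightarrow> 'm set \<Rightarrow> 's monoid"
  pull :: "nat \<Rightarrow> nat \<Rightarrow> (nat \<Rightarrow> nat) \<Rightarrow> 'm set \<Rightarrow> 'm set \<Rightarrow> 's \<Rightarrow> 's"

text \<open>A cover \<open>U\<close> of \<open>M\<close>: \<open>fst (U n)\<close> is the index set $I_n$, and \<open>snd (U n) i\<close> is $U^n_i$.\<close>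

definition open_scover :: "'m simp_space \<Rightarrow> (nat \<Rightarrow> ('m, 'i) cov) \<Rightarrow> bool" where
  "open_scover M U \<longleftrightarrow> (\<forall>n. open_cover (spc M n) (U n))"

definition admits_simplicial :: "'m simp_space \<Rightarrow> nat \<Rightarrow> (nat \<Rightarrow> ('m, 'i) cov) \<Rightarrow> bool" where
  "admits_simplicial M N U \<longleftrightarrow> (\<exists>\<tau> :: nat \<Rightarrow> nat \<Rightarrow> (nat \<Rightarrow> nat) \<Rightarrow> 'i \<Rightarrow> 'i.
     (\<forall>k\<le>N. \<forall>n\<le>N. \<forall>f\<in>Delta_hom k n. \<forall>i\<in>fst (U n).
        \<tau> k n f i \<in> fst (U k) \<and> smap M k n f ` snd (U n) i \<subseteq> snd (U k) (\<tau> k n f i)) \<and>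
     (\<forall>n\<le>N. \<forall>i\<in>fst (U n). \<tau> n n (\<lambda>j\<in>{..n}. j) i = i) \<and>
     (\<forall>k\<le>N. \<forall>l\<le>N. \<forall>n\<le>N. \<forall>f\<in>Delta_hom k l. \<forall>g\<in>Delta_hom l n. \<forall>i\<in>fst (U n).
        \<tau> k n (compose {..k} g f) i = \<tau> k l f (\<tau> l n g i)))"

text \<open>Elements $\lambda$ of $\Lambda_n$ are called \<open>\<kappa>\<close>. A strictly increasing map into $[n]$ is identified with its image \<open>S\<close>, a nonempty subset
  of $[n]$; its source is $[k]$ with \<open>k = sdim S\<close>, and \<open>senum S\<close> is the map itself.\<close>

definition faces :: "nat \<Rightarrow> nat set set" where
  "faces n = {S. S \<subseteq> {..n} \<and> S \<noteq> {}}"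

definition sdim :: "nat set \<Rightarrow> nat" where
  "sdim S = card S - 1"

definition senum :: "nat set \<Rightarrow> nat \<Rightarrow> nat" where
  "senum S = (\<lambda>j\<in>{..sdim S}. sorted_list_of_set S ! j)"

definition Lam :: "(nat \<Rightarrow> ('m, 'i) cov) \<Rightarrow> nat \<Rightarrow> (nat set \<Rightarrow> 'i) set" where
  "Lam U n = (\<Pi>\<^sub>E S\<in>faces n. fst (U (sdim S)))"

definition Ulam ::
    "'m simp_space \<Rightarrow> (nat \<Rightarrow> ('m, 'i) cov) \<Rightarrow> nat \<Rightarrow> (nat set \<Rightarrow> 'i) \<Rightarrow> 'm set" where
  "Ulam M U n \<kappa> = {z \<in> topspace (spc M n).
     \<forall>S\<in>faces n. smap M (sdim S) n (senum S) z \<in> snd (U (sdim S)) (\<kappa> S)}"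

text \<open>$\tilde g \kappa$ for a strictly increasing $g : [k] \to [n]$ and $\kappa \in \Lambda_n$.\<close>

definition lam_face :: "nat \<Rightarrow> (nat \<Rightarrow> nat) \<Rightarrow> (nat set \<Rightarrow> 'i) \<Rightarrow> nat set \<Rightarrow> 'i" where
  "lam_face k g \<kappa> = (\<lambda>S\<in>faces k. \<kappa> (g ` S))"

definition cochains ::
    "'m simp_space \<Rightarrow> ('m, 's) simp_sheaf \<Rightarrow> (nat \<Rightarrow> ('m, 'i) cov) \<Rightarrow> nat
      \<Rightarrow> ((nat set \<Rightarrow> 'i) \<Rightarrow> 's) monoid" where
  "cochains M S U n = product_group (Lam U n) (\<lambda>\<kappa>. sec S n (Ulam M U n \<kappa>))"

text \<open>The groups are written multiplicatively, so the alternating sum is a product.\<close>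

definition codiff ::
    "'m simp_space \<Rightarrow> ('m, 's) simp_sheaf \<Rightarrow> (nat \<Rightarrow> ('m, 'i) cov) \<Rightarrow> nat
      \<Rightarrow> ((nat set \<Rightarrow> 'i) \<Rightarrow> 's) \<Rightarrow> (nat set \<Rightarrow> 'i) \<Rightarrow> 's" where
  "codiff M S U n c = (\<lambda>\<kappa>\<in>Lam U (Suc n).
     let K = sec S (Suc n) (Ulam M U (Suc n) \<kappa>);
         t = (\<lambda>k. let \<epsilon> = coface (Suc n) k; \<mu> = lam_face n \<epsilon> \<kappa>
                  in pull S n (Suc n) \<epsilon> (Ulam M U n \<mu>) (Ulam M U (Suc n) \<kappa>) (c \<mu>))
     in finprod K (\<lambda>k. if even k then t k else inv\<^bsub>K\<^esub> t k) {..Suc n})"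

definition cocycles ::
    "'m simp_space \<Rightarrow> ('m, 's) simp_sheaf \<Rightarrow> (nat \<Rightarrow> ('m, 'i) cov) \<Rightarrow> nat
      \<Rightarrow> ((nat set \<Rightarrow> 'i) \<Rightarrow> 's) monoid" where
  "cocycles M S U n = (cochains M S U n)
     \<lparr>carrier := {c \<in> carrier (cochains M S U n). codiff M S U n c = \<one>\<^bsub>cochains M S U (Suc n)\<^esub>}\<rparr>"

definition coboundaries ::
    "'m simp_space \<Rightarrow> ('m, 's) simp_sheaf \<Rightarrow> (nat \<Rightarrow> ('m, 'i) cov) \<Rightarrow> nat
      \<Rightarrow> ((nat set \<Rightarrow> 'i) \<Rightarrow> 's) set" where
  "coboundaries M S U n =
     (case n of 0 \<Rightarrow> {\<one>\<^bsub>cochains M S U 0\<^esub>}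
      | Suc m \<Rightarrow> codiff M S U m ` carrier (cochains M S U m))"

definition cohomology ::
    "'m simp_space \<Rightarrow> ('m, 's) simp_sheaf \<Rightarrow> (nat \<Rightarrow> ('m, 'i) cov) \<Rightarrow> nat
      \<Rightarrow> ((nat set \<Rightarrow> 'i) \<Rightarrow> 's) set monoid" where
  "cohomology M S U n = cocycles M S U n Mod coboundaries M S U n"

definition cohom_class ::
    "'m simp_space \<Rightarrow> ('m, 's) simp_sheaf \<Rightarrow> (nat \<Rightarrow> ('m, 'i) cov) \<Rightarrow> nat
      \<Rightarrow> ((nat set \<Rightarrow> 'i) \<Rightarrow> 's) \<Rightarrow> ((nat set \<Rightarrow> 'i) \<Rightarrow> 's) set" where
  "cohom_class M S U n c = coboundaries M S U n #>\<^bsub>cocycles M S U n\<^esub> c"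

definition cochain_pull ::
    "'m simp_space \<Rightarrow> ('m, 's) simp_sheaf \<Rightarrow> (nat \<Rightarrow> 'j \<Rightarrow> 'i)
      \<Rightarrow> (nat \<Rightarrow> ('m, 'i) cov) \<Rightarrow> (nat \<Rightarrow> ('m, 'j) cov) \<Rightarrow> nat
      \<Rightarrow> ((nat set \<Rightarrow> 'i) \<Rightarrow> 's) \<Rightarrow> (nat set \<Rightarrow> 'j) \<Rightarrow> 's" where
  "cochain_pull M S \<theta> U V n c = (\<lambda>\<kappa>\<in>Lam V n.
     let \<mu> = (\<lambda>F\<in>faces n. \<theta> (sdim F) (\<kappa> F))
     in pull S n n (\<lambda>j\<in>{..n}. j) (Ulam M U n \<mu>) (Ulam M V n \<kappa>) (c \<mu>))"

definition cohom_trans ::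
    "'m simp_space \<Rightarrow> ('m, 's) simp_sheaf \<Rightarrow> nat
      \<Rightarrow> (nat \<Rightarrow> ('m, 'i) cov) \<Rightarrow> (nat \<Rightarrow> ('m, 'i) cov)
      \<Rightarrow> (((nat set \<Rightarrow> 'i) \<Rightarrow> 's) set \<Rightarrow> ((nat set \<Rightarrow> 'i) \<Rightarrow> 's) set) set" where
  "cohom_trans M S n U V =
     {\<lambda>X. \<Union>c\<in>X. cohom_class M S V n (cochain_pull M S \<theta> U V n c) | \<theta>.
        \<forall>m. refines (\<theta> m) (V m) (U m)}"

definition cech_covers :: "'m simp_space \<Rightarrow> nat \<Rightarrow> (nat \<Rightarrow> ('m, 'i) cov) set" where
  "cech_covers M n = {U. open_scover M U \<and> (\<exists>N\<ge>n + 1. admits_simplicial M N U)}"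

definition cech_group ::
    "'m simp_space \<Rightarrow> ('m, 's) simp_sheaf \<Rightarrow> nat
      \<Rightarrow> ((nat \<Rightarrow> ('m, 'i) cov) \<times> ((nat set \<Rightarrow> 'i) \<Rightarrow> 's) set) set monoid" where
  "cech_group M S n =
     colim_group (cech_covers M n) (\<lambda>U. cohomology M S U n) (cohom_trans M S n)"

definition cech_class ::
    "'m simp_space \<Rightarrow> ('m, 's) simp_sheaf \<Rightarrow> nat
      \<Rightarrow> (nat \<Rightarrow> ('m, 'i) cov) \<Rightarrow> ((nat set \<Rightarrow> 'i) \<Rightarrow> 's) set
      \<Rightarrow> ((nat \<Rightarrow> ('m, 'i) cov) \<times> ((nat set \<Rightarrow> 'i) \<Rightarrow> 's) set) set" where
  "cech_class M S n =
     colim_class (cech_covers M n) (\<lambda>U. cohomology M S U n) (cohom_trans M S n)"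


section \<open>The nerve of a groupoid and the sheaf of a module\<close>

text \<open>
  A point $(g_1, \dots, g_n)$ of $G_n$ is encoded as \<open>(x, g)\<close> with \<open>g\<close> a function on \<open>{1..n}\<close> and
  \<open>x = r(g\<^sub>1)\<close>; for \<open>n = 0\<close>, \<open>x\<close> is an arbitrary point of $G_0$. Then \<open>vertex G z i\<close> is
  $\gamma_i = g_1 \cdots g_i$, which satisfies $g_i = \gamma_{i-1}^{-1} \gamma_i$.
\<close>

primrec vertex :: "('x, 'g) topgpd \<Rightarrow> 'x \<times> (nat \<Rightarrow> 'g) \<Rightarrow> nat \<Rightarrow> 'g" where
  "vertex G z 0 = idn G (fst z)"
| "vertex G z (Suc i) = cmp G (vertex G z i) (snd z (Suc i))"

definition nerve :: "('x, 'g) topgpd \<Rightarrow> ('x \<times> (nat \<Rightarrow> 'g)) simp_space" where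
  "nerve G =
     \<lparr>spc = (\<lambda>n. subtopology (prod_topology (obj G) (product_topology (\<lambda>_. arr G) {1..n}))
        {(x, g). (0 < n \<longrightarrow> x = rng G (g 1)) \<and> (\<forall>i\<in>{1..<n}. src G (g i) = rng G (g (Suc i)))}),
      smap = (\<lambda>k n f z.
        (src G (vertex G z (f 0)),
         \<lambda>j\<in>{1..k}. cmp G (ginv G (vertex G z (f (j - 1)))) (vertex G z (f j))))\<rparr>"

definition mod_sheaf ::
    "('x, 'g) topgpd \<Rightarrow> ('x, 'a, 'g) gmod
      \<Rightarrow> ('x \<times> (nat \<Rightarrow> 'g), 'x \<times> (nat \<Rightarrow> 'g) \<Rightarrow> 'a) simp_sheaf" where
  "mod_sheaf G A =
     \<lparr>sec = (\<lambda>n U.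
        \<lparr>carrier = {\<phi> \<in> extensional U.
            continuous_map (subtopology (spc (nerve G) n) U) (arr A) \<phi> \<and>
            (\<forall>z\<in>U. src A (\<phi> z) = src G (vertex G z n))},
         mult = (\<lambda>\<phi> \<psi>. \<lambda>z\<in>U. cmp A (\<phi> z) (\<psi> z)),
         one = (\<lambda>z\<in>U. idn A (src G (vertex G z n)))\<rparr>),
      pull = (\<lambda>k n f V U \<phi>. \<lambda>z\<in>U.
        act A (cmp G (ginv G (vertex G z n)) (vertex G z (f k))) (\<phi> (smap (nerve G) k n f z)))\<rparr>"

text \<open>$\mathcal{U}_0$ as a cover of the unit space.\<close>

definition base_cover :: "(nat \<Rightarrow> ('x \<times> (nat \<Rightarrow> 'g), 'i) cov) \<Rightarrow> ('x, 'i) cov" where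
  "base_cover U = (fst (U 0), \<lambda>i. fst ` snd (U 0) i)"

text \<open>$U^1_\kappa$ viewed inside $G[\mathcal{U}_0]$.\<close>

definition edge_set ::
    "('x, 'g) topgpd \<Rightarrow> (nat \<Rightarrow> ('x \<times> (nat \<Rightarrow> 'g), 'i) cov) \<Rightarrow> (nat set \<Rightarrow> 'i)
      \<Rightarrow> ('i \<times> 'g \<times> 'i) set" where
  "edge_set G U \<kappa> = {(\<kappa> {0}, snd z 1, \<kappa> {1}) | z. z \<in> Ulam (nerve G) U 1 \<kappa>}"

definition is_lifting_family ::
    "('x, 'g) topgpd \<Rightarrow> (nat \<Rightarrow> ('x \<times> (nat \<Rightarrow> 'g), 'i) cov)
      \<Rightarrow> ('i \<times> 'x, 'b, 'i \<times> 'g \<times> 'i, 'e) extn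
      \<Rightarrow> ((nat set \<Rightarrow> 'i) \<Rightarrow> 'i \<times> 'g \<times> 'i \<Rightarrow> 'e) \<Rightarrow> bool" where
  "is_lifting_family G U X \<sigma> \<longleftrightarrow>
     (\<forall>\<kappa>\<in>Lam U 1. is_lifting (cover_gpd G (base_cover U)) X (edge_set G U \<kappa>) (\<sigma> \<kappa>))"

text \<open>$\mathrm{ext}_{\mathcal{U}}(G[\mathcal{U}_0], A[\mathcal{U}_0])$.\<close>

definition ext_lifting ::
    "('x, 'g) topgpd \<Rightarrow> ('x, 'a, 'g) gmod \<Rightarrow> (nat \<Rightarrow> ('x \<times> (nat \<Rightarrow> 'g), 'i) cov)
      \<Rightarrow> ('x, 'a, 'g, 'i) cover_extn set set" where
  "ext_lifting G A U =
     {P \<in> carrier (ext_group G A (base_cover U)). \<exists>X\<in>P. \<exists>\<sigma>. is_lifting_family G U X \<sigma>}"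

text \<open>
  The 2-cochain \<open>c\<close> of an extension relative to a family of liftings, which defines the canonical
  isomorphism:
  $\sigma_{\kappa_{01}}(g) \sigma_{\kappa_{12}}(h) = \sigma_{\kappa_{02}}(gh)\, c_\kappa(g, h)$,
  with $c_\kappa(g, h) \in A_{s(h)}$ as required of sections of $\mathcal{A}^2$.
\<close>

definition is_ext_cocycle ::
    "('x, 'g) topgpd \<Rightarrow> ('x, 'a, 'g) gmod \<Rightarrow> (nat \<Rightarrow> ('x \<times> (nat \<Rightarrow> 'g), 'i) cov)
      \<Rightarrow> ('i \<times> 'x, 'i \<times> 'a, 'i \<times> 'g \<times> 'i, 'e) extn
      \<Rightarrow> ((nat set \<Rightarrow> 'i) \<Rightarrow> 'i \<times> 'g \<times> 'i \<Rightarrow> 'e)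
      \<Rightarrow> ((nat set \<Rightarrow> 'i) \<Rightarrow> 'x \<times> (nat \<Rightarrow> 'g) \<Rightarrow> 'a) \<Rightarrow> bool" where
  "is_ext_cocycle G A U X \<sigma> c \<longleftrightarrow>
     c \<in> carrier (cocycles (nerve G) (mod_sheaf G A) U 2) \<and>
     (\<forall>\<kappa>\<in>Lam U 2. \<forall>z\<in>Ulam (nerve G) U 2 \<kappa>.
        let g = snd z 1; h = snd z 2; E = tot X;
            \<sigma>' = (\<lambda>k. \<sigma> (lam_face 1 (coface 2 k) \<kappa>))
        in cmp E (\<sigma>' 2 (\<kappa> {0}, g, \<kappa> {1})) (\<sigma>' 0 (\<kappa> {1}, h, \<kappa> {2})) =
           cmp E (\<sigma>' 1 (\<kappa> {0}, cmp G g h, \<kappa> {2})) (inc X (\<kappa> {2}, c \<kappa> z)))"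

end

theory Submission
  imports Defs
begin

text \<open>
 An extension \<open>E\<close> of a groupoid \<open>H\<close> by an \<open>H\<close>-module \<open>B\<close> that has continuous liftings $\sigma_w$ over the
 sets of an open cover $(V_w)$ of the arrows of \<open>H\<close> is described by its factor set:
 $\sigma_{w_1}(g) \sigma_{w_2}(h) = \sigma_{w_3}(gh) f_{w_1 w_2 w_3}(g, h)$. Associativity of \<open>E\<close> becomes a
 cocycle identity for \<open>f\<close>. The proof rests on three facts about factor sets. Every continuous
 solution of the cocycle identity is the factor set of an extension (\<open>factor_set_realised\<close>). An
 extension is determined by its factor set up to equivalence (\<open>presents_imp_equiv\<close>). The Baer sum of
 extensions corresponds to the sum of factor sets over a common cover (\<open>coordinate_sum_map\<close>,
 \<open>baer_sum_equiv\<close>). So the extension groups, their subgroups defined by liftings, and pull-backs can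
 all be computed with factor sets.

 Part (a). Take $H = G[\mathcal{U}_0]$ and the cover by the sets $U^1_\lambda$. A factor set then has the same shape
 as a Cech 2-cochain, except that a cochain $c_\kappa$ may also depend on the index $\kappa_{012}$. For a cocycle
 it does not: the cocycle identity at the degenerate 3-simplex $(g, h, 1)$ compares two choices of
 $\kappa_{012}$ (\<open>cocycle_index_independent\<close>). Hence cocycles and factor sets are the same thing
 (\<open>factor_set_fc\<close>, \<open>cval_cocycle\<close>). Two families of liftings differ by a continuous 1-cochain, and their
 cocycles by its coboundary (\<open>change_of_liftings\<close>), which gives the isomorphism \<open>Phi\<close>.

 Part (b). Both sides are filtered colimits, and \<open>Phi\<close> commutes with refinement (\<open>Phi_natural\<close>).
 Covers indexed by the points of the nerve carry a simplicial structure and can be made as fine as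
 one likes (\<open>point_scover\<close>); so every extension, being locally split, has liftings over some simplicial
 cover, and the simplicial covers are cofinal. What remains is that refinement maps are not unique.
 Pull-backs of an extension along two refinement maps $\theta, \theta'$ agree if the arrows $(\theta'(j), 1, \theta(j))$ lift
 continuously, because one can conjugate with these lifts (\<open>parallel_pullbacks\<close>). On the extension side
 they lift after a further refinement; on the Cech side the degenerate edges of a simplicial cover
 supply them at once (\<open>simplicial_parallel\<close>). An abstract comparison of direct systems
 (\<open>colim_comparison\<close>) then yields the isomorphism of the limits.
\<close>

section \<open>Abbreviations for topologies\<close>

abbreviation "cts \<equiv> continuous_map"
abbreviation "sbt \<equiv> subtopology"
abbreviation "pts \<equiv> topspace"
abbreviation "prt \<equiv> prod_topology"
abbreviation "dsc \<equiv> discrete_topology"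
lemmas cts_sub = continuous_map_in_subtopology continuous_map_paired
lemmas cts_sub_intro = continuous_map_from_subtopology continuous_map_fst continuous_map_snd

section \<open>Local criteria for continuity\<close>

lemma continuous_map_local:
 assumes "\<And>x. x : pts X ==>
  \<exists>N. openin X N & x : N & cts (sbt X N) Y f"
 shows "cts X Y f"
 unfolding continuous_map_def
proof (intro conjI allI impI)
 show "f : pts X \<rightarrow> pts Y"
 proof
  fix x assume "x : pts X"
  then show "f x : pts Y"
   using assms[of x] by (metis Int_iff continuous_map_image_subset_topspace image_subset_iff topspace_subtopology)
 qed
 fix U assume U: "openin Y U"
 show "openin X {x : pts X. f x : U}"
 proof (subst openin_subopen, intro ballI)
  fix x assume x: "x : {x : pts X. f x : U}"
  then obtain N where N: "openin X N" "x : N" "cts (sbt X N) Y f"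
   using assms by blast
  have "openin (sbt X N) {x : pts (sbt X N). f x : U}"
   using N(3) U by (rule openin_continuous_map_preimage)
  then have "openin X {x : pts (sbt X N). f x : U}"
   using N(1) openin_open_subtopology by blast
  then show "\<exists>T. openin X T & x : T & T \<subseteq> {x : pts X. f x : U}"
   using x N by (intro exI[of _ "{x : pts (sbt X N). f x : U}"]) auto
 qed
qed

text \<open>Preimages under local sections detect open sets of the target.\<close>

lemma quotient_map_if_local_sections:
 assumes f: "cts X Y f"
  and sec: "\<And>y. y : pts Y ==> \<exists>N s. openin Y N & y : N &
   cts (sbt Y N) X s & (\<forall>y\<in>pts Y \<inter> N. f (s y) = y)"
 shows "quotient_map X Y f"
 unfolding quotient_map_def
proof (intro conjI allI impI)
 show "f ` pts X = pts Y"
 proof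
  show "f ` pts X \<subseteq> pts Y"
   using f continuous_map_image_subset_topspace by blast
  show "pts Y \<subseteq> f ` pts X"
  proof
   fix y assume y: "y : pts Y"
   then obtain N s where "y : N" "cts (sbt Y N) X s" "f (s y) = y"
    using sec[OF y] by blast
   then show "y : f ` pts X"
    using y by (metis IntI continuous_map_image_subset_topspace image_eqI image_subset_iff
      topspace_subtopology)
  qed
 qed
 fix U assume U: "U \<subseteq> pts Y"
 show "openin X {x : pts X. f x : U} = openin Y U"
 proof
  assume "openin Y U"
  then show "openin X {x : pts X. f x : U}"
   using f by (rule openin_continuous_map_preimage[rotated])
 next
  assume op: "openin X {x : pts X. f x : U}"
  show "openin Y U"
  proof (subst openin_subopen, intro ballI)
   fix y assume y: "y : U"
   then obtain N s where N: "openin Y N" "y : N" "cts (sbt Y N) X s"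
    "\<forall>y\<in>pts Y \<inter> N. f (s y) = y"
    using sec[of y] U by blast
   let ?T = "{z : pts (sbt Y N). s z : {x : pts X. f x : U}}"
   have "openin (sbt Y N) ?T"
    using N(3) op by (rule openin_continuous_map_preimage)
   then have "openin Y ?T"
    using N(1) openin_open_subtopology by blast
   moreover have "y : ?T"
    using N y U continuous_map_image_subset_topspace[OF N(3)] by (auto simp: image_subset_iff)
   moreover have "?T \<subseteq> U"
    using N(4) by auto
   ultimately show "\<exists>T. openin Y T & y : T & T \<subseteq> U" by blast
  qed
 qed
qed

lemma continuous_map_subtopology_mono:
 assumes "cts (sbt X S) Y f" "T \<subseteq> S"
 shows "cts (sbt X T) Y f"
 using continuous_map_from_subtopology_mono[OF assms] .

lemma openin_preimage:
 assumes "cts X Y f" "openin Y U"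
 shows "openin X {x : pts X. f x : U}"
 using assms by (rule openin_continuous_map_preimage)

lemma continuous_map_in:
 assumes "cts X Y f" "x : pts X"
 shows "f x : pts Y"
 using assms continuous_map_image_subset_topspace by blast

section \<open>Groupoids\<close>

locale tgpd =
 fixes G :: "('x, 'g, 'z) topgpd_scheme"
 assumes tg: "topological_groupoid G"
begin

lemma cont_src: "cts T (arr G) a ==> cts T (obj G) (\<lambda>t. src G (a t))"
 using tg continuous_map_compose[of T "arr G" a "obj G" "src G"]
 unfolding topological_groupoid_def by (simp add: o_def)

lemma cont_rng: "cts T (arr G) a ==> cts T (obj G) (\<lambda>t. rng G (a t))"
 using tg continuous_map_compose[of T "arr G" a "obj G" "rng G"]
 unfolding topological_groupoid_def by (simp add: o_def)

lemma cont_idn: "cts T (obj G) a ==> cts T (arr G) (\<lambda>t. idn G (a t))"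
 using tg continuous_map_compose[of T "obj G" a "arr G" "idn G"]
 unfolding topological_groupoid_def by (simp add: o_def)

lemma cont_ginv: "cts T (arr G) a ==> cts T (arr G) (\<lambda>t. ginv G (a t))"
 using tg continuous_map_compose[of T "arr G" a "arr G" "ginv G"]
 unfolding topological_groupoid_def by (simp add: o_def)

lemma cont_cmp:
 assumes "cts T (arr G) a" "cts T (arr G) b"
  and "\<And>t. t : pts T ==> src G (a t) = rng G (b t)"
 shows "cts T (arr G) (\<lambda>t. cmp G (a t) (b t))"
proof -
 let ?S = "sbt (prt (arr G) (arr G)) {(g, h). src G g = rng G h}"
 have "cts T ?S (\<lambda>t. (a t, b t))"
  using assms by (auto simp: cts_sub)
 moreover have "cts ?S (arr G) (\<lambda>(g, h). cmp G g h)"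
  using tg unfolding topological_groupoid_def by blast
 ultimately have "cts T (arr G) ((\<lambda>(g, h). cmp G g h) \<circ> (\<lambda>t. (a t, b t)))"
  by (rule continuous_map_compose)
 then show ?thesis by (simp add: o_def)
qed

lemma src_in[simp]: "g : Ar G ==> src G g : Ob G"
 using tg continuous_map_in unfolding topological_groupoid_def by fast
lemma rng_in[simp]: "g : Ar G ==> rng G g : Ob G"
 using tg continuous_map_in unfolding topological_groupoid_def by fast
lemma idn_in[simp]: "x : Ob G ==> idn G x : Ar G"
 using tg continuous_map_in unfolding topological_groupoid_def by fast
lemma ginv_in[simp]: "g : Ar G ==> ginv G g : Ar G"
 using tg continuous_map_in unfolding topological_groupoid_def by fast

lemma cmp_in[simp]: "g : Ar G ==> h : Ar G ==> src G g = rng G h ==> cmp G g h : Ar G"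
proof -
 assume gh: "g : Ar G" "h : Ar G" "src G g = rng G h"
 have "cts (sbt (prt (arr G) (arr G)) {(g, h). src G g = rng G h})
    (arr G) (\<lambda>(g, h). cmp G g h)"
  using tg unfolding topological_groupoid_def by blast
 from continuous_map_in[OF this, of "(g, h)"] gh show ?thesis by simp
qed

lemma src_idn[simp]: "x : Ob G ==> src G (idn G x) = x"
 and rng_idn[simp]: "x : Ob G ==> rng G (idn G x) = x"
 and src_ginv[simp]: "g : Ar G ==> src G (ginv G g) = rng G g"
 and rng_ginv[simp]: "g : Ar G ==> rng G (ginv G g) = src G g"
 and ginv_l[simp]: "g : Ar G ==> cmp G (ginv G g) g = idn G (src G g)"
 and ginv_r[simp]: "g : Ar G ==> cmp G g (ginv G g) = idn G (rng G g)"
 using tg unfolding topological_groupoid_def by blast+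

lemma src_cmp[simp]: "g : Ar G ==> h : Ar G ==> src G g = rng G h ==> src G (cmp G g h) = src G h"
 and rng_cmp[simp]: "g : Ar G ==> h : Ar G ==> src G g = rng G h ==> rng G (cmp G g h) = rng G g"
 and assoc[simp]: "g : Ar G ==> h : Ar G ==> k : Ar G ==> src G g = rng G h ==> src G h = rng G k ==>
  cmp G (cmp G g h) k = cmp G g (cmp G h k)"
 using tg unfolding topological_groupoid_def by blast+

lemma idn_l[simp]: "g : Ar G ==> rng G g = x ==> cmp G (idn G x) g = g"
 and idn_r[simp]: "g : Ar G ==> src G g = x ==> cmp G g (idn G x) = g"
 using tg unfolding topological_groupoid_def by blast+

lemma ginv_l2[simp]: "g : Ar G ==> h : Ar G ==> src G g = rng G h ==> cmp G (ginv G g) (cmp G g h) = h"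
 by (metis assoc ginv_in ginv_l idn_l src_ginv)
lemma ginv_r2[simp]: "g : Ar G ==> h : Ar G ==> rng G g = rng G h ==> cmp G g (cmp G (ginv G g) h) = h"
 by (metis assoc ginv_in ginv_r idn_l rng_ginv src_ginv)

lemma l_cancel: "g : Ar G ==> h : Ar G ==> k : Ar G ==> src G g = rng G h ==> src G g = rng G k ==>
  cmp G g h = cmp G g k \<longleftrightarrow> h = k"
 by (metis ginv_l2)
lemma r_cancel: "g : Ar G ==> h : Ar G ==> k : Ar G ==> src G h = rng G g ==> src G k = rng G g ==>
  cmp G h g = cmp G k g \<longleftrightarrow> h = k"
 by (metis assoc ginv_in ginv_r idn_r rng_ginv)

lemma ginv_unique: "g : Ar G ==> h : Ar G ==> src G g = rng G h ==> cmp G g h = idn G (rng G g) ==> h = ginv G g"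
 by (metis ginv_in ginv_l2 ginv_r l_cancel rng_ginv)

lemma ginv_ginv[simp]: "g : Ar G ==> ginv G (ginv G g) = g"
 by (metis ginv_in ginv_l ginv_unique rng_ginv src_ginv)
lemma ginv_idn[simp]: "x : Ob G ==> ginv G (idn G x) = idn G x"
 by (metis ginv_unique idn_in idn_l rng_idn src_idn)
lemma ginv_cmp[simp]: "g : Ar G ==> h : Ar G ==> src G g = rng G h ==>
  ginv G (cmp G g h) = cmp G (ginv G h) (ginv G g)"
 by (rule ginv_unique[symmetric]) auto

lemma idem_idn: "g : Ar G ==> src G g = rng G g ==> cmp G g g = g ==> g = idn G (src G g)"
 by (metis ginv_l ginv_l2)

end

text \<open>In a category in which every arrow has a left inverse, the left inverses are two-sided.
 So only one of the two inverse laws has to be verified.\<close>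

lemma topological_groupoidI:
 assumes "cts (arr G) (obj G) (src G)"
  and "cts (arr G) (obj G) (rng G)"
  and "cts (obj G) (arr G) (idn G)"
  and "cts (arr G) (arr G) (ginv G)"
  and "cts (sbt (prt (arr G) (arr G)) {(g, h). src G g = rng G h})
    (arr G) (\<lambda>(g, h). cmp G g h)"
  and id: "\<And>x. x\<in>Ob G ==> src G (idn G x) = x & rng G (idn G x) = x"
  and un: "\<And>g. g\<in>Ar G ==> cmp G (idn G (rng G g)) g = g & cmp G g (idn G (src G g)) = g"
  and inv: "\<And>g. g\<in>Ar G ==> src G (ginv G g) = rng G g & rng G (ginv G g) = src G g &
    cmp G (ginv G g) g = idn G (src G g)"
  and sr: "\<And>g h. g\<in>Ar G ==> h\<in>Ar G ==> src G g = rng G h ==>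
    src G (cmp G g h) = src G h & rng G (cmp G g h) = rng G g"
  and assoc: "\<And>g h k. g\<in>Ar G ==> h\<in>Ar G ==> k\<in>Ar G ==> src G g = rng G h ==> src G h = rng G k ==>
    cmp G (cmp G g h) k = cmp G g (cmp G h k)"
 shows "topological_groupoid G"
proof -
 have inr: "cmp G g (ginv G g) = idn G (rng G g)" if g: "g : Ar G" for g
 proof -
  let ?k = "ginv G g" and ?l = "ginv G (ginv G g)"
  have k: "?k : Ar G" and l: "?l : Ar G"
   using assms(4) g by (metis continuous_map_in)+
  have c: "cmp G g ?k : Ar G"
   using continuous_map_in[OF assms(5), of "(g, ?k)"] g k inv[OF g] by simp
  have "cmp G g ?k = cmp G (cmp G ?l ?k) (cmp G g ?k)"
   using inv[OF g] inv[OF k] un[OF c] sr[OF g k] by simp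
  also have "\<dots> = cmp G ?l (cmp G ?k (cmp G g ?k))"
   using assoc[OF l k c] inv[OF g] inv[OF k] sr[OF g k] by simp
  also have "cmp G ?k (cmp G g ?k) = cmp G (cmp G ?k g) ?k"
   using assoc[OF k g k] inv[OF g] by simp
  also have "\<dots> = ?k"
   using inv[OF g] un[OF k] by simp
  finally show ?thesis using inv[OF g] inv[OF k] by simp
 qed
 show ?thesis
  unfolding topological_groupoid_def using assms(1-5) id un inv sr assoc inr by blast
qed

section \<open>Modules\<close>

locale gmodule = H: tgpd H for H :: "('x, 'h) topgpd" +
 fixes B :: "('x, 'b, 'h) gmod"
 assumes md: "G_module H B"
begin

sublocale B: tgpd B
 using md unfolding G_module_def by unfold_locales blast

abbreviation add (infixl "|+|" 65) where "a |+| b \<equiv> cmp B a b"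

lemma obj_B[simp]: "obj B = obj H"
 using md unfolding G_module_def by blast
lemma rng_B[simp]: "b : Ar B ==> rng B b = src B b"
 using md unfolding G_module_def by blast
lemma idn_B_in[simp]: "x : Ob H ==> idn B x : Ar B"
 and src_idn_B[simp]: "x : Ob H ==> src B (idn B x) = x"
 and src_B_in[simp]: "b : Ar B ==> src B b : Ob H"
 using B.idn_in B.src_idn B.src_in by auto

lemma comm: "a : Ar B ==> b : Ar B ==> src B a = src B b ==> a |+| b = b |+| a"
 using md unfolding G_module_def by blast

lemma add_assoc: "a : Ar B ==> b : Ar B ==> c : Ar B ==> src B a = src B b ==> src B b = src B c ==>
  (a |+| b) |+| c = a |+| (b |+| c)"
 by simp

lemma left_comm: "a : Ar B ==> b : Ar B ==> c : Ar B ==> src B a = src B b ==> src B b = src B c ==>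
  a |+| (b |+| c) = b |+| (a |+| c)"
 by (metis add_assoc comm)

lemmas ac = comm left_comm

lemma add_cancel: "a : Ar B ==> b : Ar B ==> c : Ar B ==> src B a = src B b ==> src B a = src B c ==>
  a |+| b = a |+| c \<longleftrightarrow> b = c"
 by (simp add: B.l_cancel)

lemma add_cancel_r: "a : Ar B ==> b : Ar B ==> c : Ar B ==> src B a = src B b ==> src B a = src B c ==>
  b |+| a = c |+| a \<longleftrightarrow> b = c"
 by (simp add: B.r_cancel)

lemma act_cont:
 assumes "cts T (arr H) g" "cts T (arr B) b"
  and "\<And>t. t : pts T ==> src H (g t) = src B (b t)"
 shows "cts T (arr B) (\<lambda>t. act B (g t) (b t))"
proof -
 let ?S = "sbt (prt (arr H) (arr B)) {(g, a). src H g = src B a}"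
 have "cts T ?S (\<lambda>t. (g t, b t))"
  using assms by (auto simp: cts_sub)
 moreover have "cts ?S (arr B) (\<lambda>(g, a). act B g a)"
  using md unfolding G_module_def by blast
 ultimately have "cts T (arr B) ((\<lambda>(g, a). act B g a) \<circ> (\<lambda>t. (g t, b t)))"
  by (rule continuous_map_compose)
 then show ?thesis by (simp add: o_def)
qed

lemma add_cont:
 assumes "cts T (arr B) a" "cts T (arr B) b"
  and "\<And>t. t : pts T ==> src B (a t) = src B (b t)"
 shows "cts T (arr B) (\<lambda>t. a t |+| b t)"
 using assms by (intro B.cont_cmp) (auto dest: continuous_map_in)

lemma act_in[simp]: "g : Ar H ==> b : Ar B ==> src H g = src B b ==> act B g b : Ar B"
proof -
 assume gb: "g : Ar H" "b : Ar B" "src H g = src B b"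
 have "cts (sbt (prt (arr H) (arr B)) {(g, a). src H g = src B a})
    (arr B) (\<lambda>(g, a). act B g a)"
  using md unfolding G_module_def by blast
 from continuous_map_in[OF this, of "(g, b)"] gb show ?thesis by simp
qed

lemma src_act[simp]: "g : Ar H ==> b : Ar B ==> src H g = src B b ==> src B (act B g b) = rng H g"
 and act_idn[simp]: "b : Ar B ==> src B b = x ==> act B (idn H x) b = b"
 and act_cmp[simp]: "g : Ar H ==> h : Ar H ==> b : Ar B ==> src H g = rng H h ==> src H h = src B b ==>
  act B (cmp H g h) b = act B g (act B h b)"
 and act_add[simp]: "g : Ar H ==> a : Ar B ==> b : Ar B ==> src H g = src B a ==> src H g = src B b ==>
  act B g (a |+| b) = act B g a |+| act B g b"
 using md unfolding G_module_def by blast+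

lemma act_idn0[simp]: "g : Ar H ==> src H g = x ==> act B g (idn B x) = idn B (rng H g)"
proof -
 assume g: "g : Ar H" "src H g = x"
 let ?a = "act B g (idn B x)"
 have x: "x : Ob H" using g by auto
 have "?a |+| ?a = act B g (idn B x |+| idn B x)"
  using g x by (subst act_add) auto
 also have "\<dots> = ?a" using g x by simp
 finally show ?thesis using B.idem_idn[of ?a] g x by simp
qed

lemma act_neg[simp]: "g : Ar H ==> b : Ar B ==> src H g = src B b ==> act B g (ginv B b) = ginv B (act B g b)"
 by (rule B.ginv_unique) (auto simp: act_add[symmetric] simp del: act_add)

lemma act_inv_l[simp]: "g : Ar H ==> b : Ar B ==> src H g = src B b ==> act B (ginv H g) (act B g b) = b"
 by (metis H.ginv_in H.ginv_l H.src_ginv act_cmp act_idn)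
lemma act_inv_r[simp]: "g : Ar H ==> b : Ar B ==> rng H g = src B b ==> act B g (act B (ginv H g) b) = b"
 by (metis H.ginv_in H.ginv_r H.rng_ginv H.src_ginv act_cmp act_idn)

end

section \<open>Extensions\<close>

text \<open>The arrows of an extension; \<open>tr X ga b\<close> is the translate of \<open>ga\<close> by the image of \<open>b\<close>.\<close>

abbreviation "Ea X \<equiv> arr (tot X)"
abbreviation "El X \<equiv> pts (arr (tot X))"
abbreviation "Es X \<equiv> src (tot X)"
abbreviation "Er X \<equiv> rng (tot X)"
abbreviation "Em X \<equiv> cmp (tot X)"
abbreviation "tr X ga b \<equiv> cmp (tot X) ga (inc X b)"

locale ext = gmodule H B for H :: "('x, 'h) topgpd" and B :: "('x, 'b, 'h) gmod" +
 fixes X :: "('x, 'b, 'h, 'e) extn"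
 assumes ex: "extension H B X"
begin

abbreviation E where "E \<equiv> tot X"

sublocale E: tgpd "tot X"
 using ex unfolding extension_def Let_def by unfold_locales blast

lemma obj_E[simp]: "obj (tot X) = obj H"
 and emb: "embedding_map (arr B) (Ea X) (inc X)"
 and src_i[simp]: "b : Ar B ==> Es X (inc X b) = src B b"
 and rng_i[simp]: "b : Ar B ==> Er X (inc X b) = src B b"
 and i_add: "b : Ar B ==> c : Ar B ==> src B b = src B c ==>
   inc X (b |+| c) = tr X (inc X b) c"
 and quo: "quotient_map (Ea X) (arr H) (prj X)"
 and src_pr[simp]: "ga : El X ==> src H (prj X ga) = Es X ga"
 and rng_pr[simp]: "ga : El X ==> rng H (prj X ga) = Er X ga"
 and pr_cmp[simp]: "ga : El X ==> de : El X ==> Es X ga = Er X de ==>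
   prj X (Em X ga de) = cmp H (prj X ga) (prj X de)"
 and ker: "inc X ` Ar B = {ga\<in>El X. prj X ga : idn H ` Ob H}"
 and conj0: "ga : El X ==> b : Ar B ==> src B b = Es X ga ==>
   Em X (tr X ga b) (ginv (tot X) ga) = inc X (act B (prj X ga) b)"
 using ex unfolding extension_def Let_def by blast+

lemma src_E_in[simp]: "ga : El X ==> Es X ga : Ob H"
 and rng_E_in[simp]: "ga : El X ==> Er X ga : Ob H"
 and idn_E_in[simp]: "x : Ob H ==> idn (tot X) x : El X"
 and src_E_idn[simp]: "x : Ob H ==> Es X (idn (tot X) x) = x"
 and rng_E_idn[simp]: "x : Ob H ==> Er X (idn (tot X) x) = x"
 and ginv_E_idn[simp]: "x : Ob H ==> ginv (tot X) (idn (tot X) x) = idn (tot X) x"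
 using E.src_in E.rng_in E.idn_in E.src_idn E.rng_idn E.ginv_idn by auto

lemma pr_cont: "cts (Ea X) (arr H) (prj X)"
 using quo quotient_imp_continuous_map by blast

lemma cont_pr: "cts T (Ea X) a ==> cts T (arr H) (\<lambda>t. prj X (a t))"
 using continuous_map_compose[OF _ pr_cont] by (simp add: o_def)

lemma pr_in[simp]: "ga : El X ==> prj X ga : Ar H"
 using continuous_map_in[OF pr_cont] .

lemma i_cont: "cts (arr B) (Ea X) (inc X)"
 using emb unfolding embedding_map_def
 by (metis continuous_map_in_subtopology homeomorphic_imp_continuous_map)

lemma cont_i: "cts T (arr B) a ==> cts T (Ea X) (\<lambda>t. inc X (a t))"
 using continuous_map_compose[OF _ i_cont] by (simp add: o_def)

lemma i_in[simp]: "b : Ar B ==> inc X b : El X"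
 using continuous_map_in[OF i_cont] .

lemma inj_i: "inj_on (inc X) (Ar B)"
 using emb unfolding embedding_map_def by (metis homeomorphic_imp_injective_map)

lemma i_eq[simp]: "b : Ar B ==> c : Ar B ==> inc X b = inc X c \<longleftrightarrow> b = c"
 using inj_i by (auto dest: inj_onD)

lemma i_idn[simp]: "x : Ob H ==> inc X (idn B x) = idn (tot X) x"
 using E.idem_idn[of "inc X (idn B x)"] i_add[of "idn B x" "idn B x"] by simp

lemma i_neg[simp]: "b : Ar B ==> inc X (ginv B b) = ginv (tot X) (inc X b)"
 by (rule E.ginv_unique) (auto simp: i_add[symmetric])

lemma pr_idn[simp]: "x : Ob H ==> prj X (idn (tot X) x) = idn H x"
 using H.idem_idn[of "prj X (idn (tot X) x)"] pr_cmp[of "idn (tot X) x" "idn (tot X) x"]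
 by (simp del: pr_cmp)

lemma pr_ginv[simp]: "ga : El X ==> prj X (ginv (tot X) ga) = ginv H (prj X ga)"
 by (rule H.ginv_unique) (auto simp: pr_cmp[symmetric] simp del: pr_cmp)

lemma pr_i[simp]: "b : Ar B ==> prj X (inc X b) = idn H (src B b)"
proof -
 assume b: "b : Ar B"
 then have "inc X b : {ga\<in>El X. prj X ga : idn H ` Ob H}" using ker by blast
 then obtain x where x: "x : Ob H" "prj X (inc X b) = idn H x" by blast
 then show ?thesis using b src_pr[of "inc X b"] by simp
qed

lemma kerE:
 assumes "ga : El X" "prj X ga = idn H x" "x : Ob H"
 obtains b where "b : Ar B" "ga = inc X b" "src B b = x"
proof -
 have "ga : inc X ` Ar B" unfolding ker using assms by blast
 then obtain b where b: "b : Ar B" "ga = inc X b" by blast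
 then have "src B b = x" using src_pr[OF assms(1)] assms by (metis H.src_idn src_i)
 then show ?thesis using b that by blast
qed

lemma move_i: "ga : El X ==> b : Ar B ==> src B b = Er X ga ==>
   Em X (inc X b) ga = tr X ga (act B (ginv H (prj X ga)) b)"
proof -
 assume a: "ga : El X" "b : Ar B" "src B b = Er X ga"
 let ?c = "act B (ginv H (prj X ga)) b"
 have c: "?c : Ar B" "src B ?c = Es X ga" using a by auto
 have "inc X b = Em X (tr X ga ?c) (ginv (tot X) ga)"
  using conj0[OF a(1) c] a by simp
 then show ?thesis using a c by simp
qed

text \<open>\<open>dif ga de\<close> is the coordinate of \<open>de\<close> relative to \<open>ga\<close> in the fibre of the projection through
 both: the element $b$ of $B_{s(\gamma)}$ such that $\delta = \gamma\, i(b)$.\<close>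

definition dif :: "'e => 'e => 'b" where
 "dif ga de = the_inv_into (Ar B) (inc X) (Em X (ginv (tot X) ga) de)"

lemma dif:
 assumes "ga : El X" "de : El X" "prj X ga = prj X de"
 shows "dif ga de : Ar B" "src B (dif ga de) = Es X de"
  "tr X ga (dif ga de) = de"
proof -
 have sr: "Es X ga = Es X de" "Er X ga = Er X de"
  using assms src_pr rng_pr by metis+
 let ?e = "Em X (ginv (tot X) ga) de"
 have "?e : El X" "prj X ?e = idn H (Es X de)"
  using assms sr by auto
 then obtain b where b: "b : Ar B" "?e = inc X b" "src B b = Es X de"
  using assms by (metis kerE src_E_in)
 have d: "dif ga de = b"
  unfolding dif_def b(2) using inj_i b(1) by (rule the_inv_into_f_f)
 show "dif ga de : Ar B" "src B (dif ga de) = Es X de" using b d by auto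
 show "tr X ga (dif ga de) = de"
  using assms sr unfolding d b(2)[symmetric] by simp
qed

lemma i_cancel[simp]: "ga : El X ==> b : Ar B ==> c : Ar B ==> src B b = Es X ga ==>
  src B c = Es X ga ==> tr X ga b = tr X ga c \<longleftrightarrow> b = c"
 by (simp add: E.l_cancel)

lemma dif_eqI: "ga : El X ==> b : Ar B ==> src B b = Es X ga ==>
  de = tr X ga b ==> dif ga de = b"
 using dif[of ga de] by (metis E.cmp_in E.l_cancel E.src_cmp H.idn_r i_eq i_in pr_cmp pr_i pr_in rng_i src_i src_pr)

lemma cont_dif:
 assumes "cts T (Ea X) a" "cts T (Ea X) b"
  and pr: "\<And>t. t : pts T ==> prj X (a t) = prj X (b t)"
 shows "cts T (arr B) (\<lambda>t. dif (a t) (b t))"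
proof -
 let ?I = "sbt (Ea X) (inc X ` Ar B)"
 obtain g where g: "homeomorphic_maps (arr B) ?I (inc X) g"
  using emb unfolding embedding_map_def homeomorphic_map_maps by blast
 have gi: "g (inc X b) = b" if "b : Ar B" for b
  using g that unfolding homeomorphic_maps_def by blast
 have ab: "a t : El X" "b t : El X" if "t : pts T" for t
  using assms(1,2) that by (auto dest: continuous_map_in)
 have rg: "Er X (a t) = Er X (b t)" if "t : pts T" for t
  using pr[OF that] ab[OF that] by (metis rng_pr)
 let ?c = "\<lambda>t. Em X (ginv (tot X) (a t)) (b t)"
 have ce: "?c t = inc X (dif (a t) (b t))" if "t : pts T" for t
  using dif[OF ab[OF that] pr[OF that]] ab[OF that] rg[OF that]
  by (metis E.ginv_l2 i_in pr rng_i src_pr that)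
 have "cts T (Ea X) ?c"
  using assms(1,2) ab rg by (intro E.cont_cmp E.cont_ginv) auto
 then have "cts T ?I ?c"
  using ce dif(1)[OF ab pr] by (auto simp: continuous_map_in_subtopology)
 then have "cts T (arr B) (g \<circ> ?c)"
  using g unfolding homeomorphic_maps_def by (meson continuous_map_compose)
 then show ?thesis
  by (rule continuous_map_eq) (use ce gi dif(1)[OF ab pr] in auto)
qed

lemma liftD:
 assumes "is_lifting H X W sg" "h : Ar H" "h : W"
 shows "sg h : El X" "prj X (sg h) = h" "Es X (sg h) = src H h" "Er X (sg h) = rng H h"
proof -
 show 1: "sg h : El X" and 2: "prj X (sg h) = h"
  using assms unfolding is_lifting_def by (auto dest: continuous_map_in)
 show "Es X (sg h) = src H h" "Er X (sg h) = rng H h"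
  using 1 2 src_pr rng_pr by metis+
qed

end

lemma cont_lift:
 assumes "is_lifting H X W sg" "cts T (arr H) a" "\<And>t. t : pts T ==> a t : W"
 shows "cts T (Ea X) (\<lambda>t. sg (a t))"
proof -
 have "cts T (sbt (arr H) W) a"
  using assms by (auto simp: continuous_map_in_subtopology)
 then show ?thesis
  using assms(1) continuous_map_compose unfolding is_lifting_def by (fastforce simp: o_def)
qed

subsection \<open>Equivalence of extensions\<close>

lemma ext_equiv_trans:
 assumes "ext_equiv B X Y" "ext_equiv B Y Z"
 shows "ext_equiv B X Z"
proof -
 obtain ph where ph: "homeomorphic_map (Ea X) (Ea Y) ph"
   "\<forall>ga\<in>El X. Es Y (ph ga) = Es X ga & Er Y (ph ga) = Er X ga"
   "\<forall>ga\<in>El X. \<forall>de\<in>El X. Es X ga = Er X de -->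
    ph (Em X ga de) = Em Y (ph ga) (ph de)"
   "\<forall>b\<in>Ar B. ph (inc X b) = inc Y b" "\<forall>ga\<in>El X. prj Y (ph ga) = prj X ga"
  using assms(1) unfolding ext_equiv_def by blast
 obtain ps where ps: "homeomorphic_map (Ea Y) (Ea Z) ps"
   "\<forall>ga\<in>El Y. Es Z (ps ga) = Es Y ga & Er Z (ps ga) = Er Y ga"
   "\<forall>ga\<in>El Y. \<forall>de\<in>El Y. Es Y ga = Er Y de -->
    ps (Em Y ga de) = Em Z (ps ga) (ps de)"
   "\<forall>b\<in>Ar B. ps (inc Y b) = inc Z b" "\<forall>ga\<in>El Y. prj Z (ps ga) = prj Y ga"
  using assms(2) unfolding ext_equiv_def by blast
 have in': "ph ga : El Y" if "ga : El X" for ga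
  using ph(1) that by (metis homeomorphic_imp_surjective_map image_eqI)
 show ?thesis unfolding ext_equiv_def
  using homeomorphic_map_compose[OF ph(1) ps(1)] ph(2-) ps(2-) in'
  by (intro exI[of _ "ps \<circ> ph"]) auto
qed

lemma ext_equiv_refl: "ext_equiv B X X"
 unfolding ext_equiv_def
 by (rule exI[of _ "\<lambda>x. x"]) (auto intro: homeomorphic_maps_imp_map[of _ _ _ "\<lambda>x. x"] simp: homeomorphic_maps_def)

lemma ext_equiv_sym:
 assumes "ext_equiv B X Y"
  and cl: "\<And>ga de. ga : El X ==> de : El X ==> Es X ga = Er X de ==>
   Em X ga de : El X"
  and inc: "\<And>b. b : Ar B ==> inc X b : El X"
 shows "ext_equiv B Y X"
proof -
 obtain ph where ph: "homeomorphic_map (Ea X) (Ea Y) ph"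
   "\<forall>ga\<in>El X. Es Y (ph ga) = Es X ga & Er Y (ph ga) = Er X ga"
   "\<forall>ga\<in>El X. \<forall>de\<in>El X. Es X ga = Er X de -->
    ph (Em X ga de) = Em Y (ph ga) (ph de)"
   "\<forall>b\<in>Ar B. ph (inc X b) = inc Y b" "\<forall>ga\<in>El X. prj Y (ph ga) = prj X ga"
  using assms(1) unfolding ext_equiv_def by blast
 obtain ps where ps: "homeomorphic_maps (Ea X) (Ea Y) ph ps"
  using ph(1) homeomorphic_map_maps by blast
 have in': "ps ga : El X" "ph (ps ga) = ga" if "ga : El Y" for ga
  using ps that unfolding homeomorphic_maps_def by (auto dest: continuous_map_in)
 have l: "ps (ph ga) = ga" if "ga : El X" for ga
  using ps that unfolding homeomorphic_maps_def by auto
 show ?thesis unfolding ext_equiv_def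
 proof (intro exI[of _ ps] conjI ballI impI)
  show "homeomorphic_map (Ea Y) (Ea X) ps"
   using ps homeomorphic_maps_map homeomorphic_maps_sym by blast
  fix ga de assume a: "ga : El Y" "de : El Y" "Es Y ga = Er Y de"
  have sr: "Es X (ps ga) = Er X (ps de)" using ph(2) in' a by metis
  have "ph (Em X (ps ga) (ps de)) = Em Y ga de"
   using ph(3) in' a sr by simp
  then show "ps (Em Y ga de) = Em X (ps ga) (ps de)"
   using l cl in' a sr by metis
 next
  fix b assume "b : Ar B"
  then show "ps (inc Y b) = inc X b" using l inc ph(4) by metis
 qed (use ph(2,5) in' in metis)+
qed

section \<open>Factor sets\<close>

text \<open>A family of local sections over an open cover of the arrows of \<open>H\<close> presents an extension by
 the failure of these sections to be multiplicative.\<close>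

definition gcover :: "('x, 'h) topgpd => 'w set => ('w => 'h set) => bool" where
 "gcover H Om V \<longleftrightarrow> (\<forall>w\<in>Om. openin (arr H) (V w)) & Ar H \<subseteq> (\<Union>w\<in>Om. V w)"

definition fdom :: "('x, 'h) topgpd => ('w => 'h set) => 'w => 'w => 'w => ('h \<times> 'h) set" where
 "fdom H V w1 w2 w3 = {(g, h). g : Ar H & h : Ar H & src H g = rng H h &
   g : V w1 & h : V w2 & cmp H g h : V w3}"

text \<open>Values lie in the fibre over $s(h)$, as for sections of the second sheaf of the nerve. The last
 clause is the cocycle identity for $f_{w_{02} w_{23} w_{03}}(gh, k)$ and its three companions;
 the module acts through $k^{-1}$ because coefficients are written on the right.\<close>

definition factor_set ::
  "('x, 'h) topgpd => ('x, 'b, 'h) gmod => 'w set => ('w => 'h set)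
   => ('w => 'w => 'w => 'h => 'h => 'b) => bool" where
 "factor_set H B Om V f \<longleftrightarrow>
   (\<forall>w1\<in>Om. \<forall>w2\<in>Om. \<forall>w3\<in>Om.
    cts (sbt (prt (arr H) (arr H)) (fdom H V w1 w2 w3)) (arr B)
     (\<lambda>(g, h). f w1 w2 w3 g h) &
    (\<forall>g h. (g, h) : fdom H V w1 w2 w3 --> src B (f w1 w2 w3 g h) = src H h)) &
   (\<forall>w01\<in>Om. \<forall>w12\<in>Om. \<forall>w23\<in>Om. \<forall>w02\<in>Om. \<forall>w13\<in>Om. \<forall>w03\<in>Om. \<forall>g h k.
    (g, h) : fdom H V w01 w12 w02 --> (cmp H g h, k) : fdom H V w02 w23 w03 -->
    (h, k) : fdom H V w12 w23 w13 --> (g, cmp H h k) : fdom H V w01 w13 w03 -->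
    cmp B (f w02 w23 w03 (cmp H g h) k) (act B (ginv H k) (f w01 w12 w02 g h)) =
    cmp B (f w01 w13 w03 g (cmp H h k)) (f w12 w23 w13 h k))"

definition presents ::
  "('x, 'h) topgpd => ('x, 'b, 'h) gmod => 'w set => ('w => 'h set)
   => ('x, 'b, 'h, 'e) extn => ('w => 'h => 'e) => ('w => 'w => 'w => 'h => 'h => 'b) => bool" where
 "presents H B Om V X sg f \<longleftrightarrow>
   (\<forall>w\<in>Om. is_lifting H X (V w) (sg w)) &
   (\<forall>w1\<in>Om. \<forall>w2\<in>Om. \<forall>w3\<in>Om. \<forall>g h. (g, h) : fdom H V w1 w2 w3 -->
    f w1 w2 w3 g h : Ar B & src B (f w1 w2 w3 g h) = src H h &
    Em X (sg w1 g) (sg w2 h) =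
    tr X (sg w3 (cmp H g h)) (f w1 w2 w3 g h))"

lemma factor_setD:
 assumes "factor_set H B Om V f" "w1 : Om" "w2 : Om" "w3 : Om"
 shows "(g, h) : fdom H V w1 w2 w3 ==> src B (f w1 w2 w3 g h) = src H h"
  and "(g, h) : fdom H V w1 w2 w3 ==> f w1 w2 w3 g h : Ar B"
  and "[|cts T (arr H) a; cts T (arr H) b;
   \<And>t. t : pts T ==> (a t, b t) : fdom H V w1 w2 w3|] ==>
   cts T (arr B) (\<lambda>t. f w1 w2 w3 (a t) (b t))"
proof -
 let ?S = "sbt (prt (arr H) (arr H)) (fdom H V w1 w2 w3)"
 have c: "cts ?S (arr B) (\<lambda>(g, h). f w1 w2 w3 g h)"
  using assms unfolding factor_set_def by blast
 show "(g, h) : fdom H V w1 w2 w3 ==> src B (f w1 w2 w3 g h) = src H h"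
  using assms unfolding factor_set_def by blast
 show "(g, h) : fdom H V w1 w2 w3 ==> f w1 w2 w3 g h : Ar B"
  using continuous_map_in[OF c, of "(g, h)"] by (auto simp: fdom_def)
 assume a: "cts T (arr H) a" "cts T (arr H) b"
   "\<And>t. t : pts T ==> (a t, b t) : fdom H V w1 w2 w3"
 then have "cts T ?S (\<lambda>t. (a t, b t))"
  by (auto simp: cts_sub)
 from continuous_map_compose[OF this c] show "cts T (arr B) (\<lambda>t. f w1 w2 w3 (a t) (b t))"
  by (simp add: o_def)
qed

lemma factor_set_cocycle:
 assumes "factor_set H B Om V f" "w01\<in>Om" "w12\<in>Om" "w23\<in>Om" "w02\<in>Om" "w13\<in>Om" "w03\<in>Om"
  "(g, h) : fdom H V w01 w12 w02" "(cmp H g h, k) : fdom H V w02 w23 w03"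
  "(h, k) : fdom H V w12 w23 w13" "(g, cmp H h k) : fdom H V w01 w13 w03"
 shows "cmp B (f w02 w23 w03 (cmp H g h) k) (act B (ginv H k) (f w01 w12 w02 g h)) =
    cmp B (f w01 w13 w03 g (cmp H h k)) (f w12 w23 w13 h k)"
 using assms unfolding factor_set_def by blast

lemma presentsD:
 assumes "presents H B Om V X sg f"
 shows "w : Om ==> is_lifting H X (V w) (sg w)"
  and "w1 : Om ==> w2 : Om ==> w3 : Om ==> (g, h) : fdom H V w1 w2 w3 ==>
   f w1 w2 w3 g h : Ar B & src B (f w1 w2 w3 g h) = src H h &
    Em X (sg w1 g) (sg w2 h) =
    tr X (sg w3 (cmp H g h)) (f w1 w2 w3 g h)"
 using assms unfolding presents_def by blast+

lemma presents_mono: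
 assumes "presents H B Om V X sg f" "\<And>w. w : Om' ==> rh w : Om & V' w \<subseteq> V (rh w)"
 shows "presents H B Om' V' X (\<lambda>w. sg (rh w)) (\<lambda>w1 w2 w3. f (rh w1) (rh w2) (rh w3))"
proof -
 have sub: "(g, h) : fdom H V (rh w1) (rh w2) (rh w3)"
  if "(g, h) : fdom H V' w1 w2 w3" "w1\<in>Om'" "w2\<in>Om'" "w3\<in>Om'" for g h w1 w2 w3
  using that assms(2) unfolding fdom_def by blast
 show ?thesis unfolding presents_def
 proof (intro conjI ballI)
  fix w assume w: "w : Om'"
  then show "is_lifting H X (V' w) (sg (rh w))"
   using presentsD(1)[OF assms(1)] assms(2) continuous_map_subtopology_mono
   unfolding is_lifting_def by (metis (no_types, lifting) Int_iff subset_iff)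
 next
  fix w1 w2 w3 assume w: "w1\<in>Om'" "w2\<in>Om'" "w3\<in>Om'"
  show "\<forall>g h. (g, h) : fdom H V' w1 w2 w3 -->
    f (rh w1) (rh w2) (rh w3) g h : Ar B & src B (f (rh w1) (rh w2) (rh w3) g h) = src H h &
    Em X (sg (rh w1) g) (sg (rh w2) h) =
    tr X (sg (rh w3) (cmp H g h)) (f (rh w1) (rh w2) (rh w3) g h)"
   using sub w presentsD(2)[OF assms(1), of "rh w1" "rh w2" "rh w3"] assms(2) by blast
 qed
qed

lemma presents_cong:
 assumes "presents H B Om V X sg f"
  and "\<And>w1 w2 w3 g h. w1 : Om ==> w2 : Om ==> w3 : Om ==> (g, h) : fdom H V w1 w2 w3 ==>
   f w1 w2 w3 g h = f' w1 w2 w3 g h"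
 shows "presents H B Om V X sg f'"
proof -
 have "f' w1 w2 w3 g h : Ar B & src B (f' w1 w2 w3 g h) = src H h &
    Em X (sg w1 g) (sg w2 h) =
    tr X (sg w3 (cmp H g h)) (f' w1 w2 w3 g h)"
  if "w1 : Om" "w2 : Om" "w3 : Om" "(g, h) : fdom H V w1 w2 w3" for w1 w2 w3 g h
  using presentsD(2)[OF assms(1) that] assms(2)[OF that] by simp
 then show ?thesis using presentsD(1)[OF assms(1)] unfolding presents_def by blast
qed

text \<open>The cocycle identity of the factor set of an extension is associativity, for the product of
 three local sections.\<close>

lemma (in ext) liftings_imp_factor_set:
 assumes lift: "\<And>w. w : Om ==> is_lifting H X (V w) (sg w)"
 shows "\<exists>f. factor_set H B Om V f & presents H B Om V X sg f"
proof -
 define f where "f w1 w2 w3 g h = dif (sg w3 (cmp H g h)) (Em X (sg w1 g) (sg w2 h))"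
  for w1 w2 w3 g h
 have D: "g : Ar H & h : Ar H & src H g = rng H h & sg w1 g : El X & sg w2 h : El X &
   sg w3 (cmp H g h) : El X & Es X (sg w1 g) = src H g & Er X (sg w1 g) = rng H g &
   Es X (sg w2 h) = src H h & Er X (sg w2 h) = rng H h &
   Es X (sg w3 (cmp H g h)) = src H h & Er X (sg w3 (cmp H g h)) = rng H g &
   prj X (sg w1 g) = g & prj X (sg w2 h) = h & prj X (sg w3 (cmp H g h)) = cmp H g h"
  if "w1 : Om" "w2 : Om" "w3 : Om" "(g, h) : fdom H V w1 w2 w3" for w1 w2 w3 g h
  using that(4) liftD[OF lift[OF that(1)], of g] liftD[OF lift[OF that(2)], of h]
   liftD[OF lift[OF that(3)], of "cmp H g h"]
  unfolding fdom_def by auto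
 have F: "f w1 w2 w3 g h : Ar B & src B (f w1 w2 w3 g h) = src H h &
    Em X (sg w1 g) (sg w2 h) =
    tr X (sg w3 (cmp H g h)) (f w1 w2 w3 g h)"
  if "w1 : Om" "w2 : Om" "w3 : Om" "(g, h) : fdom H V w1 w2 w3" for w1 w2 w3 g h
  using D[OF that] dif[of "sg w3 (cmp H g h)" "Em X (sg w1 g) (sg w2 h)"]
  unfolding f_def by simp
 have "factor_set H B Om V f" unfolding factor_set_def
 proof (intro conjI ballI allI impI)
  fix w1 w2 w3 assume w: "w1 : Om" "w2 : Om" "w3 : Om"
  let ?S = "sbt (prt (arr H) (arr H)) (fdom H V w1 w2 w3)"
  have t: "(fst t, snd t) : fdom H V w1 w2 w3" if "t : pts ?S" for t
   using that by auto
  have V: "fst t : V w1 & snd t : V w2 & cmp H (fst t) (snd t) : V w3" if "t : pts ?S" for t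
   using t[OF that] by (auto simp: fdom_def)
  note TD = D[OF w t]
  have c1: "cts ?S (arr H) fst" and c2: "cts ?S (arr H) snd"
   by (auto intro: cts_sub_intro)
  have c3: "cts ?S (arr H) (\<lambda>t. cmp H (fst t) (snd t))"
   by (rule H.cont_cmp[OF c1 c2]) (use TD in blast)
  have "cts ?S (arr B) (\<lambda>t. dif (sg w3 (cmp H (fst t) (snd t)))
     (Em X (sg w1 (fst t)) (sg w2 (snd t))))"
  proof (intro cont_dif E.cont_cmp)
   show "cts ?S (Ea X) (\<lambda>t. sg w3 (cmp H (fst t) (snd t)))"
    using V by (intro cont_lift[OF lift[OF w(3)] c3]) blast
   show "cts ?S (Ea X) (\<lambda>t. sg w1 (fst t))"
    using V by (intro cont_lift[OF lift[OF w(1)] c1]) blast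
   show "cts ?S (Ea X) (\<lambda>t. sg w2 (snd t))"
    using V by (intro cont_lift[OF lift[OF w(2)] c2]) blast
  qed (use TD in auto)
  then show "cts ?S (arr B) (\<lambda>(g, h). f w1 w2 w3 g h)"
   by (simp add: f_def case_prod_unfold)
  fix g h assume "(g, h) : fdom H V w1 w2 w3"
  then show "src B (f w1 w2 w3 g h) = src H h" using F w by blast
 next
  fix w01 w12 w23 w02 w13 w03 g h k
  assume w: "w01 : Om" "w12 : Om" "w23 : Om" "w02 : Om" "w13 : Om" "w03 : Om"
   and d: "(g, h) : fdom H V w01 w12 w02" "(cmp H g h, k) : fdom H V w02 w23 w03"
    "(h, k) : fdom H V w12 w23 w13" "(g, cmp H h k) : fdom H V w01 w13 w03"
  note D1 = D[OF w(1,2,4) d(1)] D[OF w(4,3,6) d(2)] D[OF w(2,3,5) d(3)] D[OF w(1,5,6) d(4)]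
  note F1 = F[OF w(1,2,4) d(1)] and F2 = F[OF w(4,3,6) d(2)] and F3 = F[OF w(2,3,5) d(3)] and F4 = F[OF w(1,5,6) d(4)]
  let ?a = "f w01 w12 w02 g h" and ?b = "f w02 w23 w03 (cmp H g h) k" and ?c = "f w12 w23 w13 h k"
   and ?d = "f w01 w13 w03 g (cmp H h k)" and ?s = "sg w03 (cmp H g (cmp H h k))"
  have "cmp E (cmp E (sg w01 g) (sg w12 h)) (sg w23 k) =
    cmp E (sg w02 (cmp H g h)) (cmp E (inc X ?a) (sg w23 k))"
   using D1 F1 by simp
  also have "cmp E (inc X ?a) (sg w23 k) = cmp E (sg w23 k) (inc X (act B (ginv H k) ?a))"
   using D1 F1 by (subst move_i) auto
  also have "cmp E (sg w02 (cmp H g h)) \<dots> = cmp E (cmp E (sg w02 (cmp H g h)) (sg w23 k)) (inc X (act B (ginv H k) ?a))"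
   using D1 F1 by simp
  also have "\<dots> = cmp E ?s (inc X (?b |+| act B (ginv H k) ?a))"
   using D1 F1 F2 by (simp add: i_add)
  finally have 1: "cmp E (cmp E (sg w01 g) (sg w12 h)) (sg w23 k) = \<dots>" .
  have "cmp E (sg w01 g) (cmp E (sg w12 h) (sg w23 k)) =
    cmp E (cmp E (sg w01 g) (sg w13 (cmp H h k))) (inc X ?c)"
   using D1 F3 by simp
  also have "\<dots> = cmp E ?s (inc X (?d |+| ?c))"
   using D1 F3 F4 by (simp add: i_add)
  finally have 2: "cmp E (sg w01 g) (cmp E (sg w12 h) (sg w23 k)) = \<dots>" .
  have "cmp E ?s (inc X (?b |+| act B (ginv H k) ?a)) = cmp E ?s (inc X (?d |+| ?c))"
   using 1 2 D1 by simp
  then show "?b |+| act B (ginv H k) ?a = ?d |+| ?c"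
   using D1 F1 F2 F3 F4 by (subst (asm) i_cancel) auto
 qed
 then show ?thesis using lift F unfolding presents_def by blast
qed

lemma presents_equiv:
 assumes md: "topological_groupoid H" "G_module H B" and "extension H B X" and eq: "ext_equiv B X Y"
  and cov: "gcover H Om V" and pr: "presents H B Om V X sg f"
 shows "\<exists>ta. presents H B Om V Y ta f"
proof -
 interpret X: ext H B X using assms by unfold_locales
 obtain ph where ph: "homeomorphic_map (Ea X) (Ea Y) ph"
   "\<forall>ga\<in>El X. Es Y (ph ga) = Es X ga & Er Y (ph ga) = Er X ga"
   "\<forall>ga\<in>El X. \<forall>de\<in>El X. Es X ga = Er X de -->
    ph (Em X ga de) = Em Y (ph ga) (ph de)"
   "\<forall>b\<in>Ar B. ph (inc X b) = inc Y b" "\<forall>ga\<in>El X. prj Y (ph ga) = prj X ga"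
  using eq unfolding ext_equiv_def by blast
 have c: "cts (Ea X) (Ea Y) ph"
  using ph(1) homeomorphic_imp_continuous_map by blast
 note L = presentsD(1)[OF pr] and P = presentsD(2)[OF pr]
 show ?thesis unfolding presents_def
 proof (intro exI[of _ "\<lambda>w h. ph (sg w h)"] conjI ballI allI impI)
  fix w assume w: "w : Om"
  show "is_lifting H Y (V w) (\<lambda>h. ph (sg w h))"
   using L[OF w] ph(5) continuous_map_compose[OF _ c] X.liftD[OF L[OF w]]
   unfolding is_lifting_def by (auto simp: o_def)
 next
  fix w1 w2 w3 g h assume w: "w1 : Om" "w2 : Om" "w3 : Om" and gh: "(g, h) : fdom H V w1 w2 w3"
  note p = P[OF w gh]
  have D: "g : Ar H" "h : Ar H" "src H g = rng H h" "g : V w1" "h : V w2" "cmp H g h : V w3" "cmp H g h : Ar H"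
   using gh by (auto simp: fdom_def)
  note l1 = X.liftD[OF L[OF w(1)] D(1) D(4)] and l2 = X.liftD[OF L[OF w(2)] D(2) D(5)]
   and l3 = X.liftD[OF L[OF w(3)] D(7) D(6)]
  have "Em Y (ph (sg w1 g)) (ph (sg w2 h)) = ph (Em X (sg w1 g) (sg w2 h))"
   using ph(3) l1 l2 D by simp
  also have "\<dots> = ph (tr X (sg w3 (cmp H g h)) (f w1 w2 w3 g h))"
   using p by simp
  also have "\<dots> = tr Y (ph (sg w3 (cmp H g h))) (f w1 w2 w3 g h)"
   using ph(3,4) l3 D p by simp
  finally show "Em Y (ph (sg w1 g)) (ph (sg w2 h)) = \<dots>" .
  show "f w1 w2 w3 g h : Ar B" "src B (f w1 w2 w3 g h) = src H h" using p by auto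
 qed
qed

section \<open>Realising factor sets\<close>

locale fset = gmodule H B for H :: "('x, 'h) topgpd" and B :: "('x, 'b, 'h) gmod" +
 fixes Om :: "'w set" and V :: "'w => 'h set" and f :: "'w => 'w => 'w => 'h => 'h => 'b"
 assumes cov: "gcover H Om V" and fs: "factor_set H B Om V f"
begin

definition wch :: "'h => 'w" where "wch h = (SOME w. w : Om & h : V w)"
definition uch :: "'x => 'w" where "uch x = wch (idn H x)"

lemma wch[simp]: "h : Ar H ==> wch h : Om" "h : Ar H ==> h : V (wch h)"
proof -
 assume "h : Ar H"
 then have "\<exists>w. w : Om & h : V w" using cov unfolding gcover_def by blast
 from someI_ex[OF this] show "wch h : Om" "h : V (wch h)" unfolding wch_def by auto
qed

lemma uch[simp]: "x : Ob H ==> uch x : Om" "x : Ob H ==> idn H x : V (uch x)"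
 unfolding uch_def by auto

lemma V_open: "w : Om ==> openin (arr H) (V w)"
 using cov unfolding gcover_def by blast

lemma fdomI: "g : Ar H ==> h : Ar H ==> src H g = rng H h ==> g : V w1 ==> h : V w2 ==>
  cmp H g h : V w3 ==> (g, h) : fdom H V w1 w2 w3"
 unfolding fdom_def by auto

lemma f_in[simp]:
 assumes "w1 : Om" "w2 : Om" "w3 : Om" "g : Ar H" "h : Ar H" "src H g = rng H h"
  "g : V w1" "h : V w2" "cmp H g h : V w3"
 shows "f w1 w2 w3 g h : Ar B" "src B (f w1 w2 w3 g h) = src H h"
 using factor_setD[OF fs assms(1-3)] fdomI assms by auto

lemma f_coc:
 assumes "w01 : Om" "w12 : Om" "w23 : Om" "w02 : Om" "w13 : Om" "w03 : Om"
  "g : Ar H" "h : Ar H" "k : Ar H" "src H g = rng H h" "src H h = rng H k"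
  "g : V w01" "h : V w12" "k : V w23" "cmp H g h : V w02" "cmp H h k : V w13"
  "cmp H g (cmp H h k) : V w03"
 shows "f w02 w23 w03 (cmp H g h) k |+| act B (ginv H k) (f w01 w12 w02 g h) =
    f w01 w13 w03 g (cmp H h k) |+| f w12 w23 w13 h k"
 by (rule factor_set_cocycle[OF fs]) (use assms in \<open>auto simp: fdom_def\<close>)

text \<open>The factor set of the set-theoretic section that takes a chosen index at every arrow. It need not
 be continuous, but it satisfies the cocycle identity, which makes the set of pairs a groupoid.\<close>

definition cc :: "'h => 'h => 'b" where
 "cc g h = f (wch g) (wch h) (wch (cmp H g h)) g h"
text \<open>The value of the factor set at a unit, by which the chosen section fails to be unital.\<close>

definition ee :: "'x => 'b" where
 "ee x = f (uch x) (uch x) (uch x) (idn H x) (idn H x)"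
definition dd :: "'w => 'h => 'b" where
 "dd w h = f w (uch (src H h)) (wch h) h (idn H (src H h)) |+| ginv B (ee (src H h))"

lemma cc_in[simp]: "g : Ar H ==> h : Ar H ==> src H g = rng H h ==> cc g h : Ar B"
 and src_cc[simp]: "g : Ar H ==> h : Ar H ==> src H g = rng H h ==> src B (cc g h) = src H h"
 unfolding cc_def by auto

lemma ee_in[simp]: "x : Ob H ==> ee x : Ar B"
 and src_ee[simp]: "x : Ob H ==> src B (ee x) = x"
 unfolding ee_def by auto

lemma dd_in[simp]: "w : Om ==> h : Ar H ==> h : V w ==> dd w h : Ar B"
 and src_dd[simp]: "w : Om ==> h : Ar H ==> h : V w ==> src B (dd w h) = src H h"
 unfolding dd_def by auto

lemma cc_coc: "g : Ar H ==> h : Ar H ==> k : Ar H ==> src H g = rng H h ==> src H h = rng H k ==>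
  cc (cmp H g h) k |+| act B (ginv H k) (cc g h) = cc g (cmp H h k) |+| cc h k"
 unfolding cc_def using f_coc[of "wch g" "wch h" "wch k" "wch (cmp H g h)" "wch (cmp H h k)" "wch (cmp H g (cmp H h k))" g h k]
 by simp

text \<open>The cocycle identity at $(1, 1, h)$.\<close>

lemma f_unit_l: "w : Om ==> u : Om ==> h : Ar H ==> h : V w ==> idn H (rng H h) : V u ==>
  f u w w (idn H (rng H h)) h = act B (ginv H h) (f u u u (idn H (rng H h)) (idn H (rng H h)))"
 using f_coc[of u u w u w w "idn H (rng H h)" "idn H (rng H h)" h]
 by (simp add: add_cancel)

lemma cc_1l: "h : Ar H ==> cc (idn H (rng H h)) h = act B (ginv H h) (ee (rng H h))"
 unfolding cc_def ee_def using f_unit_l[of "wch h" "uch (rng H h)" h] by (simp add: uch_def)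

lemma cc_1r: "h : Ar H ==> cc h (idn H (src H h)) = ee (src H h)"
 using cc_coc[of h "idn H (src H h)" "idn H (src H h)"]
 by (simp add: add_cancel cc_def ee_def uch_def)

text \<open>The local section with index $w$ is given by \<open>dd w\<close> in the coordinates
 of the chosen set-theoretic section.\<close>

lemma star:
 assumes w: "w1 : Om" "w2 : Om" "w3 : Om" and gh: "g : Ar H" "h : Ar H" "src H g = rng H h"
  "g : V w1" "h : V w2" "cmp H g h : V w3"
 shows "cc g h |+| (act B (ginv H h) (dd w1 g) |+| dd w2 h) = dd w3 (cmp H g h) |+| f w1 w2 w3 g h"
proof -
 let ?x = "src H h" and ?y = "src H g"
 let ?p = "f w1 (uch ?y) (wch g) g (idn H ?y)" and ?q = "f w2 (uch ?x) (wch h) h (idn H ?x)"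
  and ?r = "f w3 (uch ?x) (wch (cmp H g h)) (cmp H g h) (idn H ?x)"
  and ?F = "f w1 w2 w3 g h" and ?K = "f w1 (wch h) (wch (cmp H g h)) g h" and ?e = "ee ?x"
 define p where "p = act B (ginv H h) ?p"
 define e where "e = act B (ginv H h) (ee ?y)"
 have m: "?p : Ar B" "src B ?p = ?y" "?q : Ar B" "src B ?q = ?x" "?r : Ar B" "src B ?r = ?x"
   "?F : Ar B" "src B ?F = ?x" "?K : Ar B" "src B ?K = ?x" "?e : Ar B" "src B ?e = ?x"
   "ee ?y : Ar B" "src B (ee ?y) = ?y" "cc g h : Ar B" "src B (cc g h) = ?x" "?x : Ob H"
  using w gh by auto
 have m2: "p : Ar B" "src B p = ?x" "e : Ar B" "src B e = ?x"
  unfolding p_def e_def using m gh by auto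
 have i: "?r |+| ?F = ?K |+| ?q"
  using f_coc[of w1 w2 "uch ?x" w3 "wch h" "wch (cmp H g h)" g h "idn H ?x"] w gh m
  by simp
 have ii: "cc g h |+| p = ?K |+| e"
  using f_coc[of w1 "uch ?y" "wch h" "wch g" "wch h" "wch (cmp H g h)" g "idn H ?y" h] w gh m
   f_unit_l[of "wch h" "uch ?y" h]
  by (simp add: p_def e_def ee_def cc_def)
 have "cc g h |+| ((p |+| ginv B e) |+| (?q |+| ginv B ?e)) = (cc g h |+| p) |+| (ginv B e |+| (?q |+| ginv B ?e))"
  using m m2 by simp
 also have "\<dots> = (?K |+| ?q) |+| ginv B ?e"
  unfolding ii using m m2 by simp
 also have "\<dots> = (?r |+| ginv B ?e) |+| ?F"
  unfolding i[symmetric] using m m2 by (simp add: ac)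
 finally show ?thesis
  using m gh by (simp add: dd_def p_def e_def)
qed

lemma dd_unit: "x : Ob H ==> u : Om ==> idn H x : V u ==>
  ee x |+| dd u (idn H x) = f u u u (idn H x) (idn H x)"
proof -
 assume a: "x : Ob H" "u : Om" "idn H x : V u"
 let ?d = "dd u (idn H x)" and ?f = "f u u u (idn H x) (idn H x)"
 have "?d |+| (ee x |+| ?d) = ?d |+| ?f"
  using star[of u u u "idn H x" "idn H x"] a cc_1r[of "idn H x"] by (simp add: ac)
 then show ?thesis using a by (subst (asm) add_cancel) auto
qed

lemma dd_trans:
 assumes "w : Om" "w' : Om" "u : Om" "h : Ar H" "h : V w" "h : V w'" "idn H (src H h) : V u"
 shows "dd w h |+| f u u u (idn H (src H h)) (idn H (src H h)) = dd w' h |+| f w u w' h (idn H (src H h))"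
 using star[of w u w' h "idn H (src H h)"] assms cc_1r[of h] dd_unit[of "src H h" u, symmetric]
 by (simp add: ac)

definition mlt :: "'b \<times> 'h => 'b \<times> 'h => 'b \<times> 'h" where
 "mlt = (\<lambda>(b, g) (b', h). (cc g h |+| (act B (ginv H h) b |+| b'), cmp H g h))"
definition neg :: "'b \<times> 'h => 'b \<times> 'h" where
 "neg = (\<lambda>(b, h). (act B h (ginv B (ee (src H h) |+| (cc (ginv H h) h |+| b))), ginv H h))"
definition unt :: "'x => 'b \<times> 'h" where
 "unt = (\<lambda>x. (ginv B (ee x), idn H x))"
definition Esp :: "('b \<times> 'h) set" where
 "Esp = {(b, h). b : Ar B & h : Ar H & src B b = src H h}"
definition dom :: "'w => ('b \<times> 'h) topology" where
 "dom w = sbt (prt (arr B) (arr H)) {(b, h). src B b = src H h & h : V w}"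
definition chart :: "'w => 'b \<times> 'h => 'b \<times> 'h" where
 "chart w = (\<lambda>(b, h). (dd w h |+| b, h))"
definition co :: "'w => 'b \<times> 'h => 'b" where
 "co w = (\<lambda>(b, h). ginv B (dd w h) |+| b)"

text \<open>The finest topology for which all the charts are continuous; the transition functions of the
 charts are continuous, so the charts become homeomorphisms onto open sets.\<close>

definition Etop :: "('b \<times> 'h) topology" where
 "Etop = topology (\<lambda>U. U \<subseteq> Esp & (\<forall>w\<in>Om. openin (dom w) {p : pts (dom w). chart w p : U}))"

definition realisation :: "('x, 'b, 'h, 'b \<times> 'h) extn" where
 "realisation = \<lparr>tot = \<lparr>obj = obj H, arr = Etop, src = (\<lambda>(b, h). src H h), rng = (\<lambda>(b, h). rng H h),
   idn = unt, cmp = mlt, ginv = neg\<rparr>,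
   inc = (\<lambda>b. (b |+| ginv B (ee (src B b)), idn H (src B b))), prj = snd\<rparr>"

lemma istop: "istopology (\<lambda>U. U \<subseteq> Esp & (\<forall>w\<in>Om. openin (dom w) {p : pts (dom w). chart w p : U}))"
proof -
 have 1: "{p : pts (dom w). chart w p : S \<inter> T} =
  {p : pts (dom w). chart w p : S} \<inter> {p : pts (dom w). chart w p : T}" for S T w by blast
 have 2: "{p : pts (dom w). chart w p : \<Union>\<K>} =
  (\<Union>K\<in>\<K>. {p : pts (dom w). chart w p : K})" for \<K> w by blast
 show ?thesis unfolding istopology_def 1 2 by (auto intro!: openin_Int openin_Union)
qed

lemma openin_E: "openin Etop U \<longleftrightarrow> U \<subseteq> Esp & (\<forall>w\<in>Om. openin (dom w) {p : pts (dom w). chart w p : U})"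
 unfolding Etop_def using istop by (simp add: topology_inverse')

lemma topspace_dom: "pts (dom w) = {(b, h). b : Ar B & h : Ar H & src B b = src H h & h : V w}"
 unfolding dom_def by auto

lemma chart_in: "w : Om ==> p : pts (dom w) ==> chart w p : Esp"
 unfolding topspace_dom chart_def Esp_def by auto

lemma topspace_E[simp]: "pts Etop = Esp"
proof
 show "pts Etop \<subseteq> Esp" using openin_E by (metis openin_topspace)
 have "{p : pts (dom w). chart w p : Esp} = pts (dom w)" if "w : Om" for w
  using chart_in[OF that] by blast
 then have "openin Etop Esp" unfolding openin_E by auto
 then show "Esp \<subseteq> pts Etop" by (rule openin_subset)
qed

lemma chart_cont: "w : Om ==> cts (dom w) Etop (chart w)"
 unfolding continuous_map_def using chart_in openin_E by auto

lemma into_E: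
 assumes "w : Om" "cts S (arr B) b" "cts S (arr H) h"
  "\<And>s. s : pts S ==> h s : V w & src B (b s) = src H (h s)"
 shows "cts S Etop (\<lambda>s. (dd w (h s) |+| b s, h s))"
proof -
 have "cts S (dom w) (\<lambda>s. (b s, h s))"
  unfolding dom_def using assms by (auto simp: cts_sub)
 from continuous_map_compose[OF this chart_cont[OF assms(1)]] show ?thesis
  by (simp add: o_def chart_def)
qed

lemma cont_snd_E: "cts Etop (arr H) snd"
 unfolding continuous_map_def
proof (intro conjI allI impI)
 show "snd : pts Etop \<rightarrow> pts (arr H)" by (auto simp: Esp_def)
 fix N assume N: "openin (arr H) N"
 have "openin (dom w) {p : pts (dom w). chart w p : {x : pts Etop. snd x : N}}"
  if w: "w : Om" for w
 proof -
  have "cts (dom w) (arr H) snd"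
   unfolding dom_def by (auto intro: continuous_map_from_subtopology continuous_map_snd)
  then have "openin (dom w) {p : pts (dom w). snd p : N}"
   using N by (rule openin_preimage)
  moreover have "{p : pts (dom w). chart w p : {x : pts Etop. snd x : N}} =
   {p : pts (dom w). snd p : N}"
   using chart_in[OF w] by (auto simp: chart_def)
  ultimately show ?thesis by simp
 qed
 then show "openin Etop {x : pts Etop. snd x : N}"
  unfolding openin_E by auto
qed

lemma cont_snd: "cts S Etop p ==> cts S (arr H) (\<lambda>s. snd (p s))"
 using continuous_map_compose[OF _ cont_snd_E] by (simp add: o_def)

lemma cont_idsrc: "cts S (arr H) h ==> cts S (arr H) (\<lambda>s. idn H (src H (h s)))"
 by (intro H.cont_idn H.cont_src)

text \<open>The transition function between two charts is a combination of values of \<open>f\<close> at $(h,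
 1)$ and $(1, 1)$; the discontinuous choice of indices cancels.\<close>

lemma co_trans_cont:
 assumes w: "w : Om" "w' : Om"
 shows "cts (sbt (dom w') {p. snd p : V w}) (arr B) (\<lambda>p. co w (chart w' p))"
proof (rule continuous_map_local)
 let ?S = "sbt (dom w') {p. snd p : V w}"
 have c1: "cts ?S (arr H) snd" and c2: "cts ?S (arr B) fst"
  unfolding dom_def by (auto intro: continuous_map_from_subtopology continuous_map_snd continuous_map_fst)
 fix p0 assume p0: "p0 : pts ?S"
 define u where "u = uch (src H (snd p0))"
 have x0: "src H (snd p0) : Ob H" using p0 by (auto simp: topspace_dom)
 then have u: "u : Om" "idn H (src H (snd p0)) : V u" unfolding u_def by auto
 define N where "N = {p : pts ?S. idn H (src H (snd p)) : V u}"
 have N: "openin ?S N" unfolding N_def by (rule openin_preimage[OF cont_idsrc[OF c1] V_open[OF u(1)]])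
 let ?T = "sbt ?S N"
 have P: "fst p : Ar B & snd p : Ar H & src B (fst p) = src H (snd p) & snd p : V w & snd p : V w' &
   idn H (src H (snd p)) : V u & src H (snd p) : Ob H" if "p : pts ?T" for p
  using that by (auto simp: N_def topspace_dom)
 have d1: "cts ?T (arr H) snd" and d2: "cts ?T (arr B) fst"
  using c1 c2 continuous_map_from_subtopology by blast+
 note d3 = cont_idsrc[OF d1]
 let ?F = "\<lambda>p. f u u u (idn H (src H (snd p))) (idn H (src H (snd p)))"
 let ?K = "\<lambda>p. f w' u w (snd p) (idn H (src H (snd p)))"
 have cF: "cts ?T (arr B) ?F"
  by (rule factor_setD(3)[OF fs u(1) u(1) u(1) d3 d3]) (drule P, simp add: fdom_def)
 have cK: "cts ?T (arr B) ?K"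
  by (rule factor_setD(3)[OF fs w(2) u(1) w(1) d1 d3]) (drule P, simp add: fdom_def)
 have "cts ?T (arr B) (\<lambda>p. ginv B (?F p) |+| (?K p |+| fst p))"
  by (intro add_cont B.cont_ginv cF cK d2) ((drule P, simp add: w u)+)
 moreover have "ginv B (?F p) |+| (?K p |+| fst p) = co w (chart w' p)" if "p : pts ?T" for p
 proof -
  obtain b h where p: "p = (b, h)" by (cases p)
  note Q = P[OF that, unfolded p fst_conv snd_conv] w u
  have F: "?F p : Ar B" "src B (?F p) = src H h" and K: "?K p : Ar B" "src B (?K p) = src H h"
   using Q p by auto
  have D: "dd w' h : Ar B" "src B (dd w' h) = src H h" "dd w h : Ar B" "src B (dd w h) = src H h"
   using Q by auto
  have "dd w' h = dd w h |+| (?K p |+| ginv B (?F p))"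
  proof -
   have "dd w' h = (dd w' h |+| ?F p) |+| ginv B (?F p)" using D F by simp
   also have "dd w' h |+| ?F p = dd w h |+| ?K p"
    using dd_trans[of w' w u h] Q p by simp
   finally show ?thesis using D K F by simp
  qed
  then show ?thesis using D K F Q p by (simp add: co_def chart_def ac)
 qed
 ultimately have "cts ?T (arr B) (\<lambda>p. co w (chart w' p))"
  by (rule continuous_map_eq)
 then show "\<exists>N. openin ?S N & p0 : N & cts (sbt ?S N) (arr B) (\<lambda>p. co w (chart w' p))"
  using N p0 u by (intro exI[of _ N]) (auto simp: N_def)
qed

lemma co_cont:
 assumes w: "w : Om"
 shows "cts (sbt Etop {p. snd p : V w}) (arr B) (co w)"
 unfolding continuous_map_def
proof (intro conjI allI impI)
 show "co w : pts (sbt Etop {p. snd p : V w}) \<rightarrow> Ar B"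
  using w by (auto simp: Esp_def co_def)
 fix O' assume O': "openin (arr B) O'"
 let ?U = "{p : Esp. snd p : V w & co w p : O'}"
 have "openin (dom w') {p : pts (dom w'). chart w' p : ?U}" if w': "w' : Om" for w'
 proof -
  let ?N = "{p. snd p : V w}"
  have "cts (dom w') (arr H) snd"
   unfolding dom_def by (auto intro: continuous_map_from_subtopology continuous_map_snd)
  then have N: "openin (dom w') {p : pts (dom w'). snd p : V w}"
   using V_open[OF w] by (rule openin_preimage)
  let ?N' = "{p : pts (dom w'). snd p : V w}"
  have eq: "sbt (dom w') ?N = sbt (dom w') ?N'"
   using subtopology_restrict[of "dom w'" ?N] by (simp add: Int_def)
  have "openin (sbt (dom w') ?N) {p : pts (sbt (dom w') ?N). co w (chart w' p) : O'}"
   using co_trans_cont[OF w w'] O' by (rule openin_preimage)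
  then have "openin (dom w') {p : pts (sbt (dom w') ?N'). co w (chart w' p) : O'}"
   unfolding eq using openin_open_subtopology[OF N] by blast
  moreover have "{p : pts (dom w'). chart w' p : ?U} =
    {p : pts (sbt (dom w') ?N'). co w (chart w' p) : O'}"
   using chart_in[OF w'] by (auto simp: chart_def)
  ultimately show ?thesis by simp
 qed
 then have "openin Etop ?U" unfolding openin_E by auto
 moreover have "{x : pts (sbt Etop {p. snd p : V w}). co w x : O'} = ?U \<inter> {p. snd p : V w}"
  by auto
 ultimately show "openin (sbt Etop {p. snd p : V w}) {x : pts (sbt Etop {p. snd p : V w}). co w x : O'}"
  unfolding openin_subtopology by blast
qed

lemma cont_co:
 assumes "w : Om" "cts S Etop p" "\<And>s. s : pts S ==> snd (p s) : V w"
 shows "cts S (arr B) (\<lambda>s. co w (p s))"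
proof -
 have "cts S (sbt Etop {p. snd p : V w}) p"
  using assms by (auto simp: continuous_map_in_subtopology)
 from continuous_map_compose[OF this co_cont[OF assms(1)]] show ?thesis by (simp add: o_def)
qed

lemma co:
 assumes "w : Om" "p : Esp" "snd p : V w"
 shows "co w p : Ar B" "src B (co w p) = src H (snd p)" "(dd w (snd p) |+| co w p, snd p) = p"
  "dd w (snd p) |+| co w p = fst p"
 using assms by (auto simp: Esp_def co_def)

lemma mlt_chart:
 assumes w: "w1 : Om" "w2 : Om" "w3 : Om" and gh: "g : Ar H" "h : Ar H" "src H g = rng H h"
  "g : V w1" "h : V w2" "cmp H g h : V w3" and xy: "x : Ar B" "y : Ar B" "src B x = src H g" "src B y = src H h"
 shows "mlt (dd w1 g |+| x, g) (dd w2 h |+| y, h) =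
  (dd w3 (cmp H g h) |+| (f w1 w2 w3 g h |+| (act B (ginv H h) x |+| y)), cmp H g h)"
proof -
 let ?a = "act B (ginv H h) (dd w1 g)" and ?x = "act B (ginv H h) x"
 have m: "?a : Ar B" "src B ?a = src H h" "?x : Ar B" "src B ?x = src H h"
  using assms by auto
 have "cc g h |+| (act B (ginv H h) (dd w1 g |+| x) |+| (dd w2 h |+| y)) =
  (cc g h |+| (?a |+| dd w2 h)) |+| (?x |+| y)"
  using assms m by (simp add: ac)
 also have "\<dots> = dd w3 (cmp H g h) |+| (f w1 w2 w3 g h |+| (?x |+| y))"
  unfolding star[OF w gh] using assms m by simp
 finally show ?thesis by (simp add: mlt_def)
qed

lemma unt_chart: "x : Ob H ==> u : Om ==> idn H x : V u ==>
  unt x = (dd u (idn H x) |+| ginv B (f u u u (idn H x) (idn H x)), idn H x)"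
 using dd_unit[of x u, symmetric] by (simp add: unt_def ac)

lemma eq_negI: "a : Ar B ==> b : Ar B ==> src B a = src B b ==> b |+| a = idn B (src B b) ==> a = ginv B b"
 by (rule B.ginv_unique) auto

lemma neg_chart:
 assumes w: "w : Om" "w' : Om" "u : Om" and h: "h : Ar H" "h : V w" "ginv H h : V w'" "idn H (src H h) : V u"
  and x: "x : Ar B" "src B x = src H h"
 shows "neg (dd w h |+| x, h) = (dd w' (ginv H h) |+|
  act B h (ginv B (f u u u (idn H (src H h)) (idn H (src H h)) |+| (f w' w u (ginv H h) h |+| x))), ginv H h)"
proof -
 let ?x = "src H h"
 let ?F = "f u u u (idn H ?x) (idn H ?x)" and ?K = "f w' w u (ginv H h) h"
  and ?a = "act B (ginv H h) (dd w' (ginv H h))" and ?c = "cc (ginv H h) h"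
  and ?du = "dd u (idn H ?x)" and ?d = "dd w h" and ?e = "ee ?x"
 have m: "?F : Ar B" "src B ?F = ?x" "?K : Ar B" "src B ?K = ?x" "?a : Ar B" "src B ?a = ?x"
  "?c : Ar B" "src B ?c = ?x" "?du : Ar B" "src B ?du = ?x" "?d : Ar B" "src B ?d = ?x"
  "?e : Ar B" "src B ?e = ?x" "?x : Ob H"
  using assms by auto
 let ?S = "?e |+| (?c |+| (?d |+| x))" and ?T = "?F |+| (?K |+| x)"
 have s: "?c |+| (?a |+| ?d) = ?du |+| ?K"
  using star[of w' w u "ginv H h" h] assms by simp
 have "?S |+| ?a = (?e |+| (?c |+| (?a |+| ?d))) |+| x"
  using m x by (simp add: ac)
 also have "\<dots> = (?e |+| ?du) |+| (?K |+| x)"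
  unfolding s using m x by simp
 also have "\<dots> = ?T"
  using dd_unit[of ?x u] assms m by simp
 finally have T: "?T = ?S |+| ?a" by simp
 have "ginv B ?S = ?a |+| ginv B ?T"
  unfolding T
 proof (rule eq_negI[symmetric])
  show "?S |+| (?a |+| ginv B (?S |+| ?a)) = idn B (src B ?S)"
   using m x by (simp add: add_assoc[symmetric] del: B.assoc B.ginv_cmp)
 qed (use m x in auto)
 then have "act B h (ginv B ?S) = act B h (?a |+| ginv B ?T)" by simp
 also have "\<dots> = dd w' (ginv H h) |+| act B h (ginv B ?T)"
  using m x assms by (subst act_add) (auto simp del: B.ginv_cmp)
 finally show ?thesis by (simp add: neg_def)
qed

lemma tgpd_realisation: "topological_groupoid (tot realisation)"
proof (rule topological_groupoidI)
 let ?E = "tot realisation"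
 have R: "obj ?E = obj H" "arr ?E = Etop" "src ?E = (\<lambda>p. src H (snd p))" "rng ?E = (\<lambda>p. rng H (snd p))"
  "idn ?E = unt" "cmp ?E = mlt" "ginv ?E = neg"
  by (auto simp: realisation_def)
 show "cts (arr ?E) (obj ?E) (src ?E)"
  unfolding R by (intro H.cont_src cont_snd_E)
 show "cts (arr ?E) (obj ?E) (rng ?E)"
  unfolding R by (intro H.cont_rng cont_snd_E)
 show "cts (obj ?E) (arr ?E) (idn ?E)"
  unfolding R
 proof (rule continuous_map_local)
  fix x0 assume x0: "x0 : Ob H"
  define u where "u = uch x0"
  have u: "u : Om" "idn H x0 : V u" using x0 unfolding u_def by auto
  define N where "N = {x : Ob H. idn H x : V u}"
  have N: "openin (obj H) N"
   unfolding N_def by (rule openin_preimage[OF _ V_open[OF u(1)]]) (intro H.cont_idn continuous_map_id[unfolded id_def])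
  let ?T = "sbt (obj H) N"
  have c1: "cts ?T (arr H) (\<lambda>x. idn H x)"
   by (intro H.cont_idn) (auto intro: continuous_map_from_subtopology)
  have P: "x : Ob H & idn H x : V u" if "x : pts ?T" for x using that by (auto simp: N_def)
  have "cts ?T (arr B) (\<lambda>x. f u u u (idn H x) (idn H x))"
   by (rule factor_setD(3)[OF fs u(1) u(1) u(1) c1 c1]) (drule P, simp add: fdom_def)
  then have "cts ?T Etop (\<lambda>x. (dd u (idn H x) |+| ginv B (f u u u (idn H x) (idn H x)), idn H x))"
   by (intro into_E[OF u(1)] B.cont_ginv c1) (assumption | (drule P, simp add: u))+
  then have "cts ?T Etop unt"
   by (rule continuous_map_eq) (drule P, simp add: u unt_chart[where u = u])
  then show "\<exists>N. openin (obj H) N & x0 : N & cts (sbt (obj H) N) Etop unt"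
   using N x0 u by (intro exI[of _ N]) (auto simp: N_def)
 qed
 show "cts (arr ?E) (arr ?E) (ginv ?E)"
  unfolding R
 proof (rule continuous_map_local)
  fix p0 assume p0: "p0 : pts Etop"
  define h0 where "h0 = snd p0"
  have h0: "h0 : Ar H" using p0 unfolding h0_def by (auto simp: Esp_def)
  define u where "u = uch (src H h0)"
  define w where "w = wch h0"
  define w' where "w' = wch (ginv H h0)"
  have w: "u : Om" "w : Om" "w' : Om" unfolding u_def w_def w'_def using h0 by auto
  define N where "N = {p : pts Etop. idn H (src H (snd p)) : V u} \<inter> {p : pts Etop. snd p : V w}
   \<inter> {p : pts Etop. ginv H (snd p) : V w'}"
  have N: "openin Etop N" unfolding N_def
   by (intro openin_Int openin_preimage[OF _ V_open] cont_idsrc H.cont_ginv cont_snd_E w)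
  have p0N: "p0 : N"
   using p0 h0 unfolding N_def u_def w_def w'_def h0_def by auto
  let ?T = "sbt Etop N"
  have P: "p : Esp & snd p : Ar H & snd p : V w & ginv H (snd p) : V w' & idn H (src H (snd p)) : V u"
   if "p : pts ?T" for p
   using that by (auto simp: N_def Esp_def)
  have c0: "cts ?T Etop (\<lambda>p. p)"
   by (auto intro: continuous_map_from_subtopology)
  note c1 = cont_snd[OF c0] note c2 = cont_idsrc[OF c1] note c3 = H.cont_ginv[OF c1]
  have cx: "cts ?T (arr B) (\<lambda>p. co w p)"
   by (intro cont_co[OF w(2) c0]) (drule P, simp)
  let ?F = "\<lambda>p. f u u u (idn H (src H (snd p))) (idn H (src H (snd p)))"
  let ?K = "\<lambda>p. f w' w u (ginv H (snd p)) (snd p)"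
  have cF: "cts ?T (arr B) ?F"
   by (rule factor_setD(3)[OF fs w(1) w(1) w(1) c2 c2]) (drule P, simp add: fdom_def)
  have cK: "cts ?T (arr B) ?K"
   by (rule factor_setD(3)[OF fs w(3) w(2) w(1) c3 c1]) (drule P, simp add: fdom_def)
  have FK: "?F p : Ar B & src B (?F p) = src H (snd p) & ?K p : Ar B & src B (?K p) = src H (snd p) &
    co w p : Ar B & src B (co w p) = src H (snd p)"
   if "p : pts ?T" for p
   using P[OF that] w co[OF w(2), of p] by auto
  have "cts ?T Etop (\<lambda>p. (dd w' (ginv H (snd p)) |+| act B (snd p) (ginv B (?F p |+| (?K p |+| co w p))), ginv H (snd p)))"
   by (intro into_E[OF w(3)] act_cont B.cont_ginv add_cont c3 c1 cF cK cx) ((frule P, drule FK, simp)+)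
  then have "cts ?T Etop neg"
  proof (rule continuous_map_eq)
   fix p assume p: "p : pts ?T"
   show "(dd w' (ginv H (snd p)) |+| act B (snd p) (ginv B (?F p |+| (?K p |+| co w p))), ginv H (snd p)) = neg p"
    using neg_chart[of w w' u "snd p" "co w p"] P[OF p] w co[OF w(2), of p] by simp
  qed
  then show "\<exists>N. openin Etop N & p0 : N & cts (sbt Etop N) Etop neg"
   using N p0N by blast
 qed
 show "cts (sbt (prt (arr ?E) (arr ?E)) {(g, h). src ?E g = rng ?E h}) (arr ?E) (\<lambda>(g, h). cmp ?E g h)"
  (is "cts ?S _ _")
  unfolding R(2,6)
 proof (rule continuous_map_local)
  let ?S = "sbt (prt Etop Etop) {(g, h). src ?E g = rng ?E h}"
  fix s0 assume s0: "s0 : pts ?S"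
  define g where "g = (\<lambda>s :: ('b \<times> 'h) \<times> ('b \<times> 'h). snd (fst s))"
  define h where "h = (\<lambda>s :: ('b \<times> 'h) \<times> ('b \<times> 'h). snd (snd s))"
  have S: "fst s : Esp & snd s : Esp & g s : Ar H & h s : Ar H & src H (g s) = rng H (h s)" if "s : pts ?S" for s
   using that by (auto simp: g_def h_def Esp_def R(3,4))
  have cf: "cts ?S Etop fst" and cs: "cts ?S Etop snd"
   by (auto intro: cts_sub_intro)
  have cg: "cts ?S (arr H) g" and ch: "cts ?S (arr H) h"
   unfolding g_def h_def using cont_snd[OF cf] cont_snd[OF cs] by auto
  have cgh: "cts ?S (arr H) (\<lambda>s. cmp H (g s) (h s))"
   by (intro H.cont_cmp cg ch) (use S in blast)
  define w1 where "w1 = wch (g s0)"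
  define w2 where "w2 = wch (h s0)"
  define w3 where "w3 = wch (cmp H (g s0) (h s0))"
  have w: "w1 : Om" "w2 : Om" "w3 : Om" unfolding w1_def w2_def w3_def using S[OF s0] by auto
  define N where "N = {s : pts ?S. g s : V w1} \<inter> {s : pts ?S. h s : V w2} \<inter>
   {s : pts ?S. cmp H (g s) (h s) : V w3}"
  have N: "openin ?S N" unfolding N_def
   by (intro openin_Int openin_preimage[OF _ V_open] cg ch cgh w)
  have s0N: "s0 : N" using S[OF s0] s0 unfolding N_def w1_def w2_def w3_def by auto
  let ?T = "sbt ?S N"
  have P: "fst s : Esp & snd s : Esp & g s : Ar H & h s : Ar H & src H (g s) = rng H (h s) &
    g s : V w1 & h s : V w2 & cmp H (g s) (h s) : V w3" if "s : pts ?T" for s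
   using that S by (auto simp: N_def)
  have df: "cts ?T Etop fst" and ds: "cts ?T Etop snd"
   and dg: "cts ?T (arr H) g" and dh: "cts ?T (arr H) h"
   and dgh: "cts ?T (arr H) (\<lambda>s. cmp H (g s) (h s))"
   using cf cs cg ch cgh continuous_map_from_subtopology by blast+
  have dx: "cts ?T (arr B) (\<lambda>s. co w1 (fst s))" and dy: "cts ?T (arr B) (\<lambda>s. co w2 (snd s))"
   by (intro cont_co w df ds; drule P, simp add: g_def h_def)+
  have dF: "cts ?T (arr B) (\<lambda>s. f w1 w2 w3 (g s) (h s))"
   by (rule factor_setD(3)[OF fs w dg dh]) (drule P, simp add: fdom_def)
  have Q: "co w1 (fst s) : Ar B & src B (co w1 (fst s)) = src H (g s) & co w2 (snd s) : Ar B &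
   src B (co w2 (snd s)) = src H (h s) & f w1 w2 w3 (g s) (h s) : Ar B & src B (f w1 w2 w3 (g s) (h s)) = src H (h s)"
   if "s : pts ?T" for s
   using P[OF that] co[OF w(1), of "fst s"] co[OF w(2), of "snd s"] w unfolding g_def h_def by auto
  have "cts ?T Etop (\<lambda>s. (dd w3 (cmp H (g s) (h s)) |+| (f w1 w2 w3 (g s) (h s) |+|
    (act B (ginv H (h s)) (co w1 (fst s)) |+| co w2 (snd s))), cmp H (g s) (h s)))"
   by (intro into_E[OF w(3)] add_cont act_cont H.cont_ginv dgh dx dy dF dh) ((frule P, drule Q, simp)+)
  then have "cts ?T Etop (\<lambda>(g, h). mlt g h)"
  proof (rule continuous_map_eq)
   fix s assume s: "s : pts ?T"
   have "fst s = (dd w1 (g s) |+| co w1 (fst s), g s)" "snd s = (dd w2 (h s) |+| co w2 (snd s), h s)"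
    using P[OF s] co[OF w(1), of "fst s"] co[OF w(2), of "snd s"] unfolding g_def h_def by auto
   then show "(dd w3 (cmp H (g s) (h s)) |+| (f w1 w2 w3 (g s) (h s) |+|
    (act B (ginv H (h s)) (co w1 (fst s)) |+| co w2 (snd s))), cmp H (g s) (h s)) = (\<lambda>(g, h). mlt g h) s"
    using mlt_chart[OF w, of "g s" "h s" "co w1 (fst s)" "co w2 (snd s)"] P[OF s] Q[OF s]
    by (simp add: case_prod_unfold)
  qed
  then show "\<exists>N. openin ?S N & s0 : N & cts (sbt ?S N) Etop (\<lambda>(g, h). mlt g h)"
   using N s0N by blast
 qed
 fix x assume "x : Ob ?E"
 then show "src ?E (idn ?E x) = x & rng ?E (idn ?E x) = x"
  by (auto simp: realisation_def unt_def)
next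
 let ?E = "tot realisation"
 fix p assume "p : Ar ?E"
 then obtain b h where p: "p = (b, h)" "b : Ar B" "h : Ar H" "src B b = src H h"
  by (auto simp: realisation_def Esp_def)
 have "act B (ginv H h) (ee (rng H h)) |+| (act B (ginv H h) (ginv B (ee (rng H h))) |+| b) = b"
  using p by (subst act_neg) auto
 then have 1: "cmp ?E (idn ?E (rng ?E p)) p = p"
  using p cc_1l[of h] by (simp add: realisation_def unt_def mlt_def)
 have 2: "cmp ?E p (idn ?E (src ?E p)) = p"
  using p cc_1r[of h] by (simp add: realisation_def unt_def mlt_def ac)
 show "cmp ?E (idn ?E (rng ?E p)) p = p & cmp ?E p (idn ?E (src ?E p)) = p" using 1 2 by blast
 let ?c = "cc (ginv H h) h" and ?e = "ee (src H h)"
 have "?c |+| (ginv B (?e |+| (?c |+| b)) |+| b) = ginv B ?e"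
  using p by (simp add: ac, subst left_comm, auto)
 then show "src ?E (ginv ?E p) = rng ?E p & rng ?E (ginv ?E p) = src ?E p & cmp ?E (ginv ?E p) p = idn ?E (src ?E p)"
  using p by (simp add: realisation_def unt_def mlt_def neg_def del: B.ginv_cmp act_neg)
 fix q assume "q : Ar ?E" and pq: "src ?E p = rng ?E q"
 then obtain b' h' where q: "q = (b', h')" "b' : Ar B" "h' : Ar H" "src B b' = src H h'"
  by (auto simp: realisation_def Esp_def)
 have hh: "src H h = rng H h'" using p q pq by (simp add: realisation_def)
 then show "src ?E (cmp ?E p q) = src ?E q & rng ?E (cmp ?E p q) = rng ?E p"
  using p q by (simp add: realisation_def mlt_def)
 fix r assume "r : Ar ?E" and qr: "src ?E q = rng ?E r"
 then obtain b'' h'' where r: "r = (b'', h'')" "b'' : Ar B" "h'' : Ar H" "src B b'' = src H h''"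
  by (auto simp: realisation_def Esp_def)
 have hh': "src H h' = rng H h''" using r q qr by (simp add: realisation_def)
 let ?i = "act B (ginv H h'')" and ?j = "act B (ginv H h')"
 have "cc (cmp H h h') h'' |+| (?i (cc h h' |+| (?j b |+| b')) |+| b'') =
   (cc (cmp H h h') h'' |+| ?i (cc h h')) |+| (?i (?j b) |+| (?i b' |+| b''))"
  using p q r hh hh' by simp
 also have "\<dots> = (cc h (cmp H h' h'') |+| cc h' h'') |+| (?i (?j b) |+| (?i b' |+| b''))"
  using cc_coc[of h h' h''] p q r hh hh' by simp
 also have "\<dots> = cc h (cmp H h' h'') |+| (?i (?j b) |+| (cc h' h'' |+| (?i b' |+| b'')))"
  using p q r hh hh' by (simp add: ac)
 finally show "cmp ?E (cmp ?E p q) r = cmp ?E p (cmp ?E q r)"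
  using p q r hh hh' by (simp add: realisation_def mlt_def)
qed

definition sec :: "'w => 'h => 'b \<times> 'h" where "sec w h = (dd w h, h)"

lemma sec_cont:
 assumes w: "w : Om"
 shows "cts (sbt (arr H) (V w)) Etop (sec w)"
proof -
 let ?T = "sbt (arr H) (V w)"
 have P: "h : Ar H & h : V w" if "h : pts ?T" for h using that by auto
 have "cts ?T (arr H) (\<lambda>h. h)" by (auto intro: continuous_map_from_subtopology)
 then have "cts ?T Etop (\<lambda>h. (dd w h |+| idn B (src H h), h))"
  using obj_B by (intro into_E[OF w] B.cont_idn) (simp add: H.cont_src, assumption, drule P, simp)
 then show ?thesis
  by (rule continuous_map_eq) (drule P, simp add: sec_def w)
qed

lemma emb_realisation: "embedding_map (arr B) Etop (inc realisation)"
proof -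
 let ?i = "\<lambda>b. (b |+| ginv B (ee (src B b)), idn H (src B b))"
 let ?j = "\<lambda>p. ee (src H (snd p)) |+| fst p"
 have ic: "inc realisation = ?i" by (simp add: realisation_def)
 have ij: "?j (?i b) = b" if "b : Ar B" for b
  using that by (simp add: ac)
 have "cts (arr B) Etop ?i"
 proof (rule continuous_map_local)
  fix b0 assume b0: "b0 : Ar B"
  define u where "u = uch (src B b0)"
  have u: "u : Om" "idn H (src B b0) : V u" using b0 unfolding u_def by auto
  have c0: "cts (arr B) (arr H) (\<lambda>b. idn H (src B b))"
   using B.cont_src[of "arr B" "\<lambda>b. b"] by (intro H.cont_idn) simp
  define N where "N = {b : Ar B. idn H (src B b) : V u}"
  have N: "openin (arr B) N" unfolding N_def by (rule openin_preimage[OF c0 V_open[OF u(1)]])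
  let ?T = "sbt (arr B) N"
  have P: "b : Ar B & idn H (src B b) : V u & src B b : Ob H" if "b : pts ?T" for b
   using that by (auto simp: N_def)
  have c1: "cts ?T (arr H) (\<lambda>b. idn H (src B b))"
   using c0 by (rule continuous_map_from_subtopology)
  have c2: "cts ?T (arr B) (\<lambda>b. b)" by (auto intro: continuous_map_from_subtopology)
  have cF: "cts ?T (arr B) (\<lambda>b. f u u u (idn H (src B b)) (idn H (src B b)))"
   by (rule factor_setD(3)[OF fs u(1) u(1) u(1) c1 c1]) (drule P, simp add: fdom_def)
  have "cts ?T Etop (\<lambda>b. (dd u (idn H (src B b)) |+|
   (b |+| ginv B (f u u u (idn H (src B b)) (idn H (src B b)))), idn H (src B b)))"
   by (intro into_E[OF u(1)] add_cont B.cont_ginv cF c1 c2) ((drule P, simp add: u)+)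
  then have "cts ?T Etop ?i"
  proof (rule continuous_map_eq)
   fix b assume b: "b : pts ?T"
   let ?x = "src B b"
   have e: "ginv B (ee ?x) = dd u (idn H ?x) |+| ginv B (f u u u (idn H ?x) (idn H ?x))"
    using unt_chart[of ?x u] P[OF b] u by (simp add: unt_def)
   show "(dd u (idn H ?x) |+| (b |+| ginv B (f u u u (idn H ?x) (idn H ?x))), idn H ?x) = ?i b"
    unfolding e using P[OF b] u by (simp add: left_comm)
  qed
  then show "\<exists>N. openin (arr B) N & b0 : N & cts (sbt (arr B) N) Etop ?i"
   using N b0 u by (intro exI[of _ N]) (auto simp: N_def)
 qed
 moreover have "cts (sbt Etop (?i ` Ar B)) (arr B) ?j"
 proof (rule continuous_map_local)
  let ?S = "sbt Etop (?i ` Ar B)"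
  have S: "p : Esp & snd p = idn H (src H (snd p)) & snd p : Ar H & src H (snd p) : Ob H" if "p : pts ?S" for p
   using that by (auto simp: Esp_def)
  fix p0 assume p0: "p0 : pts ?S"
  define u where "u = uch (src H (snd p0))"
  have u: "u : Om" "snd p0 : V u" using S[OF p0] unfolding u_def by (simp, metis uch(2))
  have s0: "cts ?S Etop (\<lambda>p. p)" by (auto intro: continuous_map_from_subtopology)
  define N where "N = {p : pts ?S. snd p : V u}"
  have N: "openin ?S N" unfolding N_def by (rule openin_preimage[OF cont_snd[OF s0] V_open[OF u(1)]])
  let ?T = "sbt ?S N"
  have P: "p : pts ?S & snd p : V u" if "p : pts ?T" for p
   using that by (auto simp: N_def)
  have t0: "cts ?T Etop (\<lambda>p. p)" using s0 by (rule continuous_map_from_subtopology)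
  note t1 = cont_snd[OF t0]
  have cF: "cts ?T (arr B) (\<lambda>p. f u u u (snd p) (snd p))"
  proof (rule factor_setD(3)[OF fs u(1) u(1) u(1) t1 t1])
   fix p assume p: "p : pts ?T"
   obtain x where x: "snd p = idn H x" "x : Ob H" using P[OF p] S by blast
   then show "(snd p, snd p) : fdom H V u u u" using P[OF p] by (auto simp: fdom_def)
  qed
  have cx: "cts ?T (arr B) (\<lambda>p. co u p)"
   by (intro cont_co[OF u(1) t0]) (drule P, simp)
  have eq: "f u u u (snd p) (snd p) |+| co u p = ?j p & src B (f u u u (snd p) (snd p)) = src B (co u p)"
   if p: "p : pts ?T" for p
  proof -
   obtain x where x: "snd p = idn H x" "x : Ob H" using P[OF p] S by blast
   have e: "f u u u (snd p) (snd p) = ee x |+| dd u (snd p)"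
    using dd_unit[of x u] x u P[OF p] by simp
   have pE: "p : Esp" and pV: "snd p : V u" using P[OF p] S by auto
   note c = co[OF u(1) pE pV]
   have "ee x |+| dd u (snd p) |+| co u p = ee x |+| fst p"
    using c x u pV by (subst c(4)[symmetric]) simp
   then show ?thesis unfolding e using x c u pV by simp
  qed
  have "cts ?T (arr B) (\<lambda>p. f u u u (snd p) (snd p) |+| co u p)"
   by (intro add_cont cF cx) (drule eq, blast)
  then have "cts ?T (arr B) ?j"
   by (rule continuous_map_eq) (drule eq, blast)
  then show "\<exists>N. openin ?S N & p0 : N & cts (sbt ?S N) (arr B) ?j"
   using N p0 u by (intro exI[of _ N]) (auto simp: N_def)
 qed
 ultimately have "homeomorphic_maps (arr B) (sbt Etop (?i ` Ar B)) ?i ?j"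
  unfolding homeomorphic_maps_def using ij by (auto simp: continuous_map_in_subtopology)
 then show ?thesis
  unfolding embedding_map_def ic using homeomorphic_maps_map by blast
qed

lemma extension_realisation: "extension H B realisation"
proof -
 let ?E = "tot realisation"
 have arr: "arr ?E = Etop" "src ?E = (\<lambda>p. src H (snd p))" "rng ?E = (\<lambda>p. rng H (snd p))" "cmp ?E = mlt"
  "inc realisation = (\<lambda>b. (b |+| ginv B (ee (src B b)), idn H (src B b)))" "prj realisation = snd"
  by (auto simp: realisation_def)
 interpret E: tgpd ?E using tgpd_realisation by unfold_locales
 have q: "quotient_map Etop (arr H) snd"
 proof (rule quotient_map_if_local_sections[OF cont_snd_E])
  fix h assume h: "h : Ar H"
  show "\<exists>N s. openin (arr H) N & h : N & cts (sbt (arr H) N) Etop s &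
    (\<forall>y\<in>Ar H \<inter> N. snd (s y) = y)"
   using h V_open sec_cont[of "wch h"]
   by (intro exI[of _ "V (wch h)"] exI[of _ "sec (wch h)"]) (auto simp: sec_def)
 qed
 have img: "inc realisation ` Ar B = {ga\<in>Ar ?E. snd ga : idn H ` Ob H}"
 proof
  show "inc realisation ` Ar B \<subseteq> {ga\<in>Ar ?E. snd ga : idn H ` Ob H}"
   by (auto simp: arr Esp_def)
  show "{ga\<in>Ar ?E. snd ga : idn H ` Ob H} \<subseteq> inc realisation ` Ar B"
  proof
   fix p assume "p : {ga\<in>Ar ?E. snd ga : idn H ` Ob H}"
   then obtain b x where p: "p = (b, idn H x)" "b : Ar B" "x : Ob H" "src B b = x"
    by (auto simp: arr Esp_def)
   have "p = inc realisation (b |+| ee x)" using p by (simp add: arr)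
   then show "p : inc realisation ` Ar B" using p by auto
  qed
 qed
 have cj: "cmp ?E (cmp ?E p (inc realisation b)) (ginv ?E p) = inc realisation (act B (snd p) b)"
  if pb: "p : Ar ?E" "b : Ar B" "src B b = src ?E p" for p b
 proof -
  obtain a h where p: "p = (a, h)" "a : Ar B" "h : Ar H" "src B a = src H h"
   using pb by (auto simp: arr Esp_def)
  have b: "b : Ar B" "src B b = src H h" using pb p by (auto simp: arr)
  let ?c = "act B h b"
  have ib: "inc realisation b : Ar ?E" and ic: "inc realisation ?c : Ar ?E" using b p by (auto simp: arr Esp_def)
  have "act B (ginv H h) (?c |+| ginv B (ee (rng H h))) = b |+| ginv B (act B (ginv H h) (ee (rng H h)))"
   using b p by (subst act_add) auto
  then have "mlt p (inc realisation b) = mlt (inc realisation ?c) p"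
   using p b cc_1l[of h] cc_1r[of h] by (simp add: arr(5) mlt_def ac)
  then have e: "cmp ?E p (inc realisation b) = cmp ?E (inc realisation ?c) p"
   by (simp only: arr(4))
  have s: "src ?E (inc realisation ?c) = rng ?E p"
   using p b by (simp add: arr)
  have "cmp ?E (cmp ?E (inc realisation ?c) p) (ginv ?E p) = inc realisation ?c"
   using E.assoc[OF ic pb(1) E.ginv_in[OF pb(1)] s] E.ginv_r[OF pb(1)] E.rng_ginv[OF pb(1)]
    E.idn_r[OF ic s] by (simp only:)
  then show ?thesis unfolding e using p(1) by simp
 qed
 have ia: "inc realisation (b |+| b') = cmp ?E (inc realisation b) (inc realisation b')"
  if "b\<in>Ar B" "b'\<in>Ar B" "src B b = src B b'" for b b'
  using that cc_1r[of "idn H (src B b')"] by (simp add: arr mlt_def ac)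
 show ?thesis
  unfolding extension_def Let_def
 proof (intro conjI ballI impI)
  show "inc realisation (b |+| b') = cmp ?E (inc realisation b) (inc realisation b')"
   if "b\<in>Ar B" "b'\<in>Ar B" "src B b = src B b'" for b b'
   using ia that .
  show "cmp ?E (cmp ?E p (inc realisation b)) (ginv ?E p) = inc realisation (act B (prj realisation p) b)"
   if pb: "p : Ar ?E" "b : Ar B" "src B b = src ?E p" for p b
   using cj[OF that] by (simp add: arr)
  show "topological_groupoid ?E" by (rule tgpd_realisation)
  show "obj ?E = obj H" by (simp add: realisation_def)
  show "embedding_map (arr B) (arr ?E) (inc realisation)"
   using emb_realisation by (simp add: arr(1))
  show "quotient_map (arr ?E) (arr H) (prj realisation)" using q by (simp only: arr)
  show "inc realisation ` Ar B = {ga\<in>Ar ?E. prj realisation ga : idn H ` Ob H}"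
   using img by (simp only: arr(6))
  show "src ?E (inc realisation b) = src B b" "rng ?E (inc realisation b) = src B b" if "b : Ar B" for b
   using that by (simp_all add: arr)
  show "src H (prj realisation p) = src ?E p" "rng H (prj realisation p) = rng ?E p" for p
   by (simp_all add: arr)
  show "prj realisation (cmp ?E p q) = cmp H (prj realisation p) (prj realisation q)" for p q
   by (simp add: arr mlt_def case_prod_unfold)
 qed
qed

lemma presents_realisation: "presents H B Om V realisation sec f"
 unfolding presents_def
proof (intro conjI ballI allI impI)
 fix w assume "w : Om"
 then show "is_lifting H realisation (V w) (sec w)"
  using sec_cont by (auto simp: is_lifting_def realisation_def sec_def)
next
 fix w1 w2 w3 g h assume w: "w1 : Om" "w2 : Om" "w3 : Om" and "(g, h) : fdom H V w1 w2 w3"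
 then have gh: "g : Ar H" "h : Ar H" "src H g = rng H h" "g : V w1" "h : V w2" "cmp H g h : V w3"
  by (auto simp: fdom_def)
 show "f w1 w2 w3 g h : Ar B" "src B (f w1 w2 w3 g h) = src H h" using w gh by auto
 show "Em realisation (sec w1 g) (sec w2 h) =
   tr realisation (sec w3 (cmp H g h)) (f w1 w2 w3 g h)"
  using star[OF w gh] w gh cc_1r[of "cmp H g h"] by (simp add: realisation_def mlt_def sec_def ac)
qed

end

text \<open>This is the only place where a topological groupoid has to be built by hand.\<close>

theorem factor_set_realised:
 fixes B :: "('x, 'b, 'h) gmod"
 assumes "topological_groupoid H" "G_module H B" "gcover H Om V" "factor_set H B Om V f"
 shows "\<exists>(Z :: ('x, 'b, 'h, 'b \<times> 'h) extn) ta. extension H B Z & presents H B Om V Z ta f"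
proof -
 interpret fset H B Om V f using assms by unfold_locales
 show ?thesis using extension_realisation presents_realisation by blast
qed

section \<open>Baer sums and factor sets\<close>

context ext begin

lemma coord:
 assumes "is_lifting H X W sg" "ga : El X" "prj X ga : W"
 shows "dif (sg (prj X ga)) ga : Ar B" "src B (dif (sg (prj X ga)) ga) = Es X ga"
  "tr X (sg (prj X ga)) (dif (sg (prj X ga)) ga) = ga"
 using dif[of "sg (prj X ga)" ga] liftD[OF assms(1), of "prj X ga"] assms by auto

text \<open>From $\sigma(1) \sigma(1) = \sigma(1) f(1, 1)$.\<close>

lemma presents_unit:
 assumes "presents H B Om V X sg f" "u : Om" "x : Ob H" "idn H x : V u"
 shows "f u u u (idn H x) (idn H x) : Ar B" "src B (f u u u (idn H x) (idn H x)) = x"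
  "sg u (idn H x) = inc X (f u u u (idn H x) (idn H x))"
proof -
 have d: "(idn H x, idn H x) : fdom H V u u u" using assms by (auto simp: fdom_def)
 note p = presentsD(2)[OF assms(1,2,2,2) d]
 note l = liftD[OF presentsD(1)[OF assms(1,2)], of "idn H x"]
 show "f u u u (idn H x) (idn H x) : Ar B" "src B (f u u u (idn H x) (idn H x)) = x"
  using p assms by auto
 show "sg u (idn H x) = inc X (f u u u (idn H x) (idn H x))"
  using p l assms E.l_cancel[of "sg u (idn H x)" "sg u (idn H x)" "inc X (f u u u (idn H x) (idn H x))"]
  by simp
qed

text \<open>Two local sections differ by an element that is determined by the factor set.\<close>

lemma presents_trans:
 assumes pr: "presents H B Om V X sg f" and w: "w : Om" "w' : Om" "u : Om"
  and h: "h : Ar H" "h : V w" "h : V w'" "idn H (src H h) : V u"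
 obtains t where "t : Ar B" "src B t = src H h" "sg w h = tr X (sg w' h) t"
  "t |+| f u u u (idn H (src H h)) (idn H (src H h)) = f w u w' h (idn H (src H h))"
proof -
 let ?x = "idn H (src H h)"
 note l = liftD[OF presentsD(1)[OF pr w(1)] h(1,2)] and l' = liftD[OF presentsD(1)[OF pr w(2)] h(1,3)]
 obtain t where t: "t : Ar B" "src B t = src H h" "tr X (sg w' h) t = sg w h"
  using dif[of "sg w' h" "sg w h"] l l' by auto
 have d: "(h, ?x) : fdom H V w u w'" using h by (auto simp: fdom_def)
 note p = presentsD(2)[OF pr w(1,3,2) d]
 note u = presents_unit[OF pr w(3), of "src H h"]
 have "tr X (sg w' h) (t |+| f u u u ?x ?x) = Em X (sg w h) (sg u ?x)"
  using E.assoc[of "sg w' h" "inc X t" "inc X (f u u u ?x ?x)"] u t l' h by (simp add: i_add)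
 also have "\<dots> = tr X (sg w' h) (f w u w' h ?x)"
  using p h by simp
 finally have "t |+| f u u u ?x ?x = f w u w' h ?x"
  using u t l' h p by (subst (asm) i_cancel) auto
 then show ?thesis using that[OF t(1,2) t(3)[symmetric]] by blast
qed

lemma presents_mult:
 assumes pr: "presents H B Om V X sg f" and w: "w1 : Om" "w2 : Om" "w3 : Om"
  and d: "(g, h) : fdom H V w1 w2 w3" and ab: "a : Ar B" "b : Ar B" "src B a = src H g" "src B b = src H h"
 shows "Em X (tr X (sg w1 g) a) (tr X (sg w2 h) b) =
  tr X (sg w3 (cmp H g h)) (f w1 w2 w3 g h |+| (act B (ginv H h) a |+| b))"
proof -
 have D: "g : Ar H" "h : Ar H" "src H g = rng H h" "g : V w1" "h : V w2" "cmp H g h : V w3" "cmp H g h : Ar H"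
  using d by (auto simp: fdom_def)
 note l1 = liftD[OF presentsD(1)[OF pr w(1)] D(1) D(4)] and l2 = liftD[OF presentsD(1)[OF pr w(2)] D(2) D(5)]
  and l3 = liftD[OF presentsD(1)[OF pr w(3)] D(7) D(6)]
 note p = presentsD(2)[OF pr w d]
 let ?a = "act B (ginv H h) a"
 have m: "Em X (inc X a) (sg w2 h) = tr X (sg w2 h) ?a"
  using move_i[of "sg w2 h" a] l2 D ab by simp
 have "Em X (tr X (sg w1 g) a) (tr X (sg w2 h) b) =
  Em X (sg w1 g) (tr X (Em X (inc X a) (sg w2 h)) b)"
  using l1 l2 D ab by simp
 also have "\<dots> = tr X (Em X (sg w1 g) (sg w2 h)) (?a |+| b)"
  unfolding m using l1 l2 D ab by (simp add: i_add)
 also have "\<dots> = tr X (sg w3 (cmp H g h)) (f w1 w2 w3 g h |+| (?a |+| b))"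
  using p l3 D ab by (simp add: i_add)
 finally show ?thesis .
qed

lemma tr_tr: "ga : El X ==> a : Ar B ==> b : Ar B ==> src B a = Es X ga ==> src B b = Es X ga ==>
  tr X (tr X ga a) b = tr X ga (a |+| b)"
 by (simp add: i_add)

text \<open>A continuous map to an extension that commutes with translations by the module is a quotient
 map as soon as it lifts locally over \<open>H\<close>, because the translates of a lifting are local sections.\<close>

lemma quotient_by_liftings:
 assumes m: "cts P (Ea X) m"
  and t: "\<And>(T :: 'e topology) p b. cts T P p ==> cts T (arr B) b ==>
   (\<And>x. x : pts T ==> src B (b x) = Es X (m (p x))) ==> cts T P (\<lambda>x. t (p x) (b x))"
  and mt: "\<And>p b. p : pts P ==> b : Ar B ==> src B b = Es X (m p) ==> m (t p b) = tr X (m p) b"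
  and l: "\<And>h. h : Ar H ==> \<exists>V s. openin (arr H) V & h : V & cts (sbt (arr H) V) P s &
   (\<forall>h\<in>Ar H \<inter> V. prj X (m (s h)) = h)"
 shows "quotient_map P (Ea X) m"
proof (rule quotient_map_if_local_sections[OF m])
 fix y assume y: "y : El X"
 obtain V s where V: "openin (arr H) V" "prj X y : V" "cts (sbt (arr H) V) P s" "\<forall>h\<in>Ar H \<inter> V. prj X (m (s h)) = h"
  using l[OF pr_in[OF y]] by blast
 let ?N = "{z : El X. prj X z : V}" and ?p = "\<lambda>z. s (prj X z)" and ?b = "\<lambda>z. dif (m (s (prj X z))) z"
 let ?T = "sbt (Ea X) ?N"
 have id: "cts ?T (Ea X) (\<lambda>z. z)" by (auto intro: continuous_map_from_subtopology)
 have "cts ?T (sbt (arr H) V) (prj X)"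
  using cont_pr[OF id] by (auto simp: continuous_map_in_subtopology)
 from continuous_map_compose[OF this V(3)] have cp: "cts ?T P ?p" by (simp add: o_def)
 have mp: "m (?p z) : El X" "prj X (m (?p z)) = prj X z" "?p z : pts P" if "z : pts ?T" for z
  using continuous_map_in[OF cp that] continuous_map_in[OF m] V(4) that by auto
 note d = dif[OF mp(1) _ mp(2)]
 have e: "src B (?b z) = Es X (m (?p z))" if "z : pts ?T" for z
  using d(2)[OF that _ that] mp[OF that] that src_pr[of "m (?p z)"] src_pr[of z] by simp
 have cm: "cts ?T (Ea X) (\<lambda>z. m (?p z))" using continuous_map_compose[OF cp m] by (simp add: o_def)
 have "cts ?T P (\<lambda>z. t (?p z) (?b z))" by (rule t[OF cp cont_dif[OF cm id mp(2)] e])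
 moreover have "m (t (?p z) (?b z)) = z" if "z : pts ?T" for z
  using mt[OF mp(3)[OF that] d(1)[OF that _ that] e[OF that]] d(3)[OF that _ that] that by simp
 ultimately show "\<exists>N s. openin (Ea X) N & y : N & cts (sbt (Ea X) N) P s & (\<forall>y\<in>El X \<inter> N. m (s y) = y)"
  using openin_preimage[OF pr_cont V(1)] y V(2) by (intro exI[of _ ?N] exI[of _ "\<lambda>z. t (?p z) (?b z)"]) auto
qed

end

lemma gcoverD:
 assumes "gcover H Om V"
 shows "h : Ar H ==> \<exists>w\<in>Om. h : V w" "w : Om ==> openin (arr H) (V w)"
 using assms unfolding gcover_def by auto

lemma baer_space_iff: "(ga, de) : pts (baer_space X Y) \<longleftrightarrow> ga : El X & de : El Y & prj X ga = prj Y de"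
 by (auto simp: baer_space_def)

text \<open>The properties of a map \<open>m\<close> on the fibre product of \<open>X\<close> and \<open>Y\<close> which identifies \<open>Z\<close> with the
 Baer sum.\<close>

locale baer_map = X: ext H B X + Y: ext H B Y + Z: ext H B Z
 for H :: "('x, 'h) topgpd" and B :: "('x, 'b, 'h) gmod" and X :: "('x, 'b, 'h, 'e) extn"
  and Y :: "('x, 'b, 'h, 'f) extn" and Z :: "('x, 'b, 'h, 'k) extn" +
 fixes m :: "'e \<times> 'f => 'k"
 assumes m_cont: "cts (baer_space X Y) (Ea Z) m"
  and m_prj: "(ga, de) : pts (baer_space X Y) ==> prj Z (m (ga, de)) = prj X ga"
  and m_tr: "(ga, de) : pts (baer_space X Y) ==> a : Ar B ==> b : Ar B ==> src B a = Es X ga ==> src B b = Es X ga ==>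
   m (tr X ga a, tr Y de b) = tr Z (m (ga, de)) (cmp B a b)"
  and m_mult: "(ga, de) : pts (baer_space X Y) ==> (ga', de') : pts (baer_space X Y) ==> Es X ga = Er X ga' ==>
   m (Em X ga ga', Em Y de de') = Em Z (m (ga, de)) (m (ga', de'))"

text \<open>Adding the coordinates relative to the local sections does not depend on the choice of these
 sections when the factor sets add up. Hence the fibre product of two extensions
 maps to any extension that is presented by the sum of their factor sets.\<close>

lemma coordinate_sum_map:
 fixes B :: "('x, 'b, 'h) gmod"
 assumes md: "topological_groupoid H" "G_module H B" and cov: "gcover H Om V"
  and X: "extension H B X" "presents H B Om V X sg f1"
  and Y: "extension H B Y" "presents H B Om V Y ta f2"
  and Z: "extension H B Z" "presents H B Om V Z rh f3"
  and sum: "\<And>w1 w2 w3 g h. w1 : Om ==> w2 : Om ==> w3 : Om ==> (g, h) : fdom H V w1 w2 w3 ==>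
   f3 w1 w2 w3 g h = cmp B (f1 w1 w2 w3 g h) (f2 w1 w2 w3 g h)"
 shows "\<exists>m. baer_map H B X Y Z m"
proof -
 interpret X: ext H B X using md X by unfold_locales
 interpret Y: ext H B Y using md Y by unfold_locales
 interpret Z: ext H B Z using md Z by unfold_locales
 note LX = presentsD(1)[OF X(2)] and LY = presentsD(1)[OF Y(2)] and LZ = presentsD(1)[OF Z(2)]
 define M where "M w ga de = tr Z (rh w (prj X ga)) (cmp B (X.dif (sg w (prj X ga)) ga) (Y.dif (ta w (prj X ga)) de))" for w ga de
 define c where "c h = (SOME w. w : Om & h : V w)" for h
 have c: "c h : Om" "h : V (c h)" if "h : Ar H" for h
 proof -
  have "\<exists>w. w : Om & h : V w" using gcoverD(1)[OF cov that] by blast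
  from someI_ex[OF this] show "c h : Om" "h : V (c h)" unfolding c_def by auto
 qed
 have M: "M w (tr X (sg w h) a) (tr Y (ta w h) b) =
   tr Z (rh w h) (cmp B a b)"
  if "w : Om" "h : Ar H" "h : V w" "a : Ar B" "b : Ar B" "src B a = src H h" "src B b = src H h" for w h a b
 proof -
  note l = X.liftD[OF LX[OF that(1)] that(2,3)] Y.liftD[OF LY[OF that(1)] that(2,3)]
  have "X.dif (sg w h) (tr X (sg w h) a) = a" using that l by (intro X.dif_eqI) auto
  moreover have "Y.dif (ta w h) (tr Y (ta w h) b) = b" using that l by (intro Y.dif_eqI) auto
  ultimately show ?thesis unfolding M_def using that l by simp
 qed
 have Minv: "M w ga de = M w' ga de"
  if w: "w : Om" "w' : Om" and g: "ga : El X" "de : El Y" "prj X ga = prj Y de"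
   "prj X ga : V w" "prj X ga : V w'" for w w' ga de
 proof -
  let ?h = "prj X ga"
  let ?x = "idn H (src H ?h)"
  have h: "?h : Ar H" and x: "?x : Ar H" using g by auto
  have sr: "Es Y de = Es X ga" using g by (metis X.src_pr Y.src_pr)
  define u where "u = c ?x"
  have u: "u : Om" "?x : V u" unfolding u_def using c[OF x] by auto
  let ?a = "X.dif (sg w ?h) ga" and ?b = "Y.dif (ta w ?h) de"
  have a: "?a : Ar B" "src B ?a = src H ?h" "tr X (sg w ?h) ?a = ga"
   using X.coord[OF LX[OF w(1)] g(1)] g sr by auto
  have b: "?b : Ar B" "src B ?b = src H ?h" "tr Y (ta w ?h) ?b = de"
   using Y.coord[OF LY[OF w(1)] g(2)] g sr by auto
  note lX = X.liftD[OF LX[OF w(2)] h g(5)] and lY = Y.liftD[OF LY[OF w(2)] h g(5)] and lZ = Z.liftD[OF LZ[OF w(2)] h g(5)]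
  obtain t1 where t1: "t1 : Ar B" "src B t1 = src H ?h" "sg w ?h = tr X (sg w' ?h) t1"
   "cmp B t1 (f1 u u u ?x ?x) = f1 w u w' ?h ?x"
   using X.presents_trans[OF X(2) w u(1) h g(4,5) u(2)] by blast
  obtain t2 where t2: "t2 : Ar B" "src B t2 = src H ?h" "ta w ?h = tr Y (ta w' ?h) t2"
   "cmp B t2 (f2 u u u ?x ?x) = f2 w u w' ?h ?x"
   using Y.presents_trans[OF Y(2) w u(1) h g(4,5) u(2)] by blast
  obtain t3 where t3: "t3 : Ar B" "src B t3 = src H ?h" "rh w ?h = tr Z (rh w' ?h) t3"
   "cmp B t3 (f3 u u u ?x ?x) = f3 w u w' ?h ?x"
   using Z.presents_trans[OF Z(2) w u(1) h g(4,5) u(2)] by blast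
  have du: "(?x, ?x) : fdom H V u u u" and dw: "(?h, ?x) : fdom H V w u w'"
   using h x u g by (auto simp: fdom_def)
  have F: "f1 u u u ?x ?x : Ar B" "src B (f1 u u u ?x ?x) = src H ?h" "f2 u u u ?x ?x : Ar B" "src B (f2 u u u ?x ?x) = src H ?h"
   using presentsD(2)[OF X(2) u(1) u(1) u(1) du] presentsD(2)[OF Y(2) u(1) u(1) u(1) du] h by auto
  have "cmp B t3 (f3 u u u ?x ?x) = cmp B (f1 w u w' ?h ?x) (f2 w u w' ?h ?x)"
   unfolding t3(4) by (rule sum[OF w(1) u(1) w(2) dw])
  also have "\<dots> = cmp B (cmp B t1 t2) (cmp B (f1 u u u ?x ?x) (f2 u u u ?x ?x))"
   unfolding t1(4)[symmetric] t2(4)[symmetric] using F t1(1,2) t2(1,2) by (simp add: X.ac)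
  also have "\<dots> = cmp B (cmp B t1 t2) (f3 u u u ?x ?x)"
   unfolding sum[OF u(1) u(1) u(1) du] ..
  finally have t: "t3 = cmp B t1 t2"
   unfolding sum[OF u(1) u(1) u(1) du] using F t1(1,2) t2(1,2) t3(1,2)
   by (subst (asm) X.add_cancel_r) auto
  have "M w ga de = tr Z (rh w' ?h) (cmp B (cmp B t1 ?a) (cmp B t2 ?b))"
   unfolding M_def t3(3) t using t1(1,2) t2(1,2) a b lZ h g by (simp add: Z.i_add[symmetric] X.ac)
  also have "\<dots> = M w' (tr X (sg w' ?h) (cmp B t1 ?a)) (tr Y (ta w' ?h) (cmp B t2 ?b))"
   using M[OF w(2) h g(5), of "cmp B t1 ?a" "cmp B t2 ?b"] t1(1,2) t2(1,2) a(1,2) b(1,2) by simp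
  also have "tr X (sg w' ?h) (cmp B t1 ?a) = ga"
   using t1 a lX h by (simp add: X.i_add)
  also have "tr Y (ta w' ?h) (cmp B t2 ?b) = de"
   using t2 b lY h by (simp add: Y.i_add)
  finally show ?thesis .
 qed
 let ?S = "baer_space X Y"
 define m where "m z = M (c (prj X (fst z))) (fst z) (snd z)" for z
 have mM: "m z = M w (fst z) (snd z)" if z: "z : pts ?S" and w: "w : Om" "prj X (fst z) : V w" for z w
  unfolding m_def using z w c[of "prj X (fst z)"] by (cases z) (auto simp: baer_space_iff intro!: Minv)
 have cont: "cts ?S (Ea Z) m"
 proof (rule continuous_map_local)
  fix z0 assume z0: "z0 : pts ?S"
  have cf: "cts ?S (Ea X) fst" and cs: "cts ?S (Ea Y) snd"
   unfolding baer_space_def by (auto intro: cts_sub_intro)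
  obtain w where w: "w : Om" "prj X (fst z0) : V w"
   using gcoverD(1)[OF cov, of "prj X (fst z0)"] continuous_map_in[OF cf z0] by auto
  define N where "N = {z : pts ?S. prj X (fst z) : V w}"
  have N: "openin ?S N" unfolding N_def by (rule openin_preimage[OF X.cont_pr[OF cf] gcoverD(2)[OF cov w(1)]])
  let ?T = "sbt ?S N" and ?h = "\<lambda>z. prj X (fst z)"
  have P: "fst z : El X & snd z : El Y & prj Y (snd z) = ?h z & ?h z : V w & ?h z : Ar H & Es Y (snd z) = Es X (fst z)"
   if zT: "z : pts ?T" for z
  proof -
   have "fst z : El X" "snd z : El Y" "prj Y (snd z) = ?h z" "?h z : V w"
    using zT baer_space_iff[of "fst z" "snd z" X Y] by (auto simp: N_def)
   then show ?thesis using Y.src_pr[of "snd z"] by simp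
  qed
  have df: "cts ?T (Ea X) fst" and ds: "cts ?T (Ea Y) snd" using cf cs continuous_map_from_subtopology by blast+
  have W: "?h z : V w" if "z : pts ?T" for z using P[OF that] by blast
  have d1: "cts ?T (Ea X) (\<lambda>z. sg w (?h z))" by (rule cont_lift[OF LX[OF w(1)] X.cont_pr[OF df] W])
  have d2: "cts ?T (Ea Y) (\<lambda>z. ta w (?h z))" by (rule cont_lift[OF LY[OF w(1)] X.cont_pr[OF df] W])
  have d3: "cts ?T (Ea Z) (\<lambda>z. rh w (?h z))" by (rule cont_lift[OF LZ[OF w(1)] X.cont_pr[OF df] W])
  have Q: "prj X (sg w (?h z)) = ?h z & prj Y (ta w (?h z)) = prj Y (snd z) &
   src B (X.dif (sg w (?h z)) (fst z)) = Es X (fst z) & src B (Y.dif (ta w (?h z)) (snd z)) = Es X (fst z) &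
   X.dif (sg w (?h z)) (fst z) : Ar B & Y.dif (ta w (?h z)) (snd z) : Ar B & Es Z (rh w (?h z)) = Es X (fst z)"
   if "z : pts ?T" for z
   using P[OF that] X.liftD[OF LX[OF w(1)], of "?h z"] Y.liftD[OF LY[OF w(1)], of "?h z"] Z.liftD[OF LZ[OF w(1)], of "?h z"]
    X.coord[OF LX[OF w(1)], of "fst z"] Y.coord[OF LY[OF w(1)], of "snd z"] by simp
  have "cts ?T (Ea Z) (\<lambda>z. M w (fst z) (snd z))"
   unfolding M_def
   by (intro Z.E.cont_cmp d3 Z.cont_i X.add_cont X.cont_dif Y.cont_dif d1 d2 df ds) ((drule Q, simp)+)
  then have "cts ?T (Ea Z) m"
   by (rule continuous_map_eq) (use mM[OF _ w(1)] W in auto)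
  then show "\<exists>N. openin ?S N & z0 : N & cts (sbt ?S N) (Ea Z) m"
   using N z0 w by (intro exI[of _ N]) (auto simp: N_def)
 qed
 have val: "m (tr X (sg w h) a, tr Y (ta w h) b) = tr Z (rh w h) (cmp B a b)"
  if "w : Om" "h : Ar H" "h : V w" "a : Ar B" "b : Ar B" "src B a = src H h" "src B b = src H h" for w h a b
  using mM[of "(tr X (sg w h) a, tr Y (ta w h) b)" w] M[OF that] that
   X.liftD[OF LX[OF that(1)] that(2,3)] Y.liftD[OF LY[OF that(1)] that(2,3)] by (simp add: baer_space_iff)
 have crd: "\<exists>w a b. w : Om & h : V w & a : Ar B & b : Ar B & src B a = src H h & src B b = src H h &
   ga = tr X (sg w h) a & de = tr Y (ta w h) b & h : Ar H & Es X ga = src H h"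
  if z: "(ga, de) : pts ?S" and h: "prj X ga = h" for ga de h
 proof -
  have gd: "ga : El X" "de : El Y" "prj Y de = h" "h : Ar H" using z h by (auto simp: baer_space_iff)
  obtain w where w: "w : Om" "h : V w" using gcoverD(1)[OF cov gd(4)] by blast
  note q = X.coord[OF LX[OF w(1)] gd(1)] Y.coord[OF LY[OF w(1)] gd(2)]
  show ?thesis
   using q gd h w X.src_pr[OF gd(1)] Y.src_pr[OF gd(2)]
   by (intro exI[of _ w] exI[of _ "X.dif (sg w h) ga"] exI[of _ "Y.dif (ta w h) de"]) auto
 qed
 show ?thesis
 proof (intro exI[of _ m], unfold_locales)
  show "cts ?S (Ea Z) m" by (rule cont)
  fix ga de assume z: "(ga, de) : pts ?S"
  define g where "g = prj X ga"
  obtain w1 a b where w1: "w1 : Om" "g : V w1" and ab: "a : Ar B" "b : Ar B" "src B a = src H g" "src B b = src H g"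
   and gd: "ga = tr X (sg w1 g) a" "de = tr Y (ta w1 g) b" and g: "g : Ar H" "Es X ga = src H g" using crd[OF z g_def[symmetric]] by blast
  have mz: "m (ga, de) = tr Z (rh w1 g) (cmp B a b)" unfolding gd by (rule val[OF w1(1) g(1) w1(2) ab])
  note l = X.liftD[OF LX[OF w1(1)] g(1) w1(2)] and lY = Y.liftD[OF LY[OF w1(1)] g(1) w1(2)] and lZ = Z.liftD[OF LZ[OF w1(1)] g(1) w1(2)]
  show "prj Z (m (ga, de)) = prj X ga" unfolding mz using lZ ab g g_def by simp
  show "m (tr X ga a', tr Y de b') = tr Z (m (ga, de)) (cmp B a' b')"
   if "a' : Ar B" "b' : Ar B" "src B a' = Es X ga" "src B b' = Es X ga" for a' b'
  proof -
   have "m (tr X ga a', tr Y de b') = tr Z (rh w1 g) (cmp B (cmp B a a') (cmp B b b'))"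
    unfolding gd using ab that l lY g w1 val[of w1 g "cmp B a a'" "cmp B b b'"] by (simp add: X.i_add Y.i_add)
   then show ?thesis unfolding mz using ab that lZ g by (simp add: Z.i_add[symmetric] X.ac)
  qed
  fix ga' de' assume z': "(ga', de') : pts ?S" and s: "Es X ga = Er X ga'"
  define h where "h = prj X ga'"
  obtain w2 a' b' where w2: "w2 : Om" "h : V w2" and ab': "a' : Ar B" "b' : Ar B" "src B a' = src H h" "src B b' = src H h"
   and gd': "ga' = tr X (sg w2 h) a'" "de' = tr Y (ta w2 h) b'" and h: "h : Ar H" "Es X ga' = src H h" using crd[OF z' h_def[symmetric]] by blast
  have "ga' : El X" using z' by (simp add: baer_space_iff)
  then have gh: "src H g = rng H h" using s g(2) unfolding h_def by simp
  obtain w3 where w3: "w3 : Om" "cmp H g h : V w3" using gcoverD(1)[OF cov X.H.cmp_in[OF g(1) h(1) gh]] by blast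
  have d: "(g, h) : fdom H V w1 w2 w3" using g h gh w1 w2 w3 by (auto simp: fdom_def)
  note p1 = presentsD(2)[OF X(2) w1(1) w2(1) w3(1) d] and p2 = presentsD(2)[OF Y(2) w1(1) w2(1) w3(1) d]
  let ?A = "act B (ginv H h) a" and ?B = "act B (ginv H h) b" and ?F1 = "f1 w1 w2 w3 g h" and ?F2 = "f2 w1 w2 w3 g h"
  have A: "?A : Ar B" "src B ?A = src H h" "?B : Ar B" "src B ?B = src H h" using g h gh ab by auto
  have "m (Em X ga ga', Em Y de de') =
   m (tr X (sg w3 (cmp H g h)) (cmp B ?F1 (cmp B ?A a')), tr Y (ta w3 (cmp H g h)) (cmp B ?F2 (cmp B ?B b')))"
   unfolding gd gd' X.presents_mult[OF X(2) w1(1) w2(1) w3(1) d ab(1) ab'(1) ab(3) ab'(3)]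
    Y.presents_mult[OF Y(2) w1(1) w2(1) w3(1) d ab(2) ab'(2) ab(4) ab'(4)] ..
  also have "\<dots> = tr Z (rh w3 (cmp H g h)) (cmp B (cmp B ?F1 (cmp B ?A a')) (cmp B ?F2 (cmp B ?B b')))"
   using p1 p2 A ab' g h gh by (intro val w3) auto
  also have "cmp B (cmp B ?F1 (cmp B ?A a')) (cmp B ?F2 (cmp B ?B b')) =
    cmp B (f3 w1 w2 w3 g h) (cmp B (act B (ginv H h) (cmp B a b)) (cmp B a' b'))"
   unfolding sum[OF w1(1) w2(1) w3(1) d] using p1 p2 A ab ab' g h gh by (simp add: X.ac)
  also have "tr Z (rh w3 (cmp H g h)) \<dots> = Em Z (m (ga, de)) (m (ga', de'))"
   unfolding mz gd' val[OF w2(1) h(1) w2(2) ab']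
   using ab ab' by (intro Z.presents_mult[OF Z(2) w1(1) w2(1) w3(1) d, symmetric]) auto
  finally show "m (Em X ga ga', Em Y de de') = Em Z (m (ga, de)) (m (ga', de'))" .
 qed
qed

subsection \<open>Extensions with the same factor set\<close>

lemma zero_factor_set:
 assumes "topological_groupoid H" "G_module H B"
 shows "gcover H {()} (\<lambda>_. Ar H)" "factor_set H B {()} (\<lambda>_. Ar H) (\<lambda>_ _ _ g h. idn B (src H h))"
proof -
 interpret gmodule H B using assms by unfold_locales
 show "gcover H {()} (\<lambda>_. Ar H)" by (auto simp: gcover_def)
 have "cts (sbt (prt (arr H) (arr H)) S) (arr B) (\<lambda>(g, h). idn B (src H h))" for S
 proof -
  have "cts (sbt (prt (arr H) (arr H)) S) (obj H) (\<lambda>z. src H (snd z))"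
   by (intro H.cont_src continuous_map_from_subtopology continuous_map_snd)
  then show ?thesis using B.cont_idn by (simp add: case_prod_unfold)
 qed
 then show "factor_set H B {()} (\<lambda>_. Ar H) (\<lambda>_ _ _ g h. idn B (src H h))"
  unfolding factor_set_def by (auto simp: fdom_def)
qed

lemma zero_extension:
 fixes B :: "('x, 'b, 'h) gmod"
 assumes "topological_groupoid H" "G_module H B"
 obtains Z :: "('x, 'b, 'h, 'b \<times> 'h) extn" and rh where "extension H B Z"
  "is_lifting H Z (Ar H) rh"
  "\<And>g h. g : Ar H ==> h : Ar H ==> src H g = rng H h ==> Em Z (rh g) (rh h) = rh (cmp H g h)"
proof -
 obtain Z :: "('x, 'b, 'h, 'b \<times> 'h) extn" and rh where Z: "extension H B Z"
  "presents H B {()} (\<lambda>_. Ar H) Z rh (\<lambda>_ _ _ g h. idn B (src H h))"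
  using factor_set_realised[OF assms zero_factor_set[OF assms]] by blast
 interpret Z: ext H B Z using assms Z by unfold_locales
 have l: "is_lifting H Z (Ar H) (rh ())" using presentsD(1)[OF Z(2)] by simp
 show ?thesis
 proof (rule that[OF Z(1) l])
  fix g h assume gh: "g : Ar H" "h : Ar H" "src H g = rng H h"
  then have "(g, h) : fdom H (\<lambda>_. Ar H) () () ()" by (auto simp: fdom_def)
  from presentsD(2)[OF Z(2) _ _ _ this] gh Z.liftD[OF l, of "cmp H g h"]
  show "Em Z (rh () g) (rh () h) = rh () (cmp H g h)" by simp
 qed
qed

lemma multiplicative_lifting_presents:
 assumes "topological_groupoid H" "G_module H B" "extension H B Z" "is_lifting H Z (Ar H) rh"
  "\<And>g h. g : Ar H ==> h : Ar H ==> src H g = rng H h ==> Em Z (rh g) (rh h) = rh (cmp H g h)"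
  and cov: "gcover H Om V"
 shows "presents H B Om V Z (\<lambda>_. rh) (\<lambda>_ _ _ g h. idn B (src H h))"
proof -
 interpret Z: ext H B Z using assms by unfold_locales
 have V: "V w \<subseteq> Ar H" if "w : Om" for w using gcoverD(2)[OF cov that] openin_subset by blast
 show ?thesis unfolding presents_def
 proof (intro conjI ballI allI impI)
  fix w assume "w : Om"
  then show "is_lifting H Z (V w) rh"
   using assms(4) V continuous_map_subtopology_mono unfolding is_lifting_def by blast
 next
  fix w1 w2 w3 g h assume "(g, h) : fdom H V w1 w2 w3"
  then have gh: "g : Ar H" "h : Ar H" "src H g = rng H h" by (auto simp: fdom_def)
  then show "Em Z (rh g) (rh h) = tr Z (rh (cmp H g h)) (idn B (src H h))"
   using assms(5)[OF gh] Z.liftD[OF assms(4), of "cmp H g h"] by simp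
  show "idn B (src H h) : Ar B" "src B (idn B (src H h)) = src H h" using gh by auto
 qed
qed

text \<open>A morphism of extensions is bijective by the five lemma, and its inverse is continuous because
 liftings of the source give local sections.\<close>

lemma morphism_equiv:
 assumes md: "topological_groupoid H" "G_module H B" and X: "extension H B X" and Y: "extension H B Y"
  and c: "cts (Ea X) (Ea Y) ph" and p: "\<And>ga. ga : El X ==> prj Y (ph ga) = prj X ga"
  and t: "\<And>ga b. ga : El X ==> b : Ar B ==> src B b = Es X ga ==> ph (tr X ga b) = tr Y (ph ga) b"
  and mu: "\<And>ga de. ga : El X ==> de : El X ==> Es X ga = Er X de ==> ph (Em X ga de) = Em Y (ph ga) (ph de)"
  and l: "\<And>h. h : Ar H ==> \<exists>V s. openin (arr H) V & h : V & is_lifting H X V s"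
 shows "ext_equiv B X Y"
proof -
 interpret X: ext H B X using md X by unfold_locales
 interpret Y: ext H B Y using md Y by unfold_locales
 have i: "ph ga : El Y" if "ga : El X" for ga using continuous_map_in[OF c that] .
 have e: "Es Y (ph ga) = Es X ga" "Er Y (ph ga) = Er X ga" if "ga : El X" for ga
  using p[OF that] X.src_pr[OF that] Y.src_pr[OF i[OF that]] X.rng_pr[OF that] Y.rng_pr[OF i[OF that]] by simp_all
 have "quotient_map (Ea X) (Ea Y) ph"
 proof (rule Y.quotient_by_liftings[OF c, where t = "tr X"])
  show "cts T (Ea X) (\<lambda>x. tr X (q x) (b x))" if "cts T (Ea X) q" "cts T (arr B) b" "\<And>x. x : pts T ==> src B (b x) = Es Y (ph (q x))"
   for T :: "'f topology" and q b
   by (intro X.E.cont_cmp X.cont_i that(1,2)) (use that e continuous_map_in[OF that(1)] continuous_map_in[OF that(2)] in simp)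
  show "ph (tr X ga b) = tr Y (ph ga) b" if "ga : El X" "b : Ar B" "src B b = Es Y (ph ga)" for ga b
   using t that e by simp
  show "\<exists>V s. openin (arr H) V & h : V & cts (sbt (arr H) V) (Ea X) s & (\<forall>h\<in>Ar H \<inter> V. prj Y (ph (s h)) = h)" if h: "h : Ar H" for h
  proof -
   obtain V s where V: "openin (arr H) V" "h : V" "is_lifting H X V s" using l[OF h] by blast
   have "prj Y (ph (s k)) = k" if "k : Ar H \<inter> V" for k using X.liftD[OF V(3), of k] p[of "s k"] that by simp
   then show ?thesis using V unfolding is_lifting_def by blast
  qed
 qed
 moreover have "inj_on ph (El X)"
 proof (rule inj_onI)
  fix ga de assume g: "ga : El X" "de : El X" "ph ga = ph de"
  then have "prj X ga = prj X de" using p by metis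
  note d = X.dif[OF g(1,2) this]
  have "Es X ga = Es X de" using e(1)[OF g(1)] e(1)[OF g(2)] g(3) by simp
  then have "tr Y (ph ga) (X.dif ga de) = tr Y (ph ga) (idn B (Es X ga))"
   using t[OF g(1) d(1)] d g i e by simp
  then have "X.dif ga de = idn B (Es X ga)"
   using Y.i_cancel[OF i[OF g(1)] d(1), of "idn B (Es X ga)"] d(2) e(1)[OF g(1)] g \<open>Es X ga = Es X de\<close> by simp
  then show "ga = de" using d(3) g by simp
 qed
 ultimately have hm: "homeomorphic_map (Ea X) (Ea Y) ph" by (simp add: homeomorphic_map_def)
 have ph1: "ph (idn (tot X) x) = idn (tot Y) x" if x: "x : Ob H" for x
  using Y.E.idem_idn[of "ph (idn (tot X) x)"] mu[of "idn (tot X) x" "idn (tot X) x"] i e x by simp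
 have "ph (inc X b) = inc Y b" if "b : Ar B" for b
  using t[of "idn (tot X) (src B b)" b] ph1[of "src B b"] that by simp
 then show ?thesis unfolding ext_equiv_def using hm e p mu by blast
qed

text \<open>An extension with the same factor set as \<open>X\<close> is a Baer sum of \<open>X\<close> with the split extension.\<close>

theorem presents_imp_equiv:
 fixes B :: "('x, 'b, 'h) gmod"
 assumes md: "topological_groupoid H" "G_module H B" and cov: "gcover H Om V"
  and X: "extension H B X" "presents H B Om V X sg f"
  and Y: "extension H B Y" "presents H B Om V Y ta f"
 shows "ext_equiv B X Y"
proof -
 interpret X: ext H B X using md X by unfold_locales
 interpret Y: ext H B Y using md Y by unfold_locales
 obtain Z :: "('x, 'b, 'h, 'b \<times> 'h) extn" and rh where Z: "extension H B Z" "is_lifting H Z (Ar H) rh"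
  "\<And>g h. g : Ar H ==> h : Ar H ==> src H g = rng H h ==> Em Z (rh g) (rh h) = rh (cmp H g h)"
  using zero_extension[OF md] by blast
 interpret Z: ext H B Z using md Z by unfold_locales
 have sum: "f w1 w2 w3 g h = cmp B (f w1 w2 w3 g h) (idn B (src H h))"
  if "w1 : Om" "w2 : Om" "w3 : Om" "(g, h) : fdom H V w1 w2 w3" for w1 w2 w3 g h
  using presentsD(2)[OF X(2) that] by simp
 obtain m where "baer_map H B X Z Y m"
  using coordinate_sum_map[OF md cov X Z(1) multiplicative_lifting_presents[OF md Z cov] Y sum] by blast
 then interpret m: baer_map H B X Z Y m .
 let ?ph = "\<lambda>ga. m (ga, rh (prj X ga))"
 have l: "rh (prj X ga) : El Z" "prj Z (rh (prj X ga)) = prj X ga" "Es Z (rh (prj X ga)) = Es X ga" "Er Z (rh (prj X ga)) = Er X ga"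
  "(ga, rh (prj X ga)) : pts (baer_space X Z)" if "ga : El X" for ga
  using Z.liftD[OF Z(2), of "prj X ga"] that by (simp_all add: baer_space_iff)
 have id: "cts (Ea X) (Ea X) (\<lambda>ga. ga)" by simp
 have "cts (Ea X) (baer_space X Z) (\<lambda>ga. (ga, rh (prj X ga)))"
  unfolding baer_space_def using cont_lift[OF Z(2) X.cont_pr[OF id]] l(2)
  by (auto simp: cts_sub)
 from continuous_map_compose[OF this m.m_cont] have c: "cts (Ea X) (Ea Y) ?ph" by (simp add: o_def)
 show ?thesis
 proof (rule morphism_equiv[OF md X(1) Y(1) c])
  fix ga assume g: "ga : El X"
  show "prj Y (?ph ga) = prj X ga" by (rule m.m_prj[OF l(5)[OF g]])
  show "?ph (tr X ga b) = tr Y (?ph ga) b" if "b : Ar B" "src B b = Es X ga" for b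
   using m.m_tr[OF l(5)[OF g], of b "idn B (Es X ga)"] that l[OF g] g by simp
  show "?ph (Em X ga de) = Em Y (?ph ga) (?ph de)" if "de : El X" "Es X ga = Er X de" for de
   using m.m_mult[OF l(5)[OF g] l(5)[OF that(1)] that(2)] Z(3)[of "prj X ga" "prj X de"] that g by simp
 next
  show "\<exists>V s. openin (arr H) V & h : V & is_lifting H X V s" if "h : Ar H" for h
   using gcoverD[OF cov] that presentsD(1)[OF X(2)] by blast
 qed
qed

subsection \<open>The Baer sum\<close>

lemma openin_quot_topology:
 assumes R: "R = {(z, z'). z : pts S & z' : pts S & m z = m z'}"
 shows "openin (quot_topology S R) V \<longleftrightarrow> V \<subseteq> pts S // R & openin S (\<Union>V)"
  and "pts (quot_topology S R) = pts S // R"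
proof -
 have eq: "equiv (pts S) R"
  unfolding R by (intro equivI refl_onI symI transI) auto
 have "istopology (\<lambda>V. V \<subseteq> pts S // R & openin S (\<Union>V))"
  unfolding istopology_def
 proof (intro conjI allI impI)
  fix V W assume V: "V \<subseteq> pts S // R & openin S (\<Union>V)" and W: "W \<subseteq> pts S // R & openin S (\<Union>W)"
  have "\<Union>(V \<inter> W) = \<Union>V \<inter> \<Union>W"
  proof
   show "\<Union>V \<inter> \<Union>W \<subseteq> \<Union>(V \<inter> W)"
   proof
    fix z assume "z : \<Union>V \<inter> \<Union>W"
    then obtain C D where CD: "C : V" "z : C" "D : W" "z : D" by blast
    then have "C = D" using quotient_disj[OF eq, of C D] V W by blast
    then show "z : \<Union>(V \<inter> W)" using CD by blast
   qed
  qed blast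
  then show "V \<inter> W \<subseteq> pts S // R" "openin S (\<Union>(V \<inter> W))" using V W by auto
 next
  fix K assume K: "\<forall>V\<in>K. V \<subseteq> pts S // R & openin S (\<Union>V)"
  then show "\<Union>K \<subseteq> pts S // R" by blast
  have "\<Union>(\<Union>K) = (\<Union>V\<in>K. \<Union>V)" by blast
  then show "openin S (\<Union>(\<Union>K))" using K by (metis (no_types, lifting) imageE openin_Union)
 qed
 then show op: "openin (quot_topology S R) V \<longleftrightarrow> V \<subseteq> pts S // R & openin S (\<Union>V)" for V
  unfolding quot_topology_def by (simp add: topology_inverse')
 have "openin (quot_topology S R) (pts S // R)"
  unfolding op Union_quotient[OF eq] by simp
 then show "pts (quot_topology S R) = pts S // R"
  using op by (metis openin_subset openin_topspace subset_antisym)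
qed

text \<open>The two quotient maps with source \<open>S\<close> have the same fibres.\<close>

lemma quot_topology_homeomorphic:
 assumes m: "quotient_map S Z m"
  and R: "R = {(z, z'). z : pts S & z' : pts S & m z = m z'}"
  and ph: "\<And>z. z : pts S ==> ph (R `` {z}) = m z"
 shows "homeomorphic_map (quot_topology S R) Z ph"
proof -
 note op = openin_quot_topology[OF R]
 let ?q = "\<lambda>z. R `` {z}" and ?Q = "quot_topology S R"
 have cls: "?q z = {z' : pts S. m z' = m z}" if "z : pts S" for z using that unfolding R by auto
 have Q: "?q ` pts S = pts ?Q" unfolding op by (auto simp: quotient_def)
 have "quotient_map S ?Q ?q"
  unfolding quotient_map_def
 proof (intro conjI allI impI Q)
  fix V assume V: "V \<subseteq> pts ?Q"
  have "{z : pts S. ?q z : V} = \<Union>V"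
  proof
   show "{z : pts S. ?q z : V} \<subseteq> \<Union>V" using cls by blast
   show "\<Union>V \<subseteq> {z : pts S. ?q z : V}"
   proof
    fix z assume "z : \<Union>V"
    then obtain z' where "z' : pts S" "?q z' : V" "z : ?q z'" using V unfolding Q[symmetric] by blast
    then show "z : {z : pts S. ?q z : V}" using cls by auto
   qed
  qed
  then show "openin S {z : pts S. ?q z : V} = openin ?Q V" using V unfolding op by simp
 qed
 moreover have "quotient_map S Z (ph \<circ> ?q)" using m by (rule quotient_map_eq) (simp add: ph)
 ultimately have "quotient_map ?Q Z ph" by (meson continuous_compose_quotient_map quotient_imp_continuous_map quotient_map_from_composition)
 moreover have "inj_on ph (pts ?Q)"
  unfolding Q[symmetric] using ph cls by (auto intro!: inj_onI)
 ultimately show ?thesis by (simp add: homeomorphic_map_def)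
qed

context baer_map
begin

abbreviation S where "S \<equiv> baer_space X Y"

lemma m_in: "z : pts S ==> m z : El Z" using continuous_map_in[OF m_cont] .

lemma m_ends:
 assumes "(ga, de) : pts S"
 shows "Es Z (m (ga, de)) = Es X ga" "Er Z (m (ga, de)) = Er X ga" "Es Y de = Es X ga" "Er Y de = Er X ga"
proof -
 have g: "ga : El X" "de : El Y" "prj Y de = prj X ga" using assms by (auto simp: baer_space_iff)
 show "Es Z (m (ga, de)) = Es X ga" "Er Z (m (ga, de)) = Er X ga"
  using m_prj[OF assms] X.src_pr[OF g(1)] X.rng_pr[OF g(1)] Z.src_pr[OF m_in[OF assms]] Z.rng_pr[OF m_in[OF assms]] by simp_all
 show "Es Y de = Es X ga" "Er Y de = Er X ga"
  using X.src_pr[OF g(1)] X.rng_pr[OF g(1)] Y.src_pr[OF g(2)] Y.rng_pr[OF g(2)] g(3) by simp_all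
qed

lemma m_tr_l: "(ga, de) : pts S ==> b : Ar B ==> src B b = Es X ga ==> m (tr X ga b, de) = tr Z (m (ga, de)) b"
 using m_tr[of ga de b "idn B (Es X ga)"] m_ends[of ga de] by (simp add: baer_space_iff)

lemma m_tr_r: "(ga, de) : pts S ==> b : Ar B ==> src B b = Es X ga ==> m (ga, tr Y de b) = tr Z (m (ga, de)) b"
 using m_tr[of ga de "idn B (Es X ga)" b] m_ends[of ga de] by (simp add: baer_space_iff)

text \<open>The value at a pair of units is an idempotent, hence a unit.\<close>

lemma m_inc: "b : Ar B ==> m (inc X b, idn (tot Y) (src B b)) = inc Z b"
proof -
 assume b: "b : Ar B"
 let ?x = "src B b"
 let ?e = "m (idn (tot X) ?x, idn (tot Y) ?x)"
 have S: "(idn (tot X) ?x, idn (tot Y) ?x) : pts S" using b by (simp add: baer_space_iff)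
 have "?e = idn (tot Z) ?x"
  using Z.E.idem_idn[of ?e] m_mult[OF S S] m_in[OF S] m_ends[OF S] b by simp
 then show ?thesis using m_tr_l[OF S b] b by simp
qed

text \<open>Elements of one fibre of the fibre product differ by a pair $(a, b)$ of module elements, which
 \<open>m\<close> translates by $a + b$; so the fibres of \<open>m\<close> are the orbits of the
 pairs $(a, -a)$.\<close>

lemma baer_rel_kernel: "baer_rel B X Y = {(z, z'). z : pts S & z' : pts S & m z = m z'}" (is "?R = ?K")
proof
 show "?R \<subseteq> ?K"
 proof
  fix p assume "p : ?R"
  then obtain b ga de where p: "p = ((Em X (inc X b) ga, de), (ga, Em Y (inc Y b) de))"
   "b : Ar B" "(ga, de) : pts S" "src B b = Er X ga" unfolding baer_rel_def by blast
  let ?b = "act B (ginv H (prj X ga)) b"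
  have g: "ga : El X" "de : El Y" "prj Y de = prj X ga" using p(3) by (auto simp: baer_space_iff)
  have b: "?b : Ar B" "src B ?b = Es X ga" using p g by simp_all
  have e: "Em X (inc X b) ga = tr X ga ?b" "Em Y (inc Y b) de = tr Y de ?b"
   using X.move_i[OF g(1) p(2,4)] Y.move_i[OF g(2) p(2)] p(4) g(3) m_ends[OF p(3)] by simp_all
  show "p : ?K"
   using m_tr_l[OF p(3) b] m_tr_r[OF p(3) b] g b m_ends[OF p(3)] unfolding p(1) e by (simp add: baer_space_iff)
 qed
 show "?K \<subseteq> ?R"
 proof
  fix p assume "p : ?K"
  then obtain ga de ga' de' where p: "p = ((ga, de), (ga', de'))" "(ga, de) : pts S" "(ga', de') : pts S"
   "m (ga, de) = m (ga', de')" by auto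
  let ?h = "prj X ga"
  have h: "prj X ga' = ?h" "prj Y de = ?h" "prj Y de' = ?h" "ga : El X" "ga' : El X" "de : El Y" "de' : El Y"
   using m_prj[OF p(2)] m_prj[OF p(3)] p by (auto simp: baer_space_iff)
  note a = X.dif[OF h(5,4) h(1)] and b = Y.dif[OF h(6,7)]
  let ?a = "X.dif ga' ga" and ?b = "Y.dif de de'"
  have s: "Es X ga' = Es X ga" "Er X ga' = Er X ga" using m_ends[OF p(2)] m_ends[OF p(3)] p(4) by simp_all
  have S: "(ga', de) : pts S" using h by (simp add: baer_space_iff)
  have b': "?b : Ar B" "src B ?b = Es X ga" "tr Y de ?b = de'" using b h m_ends[OF p(3)] s by simp_all
  have "tr Z (m (ga', de)) ?a = tr Z (m (ga', de)) ?b"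
   using m_tr_l[OF S a(1)] m_tr_r[OF S b'(1)] a b' p(4) s by simp
  then have ab: "?b = ?a" using Z.i_cancel[OF m_in[OF S] a(1) b'(1)] a(2) b'(2) m_ends[OF S] s by simp
  let ?c = "act B ?h ?a"
  have c: "?c : Ar B" "src B ?c = Er X ga" "act B (ginv H ?h) ?c = ?a" using a h s by simp_all
  have "Em X (inc X ?c) ga' = ga" "Em Y (inc Y ?c) de = de'"
   using X.move_i[OF h(5) c(1)] Y.move_i[OF h(6) c(1)] c a(3) b'(3) h s m_ends[OF p(2)] unfolding ab by simp_all
  then show "p : ?R" unfolding baer_rel_def p(1) using c S s by force
 qed
qed

theorem baer_sum_equiv:
 assumes l: "\<And>h. h : Ar H ==> \<exists>V s t. openin (arr H) V & h : V & is_lifting H X V s & is_lifting H Y V t"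
 shows "ext_equiv B (baer_sum B X Y) Z" "ext_equiv B Z (baer_sum B X Y)"
proof -
 let ?S = S and ?R = "baer_rel B X Y"
 note R = baer_rel_kernel
 have sp: "(fst z, snd z) : pts S" if "z : pts S" for z using that by simp
 note m_pr = m_prj[OF sp, simplified] and m_src = m_ends(1,2)[OF sp, simplified]
 have quo: "quotient_map S (Ea Z) m"
 proof (rule Z.quotient_by_liftings[OF m_cont, where t = "\<lambda>z b. (tr X (fst z) b, snd z)"])
  fix T :: "'k topology" and q b assume q: "cts T S q" and b: "cts T (arr B) b"
   and e: "\<And>x. x : pts T ==> src B (b x) = Es Z (m (q x))"
  have c: "cts T (Ea X) (\<lambda>x. fst (q x))" "cts T (Ea Y) (\<lambda>x. snd (q x))"
   using q unfolding baer_space_def by (auto simp: continuous_map_in_subtopology continuous_map_pairwise o_def)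
  have Q: "fst (q x) : El X" "src B (b x) = Es X (fst (q x))" "b x : Ar B" "prj X (fst (q x)) = prj Y (snd (q x))" if "x : pts T" for x
   using continuous_map_in[OF q that] continuous_map_in[OF b that] m_src[OF continuous_map_in[OF q that]] e[OF that]
    baer_space_iff[of "fst (q x)" "snd (q x)" X Y] by auto
  have "cts T (Ea X) (\<lambda>x. tr X (fst (q x)) (b x))"
   by (intro X.E.cont_cmp X.cont_i c b) (use Q in simp)
  moreover have "prj X (tr X (fst (q x)) (b x)) = prj Y (snd (q x))" if "x : pts T" for x
   using Q(1-3)[OF that] unfolding Q(4)[OF that, symmetric] by simp
  ultimately show "cts T S (\<lambda>x. (tr X (fst (q x)) (b x), snd (q x)))"
   unfolding baer_space_def using c(2) by (auto simp: cts_sub)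
 next
  fix z b assume "z : pts S" "b : Ar B" "src B b = Es Z (m z)"
  then show "m (tr X (fst z) b, snd z) = tr Z (m z) b" using m_tr_l[OF sp] m_src by simp
 next
  fix h assume "h : Ar H"
  then obtain V s t where V: "openin (arr H) V" "h : V" "is_lifting H X V s" "is_lifting H Y V t" using l by blast
  have st: "(s k, t k) : pts S" "prj Z (m (s k, t k)) = k" if "k : Ar H \<inter> V" for k
   using X.liftD[OF V(3), of k] Y.liftD[OF V(4), of k] that m_prj[of "s k" "t k"] by (simp_all add: baer_space_iff)
  have "cts (sbt (arr H) V) S (\<lambda>k. (s k, t k))"
   using V(3,4) st(1) unfolding is_lifting_def baer_space_def by (auto simp: cts_sub)
  then show "\<exists>V s. openin (arr H) V & h : V & cts (sbt (arr H) V) S s & (\<forall>h\<in>Ar H \<inter> V. prj Z (m (s h)) = h)"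
   using V(1,2) st(2) by blast
 qed
 define ph where "ph C = m (SOME z. z : C)" for C
 have cls: "?R `` {z} = {z' : pts ?S. m z' = m z}" if "z : pts ?S" for z
  using that unfolding R by auto
 have some: "(SOME z'. z' : ?R `` {z}) : pts ?S & m (SOME z'. z' : ?R `` {z}) = m z" if "z : pts ?S" for z
  using someI[of "\<lambda>z'. z' : ?R `` {z}" z] that unfolding cls[OF that] by blast
 have ph: "ph (?R `` {z}) = m z" if "z : pts ?S" for z
  unfolding ph_def using some[OF that] by blast
 let ?W = "baer_sum B X Y"
 have W: "Ea ?W = quot_topology ?S ?R" "Es ?W = (\<lambda>C. Es X (fst (SOME z. z : C)))"
   "Er ?W = (\<lambda>C. Er X (fst (SOME z. z : C)))"
   "Em ?W = (\<lambda>C D. \<Union>(ga, de)\<in>C. \<Union>(ga', de')\<in>D. ?R `` {(Em X ga ga', Em Y de de')})"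
   "inc ?W = (\<lambda>b. ?R `` {(inc X b, idn (tot Y) (src B b))})" "prj ?W = (\<lambda>C. prj X (fst (SOME z. z : C)))"
  by (simp_all add: baer_sum_def Let_def)
 have ArW: "El ?W = pts ?S // ?R" unfolding W by (rule openin_quot_topology(2)[OF R])
 have ArE: "\<exists>z\<in>pts ?S. C = ?R `` {z}" if "C : El ?W" for C
  using that unfolding ArW by (auto simp: quotient_def)
 have ArI: "?R `` {z} : El ?W" if "z : pts ?S" for z
  using that unfolding ArW by (auto simp: quotient_def)
 have srcW: "Es ?W (?R `` {z}) = Es X (fst z)" "Er ?W (?R `` {z}) = Er X (fst z)"
  "prj ?W (?R `` {z}) = prj X (fst z)" if "z : pts ?S" for z
  unfolding W using some[OF that] m_src m_pr that by metis+
 have mz: "(Em X (fst z) (fst z'), Em Y (snd z) (snd z')) : pts S &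
   m (Em X (fst z) (fst z'), Em Y (snd z) (snd z')) = Em Z (m z) (m z')"
  if "z : pts S" "z' : pts S" "Es X (fst z) = Er X (fst z')" for z z'
  using m_mult[OF sp sp] m_ends[OF sp] baer_space_iff[of "fst z" "snd z" X Y] baer_space_iff[of "fst z'" "snd z'" X Y] that by (simp add: baer_space_iff)
 have cmpW: "Em ?W (?R `` {z}) (?R `` {z'}) = ?R `` {(Em X (fst z) (fst z'), Em Y (snd z) (snd z'))}"
  if z: "z : pts ?S" "z' : pts ?S" "Es X (fst z) = Er X (fst z')" for z z'
 proof -
  have mm: "m (Em X ga ga', Em Y de de') = Em Z (m z) (m z') & (Em X ga ga', Em Y de de') : pts ?S"
   if "(ga, de) : ?R `` {z}" "(ga', de') : ?R `` {z'}" for ga de ga' de'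
  proof -
   have a: "(ga, de) : pts ?S" "m (ga, de) = m z" "(ga', de') : pts ?S" "m (ga', de') = m z'"
    using that z cls by auto
   have "Es X ga = Er X ga'"
    using m_src[OF a(1)] m_src[OF a(3)] m_src[OF z(1)] m_src[OF z(2)] z(3) a(2,4) by simp
   then show ?thesis using mz[OF a(1,3)] a(2,4) by simp
  qed
  have zz: "(fst z, snd z) : ?R `` {z}" "(fst z', snd z') : ?R `` {z'}" using z cls by auto
  have c: "?R `` {(Em X ga ga', Em Y de de')} = {y : pts ?S. m y = Em Z (m z) (m z')}"
   if "(ga, de) : ?R `` {z}" "(ga', de') : ?R `` {z'}" for ga de ga' de'
   using mm[OF that] cls by auto
  have "Em ?W (?R `` {z}) (?R `` {z'}) = {y : pts ?S. m y = Em Z (m z) (m z')}"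
   (is "_ = ?K") unfolding W(4)
  proof (rule SUP_eq_const)
   fix p assume p: "p : ?R `` {z}"
   have "(\<Union>(ga', de')\<in>?R `` {z'}. ?R `` {(Em X (fst p) ga', Em Y (snd p) de')}) = ?K"
   proof (rule SUP_eq_const)
    fix p' assume p': "p' : ?R `` {z'}"
    show "(case p' of (ga', de') => ?R `` {(Em X (fst p) ga', Em Y (snd p) de')}) = ?K"
     using c[of "fst p" "snd p" "fst p'" "snd p'"] p p' by (simp add: case_prod_unfold)
   qed (use zz in blast)
   then show "(case p of (ga, de) => \<Union>(ga', de')\<in>?R `` {z'}.
     ?R `` {(Em X ga ga', Em Y de de')}) = ?K"
    by (simp add: case_prod_unfold)
  qed (use zz in blast)
  also have "\<dots> = ?R `` {(Em X (fst z) (fst z'), Em Y (snd z) (snd z'))}"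
   using c[OF zz] by simp
  finally show ?thesis .
 qed
 have incS: "(inc X b, idn (tot Y) (src B b)) : pts S" if "b : Ar B" for b
  using that by (simp add: baer_space_iff)
 show eq: "ext_equiv B ?W Z"
  unfolding ext_equiv_def
 proof (intro exI[of _ ph] conjI ballI impI)
  show "homeomorphic_map (Ea ?W) (Ea Z) ph"
   unfolding W(1) by (rule quot_topology_homeomorphic[OF quo R ph])
  fix C assume "C : El ?W"
  then obtain z where z: "z : pts ?S" "C = ?R `` {z}" using ArE by blast
  show "Es Z (ph C) = Es ?W C" "Er Z (ph C) = Er ?W C" "prj Z (ph C) = prj ?W C"
   unfolding z(2) ph[OF z(1)] srcW[OF z(1)] using m_src[OF z(1)] m_pr[OF z(1)] by auto
  fix D assume "D : El ?W" and CD: "Es ?W C = Er ?W D"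
  then obtain z' where z': "z' : pts ?S" "D = ?R `` {z'}" using ArE by blast
  have s: "Es X (fst z) = Er X (fst z')" using CD srcW z z' by metis
  show "ph (Em ?W C D) = Em Z (ph C) (ph D)"
   unfolding z(2) z'(2) cmpW[OF z(1) z'(1) s] ph[OF z(1)] ph[OF z'(1)]
   using mz[OF z(1) z'(1) s] ph by metis
 next
  fix b assume b: "b : Ar B"
  show "ph (inc ?W b) = inc Z b" unfolding W(5) ph[OF incS[OF b]] by (rule m_inc[OF b])
 qed
 show "ext_equiv B Z ?W"
 proof (rule ext_equiv_sym[OF eq])
  fix C D assume "C : El ?W" "D : El ?W" and CD: "Es ?W C = Er ?W D"
  then obtain z z' where z: "z : pts ?S" "C = ?R `` {z}" "z' : pts ?S" "D = ?R `` {z'}" using ArE by meson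
  have s: "Es X (fst z) = Er X (fst z')" using CD srcW z by metis
  show "Em ?W C D : El ?W"
   unfolding z(2,4) cmpW[OF z(1,3) s] by (rule ArI) (use mz[OF z(1,3) s] in blast)
 next
  fix b assume b: "b : Ar B"
  show "inc ?W b : El ?W" unfolding W(5) by (rule ArI[OF incS[OF b]])
 qed
qed

end

text \<open>The coordinates of \<open>split_ext\<close> place the module element on the left of the section.\<close>

theorem split_ext_equiv:
 fixes B :: "('x, 'b, 'h) gmod"
 assumes md: "topological_groupoid H" "G_module H B" and Z: "extension H B Z" "is_lifting H Z (Ar H) rh"
  "\<And>g h. g : Ar H ==> h : Ar H ==> src H g = rng H h ==> Em Z (rh g) (rh h) = rh (cmp H g h)"
 shows "ext_equiv B (split_ext H B) Z" "ext_equiv B Z (split_ext H B)"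
proof -
 interpret Z: ext H B Z using md Z by unfold_locales
 let ?W = "split_ext H B"
 define T where "T = sbt (prt (arr B) (arr H)) {(b, h). src B b = rng H h}"
 have W: "Ea ?W = T" "Es ?W = (\<lambda>p. src H (snd p))" "Er ?W = (\<lambda>p. rng H (snd p))"
  "Em ?W = (\<lambda>p q. (cmp B (fst p) (act B (snd p) (fst q)), cmp H (snd p) (snd q)))"
  "inc ?W = (\<lambda>b. (b, idn H (src B b)))" "prj ?W = snd"
  by (auto simp: split_ext_def case_prod_unfold T_def)
 have TI: "(b, h) : pts T \<longleftrightarrow> b : Ar B & h : Ar H & src B b = rng H h" for b h by (auto simp: T_def)
 note l = Z.liftD[OF Z(2)]
 have r1: "rh (idn H x) = idn (tot Z) x" if "x : Ob H" for x
  using Z.E.idem_idn[of "rh (idn H x)"] l[of "idn H x"] Z(3)[of "idn H x" "idn H x"] that by simp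
 let ?f = "\<lambda>p. Em Z (inc Z (fst p)) (rh (snd p))"
 let ?g = "\<lambda>ze. (act B (prj Z ze) (Z.dif (rh (prj Z ze)) ze), prj Z ze)"
 have mv: "Em Z (inc Z (act B h b)) (rh h) = tr Z (rh h) b"
  if "h : Ar H" "b : Ar B" "src B b = src H h" for h b
  using Z.move_i[of "rh h" "act B h b"] that l[of h] by simp
 have d: "prj Z (rh (prj Z ze)) = prj Z ze & Z.dif (rh (prj Z ze)) ze : Ar B & src B (Z.dif (rh (prj Z ze)) ze) = Es Z ze &
   tr Z (rh (prj Z ze)) (Z.dif (rh (prj Z ze)) ze) = ze & src H (prj Z ze) = Es Z ze"
  if "ze : El Z" for ze
  using that l[of "prj Z ze"] Z.coord[OF Z(2) that] by simp
 have id: "cts (Ea Z) (Ea Z) (\<lambda>ze. ze)" by simp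
 note cp = Z.cont_pr[OF id]
 have cr: "cts (Ea Z) (Ea Z) (\<lambda>ze. rh (prj Z ze))"
  by (rule cont_lift[OF Z(2) cp]) simp
 have "cts (Ea Z) (arr B) (\<lambda>ze. act B (prj Z ze) (Z.dif (rh (prj Z ze)) ze))"
  by (intro Z.act_cont cp Z.cont_dif cr id) ((drule d, simp)+)
 then have cg: "cts (Ea Z) T ?g"
  unfolding T_def using cp d by (auto simp: cts_sub)
 have c1: "cts T (arr B) fst" and c2: "cts T (arr H) snd"
  unfolding T_def by (auto intro: cts_sub_intro)
 have c3: "cts T (Ea Z) (\<lambda>p. rh (snd p))"
  by (rule cont_lift[OF Z(2) c2]) (auto simp: T_def)
 have cf: "cts T (Ea Z) ?f"
  by (intro Z.E.cont_cmp Z.cont_i c1 c3) (use l in \<open>auto simp: T_def\<close>)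
 have fg: "?f (?g ze) = ze" if "ze : El Z" for ze
  using d[OF that] mv[of "prj Z ze" "Z.dif (rh (prj Z ze)) ze"] that by simp
 have gf: "?g (?f p) = p" if pT: "p : pts T" for p
 proof -
  obtain b h where p: "p = (b, h)" "b : Ar B" "h : Ar H" "src B b = rng H h" using pT TI by (metis surj_pair)
  let ?b = "act B (ginv H h) b"
  have b: "?b : Ar B" "src B ?b = src H h" "act B h ?b = b" using p by auto
  have f: "?f p = tr Z (rh h) ?b" using mv[OF p(3) b(1,2)] b(3) p(1) by simp
  have "Z.dif (rh h) (?f p) = ?b" using l[OF p(3)] p(3) b f by (intro Z.dif_eqI) auto
  moreover have "prj Z (?f p) = h" unfolding f using l[OF p(3)] p(3) b by simp
  ultimately show ?thesis using b(3) p(1) by simp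
 qed
 have "homeomorphic_maps T (Ea Z) ?f ?g"
  unfolding homeomorphic_maps_def using cf cg fg gf by blast
 then have hm: "homeomorphic_map T (Ea Z) ?f" using homeomorphic_maps_map by blast
 show eq: "ext_equiv B ?W Z"
  unfolding ext_equiv_def
 proof (intro exI[of _ ?f] conjI ballI impI)
  show "homeomorphic_map (Ea ?W) (Ea Z) ?f" unfolding W(1) by (rule hm)
  fix p assume "p : El ?W"
  then obtain b h where p: "p = (b, h)" "b : Ar B" "h : Ar H" "src B b = rng H h" unfolding W using TI by (metis surj_pair)
  show "Es Z (?f p) = Es ?W p" "Er Z (?f p) = Er ?W p" "prj Z (?f p) = prj ?W p"
   unfolding W using p l[OF p(3)] by auto
  fix q assume "q : El ?W" and pq: "Es ?W p = Er ?W q"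
  then obtain b' h' where q: "q = (b', h')" "b' : Ar B" "h' : Ar H" "src B b' = rng H h'" unfolding W using TI by (metis surj_pair)
  have s: "src H h = rng H h'" using pq p(1) q(1) unfolding W by simp
  have "?f (Em ?W p q) = Em Z (inc Z b) (Em Z (Em Z (inc Z (act B h b')) (rh h)) (rh h'))"
   unfolding W p(1) q(1) using Z(3)[OF p(3) q(3) s, symmetric] p q s l[OF p(3)] l[OF q(3)] by (simp add: Z.i_add)
  also have "Em Z (inc Z (act B h b')) (rh h) = tr Z (rh h) b'"
   using mv[OF p(3) q(2)] q s by simp
  finally show "?f (Em ?W p q) = Em Z (?f p) (?f q)"
   using p q s l[OF p(3)] l[OF q(3)] by simp
 next
  fix b assume b: "b : Ar B"
  show "?f (inc ?W b) = inc Z b" unfolding W using b r1[of "src B b"] by simp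
 qed
 show "ext_equiv B Z ?W"
 proof (rule ext_equiv_sym[OF eq])
  fix p q assume "p : El ?W" "q : El ?W" "Es ?W p = Er ?W q"
  then show "Em ?W p q : El ?W" unfolding W by (auto simp: T_def)
 next
  fix b assume "b : Ar B"
  then show "inc ?W b : El ?W" unfolding W by (auto simp: T_def)
 qed
qed

section \<open>Pull-back of extensions\<close>

text \<open>\<open>un y b\<close> is the element of the pulled back module over \<open>y\<close> that corresponds to \<open>b\<close>.\<close>

locale pullback = H: gmodule H B + K: gmodule K C
 for H :: "('x, 'h) topgpd" and B :: "('x, 'b, 'h) gmod" and K :: "('y, 'k) topgpd" and C :: "('y, 'c, 'k) gmod" +
 fixes f0 :: "'y => 'x" and f :: "'k => 'h" and be :: "'c => 'b" and un :: "'y => 'b => 'c"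
 assumes f_cont: "cts (arr K) (arr H) f"
  and f0_in: "\<And>y. y : Ob K ==> f0 y : Ob H"
  and f0_cont: "cts (obj K) (obj H) f0"
  and src_f: "\<And>k. k : Ar K ==> src H (f k) = f0 (src K k)"
  and rng_f: "\<And>k. k : Ar K ==> rng H (f k) = f0 (rng K k)"
  and f_cmp: "\<And>k l. k : Ar K ==> l : Ar K ==> src K k = rng K l ==> f (cmp K k l) = cmp H (f k) (f l)"
  and be_cont: "cts (arr C) (arr B) be"
  and src_be: "\<And>c. c : Ar C ==> src B (be c) = f0 (src C c)"
  and be_add: "\<And>c d. c : Ar C ==> d : Ar C ==> src C c = src C d ==> be (cmp C c d) = cmp B (be c) (be d)"
  and be_act: "\<And>k c. k : Ar K ==> c : Ar C ==> src K k = src C c ==> be (act C k c) = act B (f k) (be c)"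
  and un_cont: "\<And>(T :: ('b \<times> 'y) topology). \<forall>t\<in>pts T. src B (fst t) = f0 (snd t) ==> cts T (arr B) fst ==>
    cts T (obj K) snd ==> cts T (arr C) (\<lambda>t. un (snd t) (fst t))"
  and un_be: "\<And>c. c : Ar C ==> un (src C c) (be c) = c"
  and un: "\<And>y b. y : Ob K ==> b : Ar B ==> src B b = f0 y ==> be (un y b) = b & src C (un y b) = y"
begin

lemma cont_un:
 assumes "cts T (arr B) b" "cts T (obj K) y" "\<And>t. t : pts T ==> src B (b t) = f0 (y t)"
 shows "cts T (arr C) (\<lambda>t. un (y t) (b t))"
proof -
 let ?S = "sbt (prt (arr B) (obj K)) {t. src B (fst t) = f0 (snd t)}"
 have "cts T ?S (\<lambda>t. (b t, y t))"
  using assms by (auto simp: cts_sub)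
 moreover have "cts ?S (arr C) (\<lambda>t. un (snd t) (fst t))"
  by (rule un_cont) (auto intro: cts_sub_intro)
 ultimately have "cts T (arr C) ((\<lambda>t. un (snd t) (fst t)) \<circ> (\<lambda>t. (b t, y t)))"
  by (rule continuous_map_compose)
 then show ?thesis by (simp add: o_def)
qed

lemma f_in[simp]: "k : Ar K ==> f k : Ar H" using continuous_map_in[OF f_cont] .
lemma be_in[simp]: "c : Ar C ==> be c : Ar B" using continuous_map_in[OF be_cont] .
lemma un_in[simp]: "y : Ob K ==> b : Ar B ==> src B b = f0 y ==> un y b : Ar C"
 using continuous_map_in[OF cont_un[of "dsc {()}" "\<lambda>_. b" "\<lambda>_. y"], of "()"] by simp
lemma f_idn[simp]: "y : Ob K ==> f (idn K y) = idn H (f0 y)"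
 using H.H.idem_idn[of "f (idn K y)"] f_cmp[of "idn K y" "idn K y"] by (simp add: src_f rng_f)
lemma f_ginv[simp]: "k : Ar K ==> f (ginv K k) = ginv H (f k)"
 by (rule H.H.ginv_unique) (auto simp: src_f rng_f f_cmp[symmetric])

lemma cont_f: "cts T (arr K) a ==> cts T (arr H) (\<lambda>t. f (a t))"
 using continuous_map_compose[OF _ f_cont] by (simp add: o_def)

abbreviation "pbk X \<equiv> pull_ext K C f0 f be X"

lemma pull_sel:
 "obj (tot (pbk X)) = obj K"
 "arr (tot (pbk X)) = sbt (prt (Ea X) (arr K)) {(ga, k). prj X ga = f k}"
 "src (tot (pbk X)) = (\<lambda>p. src K (snd p))" "rng (tot (pbk X)) = (\<lambda>p. rng K (snd p))"
 "idn (tot (pbk X)) = (\<lambda>y. (idn (tot X) (f0 y), idn K y))"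
 "cmp (tot (pbk X)) = (\<lambda>p q. (Em X (fst p) (fst q), cmp K (snd p) (snd q)))"
 "ginv (tot (pbk X)) = (\<lambda>p. (ginv (tot X) (fst p), ginv K (snd p)))"
 "inc (pbk X) = (\<lambda>c. (inc X (be c), idn K (src C c)))" "prj (pbk X) = snd"
 by (auto simp: pull_ext_def Let_def case_prod_unfold)

lemma pull_lifting:
 assumes X: "extension H B X" and l: "is_lifting H X W sg"
 shows "is_lifting K (pbk X) {k : Ar K. f k : W} (\<lambda>k. (sg (f k), k))"
proof -
 interpret X: ext H B X using H.H.tg H.md X by unfold_locales
 let ?S = "sbt (arr K) {k : Ar K. f k : W}"
 have "cts ?S (arr K) (\<lambda>k. k)" by (auto intro: continuous_map_from_subtopology)
 moreover from this have "cts ?S (Ea X) (\<lambda>k. sg (f k))"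
  by (intro cont_lift[OF l] cont_f) auto
 ultimately show ?thesis
  using X.liftD[OF l] unfolding is_lifting_def pull_sel
  by (auto simp: cts_sub)
qed

text \<open>Local splittings are needed for the projection of the pull-back to be a quotient map.\<close>

lemma extension_pull:
 assumes X: "extension H B X" and split: "\<And>h. h : Ar H ==> \<exists>W sg. openin (arr H) W & h : W & is_lifting H X W sg"
 shows "extension K C (pbk X)"
proof -
 interpret X: ext H B X using H.H.tg H.md X by unfold_locales
 let ?E = "tot (pbk X)"
 define T where "T = sbt (prt (Ea X) (arr K)) {(ga, k). prj X ga = f k}"
 have T: "arr ?E = T" unfolding pull_sel T_def ..
 have TI: "p : pts T \<longleftrightarrow> fst p : El X & snd p : Ar K & prj X (fst p) = f (snd p)" for p
  by (auto simp: T_def mem_Times_iff)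
 have sr: "Es X (fst p) = f0 (src K (snd p))" "Er X (fst p) = f0 (rng K (snd p))" if "p : pts T" for p
  using that unfolding TI by (metis X.src_pr src_f, metis X.rng_pr rng_f)
 have into: "cts S T (\<lambda>s. (a s, b s))"
  if "cts S (Ea X) a" "cts S (arr K) b" "\<And>s. s : pts S ==> prj X (a s) = f (b s)"
  for S :: "'z topology" and a b
  using that unfolding T_def by (auto simp: cts_sub)
 have c1: "cts T (Ea X) fst" and c2: "cts T (arr K) snd"
  unfolding T_def by (auto intro: cts_sub_intro)
 have tg: "topological_groupoid ?E"
 proof (rule topological_groupoidI)
  show "cts (arr ?E) (obj ?E) (src ?E)" "cts (arr ?E) (obj ?E) (rng ?E)"
   unfolding T pull_sel(1,3,4) by (intro K.H.cont_src K.H.cont_rng c2)+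
  have id: "cts (obj K) (obj K) (\<lambda>y. y)" by simp
  show "cts (obj ?E) (arr ?E) (idn ?E)"
   unfolding T pull_sel(1,5)
   by (intro into X.E.cont_idn K.H.cont_idn id) (use f0_cont f0_in in \<open>auto\<close>)
  show "cts (arr ?E) (arr ?E) (ginv ?E)"
   unfolding T pull_sel(7)
   by (intro into X.E.cont_ginv K.H.cont_ginv c1 c2) (auto simp: TI)
  let ?S = "sbt (prt (arr ?E) (arr ?E)) {(g, h). src ?E g = rng ?E h}"
  have S: "fst s : pts T & snd s : pts T & src K (snd (fst s)) = rng K (snd (snd s))" if "s : pts ?S" for s
   using that by (auto simp: T pull_sel(3,4))
  have d1: "cts ?S T fst" and d2: "cts ?S T snd"
   unfolding T by (auto intro: cts_sub_intro)
  note e = continuous_map_compose[OF d1 c1, unfolded o_def] continuous_map_compose[OF d1 c2, unfolded o_def]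
   continuous_map_compose[OF d2 c1, unfolded o_def] continuous_map_compose[OF d2 c2, unfolded o_def]
  have s1: "Es X (fst (fst s)) = Er X (fst (snd s))" if "s : pts ?S" for s
   using S[OF that] sr by metis
  have "cts ?S T (\<lambda>s. (Em X (fst (fst s)) (fst (snd s)), cmp K (snd (fst s)) (snd (snd s))))"
  proof (intro into X.E.cont_cmp K.H.cont_cmp e)
   fix s assume s: "s : pts ?S"
   show "Es X (fst (fst s)) = Er X (fst (snd s))" by (rule s1[OF s])
   show "src K (snd (fst s)) = rng K (snd (snd s))" using S[OF s] by blast
   show "prj X (Em X (fst (fst s)) (fst (snd s))) = f (cmp K (snd (fst s)) (snd (snd s)))"
    using S[OF s] s1[OF s] unfolding TI by (simp add: f_cmp)
  qed
  then show "cts ?S (arr ?E) (\<lambda>(g, h). cmp ?E g h)"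
   unfolding T pull_sel(6) by (simp add: case_prod_unfold)
 next
  fix y assume "y : Ob ?E"
  then show "src ?E (idn ?E y) = y & rng ?E (idn ?E y) = y" unfolding pull_sel by simp
 next
  fix p assume p: "p : Ar ?E"
  have pT: "p : pts T" using p unfolding T .
  note pp = pT[unfolded TI]
  show "cmp ?E (idn ?E (rng ?E p)) p = p & cmp ?E p (idn ?E (src ?E p)) = p"
   using sr[OF pT] pp unfolding pull_sel(3-7) by simp
  show "src ?E (ginv ?E p) = rng ?E p & rng ?E (ginv ?E p) = src ?E p & cmp ?E (ginv ?E p) p = idn ?E (src ?E p)"
   using pp sr[OF pT] unfolding pull_sel(3-7) by simp
  fix q assume q: "q : Ar ?E" and pq: "src ?E p = rng ?E q"
  have qT: "q : pts T" using q unfolding T .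
  note qq = qT[unfolded TI]
  have pq': "src K (snd p) = rng K (snd q)" using pq unfolding pull_sel .
  have s: "Es X (fst p) = Er X (fst q)" using sr[OF pT] sr[OF qT] pq' by simp
  show "src ?E (cmp ?E p q) = src ?E q & rng ?E (cmp ?E p q) = rng ?E p"
   using pp qq pq' unfolding pull_sel(3-7) by simp
  fix r assume r: "r : Ar ?E" and qr: "src ?E q = rng ?E r"
  have rT: "r : pts T" using r unfolding T .
  note rr = rT[unfolded TI]
  have qr': "src K (snd q) = rng K (snd r)" using qr unfolding pull_sel .
  have s': "Es X (fst q) = Er X (fst r)" using sr[OF qT] sr[OF rT] qr' by simp
  show "cmp ?E (cmp ?E p q) r = cmp ?E p (cmp ?E q r)"
   using pp qq rr pq' qr' s s' unfolding pull_sel(3-7) by simp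
 qed
 interpret E: tgpd ?E using tg by unfold_locales
 let ?i = "\<lambda>c. (inc X (be c), idn K (src C c))"
 have id: "cts (arr C) (arr C) (\<lambda>c. c)" by simp
 have ci: "cts (arr C) T ?i"
  using K.B.cont_src[OF id] continuous_map_compose[OF id be_cont]
  by (intro into X.cont_i K.H.cont_idn) (auto simp: o_def src_be)
 have emb: "embedding_map (arr C) T ?i"
 proof -
  let ?I = "sbt T (?i ` Ar C)"
  let ?j = "\<lambda>p. un (src K (snd p)) (X.dif (idn (tot X) (f0 (src K (snd p)))) (fst p))"
  have P: "\<exists>c\<in>Ar C. p = ?i c" if "p : pts ?I" for p using that by auto
  have Q: "X.dif (idn (tot X) (f0 (src K (snd p)))) (fst p) = be c" if "c : Ar C" "p = ?i c" for p c
   using that f0_in[of "src C c"] by (intro X.dif_eqI) (auto simp: src_be)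
  have ji: "?j (?i c) = c" if "c : Ar C" for c
   using Q[OF that refl] that un_be by simp
  have d1: "cts ?I (Ea X) fst" and d2: "cts ?I (arr K) snd"
   using c1 c2 continuous_map_from_subtopology by blast+
  have "cts ?I (arr C) ?j"
  proof (intro cont_un X.cont_dif d1 K.H.cont_src d2)
   show "cts ?I (Ea X) (\<lambda>p. idn (tot X) (f0 (src K (snd p))))"
    using continuous_map_compose[OF K.H.cont_src[OF d2] f0_cont]
    by (intro X.E.cont_idn) (simp add: o_def)
   fix p assume "p : pts ?I"
   then obtain c where c: "c : Ar C" "p = ?i c" using P by blast
   show "prj X (idn (tot X) (f0 (src K (snd p)))) = prj X (fst p)"
    using c f0_in[of "src C c"] by (simp add: src_be)
   show "src B (X.dif (idn (tot X) (f0 (src K (snd p)))) (fst p)) = f0 (src K (snd p))"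
    unfolding Q[OF c] using c by (simp add: src_be)
  qed
  then have "homeomorphic_maps (arr C) ?I ?i ?j"
   unfolding homeomorphic_maps_def using ci ji by (auto simp: continuous_map_in_subtopology)
  then show ?thesis unfolding embedding_map_def using homeomorphic_maps_map by blast
 qed
 have quo: "quotient_map T (arr K) snd"
 proof (rule quotient_map_if_local_sections[OF c2])
  fix k assume k: "k : Ar K"
  then obtain W sg where W: "openin (arr H) W" "f k : W" "is_lifting H X W sg" using split[of "f k"] by auto
  have "openin (arr K) {k : Ar K. f k : W}" using f_cont W(1) by (rule openin_preimage)
  then show "\<exists>N s. openin (arr K) N & k : N & cts (sbt (arr K) N) T s &
    (\<forall>y\<in>Ar K \<inter> N. snd (s y) = y)"
   using pull_lifting[OF X W(3)] W(2) k unfolding is_lifting_def T pull_sel(9) by blast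
 qed
 have img: "?i ` Ar C = {p : pts T. snd p : idn K ` Ob K}"
 proof
  show "?i ` Ar C \<subseteq> {p : pts T. snd p : idn K ` Ob K}" using continuous_map_in[OF ci] by auto
  show "{p : pts T. snd p : idn K ` Ob K} \<subseteq> ?i ` Ar C"
  proof
   fix p assume "p : {p : pts T. snd p : idn K ` Ob K}"
   then obtain y where p: "fst p : El X" "snd p = idn K y" "y : Ob K" "prj X (fst p) = idn H (f0 y)"
    unfolding TI by auto
   obtain b where b: "b : Ar B" "fst p = inc X b" "src B b = f0 y"
    using X.kerE[OF p(1) p(4) f0_in[OF p(3)]] by blast
   have "p = ?i (un y b)" using un[OF p(3) b(1,3)] b p by (simp add: prod_eq_iff)
   then show "p : ?i ` Ar C" using un_in[OF p(3) b(1,3)] by blast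
  qed
 qed
 show ?thesis unfolding extension_def Let_def
 proof (intro conjI ballI impI)
  show "topological_groupoid ?E" by (rule tg)
  show "obj ?E = obj K" by (rule pull_sel)
  show "embedding_map (arr C) (arr ?E) (inc (pbk X))" unfolding T pull_sel(8) by (rule emb)
  show "quotient_map (arr ?E) (arr K) (prj (pbk X))" unfolding T pull_sel(9) by (rule quo)
  show "inc (pbk X) ` Ar C = {ga : Ar ?E. prj (pbk X) ga : idn K ` Ob K}"
   unfolding T pull_sel(8,9) by (rule img)
  show "src ?E (inc (pbk X) c) = src C c" "rng ?E (inc (pbk X) c) = src C c" if "c : Ar C" for c
   using that by (simp_all add: pull_sel)
  show "inc (pbk X) (cmp C c d) = cmp ?E (inc (pbk X) c) (inc (pbk X) d)"
   if "c : Ar C" "d : Ar C" "src C c = src C d" for c d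
   using that by (simp add: pull_sel be_add X.i_add src_be)
  show "src K (prj (pbk X) p) = src ?E p" "rng K (prj (pbk X) p) = rng ?E p"
   "prj (pbk X) (cmp ?E p q) = cmp K (prj (pbk X) p) (prj (pbk X) q)" for p q
   by (simp_all add: pull_sel)
  fix p c assume p: "p : Ar ?E" and c: "c : Ar C" "src C c = src ?E p"
  have pT: "fst p : El X" "snd p : Ar K" "prj X (fst p) = f (snd p)" "src C c = src K (snd p)"
   using p c unfolding T TI pull_sel(3) by auto
  have s: "src B (be c) = Es X (fst p)" using sr[of p] p pT c unfolding T by (simp add: src_be)
  show "cmp ?E (cmp ?E p (inc (pbk X) c)) (ginv ?E p) = inc (pbk X) (act C (prj (pbk X) p) c)"
   using X.conj0[OF pT(1) _ s] pT c by (simp add: pull_sel be_act)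
 qed
qed

lemma presents_pull:
 assumes X: "extension H B X" and pr: "presents H B Om V X sg F"
 shows "presents K C Om (\<lambda>w. {k : Ar K. f k : V w}) (pbk X) (\<lambda>w k. (sg w (f k), k))
   (\<lambda>w1 w2 w3 g h. un (src K h) (F w1 w2 w3 (f g) (f h)))"
 unfolding presents_def
proof (intro conjI ballI allI impI)
 interpret X: ext H B X using H.H.tg H.md X by unfold_locales
 fix w assume "w : Om"
 then show "is_lifting K (pbk X) {k : Ar K. f k : V w} (\<lambda>k. (sg w (f k), k))"
  using pull_lifting[OF X] presentsD(1)[OF pr] by blast
next
 interpret X: ext H B X using H.H.tg H.md X by unfold_locales
 fix w1 w2 w3 g h assume w: "w1 : Om" "w2 : Om" "w3 : Om"
  and "(g, h) : fdom K (\<lambda>w. {k : Ar K. f k : V w}) w1 w2 w3"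
 then have gh: "g : Ar K" "h : Ar K" "src K g = rng K h" "f g : V w1" "f h : V w2" "f (cmp K g h) : V w3"
  by (auto simp: fdom_def)
 then have "(f g, f h) : fdom H V w1 w2 w3" by (auto simp: fdom_def src_f rng_f f_cmp)
 note p = presentsD(2)[OF pr w this]
 have y: "src K h : Ob K" "src B (F w1 w2 w3 (f g) (f h)) = f0 (src K h)" using p gh by (auto simp: src_f)
 note u = un[OF y(1) _ y(2)]
 show "un (src K h) (F w1 w2 w3 (f g) (f h)) : Ar C" using p y by simp
 show "src C (un (src K h) (F w1 w2 w3 (f g) (f h))) = src K h" using u p by blast
 show "cmp (tot (pbk X)) (sg w1 (f g), g) (sg w2 (f h), h) =
    cmp (tot (pbk X)) (sg w3 (f (cmp K g h)), cmp K g h) (inc (pbk X) (un (src K h) (F w1 w2 w3 (f g) (f h))))"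
  using p u gh by (simp add: pull_sel f_cmp)
qed

lemma gcover_pull: "gcover H Om V ==> gcover K Om (\<lambda>w. {k : Ar K. f k : V w})"
 unfolding gcover_def using f_in openin_preimage[OF f_cont] by blast

end

section \<open>The groupoid of a cover\<close>

lemma cover_obj_cont:
 "cts T (obj (cover_gpd G C)) p \<longleftrightarrow>
  cts T (dsc (fst C)) (\<lambda>t. fst (p t)) & cts T (obj G) (\<lambda>t. snd (p t)) &
  (\<forall>t\<in>pts T. snd (p t) : snd C (fst (p t)))"
 by (auto simp: cover_gpd_def continuous_map_in_subtopology continuous_map_pairwise o_def case_prod_unfold)

lemma cover_arr_cont:
 "cts T (arr (cover_gpd G C)) p \<longleftrightarrow>
  cts T (dsc (fst C)) (\<lambda>t. fst (p t)) & cts T (arr G) (\<lambda>t. fst (snd (p t))) &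
  cts T (dsc (fst C)) (\<lambda>t. snd (snd (p t))) &
  (\<forall>t\<in>pts T. rng G (fst (snd (p t))) : snd C (fst (p t)) & src G (fst (snd (p t))) : snd C (snd (snd (p t))))"
 by (auto simp: cover_gpd_def continuous_map_in_subtopology continuous_map_pairwise o_def case_prod_unfold)

lemma cover_mod_cont:
 "cts T (arr (cover_mod A C)) p \<longleftrightarrow>
  cts T (dsc (fst C)) (\<lambda>t. fst (p t)) & cts T (arr A) (\<lambda>t. snd (p t)) &
  (\<forall>t\<in>pts T. src A (snd (p t)) : snd C (fst (p t)))"
 by (auto simp: cover_mod_def continuous_map_in_subtopology continuous_map_pairwise o_def case_prod_unfold)

lemma cover_gpd_sel:
 "src (cover_gpd G C) = (\<lambda>p. (snd (snd p), src G (fst (snd p))))"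
 "rng (cover_gpd G C) = (\<lambda>p. (fst p, rng G (fst (snd p))))"
 "idn (cover_gpd G C) = (\<lambda>p. (fst p, idn G (snd p), fst p))"
 "cmp (cover_gpd G C) = (\<lambda>p q. (fst p, cmp G (fst (snd p)) (fst (snd q)), snd (snd q)))"
 "ginv (cover_gpd G C) = (\<lambda>p. (snd (snd p), ginv G (fst (snd p)), fst p))"
 by (auto simp: cover_gpd_def case_prod_unfold)

lemma cover_mod_sel:
 "src (cover_mod A C) = (\<lambda>p. (fst p, src A (snd p)))"
 "rng (cover_mod A C) = (\<lambda>p. (fst p, rng A (snd p)))"
 "idn (cover_mod A C) = (\<lambda>p. (fst p, idn A (snd p)))"
 "cmp (cover_mod A C) = (\<lambda>p q. (fst p, cmp A (snd p) (snd q)))"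
 "ginv (cover_mod A C) = (\<lambda>p. (fst p, ginv A (snd p)))"
 "act (cover_mod A C) = (\<lambda>p q. (fst p, act A (fst (snd p)) (snd q)))"
 by (auto simp: cover_mod_def case_prod_unfold)

lemma Ob_cover: "p : Ob (cover_gpd G C) \<longleftrightarrow> fst p : fst C & snd p : Ob G & snd p : snd C (fst p)"
 by (auto simp: cover_gpd_def mem_Times_iff)
lemma Ar_cover: "p : Ar (cover_gpd G C) \<longleftrightarrow> fst p : fst C & snd (snd p) : fst C & fst (snd p) : Ar G &
  rng G (fst (snd p)) : snd C (fst p) & src G (fst (snd p)) : snd C (snd (snd p))"
 by (auto simp: cover_gpd_def mem_Times_iff)
lemma Ar_cover_mod: "p : Ar (cover_mod A C) \<longleftrightarrow> fst p : fst C & snd p : Ar A & src A (snd p) : snd C (fst p)"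
 by (auto simp: cover_mod_def mem_Times_iff)

lemma cont_id_sub: "cts (sbt T S) T (\<lambda>t. t)"
 by (auto intro: continuous_map_from_subtopology)
lemma cont_id': "cts T T (\<lambda>t. t)"
 by simp

lemma cont_fst_sub: "cts (sbt (prt T T') S) T fst"
 and cont_snd_sub: "cts (sbt (prt T T') S) T' snd"
 by (auto intro: cts_sub_intro)

lemma cover_gpd_groupoid:
 assumes "topological_groupoid G"
 shows "topological_groupoid (cover_gpd G C)"
proof (rule topological_groupoidI)
 interpret G: tgpd G using assms by unfold_locales
 let ?H = "cover_gpd G C"
 note a = cont_id'[of "arr ?H", unfolded cover_arr_cont]
 have a1: "cts (arr ?H) (dsc (fst C)) (\<lambda>t. fst t)"
  and a2: "cts (arr ?H) (arr G) (\<lambda>t. fst (snd t))"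
  and a3: "cts (arr ?H) (dsc (fst C)) (\<lambda>t. snd (snd t))" using a by auto
 note o = cont_id'[of "obj ?H", unfolded cover_obj_cont]
 have o1: "cts (obj ?H) (dsc (fst C)) (\<lambda>t. fst t)"
  and o2: "cts (obj ?H) (obj G) (\<lambda>t. snd t)" using o by auto
 show "cts (arr ?H) (obj ?H) (src ?H)"
  unfolding cover_obj_cont cover_gpd_sel using a3 G.cont_src[OF a2] by (auto simp: Ar_cover)
 show "cts (arr ?H) (obj ?H) (rng ?H)"
  unfolding cover_obj_cont cover_gpd_sel using a1 G.cont_rng[OF a2] by (auto simp: Ar_cover)
 show "cts (obj ?H) (arr ?H) (idn ?H)"
  unfolding cover_arr_cont cover_gpd_sel using o1 G.cont_idn[OF o2] by (auto simp: Ob_cover)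
 show "cts (arr ?H) (arr ?H) (ginv ?H)"
  unfolding cover_arr_cont cover_gpd_sel using a1 a3 G.cont_ginv[OF a2] by (auto simp: Ar_cover)
 let ?S = "sbt (prt (arr ?H) (arr ?H)) {(g, h). src ?H g = rng ?H h}"
 have S: "fst t : Ar ?H & snd t : Ar ?H & src ?H (fst t) = rng ?H (snd t)" if "t : pts ?S" for t
  using that by auto
 note f = cont_fst_sub[of "arr ?H" "arr ?H" "{(g, h). src ?H g = rng ?H h}", unfolded cover_arr_cont]
  and s = cont_snd_sub[of "arr ?H" "arr ?H" "{(g, h). src ?H g = rng ?H h}", unfolded cover_arr_cont]
 have c: "cts ?S (arr G) (\<lambda>t. cmp G (fst (snd (fst t))) (fst (snd (snd t))))"
  using f s by (intro G.cont_cmp) (auto simp: cover_gpd_sel)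
 have "cts ?S (arr ?H) (\<lambda>t. cmp ?H (fst t) (snd t))"
  unfolding cover_arr_cont
 proof (intro conjI ballI)
  fix t assume "t : pts ?S"
  note t = S[OF this]
  show "rng G (fst (snd (cmp ?H (fst t) (snd t)))) : snd C (fst (cmp ?H (fst t) (snd t)))"
   "src G (fst (snd (cmp ?H (fst t) (snd t)))) : snd C (snd (snd (cmp ?H (fst t) (snd t))))"
   using t by (auto simp: cover_gpd_sel Ar_cover)
 qed (use c f s in \<open>auto simp: cover_gpd_sel\<close>)
 then show "cts ?S (arr ?H) (\<lambda>(g, h). cmp ?H g h)" by (simp add: case_prod_unfold)
qed (use tgpd.intro[OF assms] in \<open>auto simp: cover_gpd_sel Ob_cover Ar_cover tgpd.src_idn tgpd.rng_idn tgpd.idn_l tgpd.idn_r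
   tgpd.src_ginv tgpd.rng_ginv tgpd.ginv_l tgpd.src_cmp tgpd.rng_cmp tgpd.assoc prod_eq_iff\<close>)

lemma cover_module:
 assumes "topological_groupoid G" "G_module G A"
 shows "G_module (cover_gpd G C) (cover_mod A C)"
proof -
 interpret A: gmodule G A using assms by unfold_locales
 let ?H = "cover_gpd G C" and ?B = "cover_mod A C"
 have oB: "obj ?B = obj ?H" by (simp add: cover_gpd_def cover_mod_def)
 have tg: "topological_groupoid ?B"
 proof (rule topological_groupoidI)
  note a = cont_id'[of "arr ?B", unfolded cover_mod_cont]
  have a1: "cts (arr ?B) (dsc (fst C)) (\<lambda>t. fst t)"
   and a2: "cts (arr ?B) (arr A) (\<lambda>t. snd t)" using a by auto
  note o = cont_id'[of "obj ?H", unfolded cover_obj_cont]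
  have o1: "cts (obj ?H) (dsc (fst C)) (\<lambda>t. fst t)"
   and o2: "cts (obj ?H) (obj A) (\<lambda>t. snd t)" using o by auto
  have c1: "cts (arr ?B) (obj G) (\<lambda>t. src A (snd t))" using A.B.cont_src[OF a2] by simp
  have c2: "cts (arr ?B) (obj G) (\<lambda>t. rng A (snd t))" using A.B.cont_rng[OF a2] by simp
  show "cts (arr ?B) (obj ?B) (src ?B)"
   unfolding oB cover_obj_cont cover_mod_sel using a1 c1 by (auto simp: Ar_cover_mod)
  show "cts (arr ?B) (obj ?B) (rng ?B)"
   unfolding oB cover_obj_cont cover_mod_sel using a1 c2 by (auto simp: Ar_cover_mod)
  show "cts (obj ?B) (arr ?B) (idn ?B)"
   unfolding oB cover_mod_cont cover_mod_sel using o1 A.B.cont_idn[OF o2] by (auto simp: Ob_cover)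
  show "cts (arr ?B) (arr ?B) (ginv ?B)"
   unfolding cover_mod_cont cover_mod_sel using a1 A.B.cont_ginv[OF a2] by (auto simp: Ar_cover_mod)
  let ?S = "sbt (prt (arr ?B) (arr ?B)) {(g, h). src ?B g = rng ?B h}"
  have S: "fst t : Ar ?B & snd t : Ar ?B & src ?B (fst t) = rng ?B (snd t)" if "t : pts ?S" for t
   using that by auto
  note f = cont_fst_sub[of "arr ?B" "arr ?B" "{(g, h). src ?B g = rng ?B h}", unfolded cover_mod_cont]
   and s = cont_snd_sub[of "arr ?B" "arr ?B" "{(g, h). src ?B g = rng ?B h}", unfolded cover_mod_cont]
  have c: "cts ?S (arr A) (\<lambda>t. cmp A (snd (fst t)) (snd (snd t)))"
   using f s by (intro A.B.cont_cmp) (auto simp: cover_mod_sel)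
  have "cts ?S (arr ?B) (\<lambda>t. cmp ?B (fst t) (snd t))"
   unfolding cover_mod_cont
  proof (intro conjI ballI)
   fix t assume "t : pts ?S"
   note t = S[OF this]
   show "src A (snd (cmp ?B (fst t) (snd t))) : snd C (fst (cmp ?B (fst t) (snd t)))"
    using t by (auto simp: cover_mod_sel Ar_cover_mod)
  qed (use c f in \<open>auto simp: cover_mod_sel\<close>)
  then show "cts ?S (arr ?B) (\<lambda>(g, h). cmp ?B g h)" by (simp add: case_prod_unfold)
 qed (auto simp: oB cover_mod_sel Ob_cover Ar_cover_mod prod_eq_iff)
 let ?S = "sbt (prt (arr ?H) (arr ?B)) {(g, a). src ?H g = src ?B a}"
 have S: "fst t : Ar ?H & snd t : Ar ?B & src ?H (fst t) = src ?B (snd t)" if "t : pts ?S" for t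
  using that by auto
 note f = cont_fst_sub[of "arr ?H" "arr ?B" "{(g, h). src ?H g = src ?B h}", unfolded cover_arr_cont]
  and s = cont_snd_sub[of "arr ?H" "arr ?B" "{(g, h). src ?H g = src ?B h}", unfolded cover_mod_cont]
 have c: "cts ?S (arr A) (\<lambda>t. act A (fst (snd (fst t))) (snd (snd t)))"
  using f s by (intro A.act_cont) (auto simp: cover_mod_sel cover_gpd_sel)
 have "cts ?S (arr ?B) (\<lambda>t. act ?B (fst t) (snd t))"
  unfolding cover_mod_cont
 proof (intro conjI ballI)
  fix t assume "t : pts ?S"
  note t = S[OF this]
  show "src A (snd (act ?B (fst t) (snd t))) : snd C (fst (act ?B (fst t) (snd t)))"
   using t by (auto simp: cover_mod_sel cover_gpd_sel Ar_cover Ar_cover_mod)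
 qed (use c f in \<open>auto simp: cover_mod_sel\<close>)
 then have ca: "cts ?S (arr ?B) (\<lambda>(g, a). act ?B g a)" by (simp add: case_prod_unfold)
 show ?thesis unfolding G_module_def
 proof (intro conjI ballI impI)
  show "cmp ?B a b = cmp ?B b a" if "a : Ar ?B" "b : Ar ?B" "src ?B a = src ?B b" for a b
   using that A.comm[of "snd a" "snd b"] by (auto simp: cover_mod_sel Ar_cover_mod)
 qed (use oB tg ca in \<open>auto simp: cover_mod_sel cover_gpd_sel Ar_cover Ar_cover_mod prod_eq_iff\<close>)
qed

lemma discrete_comp:
 assumes "cts T (dsc S) a" "\<And>s. s : S ==> th s : S'"
 shows "cts T (dsc S') (\<lambda>t. th (a t))"
proof -
 have "cts (dsc S) (dsc S') th" using assms(2) by auto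
 from continuous_map_compose[OF assms(1) this] show ?thesis by (simp add: o_def)
qed

lemma refinement_pullback:
 assumes "topological_groupoid G" "G_module G A" and th: "refines th D C"
 shows "pullback (cover_gpd G C) (cover_mod A C) (cover_gpd G D) (cover_mod A D)
   (\<lambda>(j, x). (th j, x)) (\<lambda>(j, g, k). (th j, g, th k)) (\<lambda>(j, a). (th j, a)) (\<lambda>y b. (fst y, snd b))"
proof -
 let ?H = "cover_gpd G C" and ?B = "cover_mod A C" and ?K = "cover_gpd G D" and ?C = "cover_mod A D"
 have th: "\<And>j. j : fst D ==> th j : fst C" "\<And>j x. j : fst D ==> x : snd D j ==> x : snd C (th j)"
  using th unfolding refines_def by auto
 interpret H: gmodule ?H ?B using cover_gpd_groupoid[OF assms(1)] cover_module[OF assms(1,2)] by unfold_locales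
 interpret K: gmodule ?K ?C using cover_gpd_groupoid[OF assms(1)] cover_module[OF assms(1,2)] by unfold_locales
 note a = cont_id'[of "arr ?K", unfolded cover_arr_cont] and o = cont_id'[of "obj ?K", unfolded cover_obj_cont]
  and b = cont_id'[of "arr ?C", unfolded cover_mod_cont]
 show ?thesis
 proof (unfold_locales, goal_cases)
  case 1
  show ?case unfolding cover_arr_cont using a discrete_comp[where S' = "fst C" and th = th] th
   by (auto simp: case_prod_unfold Ar_cover)
 next
  case 3
  show ?case unfolding cover_obj_cont using o discrete_comp[where S' = "fst C" and th = th] th
   by (auto simp: case_prod_unfold Ob_cover)
 next
  case 7
  show ?case unfolding cover_mod_cont using b discrete_comp[where S' = "fst C" and th = th] th
   by (auto simp: case_prod_unfold Ar_cover_mod)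
 next
  case (11 T)
  have d: "fst t : Ar ?B & snd t : Ob ?K" if "t : pts T" for t
   using 11(2,3) that continuous_map_in by metis
  show ?case unfolding cover_mod_cont using 11(1) d 11(2,3)[unfolded cover_mod_cont cover_obj_cont]
   by (auto simp: cover_mod_sel Ob_cover Ar_cover_mod case_prod_unfold)
 qed (use th in \<open>auto simp: cover_mod_sel cover_gpd_sel Ar_cover Ar_cover_mod Ob_cover case_prod_unfold prod_eq_iff\<close>)
qed

section \<open>The group of extensions\<close>

definition fadd :: "('x, 'b, 'h) gmod => ('w => 'w => 'w => 'h => 'h => 'b)
  => ('w => 'w => 'w => 'h => 'h => 'b) => 'w => 'w => 'w => 'h => 'h => 'b" where
 "fadd B f f' = (\<lambda>w1 w2 w3 g h. cmp B (f w1 w2 w3 g h) (f' w1 w2 w3 g h))"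

definition fneg :: "('x, 'b, 'h) gmod => ('w => 'w => 'w => 'h => 'h => 'b) => 'w => 'w => 'w => 'h => 'h => 'b" where
 "fneg B f = (\<lambda>w1 w2 w3 g h. ginv B (f w1 w2 w3 g h))"

definition feq :: "('x, 'h) topgpd => 'w set => ('w => 'h set) => ('w => 'w => 'w => 'h => 'h => 'b)
  => ('w => 'w => 'w => 'h => 'h => 'b) => bool" where
 "feq H Om V f f' \<longleftrightarrow> (\<forall>w1\<in>Om. \<forall>w2\<in>Om. \<forall>w3\<in>Om. \<forall>g h. (g, h) : fdom H V w1 w2 w3 -->
   f w1 w2 w3 g h = f' w1 w2 w3 g h)"

lemma factor_set_cong:
 assumes f: "factor_set H B Om V f" and eq: "feq H Om V f f'"
 shows "factor_set H B Om V f'"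
proof -
 have e: "f w1 w2 w3 g h = f' w1 w2 w3 g h"
  if "w1 : Om" "w2 : Om" "w3 : Om" "(g, h) : fdom H V w1 w2 w3" for w1 w2 w3 g h
  using eq that unfolding feq_def by blast
 show ?thesis unfolding factor_set_def
 proof (intro conjI ballI allI impI)
  fix w1 w2 w3 assume w: "w1 : Om" "w2 : Om" "w3 : Om"
  have "cts (sbt (prt (arr H) (arr H)) (fdom H V w1 w2 w3)) (arr B)
     (\<lambda>(g, h). f w1 w2 w3 g h)" using f w unfolding factor_set_def by blast
  then show "cts (sbt (prt (arr H) (arr H)) (fdom H V w1 w2 w3)) (arr B)
     (\<lambda>(g, h). f' w1 w2 w3 g h)"
   by (rule continuous_map_eq) (clarsimp simp: e[OF w])
  fix g h assume "(g, h) : fdom H V w1 w2 w3"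
  then show "src B (f' w1 w2 w3 g h) = src H h"
   using e[OF w] factor_setD(1)[OF f w] by metis
 next
  fix w01 w12 w23 w02 w13 w03 g h k
  assume w: "w01\<in>Om" "w12\<in>Om" "w23\<in>Om" "w02\<in>Om" "w13\<in>Om" "w03\<in>Om"
   and d: "(g, h) : fdom H V w01 w12 w02" "(cmp H g h, k) : fdom H V w02 w23 w03"
    "(h, k) : fdom H V w12 w23 w13" "(g, cmp H h k) : fdom H V w01 w13 w03"
  show "cmp B (f' w02 w23 w03 (cmp H g h) k) (act B (ginv H k) (f' w01 w12 w02 g h)) =
    cmp B (f' w01 w13 w03 g (cmp H h k)) (f' w12 w23 w13 h k)"
   using factor_set_cocycle[OF f w d]
   unfolding e[OF w(1,2,4) d(1)] e[OF w(4,3,6) d(2)] e[OF w(2,3,5) d(3)] e[OF w(1,5,6) d(4)] .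
 qed
qed

lemma fdomD: "(g, h) : fdom H V w1 w2 w3 ==> g : Ar H & h : Ar H & src H g = rng H h & g : V w1 & h : V w2 & cmp H g h : V w3"
 by (auto simp: fdom_def)

text \<open>The type of arrows is the one in which classes are represented; every factor set is realised with arrows of this type.\<close>

definition class_presented :: "('x, 'h) topgpd => ('x, 'b, 'h) gmod => 'w set => ('w => 'h set)
  => ('x, 'b, 'h, 'b \<times> 'h) extn set => ('w => 'w => 'w => 'h => 'h => 'b) => bool" where
 "class_presented H B Om V P f \<longleftrightarrow>
   (\<exists>(X :: ('x, 'b, 'h, 'b \<times> 'h) extn) sg. extension H B X & presents H B Om V X sg f & P = ext_class H B X)"

lemma (in ext) presents_factor_set:
 assumes "presents H B Om V X sg f"
 shows "factor_set H B Om V f"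
proof -
 have "\<exists>f. factor_set H B Om V f & presents H B Om V X sg f"
  by (rule liftings_imp_factor_set) (rule presentsD(1)[OF assms])
 then
 obtain f' where f': "factor_set H B Om V f'" "presents H B Om V X sg f'" by (elim exE conjE)
 have "feq H Om V f' f" unfolding feq_def
 proof (intro ballI allI impI)
  fix w1 w2 w3 g h assume w: "w1 : Om" "w2 : Om" "w3 : Om" and d: "(g, h) : fdom H V w1 w2 w3"
  have gh: "cmp H g h : Ar H" "cmp H g h : V w3" "src H (cmp H g h) = src H h" using fdomD[OF d] by auto
  note l = liftD[OF presentsD(1)[OF assms w(3)] gh(1,2)]
  show "f' w1 w2 w3 g h = f w1 w2 w3 g h"
   using presentsD(2)[OF assms w d] presentsD(2)[OF f'(2) w d] l gh by (metis i_cancel)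
 qed
 then show ?thesis using factor_set_cong f'(1) by blast
qed

context gmodule
begin

lemma ext_class_eqI: "ext_equiv B X Y ==> ext_equiv B Y X ==> ext_class H B X = ext_class H B Y"
 unfolding ext_class_def by (auto intro: ext_equiv_trans)

lemma extension_equiv_sym:
 assumes "extension H B X" "ext_equiv B X Y"
 shows "ext_equiv B Y X"
proof -
 interpret X: ext H B X using H.tg md assms by unfold_locales
 show ?thesis using ext_equiv_sym[OF assms(2)] by simp
qed

lemma in_ext_class: "extension H B X ==> X : ext_class H B X"
 unfolding ext_class_def using ext_equiv_refl by blast

lemma ext_class_member:
 assumes "extension H B X" "Y : ext_class H B X"
 shows "extension H B Y" "ext_equiv B X Y" "ext_class H B Y = ext_class H B X"
 using assms extension_equiv_sym[OF assms(1)] ext_class_eqI unfolding ext_class_def by blast+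

lemma class_presented_member:
 assumes "class_presented H B Om V P f" "gcover H Om V" "X : P"
 shows "extension H B X" "\<exists>sg. presents H B Om V X sg f" "P = ext_class H B X"
proof -
 obtain Y :: "('x, 'b, 'h, 'b \<times> 'h) extn" and sg where Y: "extension H B Y" "presents H B Om V Y sg f" "P = ext_class H B Y"
  using assms unfolding class_presented_def by blast
 note m = ext_class_member[OF Y(1) assms(3)[unfolded Y(3)]]
 show "extension H B X" "P = ext_class H B X" using m Y by auto
 show "\<exists>sg. presents H B Om V X sg f" using presents_equiv[OF H.tg md Y(1) m(2) assms(2) Y(2)] .
qed

lemma class_presented_factor_set: "class_presented H B Om V P f ==> factor_set H B Om V f"
 unfolding class_presented_def using ext.presents_factor_set[of H B] H.tg md
 by (metis ext.intro ext_axioms_def gmodule_axioms)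

lemma class_presented_nonempty: "class_presented H B Om V P f ==> P ~= {}"
 unfolding class_presented_def using in_ext_class by blast

lemma class_presented_unique:
 assumes "gcover H Om V" "class_presented H B Om V P f" "class_presented H B Om V Q f'" "feq H Om V f f'"
 shows "P = Q"
proof -
 obtain X :: "('x, 'b, 'h, 'b \<times> 'h) extn" and sg where X: "extension H B X" "presents H B Om V X sg f" "P = ext_class H B X"
  using assms unfolding class_presented_def by blast
 obtain Y :: "('x, 'b, 'h, 'b \<times> 'h) extn" and ta where Y: "extension H B Y" "presents H B Om V Y ta f'" "Q = ext_class H B Y"
  using assms unfolding class_presented_def by blast
 have "presents H B Om V X sg f'"
  using presents_cong[OF X(2)] assms(4) unfolding feq_def by blast
 then have "ext_equiv B X Y" using presents_imp_equiv[OF H.tg md assms(1) X(1) _ Y(1,2)] by blast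
 then show ?thesis unfolding X Y using extension_equiv_sym[OF X(1)] ext_class_eqI by blast
qed

lemma class_presented_mono:
 assumes "class_presented H B Om V P f" "\<And>w. w : Om' ==> rh w : Om & V' w \<subseteq> V (rh w)"
 shows "class_presented H B Om' V' P (\<lambda>w1 w2 w3. f (rh w1) (rh w2) (rh w3))"
 using assms presents_mono[of H B Om V _ _ f Om' rh V'] unfolding class_presented_def by blast

lemma class_presented_exists:
 assumes "gcover H Om V" "factor_set H B Om V f"
 shows "\<exists>P. class_presented H B Om V P f"
 using factor_set_realised[OF H.tg md assms] unfolding class_presented_def by blast

lemma factor_set_add:
 assumes f: "factor_set H B Om V f" and f': "factor_set H B Om V f'"
 shows "factor_set H B Om V (fadd B f f')"
 unfolding factor_set_def
proof (intro conjI ballI allI impI)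
 fix w1 w2 w3 assume w: "w1 : Om" "w2 : Om" "w3 : Om"
 let ?S = "sbt (prt (arr H) (arr H)) (fdom H V w1 w2 w3)"
 have c: "cts ?S (arr B) (\<lambda>z. f w1 w2 w3 (fst z) (snd z))" "cts ?S (arr B) (\<lambda>z. f' w1 w2 w3 (fst z) (snd z))"
  by (rule factor_setD(3)[OF f w cont_fst_sub cont_snd_sub] factor_setD(3)[OF f' w cont_fst_sub cont_snd_sub]; auto)+
 have "cts ?S (arr B) (\<lambda>z. f w1 w2 w3 (fst z) (snd z) |+| f' w1 w2 w3 (fst z) (snd z))"
  by (intro add_cont c) (use factor_setD(1)[OF f w] factor_setD(1)[OF f' w] in auto)
 then show "cts ?S (arr B) (\<lambda>(g, h). fadd B f f' w1 w2 w3 g h)"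
  by (simp add: fadd_def case_prod_unfold)
 fix g h assume d: "(g, h) : fdom H V w1 w2 w3"
 show "src B (fadd B f f' w1 w2 w3 g h) = src H h"
  using factor_setD(1,2)[OF f w d] factor_setD(1,2)[OF f' w d] by (simp add: fadd_def)
next
 fix w01 w12 w23 w02 w13 w03 g h k
 assume w: "w01\<in>Om" "w12\<in>Om" "w23\<in>Om" "w02\<in>Om" "w13\<in>Om" "w03\<in>Om"
  and d: "(g, h) : fdom H V w01 w12 w02" "(cmp H g h, k) : fdom H V w02 w23 w03"
   "(h, k) : fdom H V w12 w23 w13" "(g, cmp H h k) : fdom H V w01 w13 w03"
 note F = factor_setD(1,2)[OF f w(1,2,4) d(1)] factor_setD(1,2)[OF f w(4,3,6) d(2)]
  factor_setD(1,2)[OF f w(2,3,5) d(3)] factor_setD(1,2)[OF f w(1,5,6) d(4)]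
 note F' = factor_setD(1,2)[OF f' w(1,2,4) d(1)] factor_setD(1,2)[OF f' w(4,3,6) d(2)]
  factor_setD(1,2)[OF f' w(2,3,5) d(3)] factor_setD(1,2)[OF f' w(1,5,6) d(4)]
 let ?a = "f w02 w23 w03 (cmp H g h) k" and ?b = "act B (ginv H k) (f w01 w12 w02 g h)"
  and ?c = "f w01 w13 w03 g (cmp H h k)" and ?d = "f w12 w23 w13 h k"
 let ?a' = "f' w02 w23 w03 (cmp H g h) k" and ?b' = "act B (ginv H k) (f' w01 w12 w02 g h)"
  and ?c' = "f' w01 w13 w03 g (cmp H h k)" and ?d' = "f' w12 w23 w13 h k"
 have gh: "k : Ar H" "h : Ar H" "src H h = rng H k" using fdomD[OF d(3)] by auto
 have "(?a |+| ?a') |+| (?b |+| ?b') = (?a |+| ?b) |+| (?a' |+| ?b')"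
  using F F' gh by (simp add: ac)
 also have "\<dots> = (?c |+| ?d) |+| (?c' |+| ?d')"
  unfolding factor_set_cocycle[OF f w d] factor_set_cocycle[OF f' w d] ..
 also have "\<dots> = (?c |+| ?c') |+| (?d |+| ?d')"
  using F F' gh by (simp add: ac)
 finally show "cmp B (fadd B f f' w02 w23 w03 (cmp H g h) k) (act B (ginv H k) (fadd B f f' w01 w12 w02 g h)) =
   cmp B (fadd B f f' w01 w13 w03 g (cmp H h k)) (fadd B f f' w12 w23 w13 h k)"
  using F F' gh by (simp add: fadd_def del: B.assoc)
qed

lemma factor_set_neg:
 assumes f: "factor_set H B Om V f"
 shows "factor_set H B Om V (fneg B f)"
 unfolding factor_set_def
proof (intro conjI ballI allI impI)
 fix w1 w2 w3 assume w: "w1 : Om" "w2 : Om" "w3 : Om"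
 let ?S = "sbt (prt (arr H) (arr H)) (fdom H V w1 w2 w3)"
 have "cts ?S (arr B) (\<lambda>z. f w1 w2 w3 (fst z) (snd z))"
  by (rule factor_setD(3)[OF f w cont_fst_sub cont_snd_sub]) auto
 then have "cts ?S (arr B) (\<lambda>z. ginv B (f w1 w2 w3 (fst z) (snd z)))" by (rule B.cont_ginv)
 then show "cts ?S (arr B) (\<lambda>(g, h). fneg B f w1 w2 w3 g h)"
  by (simp add: fneg_def case_prod_unfold)
 fix g h assume d: "(g, h) : fdom H V w1 w2 w3"
 show "src B (fneg B f w1 w2 w3 g h) = src H h"
  using factor_setD(1,2)[OF f w d] by (simp add: fneg_def)
next
 fix w01 w12 w23 w02 w13 w03 g h k
 assume w: "w01\<in>Om" "w12\<in>Om" "w23\<in>Om" "w02\<in>Om" "w13\<in>Om" "w03\<in>Om"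
  and d: "(g, h) : fdom H V w01 w12 w02" "(cmp H g h, k) : fdom H V w02 w23 w03"
   "(h, k) : fdom H V w12 w23 w13" "(g, cmp H h k) : fdom H V w01 w13 w03"
 note F = factor_setD(1,2)[OF f w(1,2,4) d(1)] factor_setD(1,2)[OF f w(4,3,6) d(2)]
  factor_setD(1,2)[OF f w(2,3,5) d(3)] factor_setD(1,2)[OF f w(1,5,6) d(4)]
 let ?a = "f w02 w23 w03 (cmp H g h) k" and ?b = "act B (ginv H k) (f w01 w12 w02 g h)"
  and ?c = "f w01 w13 w03 g (cmp H h k)" and ?d = "f w12 w23 w13 h k"
 have gh: "k : Ar H" "h : Ar H" "src H h = rng H k" using fdomD[OF d(3)] by auto
 have "ginv B ?a |+| ginv B ?b = ginv B (?a |+| ?b)" using F gh by (simp add: comm)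
 also have "\<dots> = ginv B (?c |+| ?d)" unfolding factor_set_cocycle[OF f w d] ..
 also have "\<dots> = ginv B ?c |+| ginv B ?d" using F gh by (simp add: comm)
 finally show "cmp B (fneg B f w02 w23 w03 (cmp H g h) k) (act B (ginv H k) (fneg B f w01 w12 w02 g h)) =
   cmp B (fneg B f w01 w13 w03 g (cmp H h k)) (fneg B f w12 w23 w13 h k)"
  using F gh by (simp add: fneg_def)
qed

lemma baer_class_presented:
 assumes cov: "gcover H Om V" and P: "class_presented H B Om V P f" and Q: "class_presented H B Om V Q f'"
 shows "class_presented H B Om V (\<Union>X\<in>P. \<Union>Y\<in>Q. ext_class H B (baer_sum B X Y)) (fadd B f f')"
proof -
 obtain R where R: "class_presented H B Om V R (fadd B f f')"
  using class_presented_exists[OF cov factor_set_add] class_presented_factor_set P Q by blast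
 then obtain Z :: "('x, 'b, 'h, 'b \<times> 'h) extn" and rh where Z: "extension H B Z" "presents H B Om V Z rh (fadd B f f')" "R = ext_class H B Z"
  unfolding class_presented_def by blast
 have "ext_class H B (baer_sum B X Y) = R" if XY: "X : P" "Y : Q" for X Y
 proof -
  note X = class_presented_member[OF P cov XY(1)] and Y = class_presented_member[OF Q cov XY(2)]
  obtain sg ta where s: "presents H B Om V X sg f" "presents H B Om V Y ta f'" using X Y by blast
  have "\<exists>m. baer_map H B X Y Z m"
   by (rule coordinate_sum_map[OF H.tg md cov X(1) s(1) Y(1) s(2) Z(1,2)]) (simp add: fadd_def)
  then obtain m where "baer_map H B X Y Z m" by blast
  then interpret m: baer_map H B X Y Z m .
  have l: "\<exists>V s t. openin (arr H) V & h : V & is_lifting H X V s & is_lifting H Y V t" if h: "h : Ar H" for h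
  proof -
   obtain w where w: "w : Om" "h : V w" using gcoverD(1)[OF cov h] by blast
   show ?thesis
    by (intro exI[of _ "V w"] exI[of _ "sg w"] exI[of _ "ta w"] conjI w gcoverD(2)[OF cov] presentsD(1)[OF s(1)] presentsD(1)[OF s(2)])
  qed
  show ?thesis unfolding Z(3) by (rule ext_class_eqI[OF m.baer_sum_equiv[OF l]])
 qed
 then have "(\<Union>X\<in>P. \<Union>Y\<in>Q. ext_class H B (baer_sum B X Y)) = R"
  using class_presented_nonempty[OF P] class_presented_nonempty[OF Q] by auto
 then show ?thesis using R by simp
qed

lemma split_class_presented:
 assumes cov: "gcover H Om V"
 shows "class_presented H B Om V (ext_class H B (split_ext H B)) (\<lambda>_ _ _ g h. idn B (src H h))"
proof -
 obtain Z :: "('x, 'b, 'h, 'b \<times> 'h) extn" and rh where Z: "extension H B Z"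
  "is_lifting H Z (Ar H) rh"
  "\<And>g h. g : Ar H ==> h : Ar H ==> src H g = rng H h ==> Em Z (rh g) (rh h) = rh (cmp H g h)"
  using zero_extension[OF H.tg md] by blast
 have "ext_class H B (split_ext H B) = ext_class H B Z"
  using split_ext_equiv[OF H.tg md Z] ext_class_eqI by blast
 then show ?thesis
  using multiplicative_lifting_presents[OF H.tg md Z cov] Z(1) unfolding class_presented_def by blast
qed

end

lemma is_lifting_Int:
 assumes "Ar H \<inter> S = Ar H \<inter> S'"
 shows "is_lifting H X S sg \<longleftrightarrow> is_lifting H X S' sg"
 unfolding is_lifting_def using assms
 by (metis subtopology_restrict)

text \<open>Neighbourhoods of the arrows of \<open>G\<close>, and their inverse images in the groupoid of a cover.\<close>

definition nbhds :: "('x, 'g) topgpd => ('g => 'g set) => bool" where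
 "nbhds G W \<longleftrightarrow> (\<forall>g\<in>Ar G. openin (arr G) (W g) & g : W g)"

definition cyl :: "('x, 'g) topgpd => ('x, 'i) cov => ('g => 'g set) => 'g => ('i \<times> 'g \<times> 'i) set" where
 "cyl G C W g = {p : Ar (cover_gpd G C). fst (snd p) : W g}"

locale cover_ext =
 fixes G :: "('x, 'g) topgpd" and A :: "('x, 'a, 'g) gmod" and C :: "('x, 'i) cov"
 assumes G: "topological_groupoid G" and A: "G_module G A"
begin

abbreviation H where "H \<equiv> cover_gpd G C"
abbreviation B where "B \<equiv> cover_mod A C"

sublocale gmodule "cover_gpd G C" "cover_mod A C"
 using cover_gpd_groupoid[OF G] cover_module[OF G A] by unfold_locales

sublocale G: tgpd G using G by unfold_locales

lemma gcover_cyl: "nbhds G W ==> gcover H (Ar G) (cyl G C W)"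
 unfolding gcover_def
proof (intro conjI ballI subsetI)
 assume W: "nbhds G W"
 have c: "cts (arr H) (arr G) (\<lambda>p. fst (snd p))"
  using cont_id'[of "arr H", unfolded cover_arr_cont] by blast
 show "openin (arr H) (cyl G C W g)" if "g : Ar G" for g
  unfolding cyl_def by (rule openin_preimage[OF c]) (use W that in \<open>auto simp: nbhds_def\<close>)
 fix p assume "p : Ar H"
 then show "p : (\<Union>g\<in>Ar G. cyl G C W g)"
  using W unfolding cyl_def nbhds_def by (auto simp: Ar_cover)
qed

lemma lifting_cyl: "is_lifting H X {(i, h, j). h : W g} sg \<longleftrightarrow> is_lifting H X (cyl G C W g) sg"
 by (rule is_lifting_Int) (auto simp: cyl_def)

text \<open>Local splitting is a presentation over the inverse images of neighbourhoods of the arrows of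
 \<open>G\<close>.\<close>

lemma ext_group_carrier:
 "P : carrier (ext_group G A C) \<longleftrightarrow>
  (\<exists>W f. nbhds G W & class_presented H B (Ar G) (cyl G C W) P f)"
proof
 assume "P : carrier (ext_group G A C)"
 then obtain X :: "('x, 'a, 'g, 'i) cover_extn" where X: "extension H B X" "locally_split G C X" "P = ext_class H B X"
  unfolding ext_group_def Let_def by auto
 have "\<forall>g\<in>Ar G. \<exists>W. openin (arr G) W & g : W & (\<exists>sg. is_lifting H X {(i, h, j). h : W} sg)"
  using X(2) unfolding locally_split_def by blast
 from bchoice[OF this] obtain W where W: "\<forall>g\<in>Ar G. openin (arr G) (W g) & g : W g & (\<exists>sg. is_lifting H X {(i, h, j). h : W g} sg)"
  by blast
 then have "\<forall>g\<in>Ar G. \<exists>sg. is_lifting H X (cyl G C W g) sg"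
  using lifting_cyl by blast
 from bchoice[OF this] obtain sg where s: "\<forall>g\<in>Ar G. is_lifting H X (cyl G C W g) (sg g)" by blast
 interpret X: ext H B X using X(1) by unfold_locales
 obtain f where "presents H B (Ar G) (cyl G C W) X sg f"
  using X.liftings_imp_factor_set[of "Ar G" "cyl G C W" sg] s by blast
 then show "\<exists>W f. nbhds G W & class_presented H B (Ar G) (cyl G C W) P f"
  using X W unfolding nbhds_def class_presented_def by blast
next
 assume "\<exists>W f. nbhds G W & class_presented H B (Ar G) (cyl G C W) P f"
 then obtain W f and X :: "('x, 'a, 'g, 'i) cover_extn" and sg where W: "nbhds G W" "extension H B X" "presents H B (Ar G) (cyl G C W) X sg f" "P = ext_class H B X"
  unfolding class_presented_def by blast
 have "locally_split G C X" unfolding locally_split_def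
 proof
  fix g assume g: "g : Ar G"
  have "is_lifting H X {(i, h, j). h : W g} (sg g)" unfolding lifting_cyl by (rule presentsD(1)[OF W(3) g])
  then show "\<exists>W. openin (arr G) W & g : W & (\<exists>sg. is_lifting H X {(i, h, j). h : W} sg)"
   using W(1) g unfolding nbhds_def by blast
 qed
 then show "P : carrier (ext_group G A C)"
  using W unfolding ext_group_def Let_def by auto
qed

lemma ext_group_sel:
 "mult (ext_group G A C) P Q = (\<Union>X\<in>P. \<Union>Y\<in>Q. ext_class H B (baer_sum B X Y))"
 "one (ext_group G A C) = ext_class H B (split_ext H B)"
 unfolding ext_group_def Let_def by auto

lemma cyl_mono: "(\<And>g. g : Ar G ==> W g \<subseteq> W' g) ==> class_presented H B (Ar G) (cyl G C W') P f ==>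
  class_presented H B (Ar G) (cyl G C W) P f"
 using class_presented_mono[of "Ar G" "cyl G C W'" P f "Ar G" "\<lambda>g. g" "cyl G C W"] unfolding cyl_def by blast

text \<open>Intersections of neighbourhoods give a cover that serves several extensions at once.\<close>

lemma common_presentation:
 assumes "P : carrier (ext_group G A C)" "Q : carrier (ext_group G A C)" "R : carrier (ext_group G A C)"
 shows "\<exists>W f1 f2 f3. nbhds G W & class_presented H B (Ar G) (cyl G C W) P f1 &
  class_presented H B (Ar G) (cyl G C W) Q f2 & class_presented H B (Ar G) (cyl G C W) R f3"
proof -
 obtain W1 f1 where 1: "nbhds G W1" "class_presented H B (Ar G) (cyl G C W1) P f1"
  using assms unfolding ext_group_carrier by blast
 obtain W2 f2 where 2: "nbhds G W2" "class_presented H B (Ar G) (cyl G C W2) Q f2"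
  using assms unfolding ext_group_carrier by blast
 obtain W3 f3 where 3: "nbhds G W3" "class_presented H B (Ar G) (cyl G C W3) R f3"
  using assms unfolding ext_group_carrier by blast
 let ?W = "\<lambda>g. W1 g \<inter> W2 g \<inter> W3 g"
 have "nbhds G ?W" using 1 2 3 unfolding nbhds_def by auto
 moreover have "class_presented H B (Ar G) (cyl G C ?W) P f1" by (rule cyl_mono[OF _ 1(2)]) blast
 moreover have "class_presented H B (Ar G) (cyl G C ?W) Q f2" by (rule cyl_mono[OF _ 2(2)]) blast
 moreover have "class_presented H B (Ar G) (cyl G C ?W) R f3" by (rule cyl_mono[OF _ 3(2)]) blast
 ultimately show ?thesis by blast
qed

lemma mult_presented:
 assumes "gcover H Om V" "class_presented H B Om V P f" "class_presented H B Om V Q f'"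
 shows "class_presented H B Om V (P \<otimes>\<^bsub>ext_group G A C\<^esub> Q) (fadd B f f')"
 unfolding ext_group_sel by (rule baer_class_presented[OF assms])

lemma one_presented:
 assumes "gcover H Om V"
 shows "class_presented H B Om V \<one>\<^bsub>ext_group G A C\<^esub> (\<lambda>_ _ _ g h. idn B (src H h))"
 unfolding ext_group_sel by (rule split_class_presented[OF assms])

lemma inverse_presented:
 assumes cov: "gcover H Om V" and P: "class_presented H B Om V P f"
 shows "\<exists>Q. class_presented H B Om V Q (fneg B f) & Q \<otimes>\<^bsub>ext_group G A C\<^esub> P = \<one>\<^bsub>ext_group G A C\<^esub>"
proof -
 note f = class_presented_factor_set[OF P]
 obtain Q where Q: "class_presented H B Om V Q (fneg B f)"
  using class_presented_exists[OF cov factor_set_neg[OF f]] by blast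
 have "feq H Om V (fadd B (fneg B f) f) (\<lambda>_ _ _ g h. idn B (src H h))"
  unfolding feq_def fadd_def fneg_def using factor_setD(1,2)[OF f] by simp
 then have "Q \<otimes>\<^bsub>ext_group G A C\<^esub> P = \<one>\<^bsub>ext_group G A C\<^esub>"
  by (rule class_presented_unique[OF cov mult_presented[OF cov Q P] one_presented[OF cov]])
 then show ?thesis using Q by blast
qed

text \<open>The group laws are those of factor sets over a common cover.\<close>

theorem ext_group_comm_group: "comm_group (ext_group G A C)"
proof (rule comm_groupI)
 let ?E = "ext_group G A C"
 fix P Q R assume P: "P : carrier ?E" and Q: "Q : carrier ?E"
 show "P \<otimes>\<^bsub>?E\<^esub> Q : carrier ?E"
  using common_presentation[OF P Q Q] mult_presented[OF gcover_cyl] ext_group_carrier by meson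
 obtain W f1 f2 f3 where W: "nbhds G W" "class_presented H B (Ar G) (cyl G C W) P f1"
  "class_presented H B (Ar G) (cyl G C W) Q f2" using common_presentation[OF P Q Q] by blast
 note c = gcover_cyl[OF W(1)]
 have "feq H (Ar G) (cyl G C W) (fadd B f1 f2) (fadd B f2 f1)"
  unfolding feq_def fadd_def
  using factor_setD(1,2)[OF class_presented_factor_set[OF W(2)]] factor_setD(1,2)[OF class_presented_factor_set[OF W(3)]]
  by (simp add: comm)
 then show "P \<otimes>\<^bsub>?E\<^esub> Q = Q \<otimes>\<^bsub>?E\<^esub> P"
  by (rule class_presented_unique[OF c mult_presented[OF c W(2,3)] mult_presented[OF c W(3,2)]])
 assume R: "R : carrier ?E"
 obtain W f1 f2 f3 where W: "nbhds G W" "class_presented H B (Ar G) (cyl G C W) P f1"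
  "class_presented H B (Ar G) (cyl G C W) Q f2" "class_presented H B (Ar G) (cyl G C W) R f3"
  using common_presentation[OF P Q R] by blast
 note c = gcover_cyl[OF W(1)]
 have "feq H (Ar G) (cyl G C W) (fadd B (fadd B f1 f2) f3) (fadd B f1 (fadd B f2 f3))"
  unfolding feq_def fadd_def
  using factor_setD(1,2)[OF class_presented_factor_set[OF W(2)]] factor_setD(1,2)[OF class_presented_factor_set[OF W(3)]]
   factor_setD(1,2)[OF class_presented_factor_set[OF W(4)]]
  by simp
 then show "P \<otimes>\<^bsub>?E\<^esub> Q \<otimes>\<^bsub>?E\<^esub> R = P \<otimes>\<^bsub>?E\<^esub> (Q \<otimes>\<^bsub>?E\<^esub> R)"
  by (rule class_presented_unique[OF c mult_presented[OF c mult_presented[OF c W(2,3)] W(4)]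
     mult_presented[OF c W(2) mult_presented[OF c W(3,4)]]])
next
 let ?E = "ext_group G A C"
 have "nbhds G (\<lambda>_. Ar G)" by (auto simp: nbhds_def)
 then show "\<one>\<^bsub>?E\<^esub> : carrier ?E" using one_presented[OF gcover_cyl] ext_group_carrier by blast
next
 let ?E = "ext_group G A C"
 fix P assume P: "P : carrier ?E"
 obtain W f where W: "nbhds G W" "class_presented H B (Ar G) (cyl G C W) P f"
  using P unfolding ext_group_carrier by blast
 note c = gcover_cyl[OF W(1)]
 show "\<exists>Q\<in>carrier ?E. Q \<otimes>\<^bsub>?E\<^esub> P = \<one>\<^bsub>?E\<^esub>"
  using inverse_presented[OF c W(2)] W(1) ext_group_carrier by blast
 have "feq H (Ar G) (cyl G C W) (fadd B (\<lambda>_ _ _ g h. idn B (src H h)) f) f"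
  unfolding feq_def fadd_def using factor_setD(1,2)[OF class_presented_factor_set[OF W(2)]] by simp
 then show "\<one>\<^bsub>?E\<^esub> \<otimes>\<^bsub>?E\<^esub> P = P"
  by (rule class_presented_unique[OF c mult_presented[OF c one_presented[OF c] W(2)] W(2)])
qed

text \<open>Sums and inverses of factor sets are factor sets over the same cover.\<close>

lemma presented_subgroup:
 assumes cov: "gcover H Om V" and S: "S = {P. \<exists>f. class_presented H B Om V P f}" "S \<subseteq> carrier (ext_group G A C)"
 shows "subgroup S (ext_group G A C)"
proof -
 let ?E = "ext_group G A C"
 interpret E: comm_group ?E by (rule ext_group_comm_group)
 show ?thesis
 proof (rule E.subgroupI)
  show "S \<subseteq> carrier ?E" by (rule S(2))
  show "S ~= {}" unfolding S(1) using one_presented[OF cov] by blast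
  fix P assume P: "P : S"
  then obtain f where f: "class_presented H B Om V P f" unfolding S(1) by blast
  obtain Q where Q: "class_presented H B Om V Q (fneg B f)" "Q \<otimes>\<^bsub>?E\<^esub> P = \<one>\<^bsub>?E\<^esub>"
   using inverse_presented[OF cov f] by blast
  have "Q : S" unfolding S(1) using Q by blast
  then show "inv\<^bsub>?E\<^esub> P : S" using E.inv_equality[OF Q(2)] P S(2) by auto
  fix R assume "R : S"
  then show "P \<otimes>\<^bsub>?E\<^esub> R : S" using f mult_presented[OF cov f] unfolding S(1) by blast
 qed
qed

end

section \<open>The nerve\<close>

type_synonym ('x, 'g, 'i) ncov = "nat => ('x \<times> (nat => 'g), 'i) cov"

locale nerve_module = gmodule G A for G :: "('x, 'g) topgpd" and A :: "('x, 'a, 'g) gmod"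
begin

abbreviation "N n \<equiv> spc (nerve G) n"
abbreviation "M \<equiv> nerve G"
abbreviation "S \<equiv> mod_sheaf G A"

text \<open>Names for the constants of the situation; \<open>gap z i j\<close> is $\gamma_i^{-1} \gamma_j$.\<close>

abbreviation "NT n \<equiv> topspace (N n)"
abbreviation "osc \<equiv> open_scover M"
abbreviation "UL \<equiv> Ulam M"
abbreviation "ES \<equiv> edge_set G"
abbreviation "LF \<equiv> is_lifting_family G"
abbreviation "IC \<equiv> is_ext_cocycle G A"
abbreviation "CC \<equiv> cochains M S"
abbreviation "ZZ \<equiv> cocycles M S"
abbreviation "cob \<equiv> codiff M S"
abbreviation "CL \<equiv> cohom_class M S"
abbreviation "vx \<equiv> vertex G"
abbreviation "GC \<equiv> cover_gpd G"
abbreviation "AC \<equiv> cover_mod A"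
abbreviation "EG \<equiv> ext_group G A"
abbreviation "EL \<equiv> ext_lifting G A"
abbreviation "EP \<equiv> ext_pull G A"
abbreviation "ET \<equiv> ext_trans G A"
abbreviation "CT \<equiv> cohom_trans M S 2"
abbreviation gap where "gap z i j \<equiv> cmp G (ginv G (vx z i)) (vx z j)"

lemma spc_nerve: "N n = sbt (prt (obj G) (product_topology (\<lambda>_. arr G) {1..n}))
    {(x, g). (0 < n --> x = rng G (g 1)) & (\<forall>i\<in>{1..<n}. src G (g i) = rng G (g (Suc i)))}"
 by (simp add: nerve_def)

lemma smap_nerve: "smap M k n f z =
  (src G (vx z (f 0)), \<lambda>j\<in>{1..k}. gap z (f (j - 1)) (f j))"
 by (simp add: nerve_def)

lemma topspace_N: "z : NT n \<longleftrightarrow> fst z : Ob G & snd z : (\<Pi>\<^sub>E i\<in>{1..n}. Ar G) &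
  (0 < n --> fst z = rng G (snd z 1)) & (\<forall>i\<in>{1..<n}. src G (snd z i) = rng G (snd z (Suc i)))"
 unfolding spc_nerve by (auto simp: mem_Times_iff case_prod_unfold)

lemma snd_N[simp]: "z : NT n ==> 1 <= i ==> i <= n ==> snd z i : Ar G"
 unfolding topspace_N by auto

lemma vertex_N:
 assumes z: "z : NT n" and i: "i <= n"
 shows "vx z i : Ar G & rng G (vx z i) = fst z &
  src G (vx z i) = (if i = 0 then fst z else src G (snd z i))"
 using i
proof (induction i)
 case 0
 then show ?case using z by (simp add: topspace_N)
next
 case (Suc i)
 have "src G (vx z i) = rng G (snd z (Suc i))"
 proof (cases "i = 0")
  case True
  then show ?thesis using Suc z by (simp add: topspace_N)
 next
  case False
  then have "i : {1..<n}" using Suc by auto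
  then show ?thesis using Suc z False by (simp add: topspace_N)
 qed
 then show ?case using Suc z by simp
qed

lemma vertex_in[simp]: "z : NT n ==> i <= n ==> vx z i : Ar G"
 and rng_vertex[simp]: "z : NT n ==> i <= n ==> rng G (vx z i) = fst z"
 using vertex_N by blast+

lemma src_vertex_step: "z : NT n ==> Suc i <= n ==> src G (vx z i) = rng G (snd z (Suc i))"
 using vertex_N[of z n i] unfolding topspace_N by (cases "i = 0") auto

lemma vertex_step: "z : NT n ==> Suc i <= n ==>
  gap z i (Suc i) = snd z (Suc i)"
 using src_vertex_step[of z n i] by simp

lemma smap_in:
 assumes z: "z : NT n" and f: "f : {..k} \<rightarrow> {..n}"
 shows "smap M k n f z : NT k"
proof -
 have v: "vx z (f j) : Ar G" "rng G (vx z (f j)) = fst z" if "j <= k" for j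
  using z f that by (auto simp: Pi_iff)
 show ?thesis unfolding topspace_N smap_nerve using v by auto
qed

text \<open>The vertices of a face are those of the simplex, up to a common left factor.\<close>

lemma vertex_smap:
 assumes z: "z : NT n" and f: "f : {..k} \<rightarrow> {..n}" and j: "j <= k"
 shows "vx (smap M k n f z) j = gap z (f 0) (f j)"
 using j
proof (induction j)
 case 0
 have "f 0 <= n" using f by auto
 then show ?case using z by (simp add: smap_nerve)
next
 case (Suc j)
 have "f 0 <= n" "f j <= n" "f (Suc j) <= n" using f Suc by (auto simp: Pi_iff)
 then show ?case using Suc z by (simp add: smap_nerve)
qed

lemma smap_comp:
 assumes z: "z : NT n" and g: "g : {..k} \<rightarrow> {..n}" and f: "f : {..l} \<rightarrow> {..k}"
 shows "smap M l k f (smap M k n g z) = smap M l n (\<lambda>j. g (f j)) z"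
proof -
 have b: "f j <= k" "g (f j) <= n" if "j <= l" for j using f g that by (auto simp: Pi_iff)
 have g0: "g 0 <= n" using g by auto
 have v: "vx (smap M k n g z) (f j) = gap z (g 0) (g (f j))" if "j <= l" for j
  using vertex_smap[OF z g b(1)[OF that]] .
 have "gap (smap M k n g z) (f (j - 1)) (f j) =
  gap z (g (f (j - 1))) (g (f j))" if "j : {1..l}" for j
 proof -
  have "j - 1 <= l" "j <= l" using that by auto
  then show ?thesis using v[of "j - 1"] v[of j] b[of "j - 1"] b[of j] g0 z by simp
 qed
 then have "(\<lambda>j\<in>{1..l}. gap (smap M k n g z) (f (j - 1)) (f j)) =
  (\<lambda>j\<in>{1..l}. gap z (g (f (j - 1))) (g (f j)))"
  by (rule restrict_ext)
 moreover have "src G (vx (smap M k n g z) (f 0)) = src G (vx z (g (f 0)))"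
  using v[of 0] b[of 0] g0 z by simp
 ultimately show ?thesis unfolding smap_nerve[of l] by simp
qed

lemma smap_cong: "(\<And>j. j <= k ==> f j = g j) ==> smap M k n f z = smap M k n g z"
 unfolding smap_nerve by (auto intro!: restrict_ext)

lemma smap_id:
 assumes z: "z : NT n" and f: "\<And>j. j <= n ==> f j = j"
 shows "smap M n n f z = z"
proof -
 have "gap z (j - 1) j = snd z j" if j: "j : {1..n}" for j
 proof -
  obtain i where "j = Suc i" "Suc i <= n" using j by (cases j) auto
  then show ?thesis using vertex_step[OF z, of i] by simp
 qed
 then have "(\<lambda>j\<in>{1..n}. gap z (f (j - 1)) (f j)) = (\<lambda>j\<in>{1..n}. snd z j)"
  using f by (intro restrict_ext) auto
 also have "\<dots> = snd z" using z unfolding topspace_N by (auto simp: PiE_def extensional_restrict)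
 finally show ?thesis unfolding smap_nerve using f[of 0] z by (simp add: topspace_N prod_eq_iff)
qed

lemma cont_fst_N: "cts (N n) (obj G) fst"
 unfolding spc_nerve by (rule cont_fst_sub)

lemma cont_snd_N: "i : {1..n} ==> cts (N n) (arr G) (\<lambda>z. snd z i)"
proof -
 assume i: "i : {1..n}"
 have "cts (N n) (product_topology (\<lambda>_. arr G) {1..n}) snd"
  unfolding spc_nerve by (rule cont_snd_sub)
 from continuous_map_compose[OF this continuous_map_product_projection[OF i]]
 show ?thesis by (simp add: o_def)
qed

lemma into_N:
 assumes "cts T (obj G) a" "\<And>i. i : {1..n} ==> cts T (arr G) (\<lambda>t. b t i)"
  "\<And>t. t : pts T ==> (a t, b t) : NT n"
 shows "cts T (N n) (\<lambda>t. (a t, b t))"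
proof -
 have "b t : extensional {1..n}" if "t : pts T" for t
  using assms(3)[OF that] unfolding topspace_N by (auto simp: PiE_def)
 then have "cts T (product_topology (\<lambda>_. arr G) {1..n}) b"
  unfolding continuous_map_componentwise using assms(2) by auto
 moreover have "(a t, b t) : {(x, g). (0 < n --> x = rng G (g 1)) & (\<forall>i\<in>{1..<n}. src G (g i) = rng G (g (Suc i)))}"
  if "t : pts T" for t
  using assms(3)[OF that] unfolding topspace_N by simp
 ultimately show ?thesis
  using assms(1) unfolding spc_nerve continuous_map_in_subtopology by (auto simp: continuous_map_paired)
qed

lemma cont_vertex: "i <= n ==> cts (N n) (arr G) (\<lambda>z. vx z i)"
proof (induction i)
 case 0
 then show ?case using H.cont_idn[OF cont_fst_N] by simp
next
 case (Suc i)
 have "cts (N n) (arr G) (\<lambda>z. cmp G (vx z i) (snd z (Suc i)))"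
  by (rule H.cont_cmp) (use Suc cont_snd_N[of "Suc i" n] src_vertex_step in auto)
 then show ?case by simp
qed

lemma cont_vertex_quot: "i <= n ==> j <= n ==>
  cts (N n) (arr G) (\<lambda>z. gap z i j)"
 by (intro H.cont_cmp H.cont_ginv cont_vertex) auto

lemma cont_smap:
 assumes f: "f : {..k} \<rightarrow> {..n}"
 shows "cts (N n) (N k) (smap M k n f)"
proof -
 have b: "f j <= n" if "j <= k" for j using f that by (auto simp: Pi_iff)
 have "cts (N n) (N k) (\<lambda>z. (src G (vx z (f 0)),
   \<lambda>j\<in>{1..k}. gap z (f (j - 1)) (f j)))"
 proof (rule into_N)
  show "cts (N n) (obj G) (\<lambda>z. src G (vx z (f 0)))"
   using b[of 0] by (intro H.cont_src cont_vertex) auto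
  fix i assume i: "i : {1..k}"
  then have "i <= k" "i - 1 <= k" by auto
  with i show "cts (N n) (arr G) (\<lambda>z. (\<lambda>j\<in>{1..k}. gap z (f (j - 1)) (f j)) i)"
   using b[of i] b[of "i - 1"] cont_vertex_quot[of "f (i - 1)" n "f i"] by simp
 next
  fix z assume "z : NT n"
  from smap_in[OF this f] show "(src G (vx z (f 0)),
    \<lambda>j\<in>{1..k}. gap z (f (j - 1)) (f j)) : NT k"
   unfolding smap_nerve .
 qed
 then show ?thesis unfolding smap_nerve[abs_def] .
qed

end

subsection \<open>Faces\<close>

lemma faces_finite: "finite (faces n)" "s : faces n ==> finite s"
proof -
 have "faces n \<subseteq> Pow {..n}" by (auto simp: faces_def)
 then show "finite (faces n)" using finite_subset by blast
 show "s : faces n ==> finite s" unfolding faces_def using finite_subset by blast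
qed

lemma senum_in:
 assumes "s : faces n" "j <= sdim s"
 shows "senum s j : s" "senum s j <= n"
proof -
 have f: "finite s" "s ~= {}" using assms faces_finite by (auto simp: faces_def)
 have "card s > 0" using f by (simp add: card_gt_0_iff)
 then have "j < length (sorted_list_of_set s)" using assms by (simp add: sdim_def)
 then have "sorted_list_of_set s ! j : set (sorted_list_of_set s)" by (rule nth_mem)
 then show "senum s j : s" using f assms by (simp add: senum_def)
 then show "senum s j <= n" using assms by (auto simp: faces_def)
qed

lemma senum_Pi: "s : faces n ==> senum s : {..sdim s} \<rightarrow> {..n}"
 using senum_in by auto

lemma senum_image:
 assumes s: "s : faces k" and g: "strict_mono_on {..k} g"
 shows "sdim (g ` s) = sdim s" "j <= sdim s ==> senum (g ` s) j = g (senum s j)"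
proof -
 have sub: "s \<subseteq> {..k}" "finite s" "s ~= {}" using s faces_finite by (auto simp: faces_def)
 have inj: "inj_on g s" using strict_mono_on_imp_inj_on[OF g] sub inj_on_subset by blast
 show d: "sdim (g ` s) = sdim s" unfolding sdim_def by (simp add: card_image[OF inj])
 have "sorted (map g (sorted_list_of_set s))"
 proof -
  have "sorted_wrt (\<lambda>x y. g x <= g y) (sorted_list_of_set s)"
  proof (rule sorted_wrt_mono_rel[OF _ sorted_sorted_list_of_set])
   fix x y assume "x : set (sorted_list_of_set s)" "y : set (sorted_list_of_set s)" "x <= y"
   then show "g x <= g y" using sub strict_mono_onD[OF g, of x y] by (cases "x = y") auto
  qed
  then show ?thesis by (simp add: sorted_wrt_map)
 qed
 then have "sorted_list_of_set (g ` s) = map g (sorted_list_of_set s)"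
  using sub inj by (intro sorted_distinct_set_unique) (auto simp: distinct_map)
 moreover assume "j <= sdim s"
 moreover have "card s > 0" using sub by (simp add: card_gt_0_iff)
 ultimately show "senum (g ` s) j = g (senum s j)"
  using d by (simp add: senum_def sdim_def)
qed

lemma faces_image: "s : faces k ==> g : {..k} \<rightarrow> {..n} ==> g ` s : faces n"
 unfolding faces_def by auto

lemma coface: "coface (Suc n) i = (\<lambda>j\<in>{..n}. if j < i then j else Suc j)"
 by (simp add: coface_def)

lemma coface_Pi: "coface (Suc n) i : {..n} \<rightarrow> {..Suc n}"
 by (auto simp: coface)

lemma coface_mono: "strict_mono_on {..n} (coface (Suc n) i)"
 by (auto simp: coface strict_mono_on_def)

lemma Lam_face:
 assumes "ka : Lam U n" "g : {..k} \<rightarrow> {..n}" "strict_mono_on {..k} g"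
 shows "lam_face k g ka : Lam U k"
 unfolding Lam_def lam_face_def
proof (intro restrict_PiE_iff[THEN iffD2] ballI)
 fix s assume s: "s : faces k"
 have "ka (g ` s) : fst (U (sdim (g ` s)))" using assms(1) faces_image[OF s assms(2)] unfolding Lam_def by auto
 then show "ka (g ` s) : fst (U (sdim s))" using senum_image(1)[OF s assms(3)] by simp
qed

context nerve_module
begin

lemma Ulam_sub: "UL U n ka \<subseteq> NT n"
 unfolding Ulam_def by blast

lemma Ulam_face:
 assumes z: "z : UL U n ka" and g: "g : {..k} \<rightarrow> {..n}" "strict_mono_on {..k} g"
 shows "smap M k n g z : UL U k (lam_face k g ka)"
 unfolding Ulam_def
proof (intro CollectI conjI ballI)
 have zt: "z : NT n" using z Ulam_sub by blast
 show "smap M k n g z : NT k" by (rule smap_in[OF zt g(1)])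
 fix s assume s: "s : faces k"
 have "smap M (sdim s) k (senum s) (smap M k n g z) = smap M (sdim s) n (\<lambda>j. g (senum s j)) z"
  by (rule smap_comp[OF zt g(1) senum_Pi[OF s]])
 also have "\<dots> = smap M (sdim (g ` s)) n (senum (g ` s)) z"
  unfolding senum_image(1)[OF s g(2)] by (rule smap_cong) (rule senum_image(2)[OF s g(2), symmetric])
 finally have e: "smap M (sdim s) k (senum s) (smap M k n g z) = smap M (sdim (g ` s)) n (senum (g ` s)) z" .
 have "smap M (sdim (g ` s)) n (senum (g ` s)) z : snd (U (sdim (g ` s))) (ka (g ` s))"
  using z faces_image[OF s g(1)] unfolding Ulam_def by blast
 then show "smap M (sdim s) k (senum s) (smap M k n g z) : snd (U (sdim s)) (lam_face k g ka s)"
  unfolding e using s senum_image(1)[OF s g(2)] by (simp add: lam_face_def)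
qed

lemma Ulam_coface:
 assumes "z : UL U (Suc n) ka"
 shows "smap M n (Suc n) (coface (Suc n) i) z : UL U n (lam_face n (coface (Suc n) i) ka)"
 by (rule Ulam_face[OF assms coface_Pi coface_mono])

lemma Lam_coface: "ka : Lam U (Suc n) ==> lam_face n (coface (Suc n) i) ka : Lam U n"
 by (rule Lam_face[OF _ coface_Pi coface_mono])

lemma Ulam_open:
 assumes U: "osc U" and k: "ka : Lam U n"
 shows "openin (N n) (UL U n ka)"
proof -
 have "UL U n ka = NT n \<inter> (\<Inter>s\<in>faces n. {z : NT n. smap M (sdim s) n (senum s) z : snd (U (sdim s)) (ka s)})"
  unfolding Ulam_def by blast
 moreover have "openin (N n) {z : NT n. smap M (sdim s) n (senum s) z : snd (U (sdim s)) (ka s)}"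
  if s: "s : faces n" for s
 proof (rule openin_preimage[OF cont_smap[OF senum_Pi[OF s]]])
  have "ka s : fst (U (sdim s))" using k s unfolding Lam_def by auto
  then show "openin (N (sdim s)) (snd (U (sdim s)) (ka s))"
   using U unfolding open_scover_def open_cover_def by blast
 qed
 ultimately show ?thesis
  using faces_finite(1)[of n] by (auto intro!: openin_Int_Inter)
qed

section \<open>Sections and cochains\<close>

lemma sec_carrier: "ph : carrier (sec S n W) \<longleftrightarrow> ph : extensional W &
  cts (sbt (N n) W) (arr A) ph & (\<forall>z\<in>W. src A (ph z) = src G (vx z n))"
 by (simp add: mod_sheaf_def)

lemma sec_mult: "ph \<otimes>\<^bsub>sec S n W\<^esub> ps = (\<lambda>z\<in>W. cmp A (ph z) (ps z))"
 by (simp add: mod_sheaf_def)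

lemma sec_one: "\<one>\<^bsub>sec S n W\<^esub> = (\<lambda>z\<in>W. idn A (src G (vx z n)))"
 by (simp add: mod_sheaf_def)

lemma sec_D:
 assumes "W \<subseteq> NT n" "ph : carrier (sec S n W)" "z : W"
 shows "ph z : Ar A" "src A (ph z) = src G (vx z n)"
 using assms continuous_map_in[of "sbt (N n) W" "arr A" ph z] unfolding sec_carrier by auto

lemma secI:
 assumes "cts (sbt (N n) W) (arr A) ph" "\<And>z. z : W ==> src A (ph z) = src G (vx z n)"
 shows "(\<lambda>z\<in>W. ph z) : carrier (sec S n W)"
proof -
 have "cts (sbt (N n) W) (arr A) (\<lambda>z\<in>W. ph z)"
  using assms(1) by (rule continuous_map_eq) auto
 then show ?thesis unfolding sec_carrier using assms(2) by auto
qed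

lemma sec_group:
 assumes W: "W \<subseteq> NT n"
 shows "comm_group (sec S n W)"
proof (rule comm_groupI)
 note D = sec_D[OF W]
 have ext: "ph = ps" if "ph : carrier (sec S n W)" "ps : carrier (sec S n W)" "\<And>z. z : W ==> ph z = ps z" for ph ps
  using that unfolding sec_carrier by (meson extensionalityI)
 show mc: "ph \<otimes>\<^bsub>sec S n W\<^esub> ps : carrier (sec S n W)" if "ph : carrier (sec S n W)" "ps : carrier (sec S n W)" for ph ps
  unfolding sec_mult
 proof (rule secI)
  show "cts (sbt (N n) W) (arr A) (\<lambda>z. cmp A (ph z) (ps z))"
   using that D unfolding sec_carrier by (intro add_cont) auto
  show "src A (cmp A (ph z) (ps z)) = src G (vx z n)" if "z : W" for z
   using D[OF _ that] \<open>ph : _\<close> \<open>ps : _\<close> by simp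
 qed
 have sv: "src G (vx z n) : Ob G" if "z : W" for z using subsetD[OF W that] by auto
 show oc: "\<one>\<^bsub>sec S n W\<^esub> : carrier (sec S n W)" unfolding sec_one
 proof (rule secI)
  have "cts (sbt (N n) W) (obj A) (\<lambda>z. src G (vx z n))"
   using continuous_map_from_subtopology[OF cont_vertex[of n n]] by (auto intro: H.cont_src)
  then show "cts (sbt (N n) W) (arr A) (\<lambda>z. idn A (src G (vx z n)))"
   by (rule B.cont_idn)
 qed (use sv in auto)
 fix ph assume p: "ph : carrier (sec S n W)"
 show "\<one>\<^bsub>sec S n W\<^esub> \<otimes>\<^bsub>sec S n W\<^esub> ph = ph"
  by (rule ext[OF mc[OF oc p] p]) (use D[OF p] in \<open>simp add: sec_mult sec_one\<close>)
 have i: "(\<lambda>z\<in>W. ginv A (ph z)) : carrier (sec S n W)"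
  using p D[OF p] unfolding sec_carrier by (intro secI[unfolded sec_carrier] B.cont_ginv) auto
 show "\<exists>ps\<in>carrier (sec S n W). ps \<otimes>\<^bsub>sec S n W\<^esub> ph = \<one>\<^bsub>sec S n W\<^esub>"
  by (intro bexI[OF _ i] ext[OF mc[OF i p] oc]) (use D[OF p] in \<open>simp add: sec_mult sec_one\<close>)
 fix ps assume q: "ps : carrier (sec S n W)"
 show "ph \<otimes>\<^bsub>sec S n W\<^esub> ps = ps \<otimes>\<^bsub>sec S n W\<^esub> ph"
  by (rule ext[OF mc[OF p q] mc[OF q p]]) (use D[OF p] D[OF q] in \<open>simp add: sec_mult comm\<close>)
 fix ch assume r: "ch : carrier (sec S n W)"
 show "ph \<otimes>\<^bsub>sec S n W\<^esub> ps \<otimes>\<^bsub>sec S n W\<^esub> ch = ph \<otimes>\<^bsub>sec S n W\<^esub> (ps \<otimes>\<^bsub>sec S n W\<^esub> ch)"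
  by (rule ext[OF mc[OF mc[OF p q] r] mc[OF p mc[OF q r]]])
   (use D[OF p] D[OF q] D[OF r] in \<open>simp add: sec_mult\<close>)
qed

lemma sec_inv:
 assumes W: "W \<subseteq> NT n" and p: "ph : carrier (sec S n W)"
 shows "inv\<^bsub>sec S n W\<^esub> ph = (\<lambda>z\<in>W. ginv A (ph z))"
proof -
 interpret K: comm_group "sec S n W" by (rule sec_group[OF W])
 note D = sec_D[OF W p]
 have i: "(\<lambda>z\<in>W. ginv A (ph z)) : carrier (sec S n W)"
  using p D unfolding sec_carrier by (intro secI[unfolded sec_carrier] B.cont_ginv) auto
 show ?thesis
  by (rule K.inv_equality[OF _ p i]) (use D in \<open>auto simp: sec_mult sec_one intro!: restrict_ext\<close>)
qed

lemma pull_mod: "pull S k n f V W ph = (\<lambda>z\<in>W.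
    act A (gap z n (f k)) (ph (smap M k n f z)))"
 by (simp add: mod_sheaf_def)

lemma pull_hom:
 assumes f: "f : {..k} \<rightarrow> {..n}" and W: "W \<subseteq> NT n" and V: "V \<subseteq> NT k"
  and sub: "\<And>z. z : W ==> smap M k n f z : V"
 shows "pull S k n f V W : hom (sec S k V) (sec S n W)"
proof (rule homI)
 have fk: "f k <= n" "f 0 <= n" using f by auto
 have sv: "src G (vx (smap M k n f z) k) = src G (vx z (f k))" if "z : W" for z
  using vertex_smap[OF subsetD[OF W that] f, of k] subsetD[OF W that] fk by simp
 note D = sec_D[OF V _ sub]
 fix ph assume p: "ph : carrier (sec S k V)"
 have 1: "cts (sbt (N n) W) (arr A) (\<lambda>z. act A (gap z n (f k)) (ph (smap M k n f z)))"
 proof (rule act_cont)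
  show "cts (sbt (N n) W) (arr G) (\<lambda>z. gap z n (f k))"
   using fk by (intro continuous_map_from_subtopology cont_vertex_quot) auto
  have "cts (sbt (N n) W) (sbt (N k) V) (smap M k n f)"
   using cont_smap[OF f] sub by (auto simp: continuous_map_in_subtopology intro: continuous_map_from_subtopology)
  from continuous_map_compose[OF this] p show "cts (sbt (N n) W) (arr A) (\<lambda>z. ph (smap M k n f z))"
   unfolding sec_carrier by (auto simp: o_def)
  show "src G (gap z n (f k)) = src A (ph (smap M k n f z))"
   if zW: "z : pts (sbt (N n) W)" for z
  proof -
   have "z : NT n" "z : W" using zW by auto
   then show ?thesis using D[OF p] sv fk by simp
  qed
 qed
 show "pull S k n f V W ph : carrier (sec S n W)"
  unfolding pull_mod
  by (rule secI[OF 1]) (frule subsetD[OF W], simp add: D[OF p] sv fk)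
 fix ps assume q: "ps : carrier (sec S k V)"
 show "pull S k n f V W (ph \<otimes>\<^bsub>sec S k V\<^esub> ps) = pull S k n f V W ph \<otimes>\<^bsub>sec S n W\<^esub> pull S k n f V W ps"
  unfolding pull_mod sec_mult
 proof (rule restrict_ext)
  fix z assume z: "z : W"
  then have zt: "z : NT n" using W by blast
  show "act A (gap z n (f k)) ((\<lambda>z\<in>V. cmp A (ph z) (ps z)) (smap M k n f z)) =
   cmp A ((\<lambda>z\<in>W. act A (gap z n (f k)) (ph (smap M k n f z))) z)
    ((\<lambda>z\<in>W. act A (gap z n (f k)) (ps (smap M k n f z))) z)"
   using z zt sub[OF z] D[OF p z] D[OF q z] sv[OF z] fk by simp
 qed
qed

lemma cochains_carrier: "c : carrier (CC U n) \<longleftrightarrow> c : (\<Pi>\<^sub>E ka\<in>Lam U n. carrier (sec S n (UL U n ka)))"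
 by (simp add: cochains_def)

lemma cochains_mult: "c \<otimes>\<^bsub>CC U n\<^esub> d = (\<lambda>ka\<in>Lam U n. c ka \<otimes>\<^bsub>sec S n (UL U n ka)\<^esub> d ka)"
 by (simp add: cochains_def)

lemma cochains_group: "comm_group (CC U n)"
proof -
 have g: "comm_group (sec S n (UL U n ka))" for ka by (rule sec_group[OF Ulam_sub])
 interpret group "CC U n"
  unfolding cochains_def using g comm_group.axioms(2) by (intro product_group) blast
 show ?thesis
 proof (rule group_comm_groupI)
  fix c d assume cd: "c : carrier (CC U n)" "d : carrier (CC U n)"
  show "c \<otimes>\<^bsub>CC U n\<^esub> d = d \<otimes>\<^bsub>CC U n\<^esub> c"
   unfolding cochains_mult
  proof (rule restrict_ext)
   fix ka assume "ka : Lam U n"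
   then show "c ka \<otimes>\<^bsub>sec S n (UL U n ka)\<^esub> d ka = d ka \<otimes>\<^bsub>sec S n (UL U n ka)\<^esub> c ka"
    using cd comm_monoid.m_comm[OF comm_group.axioms(1)[OF g]] unfolding cochains_carrier by (auto simp: PiE_def Pi_iff)
  qed
 qed
qed

definition cterm :: "(('x, 'g, 'i) ncov) => nat => ((nat set => 'i) => 'x \<times> (nat => 'g) => 'a)
  => (nat set => 'i) => nat => 'x \<times> (nat => 'g) => 'a" where
 "cterm U n c ka k = (let ep = coface (Suc n) k; mu = lam_face n ep ka
         in pull S n (Suc n) ep (UL U n mu) (UL U (Suc n) ka) (c mu))"

lemma codiff_cterm: "cob U n c = (\<lambda>ka\<in>Lam U (Suc n). finprod (sec S (Suc n) (UL U (Suc n) ka))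
   (\<lambda>k. if even k then cterm U n c ka k else inv\<^bsub>sec S (Suc n) (UL U (Suc n) ka)\<^esub> (cterm U n c ka k)) {..Suc n})"
 unfolding codiff_def cterm_def Let_def ..

lemma cochain_at: "c : carrier (CC U n) ==> ka : Lam U n ==> c ka : carrier (sec S n (UL U n ka))"
 unfolding cochains_carrier by auto

lemma cterm_hom:
 "pull S n (Suc n) (coface (Suc n) k) (UL U n (lam_face n (coface (Suc n) k) ka)) (UL U (Suc n) ka)
   : hom (sec S n (UL U n (lam_face n (coface (Suc n) k) ka))) (sec S (Suc n) (UL U (Suc n) ka))"
 by (rule pull_hom[OF coface_Pi Ulam_sub Ulam_sub Ulam_coface])

lemma cterm_in:
 assumes "c : carrier (CC U n)" "ka : Lam U (Suc n)"
 shows "cterm U n c ka k : carrier (sec S (Suc n) (UL U (Suc n) ka))"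
 unfolding cterm_def Let_def by (rule hom_in_carrier[OF cterm_hom cochain_at[OF assms(1) Lam_coface[OF assms(2)]]])

lemma cterm_mult:
 assumes "c : carrier (CC U n)" "d : carrier (CC U n)" "ka : Lam U (Suc n)"
 shows "cterm U n (c \<otimes>\<^bsub>CC U n\<^esub> d) ka k =
   cterm U n c ka k \<otimes>\<^bsub>sec S (Suc n) (UL U (Suc n) ka)\<^esub> cterm U n d ka k"
 unfolding cterm_def Let_def cochains_mult
 using Lam_coface[OF assms(3)] hom_mult[OF cterm_hom cochain_at[OF assms(1)] cochain_at[OF assms(2)]] by simp

lemma cterm_eval:
 assumes z: "z : UL U (Suc n) ka"
 shows "cterm U n c ka k z = act A (gap z (Suc n) (coface (Suc n) k n))
  (c (lam_face n (coface (Suc n) k) ka) (smap M n (Suc n) (coface (Suc n) k) z))"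
 unfolding cterm_def Let_def pull_mod using z by simp

lemma codiff_hom: "cob U n : hom (CC U n) (CC U (Suc n))"
proof (rule homI)
 let ?K = "\<lambda>ka. sec S (Suc n) (UL U (Suc n) ka)"
 have g: "comm_group (?K ka)" for ka by (rule sec_group[OF Ulam_sub])
 fix c assume c: "c : carrier (CC U n)"
 have s: "(\<lambda>k. if even k then cterm U n c ka k else inv\<^bsub>?K ka\<^esub> (cterm U n c ka k)) : {..Suc n} \<rightarrow> carrier (?K ka)"
  if "c : carrier (CC U n)" "ka : Lam U (Suc n)" for c ka
 proof -
  interpret comm_group "?K ka" by (rule g)
  show ?thesis using cterm_in[OF that] by auto
 qed
 show "cob U n c : carrier (CC U (Suc n))"
  unfolding codiff_cterm cochains_carrier
 proof (intro restrict_PiE_iff[THEN iffD2] ballI)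
  fix ka assume k: "ka : Lam U (Suc n)"
  interpret comm_group "?K ka" by (rule g)
  show "finprod (?K ka) (\<lambda>k. if even k then cterm U n c ka k else inv\<^bsub>?K ka\<^esub> (cterm U n c ka k)) {..Suc n} : carrier (?K ka)"
   by (rule finprod_closed[OF s[OF c k]])
 qed
 fix d assume d: "d : carrier (CC U n)"
 show "cob U n (c \<otimes>\<^bsub>CC U n\<^esub> d) = cob U n c \<otimes>\<^bsub>CC U (Suc n)\<^esub> cob U n d"
  unfolding cochains_mult[where c = "cob U n c"]
  unfolding codiff_cterm
 proof (rule restrict_ext)
  fix ka assume k: "ka : Lam U (Suc n)"
  interpret comm_group "?K ka" by (rule g)
  have "(\<lambda>k. if even k then cterm U n (c \<otimes>\<^bsub>CC U n\<^esub> d) ka k else inv\<^bsub>?K ka\<^esub> (cterm U n (c \<otimes>\<^bsub>CC U n\<^esub> d) ka k)) =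
   (\<lambda>k. (if even k then cterm U n c ka k else inv\<^bsub>?K ka\<^esub> (cterm U n c ka k)) \<otimes>\<^bsub>?K ka\<^esub>
     (if even k then cterm U n d ka k else inv\<^bsub>?K ka\<^esub> (cterm U n d ka k)))"
   unfolding cterm_mult[OF c d k] using cterm_in[OF c k] cterm_in[OF d k] by (intro ext) (simp add: inv_mult)
  then show "finprod (?K ka) (\<lambda>k. if even k then cterm U n (c \<otimes>\<^bsub>CC U n\<^esub> d) ka k
    else inv\<^bsub>?K ka\<^esub> (cterm U n (c \<otimes>\<^bsub>CC U n\<^esub> d) ka k)) {..Suc n} =
   (\<lambda>ka\<in>Lam U (Suc n). finprod (?K ka) (\<lambda>k. if even k then cterm U n c ka k else inv\<^bsub>?K ka\<^esub> (cterm U n c ka k)) {..Suc n}) ka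
    \<otimes>\<^bsub>?K ka\<^esub>
   (\<lambda>ka\<in>Lam U (Suc n). finprod (?K ka) (\<lambda>k. if even k then cterm U n d ka k else inv\<^bsub>?K ka\<^esub> (cterm U n d ka k)) {..Suc n}) ka"
   using finprod_multf[OF s[OF c k] s[OF d k]] k by simp
 qed
qed

lemma cochains_one: "\<one>\<^bsub>CC U n\<^esub> = (\<lambda>ka\<in>Lam U n. \<lambda>z\<in>UL U n ka. idn A (src G (vx z n)))"
 unfolding cochains_def one_product_group sec_one ..

lemma cocycles_carrier: "c : carrier (ZZ U n) \<longleftrightarrow> c : carrier (CC U n) &
  cob U n c = \<one>\<^bsub>CC U (Suc n)\<^esub>"
 by (simp add: cocycles_def)

lemma cocycles_sel[simp]: "mult (ZZ U n) = mult (CC U n)" "one (ZZ U n) = one (CC U n)"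
 by (simp_all add: cocycles_def)

lemma cocycles_group: "comm_group (ZZ U n)"
proof -
 interpret C: comm_group "CC U n" by (rule cochains_group)
 interpret D: comm_group "CC U (Suc n)" by (rule cochains_group)
 interpret h: group_hom "CC U n" "CC U (Suc n)" "cob U n"
  using codiff_hom by unfold_locales
 have "subgroup {c : carrier (CC U n). cob U n c = \<one>\<^bsub>CC U (Suc n)\<^esub>} (CC U n)"
  using h.subgroup_kernel unfolding kernel_def .
 then have "group (ZZ U n)" unfolding cocycles_def by (rule C.subgroup_imp_group)
 then show ?thesis
  by (rule group.group_comm_groupI) (simp add: C.m_comm cocycles_carrier)
qed

text \<open>A finite product in the group of sections, unrolled at a point.\<close>

lemma codiff_eval:
 assumes "c : carrier (CC U n)" "ka : Lam U (Suc n)" "z : UL U (Suc n) ka"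
 shows "\<exists>F. cob U n c ka z = F (Suc n) & F 0 = cterm U n c ka 0 z &
  (\<forall>m\<le>n. F (Suc m) = cmp A (if even (Suc m) then cterm U n c ka (Suc m) z else ginv A (cterm U n c ka (Suc m) z)) (F m))"
proof -
 define K where "K = sec S (Suc n) (UL U (Suc n) ka)"
 define t where "t k = (if even k then cterm U n c ka k else inv\<^bsub>K\<^esub> (cterm U n c ka k))" for k
 interpret comm_group K unfolding K_def by (rule sec_group[OF Ulam_sub])
 have t: "t k : carrier K" for k unfolding t_def using cterm_in[OF assms(1,2)] by (auto simp: K_def[symmetric])
 have K_mult: "(ph \<otimes>\<^bsub>K\<^esub> ps) z = cmp A (ph z) (ps z)" for ph ps
  unfolding K_def sec_mult using assms(3) by simp
 have "finprod K t {..Suc m} z = cmp A (t (Suc m) z) (finprod K t {..m} z)" for m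
  using t finprod_Suc[of t m] K_mult by (simp add: Pi_iff)
 moreover have "finprod K t {..0} z = cterm U n c ka 0 z"
 proof -
  have "finprod K t {..0} = t 0" by (rule finprod_0) (use t in auto)
  also have "t 0 = cterm U n c ka 0" by (simp add: t_def)
  finally show ?thesis by simp
 qed
 moreover have "t k z = (if even k then cterm U n c ka k z else ginv A (cterm U n c ka k z))" for k
  unfolding t_def K_def using sec_inv[OF Ulam_sub cterm_in[OF assms(1,2)]] assms(3) by simp
 moreover have "cob U n c ka = finprod K t {..Suc n}"
  unfolding codiff_cterm K_def t_def using assms(2) by simp
 ultimately show ?thesis by (intro exI[of _ "\<lambda>m. finprod K t {..m} z"]) auto
qed

lemma codiff_1_eval:
 assumes "c : carrier (CC U 1)" "ka : Lam U 2" "z : UL U 2 ka"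
 shows "cob U 1 c ka z = cmp A (cterm U 1 c ka 2 z) (cmp A (ginv A (cterm U 1 c ka 1 z)) (cterm U 1 c ka 0 z))"
proof -
 have a: "c : carrier (CC U 1)" "ka : Lam U (Suc 1)" "z : UL U (Suc 1) ka"
  using assms by (simp_all add: numeral_2_eq_2)
 obtain F where F: "cob U 1 c ka z = F (Suc 1)" "F 0 = cterm U 1 c ka 0 z"
  "\<forall>m\<le>1. F (Suc m) = cmp A (if even (Suc m) then cterm U 1 c ka (Suc m) z else ginv A (cterm U 1 c ka (Suc m) z)) (F m)"
  using codiff_eval[OF a] by blast
 show ?thesis using F(1,2) F(3)[rule_format, of 0] F(3)[rule_format, of 1] by (simp add: numeral_2_eq_2)
qed

lemma codiff_2_eval:
 assumes "c : carrier (CC U 2)" "ka : Lam U 3" "z : UL U 3 ka"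
 shows "cob U 2 c ka z = cmp A (ginv A (cterm U 2 c ka 3 z)) (cmp A (cterm U 2 c ka 2 z)
   (cmp A (ginv A (cterm U 2 c ka 1 z)) (cterm U 2 c ka 0 z)))"
proof -
 have a: "c : carrier (CC U 2)" "ka : Lam U (Suc 2)" "z : UL U (Suc 2) ka"
  using assms by (simp_all add: numeral_3_eq_3 numeral_2_eq_2)
 obtain F where F: "cob U 2 c ka z = F (Suc 2)" "F 0 = cterm U 2 c ka 0 z"
  "\<forall>m\<le>2. F (Suc m) = cmp A (if even (Suc m) then cterm U 2 c ka (Suc m) z else ginv A (cterm U 2 c ka (Suc m) z)) (F m)"
  using codiff_eval[OF a] by blast
 have "F 1 = cmp A (ginv A (cterm U 2 c ka 1 z)) (F 0)" using F(3)[rule_format, of 0] by simp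
 moreover have "F 2 = cmp A (cterm U 2 c ka 2 z) (F 1)" using F(3)[rule_format, of 1] by (simp add: numeral_2_eq_2)
 moreover have "F 3 = cmp A (ginv A (cterm U 2 c ka 3 z)) (F 2)" using F(3)[rule_format, of 2] by simp
 ultimately show ?thesis using F(1,2) by simp
qed

end

section \<open>Cech cocycles and factor sets\<close>

lemma sdim_single[simp]: "sdim {i} = 0" and senum_single[simp]: "senum {i} 0 = i"
 by (simp_all add: sdim_def senum_def)

lemma sdim_pair: "i < j ==> sdim {i, j} = 1"
 and senum_pair: "i < j ==> senum {i, j} 0 = i" "i < j ==> senum {i, j} (Suc 0) = j"
proof -
 assume ij: "i < j"
 then show d: "sdim {i, j} = 1" by (simp add: sdim_def)
 have "sorted_list_of_set {i, j} = [i, j]"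
  using ij by (intro sorted_distinct_set_unique) auto
 then show "senum {i, j} 0 = i" "senum {i, j} (Suc 0) = j" using d by (simp_all add: senum_def)
qed

lemma sdim_triple: "i < j ==> j < k ==> sdim {i, j, k} = 2"
 and senum_triple: "i < j ==> j < k ==> senum {i, j, k} 0 = i" "i < j ==> j < k ==> senum {i, j, k} (Suc 0) = j"
  "i < j ==> j < k ==> senum {i, j, k} 2 = k"
proof -
 assume ij: "i < j" "j < k"
 then show d: "sdim {i, j, k} = 2" by (simp add: sdim_def)
 have "sorted_list_of_set {i, j, k} = [i, j, k]"
  using ij by (intro sorted_distinct_set_unique) auto
 then show "senum {i, j, k} 0 = i" "senum {i, j, k} (Suc 0) = j" "senum {i, j, k} 2 = k"
  using d by (simp_all add: senum_def)
qed

lemma faces_single[simp]: "{i} : faces n \<longleftrightarrow> i <= n"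
 and faces_pair[simp]: "{i, j} : faces n \<longleftrightarrow> i <= n & j <= n"
 and faces_triple[simp]: "{i, j, k} : faces n \<longleftrightarrow> i <= n & j <= n & k <= n"
 by (auto simp: faces_def)

lemma faces_1: "faces 1 = {{0}, {Suc 0}, {0, Suc 0}}"
proof -
 have "{..1::nat} = {0, Suc 0}" by auto
 then have "faces 1 = Pow {0, Suc 0} - {{}}" unfolding faces_def by auto
 then show ?thesis by (auto simp: Pow_insert)
qed

lemma faces_2:
 assumes "s : faces 2"
 shows "s = {0} \<or> s = {Suc 0} \<or> s = {2} \<or> s = {0, Suc 0} \<or> s = {0, 2} \<or> s = {Suc 0, 2} \<or> s = {0, Suc 0, 2}"
proof -
 have "t = 0 \<or> t = Suc 0 \<or> t = 2" if "t : s" for t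
 proof -
  have "t <= 2" using that assms by (auto simp: faces_def)
  then show ?thesis by auto
 qed
 then have s: "s = (if 0 : s then {0} else {}) \<union> ((if Suc 0 : s then {Suc 0} else {}) \<union> (if 2 : s then {2} else {}))"
  by auto
 have "s ~= {}" using assms by (auto simp: faces_def)
 then show ?thesis
  by (cases "0 : s"; cases "Suc 0 : s"; cases "2 : s") (use s in \<open>simp_all add: insert_commute\<close>)
qed

lemma lam_face_comp: "f : {..k} \<rightarrow> {..l} ==> lam_face k f (lam_face l g ka) = lam_face k (\<lambda>t. g (f t)) ka"
 unfolding lam_face_def by (auto simp: faces_image image_image intro!: restrict_ext)

lemma lam_face_cong: "(\<And>t. t <= k ==> f t = g t) ==> lam_face k f ka = lam_face k g ka"
proof -
 assume a: "\<And>t. t <= k ==> f t = g t"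
 have "f ` s = g ` s" if "s : faces k" for s using a that by (intro image_cong) (auto simp: faces_def)
 then show ?thesis unfolding lam_face_def by (intro restrict_ext) simp
qed

text \<open>The restriction of an index of dimension $n$ to the edge from $i$ to $j$.\<close>

definition edge :: "nat => nat => (nat set => 'i) => nat set => 'i" where
 "edge i j = lam_face 1 (\<lambda>t. if t = 0 then i else j)"

lemma edge_vals[simp]: "edge i j ka {0} = ka {i}" "edge i j ka {Suc 0} = ka {j}" "edge i j ka {0, Suc 0} = ka {i, j}"
 by (simp_all add: edge_def lam_face_def insert_commute)

lemma Lam_edge: "ka : Lam U n ==> i < j ==> j <= n ==> edge i j ka : Lam U 1"
 unfolding edge_def by (rule Lam_face) (auto simp: strict_mono_on_def)

lemma edge_face: "i <= k ==> j <= k ==> edge i j (lam_face k g ka) = edge (g i) (g j) ka"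
 unfolding edge_def by (subst lam_face_comp) (auto intro!: lam_face_cong)

lemma face_coface_2: "lam_face 1 (coface 2 2) ka = edge 0 1 ka" "lam_face 1 (coface 2 1) ka = edge 0 2 ka"
 "lam_face 1 (coface 2 0) ka = edge 1 2 ka"
 unfolding edge_def by (rule lam_face_cong; auto simp: coface_def)+

lemma Lam_1_eqI:
 assumes "ka : Lam U 1" "ka' : Lam U 1" "ka {0} = ka' {0}" "ka {Suc 0} = ka' {Suc 0}" "ka {0, Suc 0} = ka' {0, Suc 0}"
 shows "ka = ka'"
proof (rule ext)
 fix s show "ka s = ka' s"
 proof (cases "s : faces 1")
  case True
  then show ?thesis using assms(3-5) unfolding faces_1 by auto
 next
  case False
  then show ?thesis using assms(1,2) unfolding Lam_def by (auto simp: PiE_def extensional_def)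
 qed
qed

context nerve_module
begin

abbreviation sum_A (infixl "|+|" 65) where "a |+| b \<equiv> cmp A a b"

definition pt0 :: "'x => 'x \<times> (nat => 'g)" where "pt0 x = (x, \<lambda>_. undefined)"
definition pt1 :: "'g => 'x \<times> (nat => 'g)" where "pt1 g = (rng G g, \<lambda>j\<in>{1..1}. g)"
definition pt2 :: "'g => 'g => 'x \<times> (nat => 'g)" where
 "pt2 g h = (rng G g, \<lambda>j\<in>{1..2}. if j = 1 then g else h)"
definition pt3 :: "'g => 'g => 'g => 'x \<times> (nat => 'g)" where
 "pt3 g h k = (rng G g, \<lambda>j\<in>{1..3}. if j = 1 then g else if j = 2 then h else k)"

lemma atLeast_small: "{1..1::nat} = {1}" "{1..2::nat} = {1, 2}" "{1..3::nat} = {1, 2, 3}" "{1..<2::nat} = {1}"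
 "{1..<3::nat} = {1, 2}"
 "{Suc 0..2::nat} = {1, 2}" "{Suc 0..3::nat} = {1, 2, 3}" "{Suc 0..<2::nat} = {1}" "{Suc 0..<3::nat} = {1, 2}"
 by auto

lemma pt_in: "x : Ob G ==> pt0 x : NT 0" "g : Ar G ==> pt1 g : NT 1"
 "g : Ar G ==> h : Ar G ==> src G g = rng G h ==> pt2 g h : NT 2"
 "g : Ar G ==> h : Ar G ==> k : Ar G ==> src G g = rng G h ==> src G h = rng G k ==> pt3 g h k : NT 3"
 unfolding topspace_N pt0_def pt1_def pt2_def pt3_def
 by (auto simp: atLeast_small numeral_2_eq_2 numeral_3_eq_3 split: if_splits)

lemma pt_vertex: "vx (pt1 g) 0 = idn G (rng G g)" "vx (pt2 g h) 0 = idn G (rng G g)" "vx (pt3 g h k) 0 = idn G (rng G g)"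
 "g : Ar G ==> vx (pt1 g) (Suc 0) = g" "g : Ar G ==> vx (pt2 g h) (Suc 0) = g"
 "g : Ar G ==> vx (pt3 g h k) (Suc 0) = g"
 "g : Ar G ==> vx (pt2 g h) 2 = cmp G g h" "g : Ar G ==> vx (pt3 g h k) 2 = cmp G g h"
 "g : Ar G ==> vx (pt3 g h k) 3 = cmp G (cmp G g h) k"
 by (simp_all add: pt1_def pt2_def pt3_def numeral_2_eq_2 numeral_3_eq_3)

declare vertex.simps[simp del]

lemma smap_0: "z : NT n ==> smap M 0 n f z = pt0 (src G (vx z (f 0)))"
 unfolding smap_nerve pt0_def by auto

lemma smap_1: "z : NT n ==> f 0 <= n ==> f (Suc 0) <= n ==>
  smap M 1 n f z = pt1 (gap z (f 0) (f (Suc 0)))"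
 unfolding smap_nerve pt1_def by (auto intro!: restrict_ext simp: atLeast_small)

lemma smap_2: "z : NT n ==> f 0 <= n ==> f (Suc 0) <= n ==> f 2 <= n ==>
  smap M 2 n f z = pt2 (gap z (f 0) (f (Suc 0)))
   (gap z (f (Suc 0)) (f 2))"
 unfolding smap_nerve pt2_def by (auto intro!: restrict_ext simp: atLeast_small)

lemma N0: "z : NT 0 ==> z = pt0 (fst z)"
 unfolding topspace_N pt0_def by (auto simp: prod_eq_iff PiE_def extensional_def)

lemma N1: "z : NT 1 ==> z = pt1 (snd z 1)"
 unfolding topspace_N pt1_def by (auto simp: prod_eq_iff PiE_def extensional_def fun_eq_iff)

lemma N2: assumes z: "z : NT 2"
 shows "z = pt2 (snd z 1) (snd z 2)" "snd z 1 : Ar G" "snd z 2 : Ar G" "src G (snd z 1) = rng G (snd z 2)"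
proof -
 show "z = pt2 (snd z 1) (snd z 2)"
  using z unfolding topspace_N pt2_def atLeast_small by (auto simp: prod_eq_iff PiE_def extensional_def fun_eq_iff)
 show "snd z 1 : Ar G" "snd z 2 : Ar G" "src G (snd z 1) = rng G (snd z 2)"
  using z unfolding topspace_N by (auto simp: atLeast_small numeral_2_eq_2)
qed

text \<open>The arrow of the cover groupoid that belongs to the edge from $i$ to $j$.\<close>

definition arw :: "(nat set => 'i) => 'x \<times> (nat => 'g) => nat => nat => 'i \<times> 'g \<times> 'i" where
 "arw ka z i j = (ka {i}, gap z i j, ka {j})"

abbreviation "fval f ka z \<equiv> f (edge 0 1 ka) (edge 1 2 ka) (edge 0 2 ka) (arw ka z 0 1) (arw ka z 1 2)"
abbreviation "lfat sg ka z i j \<equiv> sg (edge i j ka) (arw ka z i j)"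

lemma arw_face:
 assumes "z : NT n" "f : {..k} \<rightarrow> {..n}" "i <= k" "j <= k"
 shows "arw (lam_face k f ka) (smap M k n f z) i j = arw ka z (f i) (f j)"
proof -
 have b: "f i <= n" "f j <= n" "f 0 <= n" using assms by (auto simp: Pi_iff)
 show ?thesis
  using assms b by (simp add: arw_def lam_face_def vertex_smap[OF assms(1,2)])
qed

lemma base_cover_sel: "fst (base_cover U) = fst (U 0)" "snd (base_cover U) i = fst ` snd (U 0) i"
 by (simp_all add: base_cover_def)

lemma scoverD:
 assumes "osc U"
 shows "i : fst (U n) ==> openin (N n) (snd (U n) i)" "z : NT n ==> \<exists>i\<in>fst (U n). z : snd (U n) i"
  "i : fst (U n) ==> snd (U n) i \<subseteq> NT n"
 using assms openin_subset unfolding open_scover_def open_cover_def by blast+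

lemma base_mem:
 assumes U: "osc U" and i: "i : fst (U 0)"
 shows "x : snd (base_cover U) i \<longleftrightarrow> pt0 x : snd (U 0) i"
proof
 assume "x : snd (base_cover U) i"
 then obtain z where z: "z : snd (U 0) i" "x = fst z" unfolding base_cover_sel by blast
 then have "z = pt0 x" using N0 scoverD(3)[OF U i] by blast
 then show "pt0 x : snd (U 0) i" using z by simp
next
 assume "pt0 x : snd (U 0) i"
 then show "x : snd (base_cover U) i" unfolding base_cover_sel by (force simp: pt0_def)
qed

lemma Ulam_vertex:
 assumes "z : UL U n ka" "i <= n"
 shows "pt0 (src G (vx z i)) : snd (U 0) (ka {i})"
proof -
 have z: "z : NT n" using assms Ulam_sub by blast
 have "smap M (sdim {i}) n (senum {i}) z : snd (U (sdim {i})) (ka {i})"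
  using assms unfolding Ulam_def by (metis (mono_tags, lifting) faces_single mem_Collect_eq)
 then show ?thesis using smap_0[OF z] by simp
qed

lemma Ulam_edge:
 assumes "z : UL U n ka" "i < j" "j <= n"
 shows "pt1 (gap z i j) : snd (U 1) (ka {i, j})"
proof -
 have z: "z : NT n" using assms Ulam_sub by blast
 have "{i, j} : faces n" using assms by simp
 then have "smap M (sdim {i, j}) n (senum {i, j}) z : snd (U (sdim {i, j})) (ka {i, j})"
  using assms unfolding Ulam_def by blast
 then show ?thesis using smap_1[OF z, of "senum {i, j}"] sdim_pair[OF assms(2)] senum_pair[OF assms(2)] assms by simp
qed

lemma pt1_Ulam:
 assumes "g : Ar G"
 shows "pt1 g : UL U 1 ka \<longleftrightarrow> pt0 (rng G g) : snd (U 0) (ka {0}) & pt0 (src G g) : snd (U 0) (ka {Suc 0}) &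
   pt1 g : snd (U 1) (ka {0, Suc 0})"
proof -
 have z: "pt1 g : NT 1" using pt_in assms by blast
 have "smap M 1 1 (senum {0, Suc 0}) (pt1 g) = pt1 g"
  using smap_1[OF z, of "senum {0, Suc 0}"] senum_pair[of 0 "Suc 0"] assms by (simp add: pt_vertex)
 then show ?thesis using assms z sdim_pair[of 0 "Suc 0"] unfolding Ulam_def faces_1
  by (simp add: smap_0[OF z, unfolded One_nat_def] pt_vertex)
qed

lemma edge_set_iff: "p : ES U ka \<longleftrightarrow> fst (snd p) : Ar G & p = (ka {0}, fst (snd p), ka {Suc 0}) & pt1 (fst (snd p)) : UL U 1 ka"
proof
 assume "p : ES U ka"
 then obtain z where z: "z : UL U 1 ka" "p = (ka {0}, snd z 1, ka {1})" unfolding edge_set_def by blast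
 then have zt: "z : NT 1" using Ulam_sub by blast
 show "fst (snd p) : Ar G & p = (ka {0}, fst (snd p), ka {Suc 0}) & pt1 (fst (snd p)) : UL U 1 ka"
  using z N1[OF zt] zt snd_N[OF zt, of 1] by simp
next
 assume "fst (snd p) : Ar G & p = (ka {0}, fst (snd p), ka {Suc 0}) & pt1 (fst (snd p)) : UL U 1 ka"
 moreover have "snd (pt1 (fst (snd p))) 1 = fst (snd p)" by (simp add: pt1_def)
 ultimately show "p : ES U ka" unfolding edge_set_def mem_Collect_eq
  by (intro exI[of _ "pt1 (fst (snd p))"]) simp
qed

lemma arw_edge_set:
 assumes "z : UL U n ka" "i < j" "j <= n"
 shows "arw ka z i j : ES U (edge i j ka)"
proof -
 have z: "z : NT n" using assms Ulam_sub by blast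
 have "pt1 (gap z i j) : UL U 1 (edge i j ka)"
  using Ulam_vertex[OF assms(1), of i] Ulam_vertex[OF assms(1), of j] Ulam_edge[OF assms] z assms(2,3)
  by (subst pt1_Ulam) auto
 then show ?thesis unfolding edge_set_iff using z assms(2,3) by (simp add: arw_def)
qed

end

text \<open>An index of dimension $n$ with given vertices and edges, whose open set contains a given point.\<close>

definition mkl :: "'m simp_space => (nat => ('m, 'i) cov) => nat => (nat => 'i) => (nat => nat => 'i) => 'm => nat set => 'i" where
 "mkl M U n vi ei z = (\<lambda>s\<in>faces n. if card s = 1 then vi (Min s) else if card s = 2 then ei (Min s) (Max s)
   else (SOME i. i : fst (U (sdim s)) & smap M (sdim s) n (senum s) z : snd (U (sdim s)) i))"

context nerve_module
begin

lemma mkl: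
 assumes U: "osc U" and z: "z : NT n"
  and vi: "\<And>i. i <= n ==> vi i : fst (U 0) & pt0 (src G (vx z i)) : snd (U 0) (vi i)"
  and ei: "\<And>i j. i < j ==> j <= n ==> ei i j : fst (U 1) &
   pt1 (gap z i j) : snd (U 1) (ei i j)"
 shows "mkl M U n vi ei z : Lam U n" "z : UL U n (mkl M U n vi ei z)"
  "i <= n ==> mkl M U n vi ei z {i} = vi i" "i < j ==> j <= n ==> mkl M U n vi ei z {i, j} = ei i j"
proof -
 let ?m = "mkl M U n vi ei z"
 show v: "?m {i} = vi i" if "i <= n" for i using that by (simp add: mkl_def)
 show e: "?m {i, j} = ei i j" if "i < j" "j <= n" for i j using that by (simp add: mkl_def)
 have *: "?m s : fst (U (sdim s)) & smap M (sdim s) n (senum s) z : snd (U (sdim s)) (?m s)" if s: "s : faces n" for s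
 proof -
  have f: "finite s" "s ~= {}" "s \<subseteq> {..n}" using s faces_finite by (auto simp: faces_def)
  consider "card s = 1" | "card s = 2" | "card s ~= 1 & card s ~= 2" by blast
  then show ?thesis
  proof cases
   case 1
   then obtain i where i: "s = {i}" by (auto simp: card_1_singleton_iff)
   then have "i <= n" using f by auto
   then show ?thesis unfolding i using v vi smap_0[OF z] by simp
  next
   case 2
   then obtain a b where "s = {a, b}" "a ~= b" by (meson card_2_iff)
   then obtain i j where ij: "s = {i, j}" "i < j" by (metis insert_commute nat_neq_iff)
   then have n: "i <= n" "j <= n" using f by auto
   show ?thesis unfolding ij sdim_pair[OF ij(2)] e[OF ij(2) n(2)]
    using ei[OF ij(2) n(2)] smap_1[OF z, of "senum {i, j}"] senum_pair[OF ij(2)] n by simp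
  next
   case 3
   have "smap M (sdim s) n (senum s) z : pts (N (sdim s))"
    by (rule smap_in[OF z senum_Pi[OF s]])
   then have "\<exists>i. i : fst (U (sdim s)) & smap M (sdim s) n (senum s) z : snd (U (sdim s)) i"
    using scoverD(2)[OF U] by blast
   from someI_ex[OF this] show ?thesis using 3 s by (simp add: mkl_def)
  qed
 qed
 show "?m : Lam U n" unfolding Lam_def using * by (auto simp: mkl_def)
 show "z : UL U n ?m" unfolding Ulam_def using * z by blast
qed

abbreviation CH :: "(('x, 'g, 'i) ncov) => ('i \<times> 'x, 'i \<times> 'g \<times> 'i) topgpd" where
 "CH U \<equiv> GC (base_cover U)"
abbreviation CB :: "(('x, 'g, 'i) ncov) => ('i \<times> 'x, 'i \<times> 'a, 'i \<times> 'g \<times> 'i) gmod" where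
 "CB U \<equiv> AC (base_cover U)"

lemma edge_set_sub:
 assumes U: "osc U" and k: "ka : Lam U 1"
 shows "ES U ka \<subseteq> Ar (CH U)"
proof
 fix p assume p: "p : ES U ka"
 have f: "ka {0} : fst (U 0)" "ka {Suc 0} : fst (U 0)"
  using k unfolding Lam_def faces_1 PiE_def by auto
 obtain g where g: "p = (ka {0}, g, ka {Suc 0})" "g : Ar G" "pt1 g : UL U 1 ka"
  using p unfolding edge_set_iff by (metis fst_conv snd_conv)
 show "p : Ar (CH U)"
  unfolding Ar_cover g(1) fst_conv snd_conv base_mem[OF U f(1)] base_mem[OF U f(2)] base_cover_sel(1)
  using g(2) g(3)[unfolded pt1_Ulam[OF g(2)]] f by simp
qed

abbreviation "Ucls U \<equiv> class_presented (CH U) (CB U) (Lam U 1) (ES U)"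
abbreviation "Ufac U \<equiv> factor_set (CH U) (CB U) (Lam U 1) (ES U)"
abbreviation "Upres U \<equiv> presents (CH U) (CB U) (Lam U 1) (ES U)"
abbreviation "Udom U \<equiv> fdom (CH U) (ES U)"

lemma gcover_edge:
 assumes U: "osc U"
 shows "gcover (CH U) (Lam U 1) (ES U)"
 unfolding gcover_def
proof (intro conjI ballI subsetI)
 fix ka assume k: "ka : Lam U 1"
 let ?H = "CH U"
 note a = cont_id'[of "arr ?H", unfolded cover_arr_cont]
 have f: "ka {0} : fst (U 0)" "ka {Suc 0} : fst (U 0)"
  using k unfolding Lam_def faces_1 PiE_def by auto
 have c2: "cts (arr ?H) (arr G) (\<lambda>p. fst (snd p))" using a by blast
 have c: "cts (arr ?H) (N 1) (\<lambda>p. pt1 (fst (snd p)))"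
  unfolding pt1_def
 proof (rule into_N)
  show "cts (arr ?H) (arr G) (\<lambda>p. (\<lambda>j\<in>{1..1}. fst (snd p)) i)" if "i : {1..1}" for i :: nat
   using that c2 by simp
  show "(rng G (fst (snd p)), \<lambda>j\<in>{1..1}. fst (snd p)) : NT 1" if "p : Ar ?H" for p
   using pt_in(2)[of "fst (snd p)"] that unfolding pt1_def Ar_cover by blast
 qed (intro H.cont_rng c2)
 have o1: "openin (arr ?H) {p : Ar ?H. pt1 (fst (snd p)) : UL U 1 ka}"
  by (rule openin_preimage[OF c Ulam_open[OF U k]])
 have o2: "openin (arr ?H) {p : Ar ?H. fst p : {ka {0}}}"
  by (rule openin_preimage[of _ "dsc (fst (base_cover U))"]) (use a f in \<open>auto simp: base_cover_sel\<close>)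
 have o3: "openin (arr ?H) {p : Ar ?H. snd (snd p) : {ka {Suc 0}}}"
  by (rule openin_preimage[of _ "dsc (fst (base_cover U))"]) (use a f in \<open>auto simp: base_cover_sel\<close>)
 have "ES U ka = {p : Ar ?H. pt1 (fst (snd p)) : UL U 1 ka} \<inter> {p : Ar ?H. fst p : {ka {0}}} \<inter> {p : Ar ?H. snd (snd p) : {ka {Suc 0}}}"
  (is "?L = ?R")
 proof
  show "?L \<subseteq> ?R" using edge_set_sub[OF U k] unfolding edge_set_iff by (auto simp: edge_set_iff)
  show "?R \<subseteq> ?L" by (auto simp: edge_set_iff Ar_cover)
 qed
 then show "openin (arr ?H) (ES U ka)" using openin_Int[OF openin_Int[OF o1 o2] o3] by simp
next
 fix p assume p: "p : Ar (CH U)"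
 obtain i g j where ig: "p = (i, g, j)" by (cases p)
 have g: "g : Ar G" "i : fst (U 0)" "j : fst (U 0)" "pt0 (rng G g) : snd (U 0) i" "pt0 (src G g) : snd (U 0) j"
  using p base_mem[OF U] unfolding ig Ar_cover base_cover_sel(1) by auto
 obtain e where e: "e : fst (U 1)" "pt1 g : snd (U 1) e" using scoverD(2)[OF U pt_in(2)[OF g(1)]] by blast
 let ?k = "mkl M U 1 (\<lambda>t. if t = 0 then i else j) (\<lambda>_ _. e) (pt1 g)"
 have v: "(if t = 0 then i else j) : fst (U 0) & pt0 (src G (vx (pt1 g) t)) : snd (U 0) (if t = 0 then i else j)"
  if "t <= 1" for t
  using that g by (cases "t = 0") (auto simp: pt_vertex le_Suc_eq)
 have "e : fst (U 1) & pt1 (gap (pt1 g) s t) : snd (U 1) e" if "s < t" "t <= 1" for s t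
 proof -
  have "s = 0" "t = Suc 0" using that by auto
  then show ?thesis using e g by (simp add: pt_vertex)
 qed
 note m = mkl[OF U pt_in(2)[OF g(1)] v this]
 have "p : ES U ?k" unfolding edge_set_iff ig using m(2) m(3)[of 0] m(3)[of "Suc 0"] g by simp
 then show "p : (\<Union>ka\<in>Lam U 1. ES U ka)" using m(1) by blast
qed

lemma arw_in:
 assumes U: "osc U" and k: "ka : Lam U n" and z: "z : UL U n ka" and ij: "i < j" "j <= n"
 shows "arw ka z i j : Ar (CH U)"
 using edge_set_sub[OF U Lam_edge[OF k ij]] arw_edge_set[OF z ij] by blast

lemma arw_fdom:
 assumes U: "osc U" and k: "ka : Lam U n" and z: "z : UL U n ka" and ij: "i < j" "j < l" "l <= n"
 shows "(arw ka z i j, arw ka z j l) : Udom U (edge i j ka) (edge j l ka) (edge i l ka)"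
  "cmp (CH U) (arw ka z i j) (arw ka z j l) = arw ka z i l"
proof -
 have zt: "z : NT n" using z Ulam_sub by blast
 show c: "cmp (CH U) (arw ka z i j) (arw ka z j l) = arw ka z i l"
  using zt ij by (simp add: cover_gpd_sel arw_def)
 show "(arw ka z i j, arw ka z j l) : Udom U (edge i j ka) (edge j l ka) (edge i l ka)"
  unfolding fdom_def using arw_in[OF U k z] arw_edge_set[OF z] c ij zt
  by (simp add: cover_gpd_sel arw_def)
qed

text \<open>The components of a cocycle depend only on the vertices and edges of the index. For, the
 cocycle identity on the degenerate simplex $(g, h, 1)$ involves, besides terms in which the index of
 the face $\{0,1,3\}$ does not occur, the component at $(g, h)$ with that index, which is arbitrary.\<close>

lemma cocycle_index_independent:
 assumes U: "osc U" and c: "c : carrier (ZZ U 2)"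
  and k: "ka : Lam U 2" "ka' : Lam U 2" and z: "z : UL U 2 ka" "z : UL U 2 ka'"
  and eq: "\<And>i. i <= 2 ==> ka {i} = ka' {i}" "\<And>i j. i < j ==> j <= 2 ==> ka {i, j} = ka' {i, j}"
 shows "c ka z = c ka' z"
proof -
 have zt: "z : NT 2" using z Ulam_sub by blast
 obtain g h where gh: "z = pt2 g h" "g : Ar G" "h : Ar G" "src G g = rng G h" using N2[OF zt] by blast
 let ?x = "src G h"
 have x: "?x : Ob G" using gh by simp
 define y where "y = pt3 g h (idn G ?x)"
 have y: "y : NT 3" unfolding y_def using gh by (intro pt_in) auto
 have vy: "vx y 0 = idn G (rng G g)" "vx y (Suc 0) = g" "vx y 2 = cmp G g h" "vx y 3 = cmp G g h"
  unfolding y_def using gh by (simp_all add: pt_vertex)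
 have vz: "vx z 0 = idn G (rng G g)" "vx z (Suc 0) = g" "vx z 2 = cmp G g h"
  unfolding gh using gh(2) by (simp_all add: pt_vertex)
 have vyz: "vx y i = vx z (min i 2)" if "i <= 3" for i
 proof -
  have "i = 0 \<or> i = Suc 0 \<or> i = 2 \<or> i = 3" using that by auto
  then show ?thesis using vy vz by auto
 qed
 obtain e where e: "e : fst (U 1)" "pt1 (idn G ?x) : snd (U 1) e"
  using scoverD(2)[OF U pt_in(2)[OF H.idn_in[OF x]]] by blast
 define vi where "vi i = ka {min i 2}" for i
 define ei where "ei i j = (if i = 2 then e else ka {i, min j 2})" for i j
 have kin: "ka s : fst (U (sdim s))" if "s : faces 2" for s using k(1) that unfolding Lam_def by auto
 have v: "vi i : fst (U 0) & pt0 (src G (vx y i)) : snd (U 0) (vi i)" if "i <= 3" for i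
  using kin[of "{min i 2}"] Ulam_vertex[OF z(1), of "min i 2"] vyz[OF that] unfolding vi_def by simp
 have ed: "ei i j : fst (U 1) & pt1 (gap y i j) : snd (U 1) (ei i j)"
  if "i < j" "j <= 3" for i j
 proof (cases "i = 2")
  case True
  then have "j = 3" using that by simp
  then show ?thesis using True e gh unfolding ei_def by (simp add: vy)
 next
  case False
  then have "i < min j 2" "min j 2 <= 2" "min i 2 = i" using that by auto
  then show ?thesis
   using kin[of "{i, min j 2}"] sdim_pair[of i "min j 2"] Ulam_edge[OF z(1), of i "min j 2"] vyz[of i] vyz[of j] that False
   unfolding ei_def by simp
 qed
 define mu0 where "mu0 = mkl M U 3 vi ei y"
 note m = mkl[OF U y v ed, folded mu0_def]
 have y013: "smap M 2 3 (senum {0, Suc 0, 3}) y = z"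
  using smap_2[OF y, of "senum {0, Suc 0, 3}"] senum_triple[of 0 "Suc 0" 3] gh by (simp add: vy)
 define mu where "mu t = mu0({0, Suc 0, 3} := t)" for t
 have MLam: "mu (nu {0, Suc 0, 2}) : Lam U 3 & y : UL U 3 (mu (nu {0, Suc 0, 2}))"
  if kn: "nu : Lam U 2" "z : UL U 2 nu" for nu
 proof -
  have f: "{0, Suc 0, 2} : faces 2" "{0, Suc 0, 3} : faces 3" by simp_all
  have d: "sdim {0, Suc 0, 2} = 2" "sdim {0, Suc 0, 3} = 2" by (rule sdim_triple; simp)+
  have "nu {0, Suc 0, 2} : fst (U (sdim {0, Suc 0, 2}))"
   using kn(1) f unfolding Lam_def by blast
  then have t: "nu {0, Suc 0, 2} : fst (U 2)" unfolding d .
  have "smap M (sdim {0, Suc 0, 2}) 2 (senum {0, Suc 0, 2}) z : snd (U (sdim {0, Suc 0, 2})) (nu {0, Suc 0, 2})"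
   using kn(2) f(1) unfolding Ulam_def by blast
  moreover have "smap M 2 2 (senum {0, Suc 0, 2}) z = z"
  proof (rule smap_id[OF zt])
   fix j :: nat assume "j <= 2"
   then have "j = 0 \<or> j = Suc 0 \<or> j = 2" by auto
   then show "senum {0, Suc 0, 2} j = j" using senum_triple[of 0 "Suc 0" 2] by auto
  qed
  ultimately have zU: "z : snd (U 2) (nu {0, Suc 0, 2})" unfolding d by simp
  have "mu (nu {0, Suc 0, 2}) : Lam U 3"
   using m(1) t f(2) d(2) unfolding Lam_def mu_def by (auto simp: PiE_def extensional_def Pi_iff)
  moreover have "y : UL U 3 (mu (nu {0, Suc 0, 2}))"
   using m(2) zU y013 d(2) unfolding Ulam_def mu_def by simp
  ultimately show ?thesis by blast
 qed
 have cof: "coface 3 2 0 = 0" "coface 3 2 (Suc 0) = Suc 0" "coface 3 2 2 = 3"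
  by (simp_all add: coface_def)
 have face2: "lam_face 2 (coface 3 2) (mu (nu {0, Suc 0, 2})) = nu"
  if kn: "nu : Lam U 2" and en: "\<And>i. i <= 2 ==> ka {i} = nu {i}" "\<And>i j. i < j ==> j <= 2 ==> ka {i, j} = nu {i, j}" for nu
 proof (rule ext)
  fix s
  show "lam_face 2 (coface 3 2) (mu (nu {0, Suc 0, 2})) s = nu s"
  proof (cases "s : faces 2")
   case True
   have upd: "mu t s' = mu0 s'" if "0 \<notin> s' \<or> Suc 0 \<notin> s' \<or> 3 \<notin> s'" for t s'
   proof -
    have "s' ~= {0, Suc 0, 3}" using that by blast
    then show ?thesis unfolding mu_def by simp
   qed
   have mm: "mu t {0} = ka {0}" "mu t {Suc 0} = ka {Suc 0}" "mu t {3} = ka {2}" "mu t {0, Suc 0} = ka {0, Suc 0}"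
    "mu t {0, 3} = ka {0, 2}" "mu t {Suc 0, 3} = ka {Suc 0, 2}" for t
    using m(3)[of 0] m(3)[of "Suc 0"] m(3)[of 3] m(4)[of 0 "Suc 0"] m(4)[of 0 3] m(4)[of "Suc 0" 3]
    by (simp_all add: upd vi_def ei_def)
   have mt: "mu t {0, Suc 0, 3} = t" for t unfolding mu_def by simp
   show ?thesis
    using faces_2[OF True] en(1)[of 0] en(1)[of "Suc 0"] en(1)[of 2] en(2)[of 0 "Suc 0"] en(2)[of 0 2] en(2)[of "Suc 0" 2]
    by (elim disjE) (simp_all add: lam_face_def cof mm mt)
  next
   case False
   then show ?thesis using kn unfolding Lam_def lam_face_def by (auto simp: PiE_def extensional_def)
  qed
 qed
 have other: "lam_face 2 (coface 3 b) (mu t) = lam_face 2 (coface 3 b) (mu t')" if "b = 0 \<or> b = 1 \<or> b = 3" for b t t'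
  unfolding lam_face_def
 proof (rule restrict_ext)
  fix s assume "s : faces 2"
  then have "b \<notin> coface 3 b ` s" by (auto simp: coface_def faces_def)
  then have "coface 3 b ` s ~= {0, Suc 0, 3}" using that by auto
  then show "mu t (coface 3 b ` s) = mu t' (coface 3 b ` s)" unfolding mu_def by simp
 qed
 have cc: "c : carrier (CC U 2)" "cob U 2 c = \<one>\<^bsub>CC U 3\<^esub>"
  using c unfolding cocycles_carrier by (simp_all add: numeral_3_eq_3 numeral_2_eq_2)
 let ?t = "ka {0, Suc 0, 2}" and ?t' = "ka' {0, Suc 0, 2}"
 have M: "mu ?t : Lam U 3" "y : UL U 3 (mu ?t)" "mu ?t' : Lam U 3" "y : UL U 3 (mu ?t')"
  using MLam[OF k(1) z(1)] MLam[OF k(2) z(2)] by auto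
 have E: "Suc 2 = 3" by simp
 have y2: "smap M 2 3 (coface 3 2) y = z"
  using smap_2[OF y, of "coface 3 2"] gh by (simp add: vy cof)
 have T: "cterm U 2 c (mu t) b y = act A (gap y 3 (coface 3 b 2))
  (c (lam_face 2 (coface 3 b) (mu t)) (smap M 2 3 (coface 3 b) y))" if "y : UL U 3 (mu t)" for t b
  using cterm_eval[of y U 2 "mu t" c b] that by simp
 have in': "cterm U 2 c (mu t) b y : Ar A & src A (cterm U 2 c (mu t) b y) = src G (vx y 3)"
  if "mu t : Lam U 3" "y : UL U 3 (mu t)" for t b
 proof -
  have "cterm U 2 c (mu t) b : carrier (sec S 3 (UL U 3 (mu t)))"
   using cterm_in[OF cc(1), of "mu t" b] that(1) by simp
  from sec_D[OF Ulam_sub this that(2)] show ?thesis by blast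
 qed
 have same: "cterm U 2 c (mu ?t) b y = cterm U 2 c (mu ?t') b y" if "b = 0 \<or> b = 1 \<or> b = 3" for b
  unfolding T[OF M(2)] T[OF M(4)] other[OF that, of ?t ?t'] ..
 have xy: "src G (vx y 3) : Ob G" using y by simp
 have "cob U 2 c (mu ?t) y = cob U 2 c (mu ?t') y"
  unfolding cc(2) cochains_one using M by simp
 moreover have *: "cterm U 2 c (mu ?t') 0 y = cterm U 2 c (mu ?t) 0 y" "cterm U 2 c (mu ?t') 1 y = cterm U 2 c (mu ?t) 1 y"
  "cterm U 2 c (mu ?t') 3 y = cterm U 2 c (mu ?t) 3 y" using same[of 0] same[of 1] same[of 3] by simp_all
 moreover define r where "r = ginv A (cterm U 2 c (mu ?t) 1 y) |+| cterm U 2 c (mu ?t) 0 y"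
 ultimately have "ginv A (cterm U 2 c (mu ?t) 3 y) |+| (cterm U 2 c (mu ?t) 2 y |+| r) =
  ginv A (cterm U 2 c (mu ?t) 3 y) |+| (cterm U 2 c (mu ?t') 2 y |+| r)"
  unfolding codiff_2_eval[OF cc(1) M(1,2)] codiff_2_eval[OF cc(1) M(3,4)] * by (simp only:)
 moreover have r: "r : Ar A" "src A r = src G (vx y 3)"
  unfolding r_def using in'[OF M(1,2), of 0] in'[OF M(1,2), of 1] by simp_all
 ultimately have "cterm U 2 c (mu ?t) 2 y |+| r = cterm U 2 c (mu ?t') 2 y |+| r"
  using in'[OF M(1,2), of 3] in'[OF M(1,2), of 2] in'[OF M(3,4), of 2] by (subst (asm) add_cancel) auto
 then have "cterm U 2 c (mu ?t) 2 y = cterm U 2 c (mu ?t') 2 y"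
  using r in'[OF M(1,2), of 2] in'[OF M(3,4), of 2] by (subst (asm) add_cancel_r) auto
 moreover have "cterm U 2 c (mu ?t) 2 y = c ka z"
  unfolding T[OF M(2)] y2 face2[OF k(1) refl refl] cof
  using sec_D[OF Ulam_sub cochain_at[OF cc(1) k(1)] z(1)] y gh by (simp add: vy vz pt_vertex)
 moreover have f2': "lam_face 2 (coface 3 2) (mu ?t') = ka'" by (rule face2[OF k(2)]) (fact eq)+
 have "cterm U 2 c (mu ?t') 2 y = c ka' z"
  unfolding T[OF M(4)] y2 f2' cof
  using sec_D[OF Ulam_sub cochain_at[OF cc(1) k(2)] z(2)] y gh by (simp add: vy vz pt_vertex)
 ultimately show ?thesis by simp
qed

end

context nerve_module
begin

lemma cont_pt2:
 assumes "cts T (arr G) a" "cts T (arr G) b" "\<And>t. t : pts T ==> src G (a t) = rng G (b t)"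
 shows "cts T (N 2) (\<lambda>t. pt2 (a t) (b t))"
 unfolding pt2_def
proof (rule into_N)
 show "cts T (obj G) (\<lambda>t. rng G (a t))" by (intro H.cont_rng assms)
 fix i :: nat assume "i : {1..2}"
 then show "cts T (arr G) (\<lambda>t. (\<lambda>j\<in>{1..2}. if j = 1 then a t else b t) i)"
  using assms(1,2) by (cases "i = 1") auto
next
 fix t assume t: "t : pts T"
 show "(rng G (a t), \<lambda>j\<in>{1..2}. if j = 1 then a t else b t) : NT 2"
  by (rule pt_in(3)[OF continuous_map_in[OF assms(1) t] continuous_map_in[OF assms(2) t] assms(3)[OF t], unfolded pt2_def])
qed

lemma N2_arw:
 assumes z: "z : NT 2"
 shows "z = pt2 (fst (snd (arw ka z 0 1))) (fst (snd (arw ka z 1 2)))"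
proof -
 note n = N2[OF z]
 have "fst (snd (arw ka z 0 1)) = snd z 1" "fst (snd (arw ka z 1 2)) = snd z 2"
  using vertex_step[OF z, of 0] vertex_step[OF z, of 1] by (simp_all add: arw_def numeral_2_eq_2)
 then show ?thesis using n(1) by simp
qed

lemma N2_arw':
 assumes z: "z : NT 2"
 shows "arw ka z 0 1 = (ka {0}, snd z 1, ka {1})" "arw ka z 1 2 = (ka {1}, snd z 2, ka {2})"
  "arw ka z 0 2 = (ka {0}, cmp G (snd z 1) (snd z 2), ka {2})"
proof -
 note n = N2[OF z]
 show "arw ka z 0 1 = (ka {0}, snd z 1, ka {1})" "arw ka z 1 2 = (ka {1}, snd z 2, ka {2})"
  using vertex_step[OF z, of 0] vertex_step[OF z, of 1] by (simp_all add: arw_def numeral_2_eq_2)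
 have "gap z 0 2 = cmp G (snd z 1) (snd z 2)"
  using n(2-4) by (subst (1 2) n(1)) (simp add: pt_vertex)
 then show "arw ka z 0 2 = (ka {0}, cmp G (snd z 1) (snd z 2), ka {2})" by (simp add: arw_def)
qed

lemma is_ext_cocycle_alt:
 "IC U X sg c \<longleftrightarrow> c : carrier (ZZ U 2) &
  (\<forall>ka\<in>Lam U 2. \<forall>z\<in>UL U 2 ka.
   Em X (lfat sg ka z 0 1) (lfat sg ka z 1 2) =
   tr X (lfat sg ka z 0 2) (ka {2}, c ka z))"
proof -
 have "arw ka z 0 1 = (ka {0}, snd z 1, ka {1})" "arw ka z 1 2 = (ka {1}, snd z 2, ka {2})"
  "arw ka z 0 2 = (ka {0}, cmp G (snd z 1) (snd z 2), ka {2})" if "z : UL U 2 ka" for z ka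
  using N2_arw'[OF subsetD[OF Ulam_sub that]] by blast+
 then show ?thesis
  unfolding is_ext_cocycle_def Let_def face_coface_2 by (simp cong: ball_cong)
qed

lemma edge_setD: "p : ES U ka ==> p = (ka {0}, fst (snd p), ka {Suc 0}) & fst (snd p) : Ar G &
  pt0 (rng G (fst (snd p))) : snd (U 0) (ka {0}) & pt0 (src G (fst (snd p))) : snd (U 0) (ka {Suc 0}) &
   pt1 (fst (snd p)) : snd (U 1) (ka {0, Suc 0})"
 unfolding edge_set_iff using pt1_Ulam by blast

lemma Lam_1_in: "ka : Lam U 1 ==> ka {0} : fst (U 0) & ka {Suc 0} : fst (U 0) & ka {0, Suc 0} : fst (U 1)"
 using sdim_pair[of 0 "Suc 0"] unfolding Lam_def faces_1 PiE_def by auto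

definition mk2 :: "(('x, 'g, 'i) ncov) => (nat set => 'i) => (nat set => 'i) => (nat set => 'i)
  => 'x \<times> (nat => 'g) => nat set => 'i" where
 "mk2 U ka1 ka2 ka3 z = mkl M U 2 (\<lambda>i. if i = 0 then ka1 {0} else if i = Suc 0 then ka1 {Suc 0} else ka2 {Suc 0})
   (\<lambda>i j. if j = Suc 0 then ka1 {0, Suc 0} else if i = Suc 0 then ka2 {0, Suc 0} else ka3 {0, Suc 0}) z"

lemma le_2: "i <= (2::nat) \<longleftrightarrow> i = 0 \<or> i = Suc 0 \<or> i = 2" by auto
lemma le_3: "i <= (3::nat) \<longleftrightarrow> i = 0 \<or> i = Suc 0 \<or> i = 2 \<or> i = 3" by auto

text \<open>Any three edges that match at composable arrows are the edges of an index of dimension 2.\<close>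

lemma fdom_index2:
 assumes U: "osc U" and w: "ka1 : Lam U 1" "ka2 : Lam U 1" "ka3 : Lam U 1"
  and d: "(p, q) : Udom U ka1 ka2 ka3"
 defines "z \<equiv> pt2 (fst (snd p)) (fst (snd q))"
 defines "ka \<equiv> mk2 U ka1 ka2 ka3 z"
 shows "ka : Lam U 2" "z : UL U 2 ka" "edge 0 1 ka = ka1" "edge 1 2 ka = ka2" "edge 0 2 ka = ka3"
  "arw ka z 0 1 = p" "arw ka z 1 2 = q"
proof -
 define g where "g = fst (snd p)"
 define h where "h = fst (snd q)"
 note fd = fdomD[OF d]
 have s: "src (CH U) p = rng (CH U) q" "p : ES U ka1" "q : ES U ka2" "cmp (CH U) p q : ES U ka3"
  using fd by blast+
 note e1 = edge_setD[OF s(2), folded g_def] and e2 = edge_setD[OF s(3), folded h_def]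
 have c3: "fst (snd (cmp (CH U) p q)) = cmp G g h" unfolding g_def h_def by (simp add: cover_gpd_sel)
 note e3 = edge_setD[OF s(4), unfolded c3]
 have gh: "g : Ar G" "h : Ar G" "src G g = rng G h" "ka1 {Suc 0} = ka2 {0}"
 proof -
  show "g : Ar G" "h : Ar G" using e1 e2 by auto
  have "p = (ka1 {0}, g, ka1 {Suc 0})" "q = (ka2 {0}, h, ka2 {Suc 0})" using e1 e2 by auto
  then show "src G g = rng G h" "ka1 {Suc 0} = ka2 {0}" using s(1) by (simp_all add: cover_gpd_sel)
 qed
 have k3: "ka3 {0} = ka1 {0}" "ka3 {Suc 0} = ka2 {Suc 0}"
 proof -
  have "cmp (CH U) p q = (fst p, cmp G g h, snd (snd q))" unfolding g_def h_def by (simp add: cover_gpd_sel)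
  moreover have "fst p = ka1 {0}" "snd (snd q) = ka2 {Suc 0}" using e1 e2 by (metis fst_conv, metis snd_conv)
  ultimately show "ka3 {0} = ka1 {0}" "ka3 {Suc 0} = ka2 {Suc 0}" using e3 by auto
 qed
 have z: "z = pt2 g h" unfolding z_def g_def h_def ..
 have zt: "z : NT 2" unfolding z using gh by (intro pt_in) auto
 have vz: "vx z 0 = idn G (rng G g)" "vx z (Suc 0) = g" "vx z 2 = cmp G g h"
  unfolding z using gh(1) by (simp_all add: pt_vertex)
 note L = Lam_1_in[OF w(1)] Lam_1_in[OF w(2)] Lam_1_in[OF w(3)]
 let ?vi = "\<lambda>i. if i = 0 then ka1 {0} else if i = Suc 0 then ka1 {Suc 0} else ka2 {Suc 0}"
 let ?ei = "\<lambda>i j. if j = Suc 0 then ka1 {0, Suc 0} else if i = Suc 0 then ka2 {0, Suc 0} else ka3 {0, Suc 0}"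
 have v: "?vi i : fst (U 0) & pt0 (src G (vx z i)) : snd (U 0) (?vi i)" if "i <= 2" for i
  using that L e1 e2 gh vz unfolding le_2 by (elim disjE) auto
 have e: "?ei i j : fst (U 1) & pt1 (gap z i j) : snd (U 1) (?ei i j)"
  if "i < j" "j <= 2" for i j
 proof -
  have "i = 0 & j = Suc 0 \<or> i = 0 & j = 2 \<or> i = Suc 0 & j = 2" using that by auto
  then show ?thesis using L e1 e2 e3 gh vz by (elim disjE) auto
 qed
 note m = mkl[OF U zt v e, folded mk2_def, folded ka_def]
 show kL: "ka : Lam U 2" by (rule m(1))
 show "z : UL U 2 ka" by (rule m(2))
 have vals: "ka {0} = ka1 {0}" "ka {Suc 0} = ka1 {Suc 0}" "ka {2} = ka2 {Suc 0}" "ka {0, Suc 0} = ka1 {0, Suc 0}"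
  "ka {Suc 0, 2} = ka2 {0, Suc 0}" "ka {0, 2} = ka3 {0, Suc 0}"
  using m(3)[of 0] m(3)[of "Suc 0"] m(3)[of 2] m(4)[of 0 "Suc 0"] m(4)[of "Suc 0" 2] m(4)[of 0 2] by simp_all
 show "edge 0 1 ka = ka1"
  by (rule Lam_1_eqI[OF Lam_edge[OF kL] w(1)]) (simp_all add: vals)
 show "edge 1 2 ka = ka2"
  by (rule Lam_1_eqI[OF Lam_edge[OF kL] w(2)]) (simp_all add: vals gh)
 show "edge 0 2 ka = ka3"
  by (rule Lam_1_eqI[OF Lam_edge[OF kL] w(3)]) (simp_all add: vals k3)
 show "arw ka z 0 1 = p"
  using e1 gh vz vals by (simp add: arw_def)
 show "arw ka z 1 2 = q"
  using e2 gh vz vals by (simp add: arw_def)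
qed

lemma fdom_index3:
 assumes U: "osc U"
  and w: "w01 : Lam U 1" "w12 : Lam U 1" "w23 : Lam U 1" "w02 : Lam U 1" "w13 : Lam U 1" "w03 : Lam U 1"
  and d: "(p, q) : Udom U w01 w12 w02" "(cmp (CH U) p q, r) : Udom U w02 w23 w03"
   "(q, r) : Udom U w12 w23 w13" "(p, cmp (CH U) q r) : Udom U w01 w13 w03"
 obtains mu y where "mu : Lam U 3" "y : UL U 3 mu" "edge 0 1 mu = w01" "edge 1 2 mu = w12" "edge 2 3 mu = w23"
  "edge 0 2 mu = w02" "edge 1 3 mu = w13" "edge 0 3 mu = w03" "arw mu y 0 1 = p" "arw mu y 1 2 = q" "arw mu y 2 3 = r"
proof -
 define g where "g = fst (snd p)"
 define h where "h = fst (snd q)"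
 define k where "k = fst (snd r)"
 have m: "p : ES U w01" "q : ES U w12" "r : ES U w23" "cmp (CH U) p q : ES U w02"
  "cmp (CH U) q r : ES U w13" "cmp (CH U) p (cmp (CH U) q r) : ES U w03"
  and s: "src (CH U) p = rng (CH U) q" "src (CH U) q = rng (CH U) r"
  using fdomD[OF d(1)] fdomD[OF d(3)] fdomD[OF d(4)] by blast+
 note e1 = edge_setD[OF m(1), folded g_def] and e2 = edge_setD[OF m(2), folded h_def] and e3 = edge_setD[OF m(3), folded k_def]
 have P: "p = (w01 {0}, g, w01 {Suc 0})" "q = (w12 {0}, h, w12 {Suc 0})" "r = (w23 {0}, k, w23 {Suc 0})"
  using e1 e2 e3 by auto
 have gh: "g : Ar G" "h : Ar G" "k : Ar G" using e1 e2 e3 by auto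
 have sr: "src G g = rng G h" "w01 {Suc 0} = w12 {0}" "src G h = rng G k" "w12 {Suc 0} = w23 {0}"
  using s unfolding P by (simp_all add: cover_gpd_sel)
 have c: "cmp (CH U) p q = (w01 {0}, cmp G g h, w12 {Suc 0})" "cmp (CH U) q r = (w12 {0}, cmp G h k, w23 {Suc 0})"
  "cmp (CH U) p (w12 {0}, cmp G h k, w23 {Suc 0}) = (w01 {0}, cmp G g (cmp G h k), w23 {Suc 0})"
  unfolding P by (simp_all add: cover_gpd_sel)
 note e4 = edge_setD[OF m(4), unfolded c fst_conv snd_conv] and e5 = edge_setD[OF m(5), unfolded c fst_conv snd_conv]
  and e6 = edge_setD[OF m(6), unfolded c fst_conv snd_conv]
 define y where "y = pt3 g h k"
 have y: "y : NT 3" unfolding y_def using gh sr by (intro pt_in) auto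
 have vy: "vx y 0 = idn G (rng G g)" "vx y (Suc 0) = g" "vx y 2 = cmp G g h" "vx y 3 = cmp G g (cmp G h k)"
  unfolding y_def using gh sr by (simp_all add: pt_vertex)
 note L = Lam_1_in[OF w(1)] Lam_1_in[OF w(2)] Lam_1_in[OF w(3)] Lam_1_in[OF w(4)] Lam_1_in[OF w(5)] Lam_1_in[OF w(6)]
 let ?vi = "\<lambda>i. if i = 0 then w01 {0} else if i = Suc 0 then w01 {Suc 0} else if i = 2 then w12 {Suc 0} else w23 {Suc 0}"
 let ?ei = "\<lambda>i j. (if i = 0 then if j = Suc 0 then w01 else if j = 2 then w02 else w03 else
   if i = Suc 0 then if j = 2 then w12 else w13 else w23) {0, Suc 0}"
 have v: "?vi i : fst (U 0) & pt0 (src G (vx y i)) : snd (U 0) (?vi i)" if "i <= 3" for i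
  using that L e1 e2 e3 gh sr vy unfolding le_3 by (elim disjE) auto
 have e: "?ei i j : fst (U 1) & pt1 (gap y i j) : snd (U 1) (?ei i j)"
  if "i < j" "j <= 3" for i j
 proof -
  have "i = 0 & j = Suc 0 \<or> i = 0 & j = 2 \<or> i = 0 & j = 3 \<or> i = Suc 0 & j = 2 \<or> i = Suc 0 & j = 3 \<or> i = 2 & j = 3"
   using that by auto
  then show ?thesis using L e1 e2 e3 e4 e5 e6 gh sr vy by (elim disjE) auto
 qed
 define mu where "mu = mkl M U 3 ?vi ?ei y"
 note m = mkl[OF U y v e, folded mu_def]
 have vals: "mu {0} = w01 {0}" "mu {Suc 0} = w01 {Suc 0}" "mu {2} = w12 {Suc 0}" "mu {3} = w23 {Suc 0}"
  "mu {0, Suc 0} = w01 {0, Suc 0}" "mu {0, 2} = w02 {0, Suc 0}" "mu {0, 3} = w03 {0, Suc 0}"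
  "mu {Suc 0, 2} = w12 {0, Suc 0}" "mu {Suc 0, 3} = w13 {0, Suc 0}" "mu {2, 3} = w23 {0, Suc 0}"
  using m(3)[of 0] m(3)[of "Suc 0"] m(3)[of 2] m(3)[of 3] m(4)[of 0 "Suc 0"] m(4)[of 0 2] m(4)[of 0 3]
   m(4)[of "Suc 0" 2] m(4)[of "Suc 0" 3] m(4)[of 2 3] by simp_all
 show ?thesis
 proof (rule that[OF m(1,2)])
  show "edge 0 1 mu = w01" by (rule Lam_1_eqI[OF Lam_edge[OF m(1)] w(1)]) (simp_all add: vals)
  show "edge 1 2 mu = w12" by (rule Lam_1_eqI[OF Lam_edge[OF m(1)] w(2)]) (simp_all add: vals sr)
  show "edge 2 3 mu = w23" by (rule Lam_1_eqI[OF Lam_edge[OF m(1)] w(3)]) (simp_all add: vals sr)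
  show "edge 0 2 mu = w02" by (rule Lam_1_eqI[OF Lam_edge[OF m(1)] w(4)]) (use e4 in \<open>simp_all add: vals\<close>)
  show "edge 1 3 mu = w13" by (rule Lam_1_eqI[OF Lam_edge[OF m(1)] w(5)]) (use e5 sr in \<open>simp_all add: vals\<close>)
  show "edge 0 3 mu = w03" by (rule Lam_1_eqI[OF Lam_edge[OF m(1)] w(6)]) (use e6 in \<open>simp_all add: vals\<close>)
  show "arw mu y 0 1 = p" "arw mu y 1 2 = q" "arw mu y 2 3 = r"
   unfolding P using gh sr vy vals by (simp_all add: arw_def)
 qed
qed

text \<open>The factor set of a Cech cocycle, and conversely.\<close>

text \<open>The index of dimension 2 has the prescribed edges; its value on the whole simplex is arbitrary.\<close>

definition fc :: "(('x, 'g, 'i) ncov) => ((nat set => 'i) => 'x \<times> (nat => 'g) => 'a)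
  => (nat set => 'i) => (nat set => 'i) => (nat set => 'i) => 'i \<times> 'g \<times> 'i => 'i \<times> 'g \<times> 'i => 'i \<times> 'a" where
 "fc U c ka1 ka2 ka3 p q = (let z = pt2 (fst (snd p)) (fst (snd q)) in (snd (snd q), c (mk2 U ka1 ka2 ka3 z) z))"

definition cval :: "(('x, 'g, 'i) ncov) => ((nat set => 'i) => (nat set => 'i) => (nat set => 'i)
  => 'i \<times> 'g \<times> 'i => 'i \<times> 'g \<times> 'i => 'i \<times> 'a) => (nat set => 'i) => 'x \<times> (nat => 'g) => 'a" where
 "cval U f = (\<lambda>ka\<in>Lam U 2. \<lambda>z\<in>UL U 2 ka.
   snd (fval f ka z))"

lemma fc_eq:
 assumes U: "osc U" and c: "c : carrier (ZZ U 2)" and k: "ka : Lam U 2" and z: "z : UL U 2 ka"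
 shows "fval (fc U c) ka z = (ka {2}, c ka z)"
proof -
 have zt: "z : NT 2" using z Ulam_sub by blast
 have d: "(arw ka z 0 1, arw ka z 1 2) : Udom U (edge 0 1 ka) (edge 1 2 ka) (edge 0 2 ka)"
  using arw_fdom(1)[OF U k z, of 0 1 2] by simp
 have L: "edge 0 1 ka : Lam U 1" "edge 1 2 ka : Lam U 1" "edge 0 2 ka : Lam U 1" using Lam_edge[OF k] by auto
 note i = fdom_index2[OF U L d]
 define ka' where "ka' = mk2 U (edge 0 1 ka) (edge 1 2 ka) (edge 0 2 ka) z"
 have zz: "pt2 (fst (snd (arw ka z 0 1))) (fst (snd (arw ka z 1 2))) = z"
  using N2_arw[OF zt, of ka] by simp
 have ee: "ka' : Lam U 2" "z : UL U 2 ka'" "edge 0 1 ka' = edge 0 1 ka" "edge 1 2 ka' = edge 1 2 ka" "edge 0 2 ka' = edge 0 2 ka"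
  using i[unfolded zz] unfolding ka'_def by simp_all
 have v: "ka {i} = ka' {i}" if "i <= 2" for i
  using that fun_cong[OF ee(3), of "{0}"] fun_cong[OF ee(3), of "{Suc 0}"] fun_cong[OF ee(4), of "{Suc 0}"]
  unfolding le_2 by (elim disjE) simp_all
 have e: "ka {i, j} = ka' {i, j}" if "i < j" "j <= 2" for i j
 proof -
  have "i = 0 & j = Suc 0 \<or> i = 0 & j = 2 \<or> i = Suc 0 & j = 2" using that by auto
  then show ?thesis
   using fun_cong[OF ee(3), of "{0, Suc 0}"] fun_cong[OF ee(4), of "{0, Suc 0}"] fun_cong[OF ee(5), of "{0, Suc 0}"]
   by (elim disjE) simp_all
 qed
 have "c ka z = c ka' z" by (rule cocycle_index_independent[OF U c k ee(1) z ee(2) v e])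
 then show ?thesis
  unfolding fc_def Let_def N2_arw[OF zt, of ka, symmetric] ka'_def by (simp add: arw_def)
qed

lemma cterm_low:
 assumes c: "c : carrier (CC U n)" and k: "ka : Lam U (Suc n)" and z: "z : UL U (Suc n) ka" and b: "b <= n"
 shows "cterm U n c ka b z = c (lam_face n (coface (Suc n) b) ka) (smap M n (Suc n) (coface (Suc n) b) z)"
proof -
 have zt: "z : NT (Suc n)" using z Ulam_sub by blast
 note d = sec_D[OF Ulam_sub cochain_at[OF c Lam_coface[OF k]] Ulam_coface[OF z], of b]
 have cf: "coface (Suc n) b n = Suc n" using b by (simp add: coface)
 have v: "src G (vx (smap M n (Suc n) (coface (Suc n) b) z) n) = src G (vx z (Suc n))"
  using vertex_smap[OF zt coface_Pi, of n b] zt cf funcset_mem[OF coface_Pi, of 0 n b] by simp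
 show ?thesis unfolding cterm_eval[OF z] cf using d v zt by simp
qed

lemma cterm_top:
 assumes z: "z : UL U (Suc n) ka"
 shows "cterm U n c ka (Suc n) z = act A (gap z (Suc n) n)
  (c (lam_face n (coface (Suc n) (Suc n)) ka) (smap M n (Suc n) (coface (Suc n) (Suc n)) z))"
 unfolding cterm_eval[OF z] by (simp add: coface)

lemma cocycle_identity:
 assumes c: "c : carrier (CC U 2)" and m: "mu : Lam U 3" and y: "y : UL U 3 mu"
 defines "C \<equiv> (\<lambda>b. c (lam_face 2 (coface 3 b) mu) (smap M 2 3 (coface 3 b) y))"
 defines "k \<equiv> gap y 3 2"
 shows "cob U 2 c mu y = idn A (src G (vx y 3)) \<longleftrightarrow> C 1 |+| act A k (C 3) = C 2 |+| C 0"
proof -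
 have yt: "y : NT 3" using y Ulam_sub by blast
 have E: "Suc 2 = 3" by simp
 note low = cterm_low[of c U 2 mu y, unfolded E, OF c m y]
 have t: "cterm U 2 c mu 0 y = C 0" "cterm U 2 c mu 1 y = C 1" "cterm U 2 c mu 2 y = C 2" "cterm U 2 c mu 3 y = act A k (C 3)"
  unfolding C_def k_def using low[of 0] low[of 1] low[of 2] cterm_top[of y U 2 mu c, unfolded E, OF y] by simp_all
 have in': "cterm U 2 c mu b y : Ar A" "src A (cterm U 2 c mu b y) = src G (vx y 3)" for b
 proof -
  have "cterm U 2 c mu b : carrier (sec S 3 (UL U 3 mu))" using cterm_in[OF c, of mu b] m by simp
  from sec_D[OF Ulam_sub this y] show "cterm U 2 c mu b y : Ar A" "src A (cterm U 2 c mu b y) = src G (vx y 3)" by blast+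
 qed
 note I = in'[of 0, unfolded t] in'[of 1, unfolded t] in'[of 2, unfolded t] in'[of 3, unfolded t]
 have x: "src G (vx y 3) : Ob G" using yt by simp
 have "ginv A (act A k (C 3)) |+| (C 2 |+| (ginv A (C 1) |+| C 0)) = ginv A (C 1 |+| act A k (C 3)) |+| (C 2 |+| C 0)"
  using I by (simp add: left_comm)
 moreover have "ginv A (C 1 |+| act A k (C 3)) |+| (C 2 |+| C 0) = idn A (src G (vx y 3)) \<longleftrightarrow> C 1 |+| act A k (C 3) = C 2 |+| C 0"
  (is "ginv A ?p |+| ?q = _ \<longleftrightarrow> _")
 proof -
  have p: "?p : Ar A" "src A ?p = src G (vx y 3)" and q: "?q : Ar A" "src A ?q = src G (vx y 3)"
   using I by simp_all
  have "ginv A ?p |+| ?p = idn A (src G (vx y 3))" using p B.ginv_l[OF p(1)] by simp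
  then have "ginv A ?p |+| ?q = idn A (src G (vx y 3)) \<longleftrightarrow> ginv A ?p |+| ?q = ginv A ?p |+| ?p" by simp
  also have "\<dots> \<longleftrightarrow> ?q = ?p" using p q by (intro add_cancel) (simp_all del: B.ginv_cmp)
  finally show ?thesis by (simp add: eq_commute)
 qed
 ultimately show ?thesis unfolding codiff_2_eval[OF c m y] t by (simp del: B.ginv_cmp)
qed

lemma coface_3: "coface 3 0 0 = 1" "coface 3 0 (Suc 0) = 2" "coface 3 0 2 = 3" "coface 3 1 0 = 0" "coface 3 1 (Suc 0) = 2" "coface 3 1 2 = 3"
 "coface 3 2 0 = 0" "coface 3 2 (Suc 0) = 1" "coface 3 2 2 = 3" "coface 3 3 0 = 0" "coface 3 3 (Suc 0) = 1" "coface 3 3 2 = 2"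
 by (simp_all add: coface_def)

lemma coface_3_Pi: "coface 3 b : {..2} \<rightarrow> {..3}" and coface_3_mono: "strict_mono_on {..2} (coface 3 b)"
 using coface_Pi[of 2 b] coface_mono[of 2 b] by simp_all

text \<open>The value of a cochain or factor set on the faces of a 3-simplex.\<close>

lemma face_3:
 assumes m: "mu : Lam U 3" and y: "y : UL U 3 mu"
 defines "nu \<equiv> (\<lambda>b. lam_face 2 (coface 3 b) mu)" and "z \<equiv> (\<lambda>b. smap M 2 3 (coface 3 b) y)"
 shows "nu b : Lam U 2" "z b : UL U 2 (nu b)"
  "i <= 2 ==> j <= 2 ==> edge i j (nu b) = edge (coface 3 b i) (coface 3 b j) mu"
  "i <= 2 ==> j <= 2 ==> arw (nu b) (z b) i j = arw mu y (coface 3 b i) (coface 3 b j)"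
  "nu b {2} = mu {coface 3 b 2}"
proof -
 have yt: "y : NT 3" using y Ulam_sub by blast
 show "nu b : Lam U 2" unfolding nu_def by (rule Lam_face[OF m coface_3_Pi coface_3_mono])
 show "z b : UL U 2 (nu b)" unfolding nu_def z_def by (rule Ulam_face[OF y coface_3_Pi coface_3_mono])
 show "i <= 2 ==> j <= 2 ==> edge i j (nu b) = edge (coface 3 b i) (coface 3 b j) mu"
  unfolding nu_def by (rule edge_face)
 show "i <= 2 ==> j <= 2 ==> arw (nu b) (z b) i j = arw mu y (coface 3 b i) (coface 3 b j)"
  unfolding nu_def z_def by (rule arw_face[OF yt coface_3_Pi])
 show "nu b {2} = mu {coface 3 b 2}" unfolding nu_def lam_face_def by simp
qed

lemma cocycleI:
 assumes c: "c : carrier (CC U 2)"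
  and eq: "\<And>mu y. mu : Lam U 3 ==> y : UL U 3 mu ==> cob U 2 c mu y = idn A (src G (vx y 3))"
 shows "c : carrier (ZZ U 2)"
proof -
 have E: "Suc 2 = 3" by simp
 have d: "cob U 2 c : carrier (CC U 3)"
  using hom_in_carrier[OF codiff_hom c] unfolding E .
 have "cob U 2 c = \<one>\<^bsub>CC U 3\<^esub>"
 proof (rule ext)
  fix mu
  show "cob U 2 c mu = \<one>\<^bsub>CC U 3\<^esub> mu"
  proof (cases "mu : Lam U 3")
   case True
   have "cob U 2 c mu : extensional (UL U 3 mu)"
    using cochain_at[OF d True] unfolding sec_carrier by blast
   then have "cob U 2 c mu = (\<lambda>y\<in>UL U 3 mu. idn A (src G (vx y 3)))"
    using eq[OF True] by (intro extensionalityI[of _ "UL U 3 mu"]) auto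
   then show ?thesis unfolding cochains_one using True by simp
  next
   case False
   then show ?thesis using d unfolding cochains_carrier cochains_one by (auto simp: PiE_def extensional_def)
  qed
 qed
 then show ?thesis unfolding cocycles_carrier E using c by blast
qed

lemma cocycleD:
 assumes "c : carrier (ZZ U 2)"
 shows "c : carrier (CC U 2)" "mu : Lam U 3 ==> y : UL U 3 mu ==> cob U 2 c mu y = idn A (src G (vx y 3))"
proof -
 have E: "Suc 2 = 3" by simp
 show "c : carrier (CC U 2)" using assms unfolding cocycles_carrier by blast
 have "cob U 2 c = \<one>\<^bsub>CC U 3\<^esub>" using assms unfolding cocycles_carrier E by blast
 then show "mu : Lam U 3 ==> y : UL U 3 mu ==> cob U 2 c mu y = idn A (src G (vx y 3))"
  unfolding cochains_one by simp
qed

lemma CB_vals: "fst (cmp (CB U) p q) = fst p" "snd (cmp (CB U) p q) = snd p |+| snd q"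
 "act (CB U) r q = (fst r, act A (fst (snd r)) (snd q))" "src (CB U) b = (fst b, src A (snd b))"
 "ginv (CH U) r = (snd (snd r), ginv G (fst (snd r)), fst r)"
 by (simp_all add: cover_mod_sel cover_gpd_sel)

lemma cmp_CB: "cmp (CB U) p q = (fst p, snd p |+| snd q)"
 by (simp add: cover_mod_sel)

lemma arw_inv: "y : NT n ==> i <= n ==> j <= n ==> ginv (CH U) (arw mu y i j) = arw mu y j i"
 by (simp add: arw_def cover_gpd_sel)

theorem factor_set_fc:
 assumes U: "osc U" and c: "c : carrier (ZZ U 2)"
 shows "Ufac U (fc U c)"
 unfolding factor_set_def
proof (intro conjI ballI allI impI)
 note cD = cocycleD[OF c]
 fix ka1 ka2 ka3 assume w: "ka1 : Lam U 1" "ka2 : Lam U 1" "ka3 : Lam U 1"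
 let ?D = "Udom U ka1 ka2 ka3"
 let ?T = "sbt (prt (arr (CH U)) (arr (CH U))) ?D"
 let ?g = "\<lambda>t::('b \<times> 'g \<times> 'b) \<times> 'b \<times> 'g \<times> 'b. fst (snd (fst t))" and ?h = "\<lambda>t::('b \<times> 'g \<times> 'b) \<times> 'b \<times> 'g \<times> 'b. fst (snd (snd t))"
 have T: "(fst t, snd t) : ?D" if "t : pts ?T" for t using that by auto
 \<comment> \<open>Near a given point the index of the 2-simplex can be kept fixed.\<close>
 have loc: "fc U c ka1 ka2 ka3 p q = (ka {2}, c ka (pt2 (fst (snd p)) (fst (snd q))))"
  if d: "(p, q) : ?D" and k: "ka : Lam U 2" "edge 0 1 ka = ka1" "edge 1 2 ka = ka2" "edge 0 2 ka = ka3"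
   and z: "pt2 (fst (snd p)) (fst (snd q)) : UL U 2 ka" for p q ka
 proof -
  note i = fdom_index2[OF U w d]
  let ?z = "pt2 (fst (snd p)) (fst (snd q))"
  let ?k = "mk2 U ka1 ka2 ka3 ?z"
  have v: "ka {0} = ?k {0}" "ka {Suc 0} = ?k {Suc 0}" "ka {2} = ?k {2}"
  proof -
   have "edge 0 1 ka = edge 0 1 ?k" "edge 1 2 ka = edge 1 2 ?k" using k i by simp_all
   from fun_cong[OF this(1), of "{0}"] fun_cong[OF this(1), of "{Suc 0}"] fun_cong[OF this(2), of "{Suc 0}"]
   show "ka {0} = ?k {0}" "ka {Suc 0} = ?k {Suc 0}" "ka {2} = ?k {2}" by simp_all
  qed
  have "arw ka ?z 0 1 = p" "arw ka ?z 1 2 = q" using i(6,7) v unfolding arw_def by simp_all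
  then show ?thesis using fc_eq[OF U c k(1) z] k by simp
 qed
 show "cts ?T (arr (CB U)) (\<lambda>(p, q). fc U c ka1 ka2 ka3 p q)"
 proof (rule continuous_map_local)
  fix t0 assume t0: "t0 : pts ?T"
  let ?z0 = "pt2 (?g t0) (?h t0)"
  define ka where "ka = mk2 U ka1 ka2 ka3 ?z0"
  note i = fdom_index2[OF U w T[OF t0], folded ka_def]
  have f1: "cts ?T (arr (CH U)) fst" and f2: "cts ?T (arr (CH U)) snd"
   by (rule cont_fst_sub, rule cont_snd_sub)
  have cg: "cts ?T (arr G) ?g" and ch: "cts ?T (arr G) ?h"
   using f1 f2 unfolding cover_arr_cont by blast+
  have gh: "src G (?g t) = rng G (?h t)" if "t : pts ?T" for t
   using fdomD[OF T[OF that]] by (simp add: cover_gpd_sel)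
  have cz: "cts ?T (N 2) (\<lambda>t. pt2 (?g t) (?h t))" by (rule cont_pt2[OF cg ch gh])
  define O' where "O' = {t : pts ?T. pt2 (?g t) (?h t) : UL U 2 ka}"
  have O': "openin ?T O'" unfolding O'_def by (rule openin_preimage[OF cz Ulam_open[OF U i(1)]])
  let ?T' = "sbt ?T O'"
  have P: "t : pts ?T & pt2 (?g t) (?h t) : UL U 2 ka" if "t : pts ?T'" for t
   using that by (auto simp: O'_def)
  have k2: "ka {2} : fst (U 0)" using i(1) unfolding Lam_def by (auto dest: PiE_mem[of _ _ _ "{2}"])
  have "cts ?T' (sbt (N 2) (UL U 2 ka)) (\<lambda>t. pt2 (?g t) (?h t))"
   using cz P by (auto simp: continuous_map_in_subtopology intro: continuous_map_from_subtopology)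
  moreover have "cts (sbt (N 2) (UL U 2 ka)) (arr A) (c ka)"
   using cochain_at[OF cD(1) i(1)] unfolding sec_carrier by blast
  ultimately have cc: "cts ?T' (arr A) (\<lambda>t. c ka (pt2 (?g t) (?h t)))"
   using continuous_map_compose by (fastforce simp: o_def)
  have "cts ?T' (arr (CB U)) (\<lambda>t. (ka {2}, c ka (pt2 (?g t) (?h t))))"
   unfolding cover_mod_cont fst_conv snd_conv
  proof (intro conjI ballI cc)
   show "cts ?T' (dsc (fst (base_cover U))) (\<lambda>t. ka {2})"
    using k2 by (simp add: base_cover_sel)
   fix t assume "t : pts ?T'"
   note p = P[OF this]
   show "src A (c ka (pt2 (?g t) (?h t))) : snd (base_cover U) (ka {2})"
    using sec_D[OF Ulam_sub cochain_at[OF cD(1) i(1)], of "pt2 (?g t) (?h t)"] p Ulam_vertex[of _ U 2 ka 2]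
     base_mem[OF U k2] by simp
  qed
  then have "cts ?T' (arr (CB U)) (\<lambda>(p, q). fc U c ka1 ka2 ka3 p q)"
  proof (rule continuous_map_eq)
   fix t assume "t : pts ?T'"
   note p = P[OF this]
   show "(ka {2}, c ka (pt2 (?g t) (?h t))) = (case t of (p, q) => fc U c ka1 ka2 ka3 p q)"
    using loc[OF T i(1,3,4,5)] p by (simp add: case_prod_unfold)
  qed
  moreover have "t0 : O'" using t0 i(2) unfolding O'_def by simp
  ultimately show "\<exists>Q. openin ?T Q & t0 : Q & cts (sbt ?T Q) (arr (CB U)) (\<lambda>(p, q). fc U c ka1 ka2 ka3 p q)"
   using O' by blast
 qed
 fix p q assume d: "(p, q) : ?D"
 note i = fdom_index2[OF U w d]
 let ?z = "pt2 (fst (snd p)) (fst (snd q))"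
 have zt: "?z : NT 2" using i(2) Ulam_sub by blast
 show "src (CB U) (fc U c ka1 ka2 ka3 p q) = src (CH U) q"
  using sec_D(2)[OF Ulam_sub cochain_at[OF cD(1) i(1)] i(2)] fdomD[OF d]
  by (simp add: fc_def Let_def CB_vals cover_gpd_sel pt_vertex Ar_cover)
next
 note cD = cocycleD[OF c]
 fix w01 w12 w23 w02 w13 w03 p q r
 assume w: "w01 : Lam U 1" "w12 : Lam U 1" "w23 : Lam U 1" "w02 : Lam U 1" "w13 : Lam U 1" "w03 : Lam U 1"
  and d: "(p, q) : Udom U w01 w12 w02" "(cmp (CH U) p q, r) : Udom U w02 w23 w03"
   "(q, r) : Udom U w12 w23 w13" "(p, cmp (CH U) q r) : Udom U w01 w13 w03"
 obtain mu y where my: "mu : Lam U 3" "y : UL U 3 mu" "edge 0 1 mu = w01" "edge 1 2 mu = w12" "edge 2 3 mu = w23"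
  "edge 0 2 mu = w02" "edge 1 3 mu = w13" "edge 0 3 mu = w03" "arw mu y 0 1 = p" "arw mu y 1 2 = q" "arw mu y 2 3 = r"
  using fdom_index3[OF U w d] by blast
 have yt: "y : NT 3" using my Ulam_sub by blast
 note f = face_3[OF my(1,2)]
 note F = fc_eq[OF U c f(1,2)]
 have pq: "cmp (CH U) p q = arw mu y 0 2" "cmp (CH U) q r = arw mu y 1 3"
  using arw_fdom(2)[OF U my(1,2), of 0 1 2] arw_fdom(2)[OF U my(1,2), of 1 2 3] my by simp_all
 let ?C = "\<lambda>b. c (lam_face 2 (coface 3 b) mu) (smap M 2 3 (coface 3 b) y)"
 have F3: "fc U c w01 w12 w02 p q = (mu {2}, ?C 3)"
  using F[of 3] f(3)[of 0 1 3] f(3)[of 1 2 3] f(3)[of 0 2 3] f(4)[of 0 1 3] f(4)[of 1 2 3] f(5)[of 3] my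
  by (simp add: coface_3)
 have F1: "fc U c w02 w23 w03 (cmp (CH U) p q) r = (mu {3}, ?C 1)"
  using F[of 1] f(3)[of 0 1 1] f(3)[of 1 2 1] f(3)[of 0 2 1] f(4)[of 0 1 1] f(4)[of 1 2 1] f(5)[of 1] my pq
  by (simp add: coface_3 coface_3[unfolded One_nat_def])
 have F2: "fc U c w01 w13 w03 p (cmp (CH U) q r) = (mu {3}, ?C 2)"
  using F[of 2] f(3)[of 0 1 2] f(3)[of 1 2 2] f(3)[of 0 2 2] f(4)[of 0 1 2] f(4)[of 1 2 2] f(5)[of 2] my pq
  by (simp add: coface_3 coface_3[unfolded One_nat_def])
 have F0: "fc U c w12 w23 w13 q r = (mu {3}, ?C 0)"
  using F[of 0] f(3)[of 0 1 0] f(3)[of 1 2 0] f(3)[of 0 2 0] f(4)[of 0 1 0] f(4)[of 1 2 0] f(5)[of 0] my pq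
  by (simp add: coface_3 coface_3[unfolded One_nat_def])
 have r: "ginv (CH U) r = arw mu y 3 2" unfolding my(11)[symmetric] by (rule arw_inv[OF yt]) simp_all
 show "cmp (CB U) (fc U c w02 w23 w03 (cmp (CH U) p q) r) (act (CB U) (ginv (CH U) r) (fc U c w01 w12 w02 p q)) =
    cmp (CB U) (fc U c w01 w13 w03 p (cmp (CH U) q r)) (fc U c w12 w23 w13 q r)"
  unfolding F0 F1 F2 F3 r
  using cocycle_identity[OF cD(1) my(1,2)] cD(2)[OF my(1,2)] by (simp add: cmp_CB CB_vals arw_def)
qed

theorem cval_cocycle:
 assumes U: "osc U" and f: "Ufac U f"
 shows "cval U f : carrier (ZZ U 2)"
proof -
 have val: "fval f ka z = (ka {2}, cval U f ka z)
   & cval U f ka z : Ar A & src A (cval U f ka z) = src G (vx z 2)"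
  if k: "ka : Lam U 2" and z: "z : UL U 2 ka" for ka z
 proof -
  have zt: "z : NT 2" using z Ulam_sub by blast
  let ?f = "fval f ka z"
  have d: "(arw ka z 0 1, arw ka z 1 2) : Udom U (edge 0 1 ka) (edge 1 2 ka) (edge 0 2 ka)"
   using arw_fdom(1)[OF U k z, of 0 1 2] by simp
  have L: "edge 0 1 ka : Lam U 1" "edge 1 2 ka : Lam U 1" "edge 0 2 ka : Lam U 1" using Lam_edge[OF k] by auto
  have "?f : Ar (CB U)" "src (CB U) ?f = src (CH U) (arw ka z 1 2)" using factor_setD(1,2)[OF f L d] by auto
  then have "fst ?f = ka {2}" "snd ?f : Ar A" "src A (snd ?f) = src G (vx z 2)"
   using zt unfolding CB_vals Ar_cover_mod by (simp_all add: cover_gpd_sel arw_def)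
  then show ?thesis using k z unfolding cval_def by (simp add: prod_eq_iff)
 qed
 have c: "cval U f : carrier (CC U 2)"
  unfolding cochains_carrier
 proof (rule PiE_I)
  fix ka assume k: "ka : Lam U 2"
  let ?T = "sbt (N 2) (UL U 2 ka)"
  have L: "edge 0 1 ka : Lam U 1" "edge 1 2 ka : Lam U 1" "edge 0 2 ka : Lam U 1" using Lam_edge[OF k] by auto
  have T: "z : UL U 2 ka" if "z : pts ?T" for z using that by simp
  have kin: "ka {i} : fst (U 0)" if "i <= 2" for i
   using k that unfolding Lam_def by (auto dest: PiE_mem[of _ _ _ "{i}"])
  have ca: "cts ?T (arr (CH U)) (\<lambda>z. arw ka z i j)" if ij: "i < j" "j <= 2" for i j
   unfolding cover_arr_cont
  proof (intro conjI ballI)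
   show "cts ?T (dsc (fst (base_cover U))) (\<lambda>z. fst (arw ka z i j))"
    "cts ?T (dsc (fst (base_cover U))) (\<lambda>z. snd (snd (arw ka z i j)))"
    using kin ij by (simp_all add: arw_def base_cover_sel)
   show "cts ?T (arr G) (\<lambda>z. fst (snd (arw ka z i j)))"
    using cont_vertex_quot[of i 2 j] ij by (simp add: arw_def continuous_map_from_subtopology)
   fix z assume "z : pts ?T"
   from arw_in[OF U k T[OF this] ij]
   show "rng G (fst (snd (arw ka z i j))) : snd (base_cover U) (fst (arw ka z i j))"
    "src G (fst (snd (arw ka z i j))) : snd (base_cover U) (snd (snd (arw ka z i j)))" unfolding Ar_cover by blast+
  qed
  have "cts ?T (arr (CB U)) (\<lambda>z. fval f ka z)"
   by (rule factor_setD(3)[OF f L]) (use ca arw_fdom(1)[OF U k, of _ 0 1 2] in auto)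
  then have "cts ?T (arr A) (\<lambda>z. snd (fval f ka z))"
   unfolding cover_mod_cont by blast
  moreover have "cval U f ka = (\<lambda>z\<in>UL U 2 ka. snd (fval f ka z))"
   using k unfolding cval_def by simp
  ultimately show "cval U f ka : carrier (sec S 2 (UL U 2 ka))"
   using secI[of 2 "UL U 2 ka"] val[OF k] by simp
 qed (simp add: cval_def)
 show ?thesis
 proof (rule cocycleI[OF c])
  fix mu y assume m: "mu : Lam U 3" and y: "y : UL U 3 mu"
  have yt: "y : NT 3" using y Ulam_sub by blast
  note g = face_3[OF m y]
  note V = val[OF g(1,2), THEN conjunct1]
  let ?C = "\<lambda>b. cval U f (lam_face 2 (coface 3 b) mu) (smap M 2 3 (coface 3 b) y)"
  let ?e = "\<lambda>i j. edge i j mu" and ?a = "\<lambda>i j. arw mu y i j"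
  have V3: "f (?e 0 1) (?e 1 2) (?e 0 2) (?a 0 1) (?a 1 2) = (mu {2}, ?C 3)"
   using V[of 3] g(3)[of 0 1 3] g(3)[of 1 2 3] g(3)[of 0 2 3] g(4)[of 0 1 3] g(4)[of 1 2 3] g(5)[of 3] by (simp add: coface_3)
  have V1: "f (?e 0 2) (?e 2 3) (?e 0 3) (?a 0 2) (?a 2 3) = (mu {3}, ?C 1)"
   using V[of 1] g(3)[of 0 1 1] g(3)[of 1 2 1] g(3)[of 0 2 1] g(4)[of 0 1 1] g(4)[of 1 2 1] g(5)[of 1]
   by (simp add: coface_3 coface_3[unfolded One_nat_def])
  have V2: "f (?e 0 1) (?e 1 3) (?e 0 3) (?a 0 1) (?a 1 3) = (mu {3}, ?C 2)"
   using V[of 2] g(3)[of 0 1 2] g(3)[of 1 2 2] g(3)[of 0 2 2] g(4)[of 0 1 2] g(4)[of 1 2 2] g(5)[of 2]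
   by (simp add: coface_3 coface_3[unfolded One_nat_def])
  have V0: "f (?e 1 2) (?e 2 3) (?e 1 3) (?a 1 2) (?a 2 3) = (mu {3}, ?C 0)"
   using V[of 0] g(3)[of 0 1 0] g(3)[of 1 2 0] g(3)[of 0 2 0] g(4)[of 0 1 0] g(4)[of 1 2 0] g(5)[of 0]
   by (simp add: coface_3 coface_3[unfolded One_nat_def])
  note a = arw_fdom[OF U m y]
  have q: "cmp (CH U) (?a 0 1) (?a 1 2) = ?a 0 2" "cmp (CH U) (?a 1 2) (?a 2 3) = ?a 1 3" using a(2)[of 0 1 2] a(2)[of 1 2 3] by simp_all
  have L: "?e i j : Lam U 1" if "i < j" "j <= 3" for i j using Lam_edge[OF m that] .
  have "cmp (CB U) (f (?e 0 2) (?e 2 3) (?e 0 3) (cmp (CH U) (?a 0 1) (?a 1 2)) (?a 2 3))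
    (act (CB U) (ginv (CH U) (?a 2 3)) (f (?e 0 1) (?e 1 2) (?e 0 2) (?a 0 1) (?a 1 2))) =
   cmp (CB U) (f (?e 0 1) (?e 1 3) (?e 0 3) (?a 0 1) (cmp (CH U) (?a 1 2) (?a 2 3))) (f (?e 1 2) (?e 2 3) (?e 1 3) (?a 1 2) (?a 2 3))"
  proof (rule factor_set_cocycle[OF f])
   show "(?a 0 1, ?a 1 2) : Udom U (?e 0 1) (?e 1 2) (?e 0 2)" using a(1)[of 0 1 2] by simp
   show "(cmp (CH U) (?a 0 1) (?a 1 2), ?a 2 3) : Udom U (?e 0 2) (?e 2 3) (?e 0 3)"
    unfolding q using a(1)[of 0 2 3] by simp
   show "(?a 1 2, ?a 2 3) : Udom U (?e 1 2) (?e 2 3) (?e 1 3)" using a(1)[of 1 2 3] by simp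
   show "(?a 0 1, cmp (CH U) (?a 1 2) (?a 2 3)) : Udom U (?e 0 1) (?e 1 3) (?e 0 3)"
    unfolding q using a(1)[of 0 1 3] by simp
  qed (rule L; simp)+
  then have "?C 1 |+| act A (fst (snd (?a 3 2))) (?C 3) = ?C 2 |+| ?C 0"
   unfolding q V0 V1 V2 V3 arw_inv[OF yt, of 2 3, simplified] by (simp add: cmp_CB CB_vals)
  then show "cob U 2 (cval U f) mu y = idn A (src G (vx y 3))"
   unfolding cocycle_identity[OF c m y] by (simp add: arw_def)
 qed
qed

lemma cval_eq:
 assumes U: "osc U" and f: "Ufac U f"
  and k: "ka : Lam U 2" and z: "z : UL U 2 ka"
 shows "fval f ka z = (ka {2}, cval U f ka z)"
proof -
 have zt: "z : NT 2" using z Ulam_sub by blast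
 have d: "(arw ka z 0 1, arw ka z 1 2) : Udom U (edge 0 1 ka) (edge 1 2 ka) (edge 0 2 ka)"
  using arw_fdom(1)[OF U k z, of 0 1 2] by simp
 have L: "edge 0 1 ka : Lam U 1" "edge 1 2 ka : Lam U 1" "edge 0 2 ka : Lam U 1" using Lam_edge[OF k] by auto
 show ?thesis using factor_setD(1)[OF f L d] k z unfolding cval_def CB_vals
  by (simp add: prod_eq_iff cover_gpd_sel arw_def)
qed

lemma presents_imp_cocycle:
 assumes U: "osc U" and f: "Ufac U f"
  and pr: "Upres U X sg f"
 shows "LF U X sg" "IC U X sg (cval U f)"
proof -
 show "LF U X sg" unfolding is_lifting_family_def using presentsD(1)[OF pr] by blast
 show "IC U X sg (cval U f)"
  unfolding is_ext_cocycle_alt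
 proof (intro conjI ballI cval_cocycle[OF U f])
  fix ka z assume k: "ka : Lam U 2" and z: "z : UL U 2 ka"
  have d: "(arw ka z 0 1, arw ka z 1 2) : Udom U (edge 0 1 ka) (edge 1 2 ka) (edge 0 2 ka)"
   and e: "cmp (CH U) (arw ka z 0 1) (arw ka z 1 2) = arw ka z 0 2"
   using arw_fdom[OF U k z, of 0 1 2] by simp_all
  have L: "edge 0 1 ka : Lam U 1" "edge 1 2 ka : Lam U 1" "edge 0 2 ka : Lam U 1" using Lam_edge[OF k] by auto
  show "Em X (lfat sg ka z 0 1) (lfat sg ka z 1 2) =
   tr X (lfat sg ka z 0 2) (ka {2}, cval U f ka z)"
   using presentsD(2)[OF pr L d] unfolding e cval_eq[OF U f k z] by blast
 qed
qed

lemma cocycle_imp_presents: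
 assumes U: "osc U" and l: "LF U X sg" and c: "IC U X sg c"
 shows "Upres U X sg (fc U c)"
proof -
 have cz: "c : carrier (ZZ U 2)" using c unfolding is_ext_cocycle_alt by blast
 note f = factor_set_fc[OF U cz]
 show ?thesis unfolding presents_def
 proof (intro conjI ballI allI impI)
  fix ka assume "ka : Lam U 1"
  then show "is_lifting (CH U) X (ES U ka) (sg ka)" using l unfolding is_lifting_family_def by blast
 next
  fix ka1 ka2 ka3 p q assume w: "ka1 : Lam U 1" "ka2 : Lam U 1" "ka3 : Lam U 1"
   and d: "(p, q) : Udom U ka1 ka2 ka3"
  show "fc U c ka1 ka2 ka3 p q : Ar (CB U)" "src (CB U) (fc U c ka1 ka2 ka3 p q) = src (CH U) q"
   using factor_setD(1,2)[OF f w d] by auto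
  define z where "z = pt2 (fst (snd p)) (fst (snd q))"
  define ka where "ka = mk2 U ka1 ka2 ka3 z"
  note i = fdom_index2[OF U w d, folded z_def, folded ka_def]
  have pq: "cmp (CH U) p q = arw ka z 0 2" using arw_fdom(2)[OF U i(1,2), of 0 1 2] i(6,7) by simp
  have "Em X (lfat sg ka z 0 1) (lfat sg ka z 1 2) =
   tr X (lfat sg ka z 0 2) (ka {2}, c ka z)"
   using c i(1,2) unfolding is_ext_cocycle_alt by blast
  then show "Em X (sg ka1 p) (sg ka2 q) = tr X (sg ka3 (cmp (CH U) p q)) (fc U c ka1 ka2 ka3 p q)"
   using fc_eq[OF U cz i(1,2)] unfolding i(3-7) pq by simp
 qed
qed

end

section \<open>Extensions with liftings and the second cohomology\<close>

context nerve_module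
begin

lemma cont_arw:
 assumes U: "osc U" and k: "ka : Lam U n" and ij: "i < j" "j <= n"
 shows "cts (sbt (N n) (UL U n ka)) (arr (CH U)) (\<lambda>z. arw ka z i j)"
 unfolding cover_arr_cont
proof (intro conjI ballI)
 let ?T = "sbt (N n) (UL U n ka)"
 have kin: "ka {i} : fst (U 0)" if "i <= n" for i
  using k that unfolding Lam_def by (auto dest: PiE_mem[of _ _ _ "{i}"])
 show "cts ?T (dsc (fst (base_cover U))) (\<lambda>z. fst (arw ka z i j))"
  "cts ?T (dsc (fst (base_cover U))) (\<lambda>z. snd (snd (arw ka z i j)))"
  using kin ij by (simp_all add: arw_def base_cover_sel)
 show "cts ?T (arr G) (\<lambda>z. fst (snd (arw ka z i j)))"
  using cont_vertex_quot[of i n j] ij by (simp add: arw_def continuous_map_from_subtopology)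
 fix z assume "z : pts ?T"
 then have "z : UL U n ka" by simp
 from arw_in[OF U k this ij]
 show "rng G (fst (snd (arw ka z i j))) : snd (base_cover U) (fst (arw ka z i j))"
  "src G (fst (snd (arw ka z i j))) : snd (base_cover U) (snd (snd (arw ka z i j)))" unfolding Ar_cover by blast+
qed

lemma cover_ext_base: "cover_ext G A"
 using H.tg md by unfold_locales

text \<open>The index of dimension 1 with end points \<open>i\<close>, \<open>j\<close> and edge
 \<open>e\<close>.\<close>

definition kk :: "'i => 'i => 'i => nat set => 'i" where
 "kk i e j = (\<lambda>s\<in>faces 1. if s = {0} then i else if s = {Suc 0} then j else e)"

lemma kk_vals[simp]: "kk i e j {0} = i" "kk i e j {Suc 0} = j" "kk i e j {0, Suc 0} = e"
 by (simp_all add: kk_def faces_1)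

lemma kk_in: "i : fst (U 0) ==> j : fst (U 0) ==> e : fst (U 1) ==> kk i e j : Lam U 1"
 unfolding Lam_def kk_def faces_1 using sdim_pair[of 0 "Suc 0"] by (intro iffD2[OF restrict_PiE_iff]) auto

lemma kk_edge_set:
 assumes U: "osc U" and p: "p : Ar (CH U)" and e: "pt1 (fst (snd p)) : snd (U 1) e"
 shows "p : ES U (kk (fst p) e (snd (snd p)))"
proof -
 have "fst p : fst (U 0)" "snd (snd p) : fst (U 0)" using p unfolding Ar_cover base_cover_sel(1) by auto
 then show ?thesis
  using p e unfolding edge_set_iff Ar_cover by (simp add: pt1_Ulam[unfolded One_nat_def] base_mem[OF U])
qed

text \<open>Liftings over all $U^1_\lambda$ imply local splitting in the strong sense, with a neighbourhood
 in $G$ that serves all pairs $(i, j)$: the set $U^1_e$ of any edge index $e$ is such a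
 neighbourhood.\<close>

lemma ext_lifting_presented:
 assumes U: "osc U"
 shows "P : EL U \<longleftrightarrow> (\<exists>f. Ucls U P f)"
proof -
 interpret C: cover_ext G A "base_cover U" by (rule cover_ext_base)
 show ?thesis
 proof
  assume "P : EL U"
  then obtain X sg where P: "P : carrier (EG (base_cover U))" "X : P" "LF U X sg"
   unfolding ext_lifting_def by blast
  obtain W f where W: "nbhds G W" "class_presented (CH U) (CB U) (Ar G) (cyl G (base_cover U) W) P f"
   using P(1) unfolding C.ext_group_carrier by blast
  note m = C.class_presented_member[OF W(2) C.gcover_cyl[OF W(1)] P(2)]
  interpret X: ext "CH U" "CB U" X using m(1) by unfold_locales
  have "\<exists>f. Ufac U f & Upres U X sg f"
   by (rule X.liftings_imp_factor_set) (use P(3) in \<open>simp add: is_lifting_family_def\<close>)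
  then show "\<exists>f. Ucls U P f"
   unfolding class_presented_def using m(1,3) by blast
 next
  assume "\<exists>f. Ucls U P f"
  then obtain f and X :: "('b \<times> 'x, 'b \<times> 'a, 'b \<times> 'g \<times> 'b, ('b \<times> 'a) \<times> ('b \<times> 'g \<times> 'b)) extn" and sg where
   X: "extension (CH U) (CB U) X" "Upres U X sg f" "P = ext_class (CH U) (CB U) X"
   unfolding class_presented_def by blast
  interpret X: ext "CH U" "CB U" X using X(1) by unfold_locales
  have "\<forall>g\<in>Ar G. \<exists>e. e : fst (U 1) & pt1 g : snd (U 1) e" using scoverD(2)[OF U] pt_in(2) by blast
  from bchoice[OF this] obtain e where e: "\<And>g. g : Ar G ==> e g : fst (U 1) & pt1 g : snd (U 1) (e g)" by blast
  define W where "W g = {h : Ar G. pt1 h : snd (U 1) (e g)}" for g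
  have cp: "cts (arr G) (N 1) pt1"
   unfolding pt1_def
  proof (rule into_N)
   show "cts (arr G) (obj G) (\<lambda>t. rng G t)" by (rule H.cont_rng) simp
   show "cts (arr G) (arr G) (\<lambda>t. (\<lambda>j\<in>{1..1}. t) i)" if "i : {1..1}" for i :: nat using that by simp
   show "(rng G t, \<lambda>j\<in>{1..1}. t) : NT 1" if "t : Ar G" for t
    using pt_in(2)[OF that] unfolding pt1_def .
  qed
  have W: "nbhds G W"
   unfolding nbhds_def W_def using e openin_preimage[OF cp scoverD(1)[OF U]] by blast
  have lift: "is_lifting (CH U) X (cyl G (base_cover U) W g) (\<lambda>p. sg (kk (fst p) (e g) (snd (snd p))) p)"
   if g: "g : Ar G" for g
  proof -
   have kp: "kk (fst p) (e g) (snd (snd p)) : Lam U 1 & p : ES U (kk (fst p) (e g) (snd (snd p))) & p : Ar (CH U)"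
    if "p : cyl G (base_cover U) W g" for p
    using that kk_edge_set[OF U, of p "e g"] e[OF g] kk_in[of "fst p" U "snd (snd p)" "e g"]
    unfolding cyl_def W_def by (auto simp: Ar_cover base_cover_sel)
   let ?T = "sbt (arr (CH U)) (cyl G (base_cover U) W g)"
   have "cts ?T (Ea X) (\<lambda>p. sg (kk (fst p) (e g) (snd (snd p))) p)"
   proof (rule continuous_map_local)
    fix p0 assume p0: "p0 : pts ?T"
    define ka where "ka = kk (fst p0) (e g) (snd (snd p0))"
    have k: "ka : Lam U 1" "p0 : ES U ka" using kp p0 unfolding ka_def by auto
    let ?N = "ES U ka \<inter> cyl G (base_cover U) W g"
    have N: "openin ?T ?N"
     using gcoverD(2)[OF gcover_edge[OF U] k(1)] by (metis openin_subtopology_Int)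
    have "cts (sbt ?T ?N) (arr (CH U)) (\<lambda>p. p)"
     by (intro continuous_map_from_subtopology cont_id_sub)
    then have "cts (sbt ?T ?N) (Ea X) (\<lambda>p. sg ka p)"
     by (rule cont_lift[OF presentsD(1)[OF X(2) k(1)]]) auto
    then have "cts (sbt ?T ?N) (Ea X) (\<lambda>p. sg (kk (fst p) (e g) (snd (snd p))) p)"
    proof (rule continuous_map_eq)
     fix p assume "p : pts (sbt ?T ?N)"
     then have "p : ES U ka" by auto
     then have "p = (ka {0}, fst (snd p), ka {Suc 0})" using edge_setD by blast
     then have "fst p = fst p0" "snd (snd p) = snd (snd p0)" unfolding ka_def kk_vals by (metis fst_conv, metis snd_conv)
     then show "sg ka p = sg (kk (fst p) (e g) (snd (snd p))) p" unfolding ka_def by simp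
    qed
    then show "\<exists>N. openin ?T N & p0 : N & cts (sbt ?T N) (Ea X) (\<lambda>p. sg (kk (fst p) (e g) (snd (snd p))) p)"
     using N k(2) p0 by (intro exI[of _ ?N]) auto
   qed
   then show ?thesis
    unfolding is_lifting_def using kp X.liftD(2)[OF presentsD(1)[OF X(2)]] by auto
  qed
  have "\<exists>f. factor_set (CH U) (CB U) (Ar G) (cyl G (base_cover U) W) f &
   presents (CH U) (CB U) (Ar G) (cyl G (base_cover U) W) X (\<lambda>g p. sg (kk (fst p) (e g) (snd (snd p))) p) f"
   by (rule X.liftings_imp_factor_set) (rule lift)
  then have "P : carrier (EG (base_cover U))"
   unfolding C.ext_group_carrier class_presented_def using W X(1,3) by blast
  moreover have "X : P" unfolding X(3) by (rule C.in_ext_class[OF X(1)])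
  moreover have "LF U X sg" unfolding is_lifting_family_def using presentsD(1)[OF X(2)] by blast
  ultimately show "P : EL U" unfolding ext_lifting_def by blast
 qed
qed

lemma ext_lifting_subgroup:
 assumes U: "osc U"
 shows "subgroup (EL U) (EG (base_cover U))"
proof -
 interpret C: cover_ext G A "base_cover U" by (rule cover_ext_base)
 show ?thesis
 proof (rule C.presented_subgroup[OF gcover_edge[OF U]])
  show "EL U = {P. \<exists>f. Ucls U P f}"
   using ext_lifting_presented[OF U] by blast
  show "EL U \<subseteq> carrier (EG (base_cover U))" unfolding ext_lifting_def by blast
 qed
qed

subsection \<open>Changing the liftings\<close>

lemma edge_self: "ka : Lam U 1 ==> edge 0 1 ka = ka"
 by (rule Lam_1_eqI[OF Lam_edge[of ka U 1 0 1]]) simp_all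

lemma cterm_1:
 assumes c: "b : carrier (CC U 1)" and k: "ka : Lam U 2" and z: "z : UL U 2 ka"
 defines "g \<equiv> (\<lambda>i j. gap z i j)"
 shows "cterm U 1 b ka 0 z = b (edge 1 2 ka) (pt1 (g 1 2))" "cterm U 1 b ka 1 z = b (edge 0 2 ka) (pt1 (g 0 2))"
  "cterm U 1 b ka 2 z = act A (g 2 1) (b (edge 0 1 ka) (pt1 (g 0 1)))"
proof -
 have zt: "z : NT 2" using z Ulam_sub by blast
 have E: "Suc 1 = 2" by simp
 note low = cterm_low[of b U 1 ka z, unfolded E, OF c k z]
 have s: "smap M 1 2 (coface 2 0) z = pt1 (g 1 2)" "smap M 1 2 (coface 2 1) z = pt1 (g 0 2)"
  "smap M 1 2 (coface 2 2) z = pt1 (g 0 1)"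
  unfolding g_def by (subst smap_1[OF zt]; simp add: coface_def numeral_2_eq_2)+
 show "cterm U 1 b ka 0 z = b (edge 1 2 ka) (pt1 (g 1 2))" "cterm U 1 b ka 1 z = b (edge 0 2 ka) (pt1 (g 0 2))"
  using low[of 0] low[of 1] unfolding s face_coface_2 by simp_all
 show "cterm U 1 b ka 2 z = act A (g 2 1) (b (edge 0 1 ka) (pt1 (g 0 1)))"
  using cterm_top[of z U 1 ka b, unfolded E, OF z] unfolding s face_coface_2 g_def .
qed

lemma cochain_1_value:
 assumes b: "b : carrier (CC U 1)" and k: "ka : Lam U 1" and p: "p : ES U ka"
 shows "b ka (pt1 (fst (snd p))) : Ar A" "src A (b ka (pt1 (fst (snd p)))) = src G (fst (snd p))"
proof -
 note d = p[unfolded edge_set_iff]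
 from sec_D[OF Ulam_sub cochain_at[OF b k], of "pt1 (fst (snd p))"] d
 show "b ka (pt1 (fst (snd p))) : Ar A" "src A (b ka (pt1 (fst (snd p)))) = src G (fst (snd p))"
  by (simp_all add: pt_vertex)
qed

lemma cochains_eqI:
 assumes "c : carrier (CC U n)" "c' : carrier (CC U n)"
  "\<And>ka z. ka : Lam U n ==> z : UL U n ka ==> c ka z = c' ka z"
 shows "c = c'"
proof (rule PiE_ext)
 show "c : (\<Pi>\<^sub>E ka\<in>Lam U n. carrier (sec S n (UL U n ka)))" "c' : (\<Pi>\<^sub>E ka\<in>Lam U n. carrier (sec S n (UL U n ka)))"
  using assms unfolding cochains_carrier by auto
 fix ka assume k: "ka : Lam U n"
 have "c ka : extensional (UL U n ka)" "c' ka : extensional (UL U n ka)"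
  using cochain_at[OF assms(1) k] cochain_at[OF assms(2) k] unfolding sec_carrier by auto
 then show "c ka = c' ka" using assms(3)[OF k] by (rule extensionalityI)
qed

lemma cochains_mult_at: "ka : Lam U n ==> z : UL U n ka ==> (c \<otimes>\<^bsub>CC U n\<^esub> d) ka z = cmp A (c ka z) (d ka z)"
 by (simp add: cochains_mult sec_mult)

text \<open>A 1-cochain as a function on the arrows of the cover groupoid, with values in the pulled back
 module.\<close>

definition tw :: "((nat set => 'i) => 'x \<times> (nat => 'g) => 'a) => (nat set => 'i) => 'i \<times> 'g \<times> 'i => 'i \<times> 'a" where
 "tw b ka p = (ka {Suc 0}, b ka (pt1 (fst (snd p))))"

lemma tw_in:
 assumes U: "osc U" and b: "b : carrier (CC U 1)" and k: "ka : Lam U 1" and p: "p : ES U ka"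
 shows "tw b ka p : Ar (CB U)" "src (CB U) (tw b ka p) = src (CH U) p"
proof -
 have "p = (ka {0}, fst (snd p), ka {Suc 0})" using p edge_setD by blast
 then have e: "snd (snd p) = ka {Suc 0}" by (metis snd_conv)
 show "tw b ka p : Ar (CB U)" "src (CB U) (tw b ka p) = src (CH U) p"
  using cochain_1_value[OF b k p] subsetD[OF edge_set_sub[OF U k] p] e unfolding Ar_cover_mod Ar_cover CB_vals tw_def
  by (simp_all add: cover_gpd_sel)
qed

lemma cochain_2_in:
 assumes U: "osc U" and c: "c : carrier (CC U 2)" and k: "ka : Lam U 2" and z: "z : UL U 2 ka"
 shows "(ka {2}, c ka z) : Ar (CB U)" "src (CB U) (ka {2}, c ka z) = src (CH U) (arw ka z 0 2)"
proof -
 have i: "ka {2} : fst (U 0)" using Lam_1_in[OF Lam_edge[OF k, of 1 2]] by simp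
 note v = sec_D[OF Ulam_sub cochain_at[OF c k] z]
 have zt: "z : NT 2" using z Ulam_sub by blast
 show "(ka {2}, c ka z) : Ar (CB U)"
  unfolding Ar_cover_mod base_cover_sel(1) fst_conv snd_conv using i v Ulam_vertex[OF z, of 2] base_mem[OF U i] by simp
 show "src (CB U) (ka {2}, c ka z) = src (CH U) (arw ka z 0 2)"
  unfolding CB_vals fst_conv snd_conv using v zt by (simp add: cover_gpd_sel arw_def)
qed

text \<open>Multiplying the liftings by a 1-cochain changes the cocycle by its coboundary.\<close>

lemma change_of_liftings:
 assumes U: "osc U" and X: "extension (CH U) (CB U) X"
  and s: "LF U X sg" "IC U X sg c"
  and s': "IC U X sg' c'"
  and b: "b : carrier (CC U 1)"
  and eq: "\<And>ka p. ka : Lam U 1 ==> p : ES U ka ==> sg' ka p = tr X (sg ka p) (tw b ka p)"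
 shows "c' = cob U 1 b \<otimes>\<^bsub>CC U 2\<^esub> c"
proof -
 interpret C: cover_ext G A "base_cover U" by (rule cover_ext_base)
 interpret X: ext "CH U" "CB U" X using X by unfold_locales
 interpret C2: comm_group "CC U 2" by (rule cochains_group)
 have cz: "c : carrier (CC U 2)" "c' : carrier (CC U 2)" "c : carrier (ZZ U 2)"
  using s s' unfolding is_ext_cocycle_alt cocycles_carrier by auto
 have db: "cob U 1 b : carrier (CC U 2)" using hom_in_carrier[OF codiff_hom b] by (simp add: numeral_2_eq_2)
 have pr: "Upres U X sg (fc U c)" by (rule cocycle_imp_presents[OF U s])
 show ?thesis
 proof (rule cochains_eqI[OF cz(2) C2.m_closed[OF db cz(1)]])
  fix ka z assume k: "ka : Lam U 2" and z: "z : UL U 2 ka"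
  have zt: "z : NT 2" using z Ulam_sub by blast
  let ?P = "arw ka z 0 1" and ?Q = "arw ka z 1 2" and ?R = "arw ka z 0 2"
  let ?sR = "sg (edge 0 2 ka) ?R" and ?pl = "cmp (CB U)"
  have L: "edge 0 1 ka : Lam U 1" "edge 1 2 ka : Lam U 1" "edge 0 2 ka : Lam U 1" using Lam_edge[OF k] by auto
  have e: "?P : ES U (edge 0 1 ka)" "?Q : ES U (edge 1 2 ka)" "?R : ES U (edge 0 2 ka)"
   using arw_edge_set[OF z] by auto
  have d: "(?P, ?Q) : Udom U (edge 0 1 ka) (edge 1 2 ka) (edge 0 2 ka)" and pq: "cmp (CH U) ?P ?Q = ?R"
   using arw_fdom[OF U k z, of 0 1 2] by simp_all
  have PQ: "?Q : Ar (CH U)" "src (CH U) ?P = rng (CH U) ?Q" "src (CH U) ?R = src (CH U) ?Q"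
   using fdomD[OF d] by (auto simp: pq[symmetric])
  define t1 where "t1 = tw b (edge 0 1 ka) ?P"
  define t2 where "t2 = tw b (edge 1 2 ka) ?Q"
  define t3 where "t3 = tw b (edge 0 2 ka) ?R"
  define C where "C = (ka {2}, c ka z)"
  define C' where "C' = (ka {2}, c' ka z)"
  define a where "a = act (CB U) (ginv (CH U) ?Q) t1"
  note t = tw_in[OF U b L(1) e(1), folded t1_def] tw_in[OF U b L(2) e(2), folded t2_def]
   tw_in[OF U b L(3) e(3), folded t3_def] cochain_2_in[OF U cz(1) k z, folded C_def] cochain_2_in[OF U cz(2) k z, folded C'_def]
  have a: "a : Ar (CB U)" "src (CB U) a = src (CH U) ?Q" unfolding a_def using t PQ by simp_all
  note l3 = X.liftD[OF presentsD(1)[OF pr L(3)] arw_in[OF U k z, of 0 2, simplified] e(3)]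
  have "tr X ?sR (?pl C (?pl a t2)) = Em X (sg' (edge 0 1 ka) ?P) (sg' (edge 1 2 ka) ?Q)"
   unfolding eq[OF L(1) e(1)] eq[OF L(2) e(2)] t1_def[symmetric] t2_def[symmetric] X.presents_mult[OF pr L d t(1,3,2,4)] pq
    fc_eq[OF U cz(3) k z] a_def C_def ..
  also have "\<dots> = tr X (sg' (edge 0 2 ka) ?R) C'"
   using s' k z unfolding is_ext_cocycle_alt C'_def by blast
  also have "\<dots> = tr X ?sR (?pl t3 C')"
   unfolding eq[OF L(3) e(3)] t3_def[symmetric] using l3 t by (simp add: X.i_add)
  finally have main: "?pl C (?pl a t2) = ?pl t3 C'" using l3 t a PQ by (subst (asm) X.i_cancel) auto
  let ?r = "?pl (?pl a (?pl (ginv (CB U) t3) t2)) C"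
  have "?pl t3 ?r = ?pl (?pl t3 (?pl (ginv (CB U) t3) (?pl a t2))) C" using t a PQ by (simp add: C.left_comm)
  also have "\<dots> = ?pl C (?pl a t2)" using t a PQ by (simp add: C.comm)
  finally have "?pl t3 C' = ?pl t3 ?r" unfolding main by simp
  then have "C' = ?r" using t a PQ by (subst (asm) C.add_cancel) auto
  then have "snd C' = snd ?r" by simp
  then show "c' ka z = (cob U 1 b \<otimes>\<^bsub>CC U 2\<^esub> c) ka z"
   unfolding cochains_mult_at[OF k z] codiff_1_eval[OF b k z] cterm_1[OF b k z]
   using zt by (simp add: CB_vals cover_mod_sel C_def C'_def a_def t1_def t2_def t3_def tw_def arw_def)
 qed
qed

lemma twisted_liftings:
 assumes U: "osc U" and X: "extension (CH U) (CB U) X"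
  and s: "LF U X sg" "IC U X sg c" and b: "b : carrier (CC U 1)"
 shows "\<exists>sg'. LF U X sg' & IC U X sg' (cob U 1 b \<otimes>\<^bsub>CC U 2\<^esub> c)"
proof -
 interpret X: ext "CH U" "CB U" X
  using X cover_gpd_groupoid[OF H.tg] cover_module[OF H.tg md] by unfold_locales
 define sg' where "sg' ka p = tr X (sg ka p) (tw b ka p)" for ka p
 have l: "is_lifting (CH U) X (ES U ka) (sg' ka)" if k: "ka : Lam U 1" for ka
 proof -
  let ?T = "sbt (arr (CH U)) (ES U ka)"
  have ls: "is_lifting (CH U) X (ES U ka) (sg ka)" using s(1) k unfolding is_lifting_family_def by blast
  note B = tw_in[OF U b k]
  have id: "cts ?T (arr (CH U)) (\<lambda>p. p)" by (rule cont_id_sub)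
  have c1: "cts ?T (Ea X) (\<lambda>p. sg ka p)" by (rule cont_lift[OF ls id]) auto
  have c2: "cts ?T (arr G) (\<lambda>p. fst (snd p))" using id unfolding cover_arr_cont by blast
  have "cts ?T (N 1) (\<lambda>p. pt1 (fst (snd p)))"
   unfolding pt1_def
  proof (rule into_N)
   show "cts ?T (obj G) (\<lambda>p. rng G (fst (snd p)))" by (rule H.cont_rng[OF c2])
   show "cts ?T (arr G) (\<lambda>p. (\<lambda>j\<in>{1..1}. fst (snd p)) i)" if "i : {1..1}" for i :: nat using that c2 by simp
   show "(rng G (fst (snd p)), \<lambda>j\<in>{1..1}. fst (snd p)) : NT 1" if "p : pts ?T" for p
    using pt_in(2)[OF continuous_map_in[OF c2 that]] unfolding pt1_def .
  qed
  then have "cts ?T (sbt (N 1) (UL U 1 ka)) (\<lambda>p. pt1 (fst (snd p)))"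
   unfolding continuous_map_in_subtopology by (auto simp: edge_set_iff)
  moreover have "cts (sbt (N 1) (UL U 1 ka)) (arr A) (b ka)"
   using cochain_at[OF b k] unfolding sec_carrier by blast
  ultimately have c3: "cts ?T (arr A) (\<lambda>p. b ka (pt1 (fst (snd p))))"
   using continuous_map_compose by (fastforce simp: o_def)
  have c4: "cts ?T (arr (CB U)) (tw b ka)"
   unfolding cover_mod_cont tw_def fst_conv snd_conv
  proof (intro conjI c3 ballI)
   show "cts ?T (dsc (fst (base_cover U))) (\<lambda>p. ka {Suc 0})"
    using Lam_1_in[OF k] by (simp add: base_cover_sel)
   show "src A (b ka (pt1 (fst (snd p)))) : snd (base_cover U) (ka {Suc 0})" if "p : pts ?T" for p
    using B(1)[of p] that unfolding Ar_cover_mod tw_def by auto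
  qed
  have "cts ?T (Ea X) (sg' ka)"
   unfolding sg'_def by (intro X.E.cont_cmp c1 X.cont_i c4) (use B X.liftD[OF ls] in auto)
  moreover have "prj X (sg' ka p) = p" if "p : Ar (CH U) \<inter> ES U ka" for p
   unfolding sg'_def using B[of p] that X.liftD[OF ls, of p] by simp
  ultimately show ?thesis unfolding is_lifting_def by blast
 qed
 then have lf: "LF U X sg'" unfolding is_lifting_family_def by blast
 have "\<exists>f. Ufac U f & Upres U X sg' f"
  by (rule X.liftings_imp_factor_set) (rule l)
 then obtain f where f: "Ufac U f" "Upres U X sg' f" by blast
 note c' = presents_imp_cocycle(2)[OF U f]
 have "cval U f = cob U 1 b \<otimes>\<^bsub>CC U 2\<^esub> c"
  by (rule change_of_liftings[OF U X s c' b]) (simp add: sg'_def)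
 then show ?thesis using lf c' by auto
qed

lemma lifting_difference:
 assumes U: "osc U" and X: "extension (CH U) (CB U) X"
  and s: "LF U X sg" "IC U X sg c"
  and s': "LF U X sg'" "IC U X sg' c'"
 shows "\<exists>b\<in>carrier (CC U 1). c' = cob U 1 b \<otimes>\<^bsub>CC U 2\<^esub> c"
proof -
 interpret X: ext "CH U" "CB U" X
  using X cover_gpd_groupoid[OF H.tg] cover_module[OF H.tg md] by unfold_locales
 have ls: "is_lifting (CH U) X (ES U ka) (sg ka)" "is_lifting (CH U) X (ES U ka) (sg' ka)" if "ka : Lam U 1" for ka
  using s(1) s'(1) that unfolding is_lifting_family_def by auto
 define b where "b = (\<lambda>ka\<in>Lam U 1. \<lambda>z\<in>UL U 1 ka. snd (X.dif (sg ka (arw ka z 0 1)) (sg' ka (arw ka z 0 1))))"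
 have D: "X.dif (sg ka p) (sg' ka p) : Ar (CB U) & src (CB U) (X.dif (sg ka p) (sg' ka p)) = src (CH U) p &
   tr X (sg ka p) (X.dif (sg ka p) (sg' ka p)) = sg' ka p & prj X (sg ka p) = prj X (sg' ka p)"
  if k: "ka : Lam U 1" and p: "p : ES U ka" for ka p
 proof -
  have pa: "p : Ar (CH U)" using edge_set_sub[OF U k] p by blast
  note l = X.liftD[OF ls(1)[OF k] pa p] and l' = X.liftD[OF ls(2)[OF k] pa p]
  show ?thesis using X.dif[of "sg ka p" "sg' ka p"] l l' by simp
 qed
 have az: "arw ka z 0 1 : ES U ka" if "ka : Lam U 1" "z : UL U 1 ka" for ka z
  using arw_edge_set[OF that(2), of 0 1] edge_self[OF that(1)] by simp
 have b: "b : carrier (CC U 1)"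
  unfolding cochains_carrier
 proof (rule PiE_I)
  fix ka assume k: "ka : Lam U 1"
  let ?T = "sbt (N 1) (UL U 1 ka)"
  have T: "z : UL U 1 ka" if "z : pts ?T" for z using that by simp
  have ca: "cts ?T (arr (CH U)) (\<lambda>z. arw ka z 0 1)" by (rule cont_arw[OF U k]) simp_all
  have "cts ?T (arr (CB U)) (\<lambda>z. X.dif (sg ka (arw ka z 0 1)) (sg' ka (arw ka z 0 1)))"
  proof (rule X.cont_dif[OF cont_lift[OF ls(1)[OF k] ca] cont_lift[OF ls(2)[OF k] ca]])
   fix z assume z: "z : pts ?T"
   show "arw ka z 0 1 : ES U ka" by (rule az[OF k T[OF z]])
   then show "arw ka z 0 1 : ES U ka" .
   show "prj X (sg ka (arw ka z 0 1)) = prj X (sg' ka (arw ka z 0 1))" using D[OF k az[OF k T[OF z]]] by blast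
  qed
  then have "cts ?T (arr A) (\<lambda>z. snd (X.dif (sg ka (arw ka z 0 1)) (sg' ka (arw ka z 0 1))))"
   unfolding cover_mod_cont by blast
  then have "(\<lambda>z\<in>UL U 1 ka. snd (X.dif (sg ka (arw ka z 0 1)) (sg' ka (arw ka z 0 1)))) : carrier (sec S 1 (UL U 1 ka))"
  proof (rule secI)
   fix z assume z: "z : UL U 1 ka"
   show "src A (snd (X.dif (sg ka (arw ka z 0 1)) (sg' ka (arw ka z 0 1)))) = src G (vx z 1)"
    using D[OF k az[OF k z]] subsetD[OF Ulam_sub z] unfolding CB_vals by (simp add: cover_gpd_sel arw_def)
  qed
  then show "b ka : carrier (sec S 1 (UL U 1 ka))" using k by (simp add: b_def)
 qed (simp add: b_def)
 have "sg' ka p = tr X (sg ka p) (tw b ka p)"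
  if k: "ka : Lam U 1" and p: "p : ES U ka" for ka p
 proof -
  have q: "p = (ka {0}, fst (snd p), ka {Suc 0})" "fst (snd p) : Ar G" "pt1 (fst (snd p)) : UL U 1 ka"
   using p unfolding edge_set_iff by blast+
  have a: "arw ka (pt1 (fst (snd p))) 0 1 = p" using q(1,2) by (simp add: arw_def pt_vertex)
  have "b ka (pt1 (fst (snd p))) = snd (X.dif (sg ka p) (sg' ka p))" using k q(3) a by (simp add: b_def)
  moreover have "fst (X.dif (sg ka p) (sg' ka p)) = ka {Suc 0}"
  proof -
   have "fst (src (CB U) (X.dif (sg ka p) (sg' ka p))) = snd (snd p)" using D[OF k p] by (simp add: cover_gpd_sel)
   then show ?thesis unfolding CB_vals using q(1) by (metis fst_conv snd_conv)
  qed
  ultimately have "tw b ka p = X.dif (sg ka p) (sg' ka p)" by (simp add: prod_eq_iff tw_def)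
  then show ?thesis using D[OF k p] by simp
 qed
 from change_of_liftings[OF U X s s'(2) b this] b show ?thesis by blast
qed

subsection \<open>The isomorphism for a fixed cover\<close>

lemma coboundaries_2: "coboundaries M S U 2 = cob U 1 ` carrier (CC U 1)"
 by (simp add: coboundaries_def numeral_2_eq_2)

text \<open>That coboundaries are cocycles is seen on the split extension: a 1-cochain twists its
 multiplicative section, and the coboundary is the cocycle of the resulting family of liftings.\<close>

lemma coboundary_cocycle:
 assumes U: "osc U" and b: "b : carrier (CC U 1)"
 shows "cob U 1 b : carrier (ZZ U 2)"
proof -
 interpret C: cover_ext G A "base_cover U" by (rule cover_ext_base)
 interpret Z: comm_group "ZZ U 2" by (rule cocycles_group)
 interpret C2: comm_group "CC U 2" by (rule cochains_group)
 note one = C.one_presented[OF gcover_edge[OF U]]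
 note f = C.class_presented_factor_set[OF one]
 obtain X :: "('b \<times> 'x, 'b \<times> 'a, 'b \<times> 'g \<times> 'b, ('b \<times> 'a) \<times> ('b \<times> 'g \<times> 'b)) extn" and sg where
  X: "extension (CH U) (CB U) X" "Upres U X sg (\<lambda>_ _ _ g h. idn (CB U) (src (CH U) h))"
  using one unfolding class_presented_def by blast
 define c where "c = cval U (\<lambda>_ _ _ g h. idn (CB U) (src (CH U) h))"
 note p = presents_imp_cocycle[OF U f X(2), folded c_def]
 obtain sg' where "IC U X sg' (cob U 1 b \<otimes>\<^bsub>CC U 2\<^esub> c)"
  using twisted_liftings[OF U X(1) p b] by blast
 then have c': "cob U 1 b \<otimes>\<^bsub>CC U 2\<^esub> c : carrier (ZZ U 2)" unfolding is_ext_cocycle_alt by blast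
 have c: "c : carrier (ZZ U 2)" using p(2) unfolding is_ext_cocycle_alt by blast
 let ?d = "inv\<^bsub>ZZ U 2\<^esub> c"
 have d: "?d : carrier (ZZ U 2)" "c \<otimes>\<^bsub>CC U 2\<^esub> ?d = \<one>\<^bsub>CC U 2\<^esub>"
  using c Z.r_inv[OF c] by auto
 have E: "Suc 1 = 2" by simp
 have db: "cob U 1 b : carrier (CC U 2)" using hom_in_carrier[OF codiff_hom b] unfolding E .
 have sub: "x : carrier (CC U 2)" if "x : carrier (ZZ U 2)" for x
  using that unfolding cocycles_carrier by blast
 have "cob U 1 b = (cob U 1 b \<otimes>\<^bsub>CC U 2\<^esub> c) \<otimes>\<^bsub>CC U 2\<^esub> ?d"
  using db sub[OF c] sub[OF d(1)] d(2) by (simp add: C2.m_assoc)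
 moreover have "(cob U 1 b \<otimes>\<^bsub>CC U 2\<^esub> c) \<otimes>\<^bsub>CC U 2\<^esub> ?d : carrier (ZZ U 2)"
  using Z.m_closed[OF c' d(1)] by simp
 ultimately show ?thesis by simp
qed

lemma coboundaries_subgroup:
 assumes U: "osc U"
 shows "subgroup (coboundaries M S U 2) (ZZ U 2)"
proof -
 interpret Z: comm_group "ZZ U 2" by (rule cocycles_group)
 interpret C1: comm_group "CC U 1" by (rule cochains_group)
 have E: "Suc 1 = 2" by simp
 note h = codiff_hom[of U 1, unfolded E]
 have "cob U 1 : hom (CC U 1) (ZZ U 2)"
 proof (rule homI)
  fix x y assume xy: "x : carrier (CC U 1)" "y : carrier (CC U 1)"
  show "cob U 1 (x \<otimes>\<^bsub>CC U 1\<^esub> y) = cob U 1 x \<otimes>\<^bsub>ZZ U 2\<^esub> cob U 1 y"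
   using hom_mult[OF h xy] by simp
 qed (rule coboundary_cocycle[OF U])
 then interpret h: group_hom "CC U 1" "ZZ U 2" "cob U 1" by unfold_locales
 show ?thesis unfolding coboundaries_2 by (rule h.img_is_subgroup)
qed

lemma cohomology_comm_group:
 assumes U: "osc U"
 shows "comm_group (cohomology M S U 2)"
 unfolding cohomology_def
 by (rule comm_group.abelian_FactGroup[OF cocycles_group coboundaries_subgroup[OF U]])

text \<open>All cocycles of members of the class, for all families of liftings.\<close>

definition Phi :: "(('x, 'g, 'i) ncov) => ('x, 'a, 'g, 'i) cover_extn set
  => ((nat set => 'i) => 'x \<times> (nat => 'g) => 'a) set" where
 "Phi U P = {c. \<exists>X\<in>P. \<exists>sg. LF U X sg & IC U X sg c}"

lemma cohom_class_iff:
 "c' : CL U 2 c \<longleftrightarrow> (\<exists>b\<in>carrier (CC U 1). c' = cob U 1 b \<otimes>\<^bsub>CC U 2\<^esub> c)"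
 unfolding cohom_class_def r_coset_def coboundaries_2 by auto

lemma cval_fc:
 assumes U: "osc U" and cz: "c : carrier (ZZ U 2)"
 shows "cval U (fc U c) = c"
proof (rule cochains_eqI)
 show "cval U (fc U c) : carrier (CC U 2)" "c : carrier (CC U 2)"
  using cval_cocycle[OF U factor_set_fc[OF U cz]] cz unfolding cocycles_carrier by auto
 fix ka z assume "ka : Lam U 2" "z : UL U 2 ka"
 then show "cval U (fc U c) ka z = c ka z" using fc_eq[OF U cz] unfolding cval_def by simp
qed

text \<open>Equivalent extensions have the same cocycles, and the cocycles of one extension form a coset of
 the coboundaries.\<close>

lemma Phi_class:
 assumes U: "osc U" and P: "Ucls U P f" and X: "X : P"
  and s: "LF U X sg" "IC U X sg c"
 shows "Phi U P = CL U 2 c"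
proof -
 interpret C: cover_ext G A "base_cover U" by (rule cover_ext_base)
 note cov = gcover_edge[OF U]
 note m = C.class_presented_member[OF P cov]
 note p = cocycle_imp_presents[OF U s]
 show ?thesis
 proof (intro subset_antisym subsetI)
  fix c' assume "c' : Phi U P"
  then obtain Y ta where Y: "Y : P" "LF U Y ta" "IC U Y ta c'" unfolding Phi_def by blast
  have "ext_equiv (CB U) X Y" using m(3)[OF X] Y(1) unfolding ext_class_def by blast
  from presents_equiv[OF C.H.tg C.md m(1)[OF X] this cov p]
  obtain ta' where t: "Upres U Y ta' (fc U c)" by blast
  have cz: "c : carrier (ZZ U 2)" using s unfolding is_ext_cocycle_alt by blast
  have "IC U Y ta' (cval U (fc U c))" "LF U Y ta'"
   using presents_imp_cocycle[OF U factor_set_fc[OF U cz] t] by auto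
  moreover note cval_fc[OF U cz]
  ultimately show "c' : CL U 2 c"
   unfolding cohom_class_iff using lifting_difference[OF U m(1)[OF Y(1)] _ _ Y(2,3)] by metis
 next
  fix c' assume "c' : CL U 2 c"
  then obtain b where "b : carrier (CC U 1)" "c' = cob U 1 b \<otimes>\<^bsub>CC U 2\<^esub> c"
   unfolding cohom_class_iff by blast
  then show "c' : Phi U P" using twisted_liftings[OF U m(1)[OF X] s] X unfolding Phi_def by blast
 qed
qed

lemma Phi_presented:
 assumes U: "osc U" and P: "Ucls U P f"
 shows "Phi U P = CL U 2 (cval U f)" "cval U f : carrier (ZZ U 2)"
proof -
 interpret C: cover_ext G A "base_cover U" by (rule cover_ext_base)
 note f = C.class_presented_factor_set[OF P]
 obtain X where X: "X : P" using C.class_presented_nonempty[OF P] by blast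
 obtain sg where s: "Upres U X sg f"
  using C.class_presented_member(2)[OF P gcover_edge[OF U] X] by blast
 show "Phi U P = CL U 2 (cval U f)"
  by (rule Phi_class[OF U P X presents_imp_cocycle[OF U f s]])
 show "cval U f : carrier (ZZ U 2)" by (rule cval_cocycle[OF U f])
qed

theorem Phi_iso:
 assumes U: "osc U"
 shows "Phi U : iso ((EG (base_cover U))\<lparr>carrier := EL U\<rparr>) (cohomology M S U 2)"
proof -
 interpret C: cover_ext G A "base_cover U" by (rule cover_ext_base)
 interpret Z: comm_group "ZZ U 2" by (rule cocycles_group)
 note cov = gcover_edge[OF U]
 have n: "normal (coboundaries M S U 2) (ZZ U 2)"
  by (rule Z.subgroup_imp_normal[OF coboundaries_subgroup[OF U]])
 let ?E = "(EG (base_cover U))\<lparr>carrier := EL U\<rparr>"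
 have hom: "Phi U : hom ?E (cohomology M S U 2)"
 proof (rule homI)
  fix P assume "P : carrier ?E"
  then obtain f where f: "Ucls U P f"
   using ext_lifting_presented[OF U] by auto
  show "Phi U P : carrier (cohomology M S U 2)"
   unfolding Phi_presented(1)[OF U f] cohomology_def carrier_FactGroup cohom_class_def using Phi_presented(2)[OF U f] by blast
  fix Q assume "Q : carrier ?E"
  then obtain f' where f': "Ucls U Q f'"
   using ext_lifting_presented[OF U] by auto
  note pq = C.mult_presented[OF cov f f']
  note fs = C.class_presented_factor_set[OF f] C.class_presented_factor_set[OF f'] C.class_presented_factor_set[OF pq]
  have "cval U (fadd (CB U) f f') = cval U f \<otimes>\<^bsub>CC U 2\<^esub> cval U f'"
   unfolding cochains_mult sec_mult cval_def
   by (auto simp: fadd_def cmp_CB intro!: restrict_ext)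
  then show "Phi U (P \<otimes>\<^bsub>?E\<^esub> Q) = Phi U P \<otimes>\<^bsub>cohomology M S U 2\<^esub> Phi U Q"
   using Phi_presented[OF U f] Phi_presented[OF U f'] Phi_presented[OF U pq]
    normal.rcos_sum[OF n, of "cval U f" "cval U f'"]
   by (simp add: cohomology_def cohom_class_def)
 qed
 have inj: "inj_on (Phi U) (EL U)"
 proof (rule inj_onI)
  fix P Q assume P: "P : EL U" and Q: "Q : EL U" and eq: "Phi U P = Phi U Q"
  obtain f where f: "Ucls U P f"
   using P ext_lifting_presented[OF U] by blast
  obtain f' where f': "Ucls U Q f'"
   using Q ext_lifting_presented[OF U] by blast
  interpret cocyc: subgroup "coboundaries M S U 2" "ZZ U 2" by (rule coboundaries_subgroup[OF U])
  have "cval U f : Phi U P"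
   unfolding Phi_presented(1)[OF U f] cohom_class_def
   by (rule Z.rcos_self[OF Phi_presented(2)[OF U f] coboundaries_subgroup[OF U]])
  then have cP: "cval U f : Phi U P" "cval U f : Phi U Q" using eq by auto
  have pres: "Ucls U R (fc U (cval U f))"
   if cR: "cval U f : Phi U R" and pR: "Ucls U R fR" for R fR
  proof -
   obtain X sg where X: "X : R" "LF U X sg" "IC U X sg (cval U f)"
    using cR unfolding Phi_def by blast
   show ?thesis unfolding class_presented_def
    using C.class_presented_member[OF pR cov X(1)] cocycle_imp_presents[OF U X(2,3)] by blast
  qed
  show "P = Q"
   by (rule C.class_presented_unique[OF cov pres[OF cP(1) f] pres[OF cP(2) f']]) (simp add: feq_def)
 qed
 have "carrier (cohomology M S U 2) \<subseteq> Phi U ` EL U"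
 proof
  fix K assume "K : carrier (cohomology M S U 2)"
  then obtain c where c: "c : carrier (ZZ U 2)" "K = CL U 2 c"
   unfolding cohomology_def carrier_FactGroup cohom_class_def by blast
  obtain P where P: "Ucls U P (fc U c)"
   using C.class_presented_exists[OF cov factor_set_fc[OF U c(1)]] by blast
  have "Phi U P = K" using Phi_presented(1)[OF U P] cval_fc[OF U c(1)] c(2) by simp
  then show "K : Phi U ` EL U" using ext_lifting_presented[OF U] P by blast
 qed
 moreover have "Phi U ` EL U \<subseteq> carrier (cohomology M S U 2)"
  using hom_in_carrier[OF hom] by auto
 ultimately have "bij_betw (Phi U) (carrier ?E) (carrier (cohomology M S U 2))"
  using inj by (auto simp: bij_betw_def)
 then show ?thesis using hom unfolding iso_def by blast
qed

theorem Phi_canonical: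
 assumes U: "osc U" and P: "P : EL U" "X : P" and s: "LF U X sg"
 shows "\<exists>c. IC U X sg c & Phi U P = CL U 2 c"
proof -
 interpret C: cover_ext G A "base_cover U" by (rule cover_ext_base)
 obtain f where f: "Ucls U P f"
  using P ext_lifting_presented[OF U] by blast
 note m = C.class_presented_member[OF f gcover_edge[OF U] P(2)]
 interpret X: ext "CH U" "CB U" X using m(1) by unfold_locales
 have "\<exists>f. Ufac U f & Upres U X sg f"
  by (rule X.liftings_imp_factor_set) (use s in \<open>simp add: is_lifting_family_def\<close>)
 then obtain f' where f': "Ufac U f'" "Upres U X sg f'" by blast
 show ?thesis using presents_imp_cocycle[OF U f'] Phi_class[OF U f P(2)] by blast
qed

end

section \<open>Direct limits of groups\<close>

text \<open>A direct system in which several transition maps may lead from \<open>F u\<close> to \<open>F v\<close>; the axiom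
 \<open>par\<close>, that parallel maps agree on each element further on, makes its limit a filtered colimit.\<close>

locale dirsys =
 fixes Ix :: "'u set" and F :: "'u => 'h monoid" and T :: "'u => 'u => ('h => 'h) set"
 assumes grp: "u : Ix ==> comm_group (F u)"
  and hm: "u : Ix ==> v : Ix ==> t : T u v ==> t : hom (F u) (F v)"
  and ne: "Ix ~= {}"
  and dir: "u : Ix ==> v : Ix ==> \<exists>w\<in>Ix. T u w ~= {} & T v w ~= {}"
  and comp: "u : Ix ==> v : Ix ==> w : Ix ==> t : T u v ==> s : T v w ==>
   \<exists>r\<in>T u w. \<forall>x\<in>carrier (F u). r x = s (t x)"
  and par: "u : Ix ==> v : Ix ==> t : T u v ==> t' : T u v ==> x : carrier (F u) ==>
   \<exists>w\<in>Ix. \<exists>s\<in>T v w. s (t x) = s (t' x)"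
begin

abbreviation "cls \<equiv> colim_class Ix F T"
abbreviation "L \<equiv> colim_group Ix F T"

lemma tr_in: "u : Ix ==> v : Ix ==> t : T u v ==> x : carrier (F u) ==> t x : carrier (F v)"
 by (rule hom_in_carrier[OF hm])

lemma comp_par:
 assumes "u : Ix" "v : Ix" "v' : Ix" "w : Ix" "a : T u v" "s : T v w" "a' : T u v'" "s' : T v' w" "x : carrier (F u)"
 shows "\<exists>w'\<in>Ix. \<exists>c\<in>T w w'. c (s (a x)) = c (s' (a' x))"
proof -
 obtain r where r: "r : T u w" "r x = s (a x)" using comp[of u v w a s] assms by blast
 obtain r' where r': "r' : T u w" "r' x = s' (a' x)" using comp[of u v' w a' s'] assms by blast
 show ?thesis using par[OF assms(1,4) r(1) r'(1) assms(9)] r(2) r'(2) by simp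
qed

text \<open>Equality further on; in a filtered system this is the colimit relation.\<close>

definition meet :: "'u \<times> 'h => 'u \<times> 'h => bool" where
 "meet P Q \<longleftrightarrow> (\<exists>w\<in>Ix. \<exists>t\<in>T (fst P) w. \<exists>s\<in>T (fst Q) w. t (snd P) = s (snd Q))"

text \<open>If two elements become equal somewhere, then they become equal after any given pair of transition
 maps.\<close>

lemma meet_later:
 assumes P: "u : Ix" "v : Ix" "w : Ix" "x : carrier (F u)" "y : carrier (F v)" "meet (u, x) (v, y)" "t : T u w" "s : T v w"
 shows "\<exists>w'\<in>Ix. \<exists>c\<in>T w w'. c (t x) = c (s y)"
proof -
 obtain z a b where z: "z : Ix" "a : T u z" "b : T v z" "a x = b y" using P(6) unfolding meet_def by auto
 obtain m i j where m: "m : Ix" "i : T z m" "j : T w m" using dir[OF z(1) P(3)] by blast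
 obtain m1 c1 where m1: "m1 : Ix" "c1 : T m m1" "c1 (i (a x)) = c1 (j (t x))"
  using comp_par[OF P(1) z(1) P(3) m(1) z(2) m(2) P(7) m(3) P(4)] by blast
 obtain i1 where i1: "i1 : T z m1" "i1 (b y) = c1 (i (b y))" using comp[OF z(1) m(1) m1(1) m(2) m1(2)] tr_in[OF P(2) z(1,3) P(5)] by blast
 obtain j1 where j1: "j1 : T w m1" "\<forall>y\<in>carrier (F w). j1 y = c1 (j y)" using comp[OF P(3) m(1) m1(1) m(3) m1(2)] by blast
 obtain m2 c2 where m2: "m2 : Ix" "c2 : T m1 m2" "c2 (i1 (b y)) = c2 (j1 (s y))"
  using comp_par[OF P(2) z(1) P(3) m1(1) z(3) i1(1) P(8) j1(1) P(5)] by blast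
 obtain c where c: "c : T w m2" "\<forall>y\<in>carrier (F w). c y = c2 (j1 y)" using comp[OF P(3) m1(1) m2(1) j1(1) m2(2)] by blast
 have "c (t x) = c (s y)"
  using c(2) j1(2) m1(3) m2(3) i1(2) z(4) tr_in[OF P(1,3,7,4)] tr_in[OF P(2,3,8,5)] by metis
 then show ?thesis using m2(1) c(1) by blast
qed

lemma meet_sym: "meet P Q ==> meet Q P"
 unfolding meet_def by metis

lemma meet_refl: "u : Ix ==> meet (u, x) (u, x)"
 unfolding meet_def using dir[of u u] by fastforce

lemma meet_trans:
 assumes m: "meet (u, x) (v, y)" "meet (v, y) (w, z)" and i: "u : Ix" "v : Ix" "w : Ix"
  and x: "x : carrier (F u)" "y : carrier (F v)" "z : carrier (F w)"
 shows "meet (u, x) (w, z)"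
proof -
 obtain p t s where p: "p : Ix" "t : T u p" "s : T v p" "t x = s y" using m(1) unfolding meet_def by auto
 obtain q t' s' where q: "q : Ix" "t' : T v q" "s' : T w q" "t' y = s' z" using m(2) unfolding meet_def by auto
 obtain k a b where k: "k : Ix" "a : T p k" "b : T q k" using dir[OF p(1) q(1)] by blast
 obtain l c where l: "l : Ix" "c : T k l" "c (a (s y)) = c (b (t' y))"
  using comp_par[OF i(2) p(1) q(1) k(1) p(3) k(2) q(2) k(3) x(2)] by blast
 obtain r where r: "r : T u k" "r x = a (t x)" using comp[OF i(1) p(1) k(1) p(2) k(2)] x by blast
 obtain r' where r': "r' : T w k" "r' z = b (s' z)" using comp[OF i(3) q(1) k(1) q(3) k(3)] x by blast
 obtain h where h: "h : T u l" "h x = c (r x)" using comp[OF i(1) k(1) l(1) r(1) l(2)] x by blast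
 obtain h' where h': "h' : T w l" "h' z = c (r' z)" using comp[OF i(3) k(1) l(1) r'(1) l(2)] x by blast
 have "h x = h' z" using h(2) h'(2) r(2) r'(2) l(3) p(4) q(4) by simp
 then show ?thesis unfolding meet_def using h(1) h'(1) l(1) by auto
qed

lemma step_meet:
 assumes "u : Ix" "v : Ix" "x : carrier (F u)" "t : T u v"
 shows "meet (u, x) (v, t x)"
proof -
 obtain w a where w: "w : Ix" "a : T v w" using dir[OF assms(2,2)] by blast
 obtain r where "r : T u w" "r x = a (t x)" using comp[OF assms(1,2) w(1) assms(4) w(2)] assms(3) by blast
 then show ?thesis unfolding meet_def using w by auto
qed

lemma colim_rel_iff: "(P, Q) : colim_rel Ix F T \<longleftrightarrow> P : colim_set Ix F & Q : colim_set Ix F & meet P Q"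
proof -
 define R where "R = {((u, x), (v, t x)) | u v x t. u : Ix & v : Ix & x : carrier (F u) & t : T u v}"
 have R: "fst p : Ix & snd p : carrier (F (fst p)) & fst q : Ix & snd q : carrier (F (fst q)) & meet p q"
  if "(p, q) : R \<union> R\<inverse>" for p q
  using that step_meet meet_sym tr_in unfolding R_def by auto
 have fwd: "meet P Q" if st: "(P, Q) : (R \<union> R\<inverse>)\<^sup>*" and P: "P : colim_set Ix F"
  using st
 proof (induction rule: rtrancl_induct)
  case base
  then show ?case using P meet_refl[of "fst P" "snd P"] unfolding colim_set_def by auto
 next
  case (step p q)
  show ?case using meet_trans[of "fst P" "snd P" "fst p" "snd p" "fst q" "snd q"] step(3) R[OF step(2)] P
   unfolding colim_set_def by auto
 qed
 have bwd: "(P, Q) : (R \<union> R\<inverse>)\<^sup>*" if m: "meet P Q" and P: "P : colim_set Ix F" "Q : colim_set Ix F"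
 proof -
  obtain w t s where w: "w : Ix" "t : T (fst P) w" "s : T (fst Q) w" "t (snd P) = s (snd Q)"
   using m unfolding meet_def by blast
  have st: "(p, (w, r (snd p))) : R" if "p : colim_set Ix F" "r : T (fst p) w" for p r
   unfolding R_def using that w(1) by (intro CollectI exI[of _ "fst p"] exI[of _ "snd p"] exI[of _ w] exI[of _ r]) (auto simp: colim_set_def)
  have "(P, (w, t (snd P))) : R" "(Q, (w, s (snd Q))) : R" using st P w(2,3) by blast+
  then have "(P, (w, t (snd P))) : R \<union> R\<inverse>" "((w, t (snd P)), Q) : R \<union> R\<inverse>" using w(4) by auto
  then show ?thesis by (meson r_into_rtrancl rtrancl_trans)
 qed
 show ?thesis using fwd bwd unfolding colim_rel_def Let_def R_def[symmetric] by auto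
qed

lemma equiv_colim: "equiv (colim_set Ix F) (colim_rel Ix F T)"
proof (rule equivI)
 show "refl_on (colim_set Ix F) (colim_rel Ix F T)"
  unfolding refl_on_def colim_rel_iff using meet_refl by (auto simp: colim_set_def)
 show "sym (colim_rel Ix F T)" unfolding sym_def colim_rel_iff using meet_sym by blast
 show "trans (colim_rel Ix F T)"
  unfolding trans_def colim_rel_iff using meet_trans by (auto simp: colim_set_def)
qed (auto simp: colim_rel_iff)

lemma in_cls: "(v, y) : cls u x \<longleftrightarrow> u : Ix & v : Ix & x : carrier (F u) & y : carrier (F v) & meet (u, x) (v, y)"
 unfolding colim_class_def by (auto simp: colim_rel_iff colim_set_def)

lemma cls_eq:
 assumes "u : Ix" "v : Ix" "x : carrier (F u)" "y : carrier (F v)"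
 shows "cls u x = cls v y \<longleftrightarrow> meet (u, x) (v, y)"
 unfolding colim_class_def using eq_equiv_class_iff[OF equiv_colim, of "(u, x)" "(v, y)"] assms
 by (auto simp: colim_rel_iff colim_set_def)

lemma cls_step: "u : Ix ==> v : Ix ==> x : carrier (F u) ==> t : T u v ==> cls v (t x) = cls u x"
 by (metis cls_eq step_meet tr_in)

lemma cls_eqD:
 assumes "cls u x = cls v y" "u : Ix" "v : Ix" "w : Ix" "x : carrier (F u)" "y : carrier (F v)" "t : T u w" "s : T v w"
 shows "\<exists>w'\<in>Ix. \<exists>c\<in>T w w'. c (t x) = c (s y)"
 using meet_later[OF assms(2-6) _ assms(7,8)] assms cls_eq by blast

lemma L_carrier: "al : carrier L \<longleftrightarrow> (\<exists>u\<in>Ix. \<exists>x\<in>carrier (F u). al = cls u x)"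
 unfolding colim_group_def colim_class_def quotient_def colim_set_def by auto

text \<open>Representatives of two classes move to a common index.\<close>

lemma common:
 assumes "al : carrier L" "be : carrier L"
 obtains w x y where "w : Ix" "x : carrier (F w)" "y : carrier (F w)" "al = cls w x" "be = cls w y"
proof -
 obtain u x v y where ux: "u : Ix" "x : carrier (F u)" "al = cls u x" "v : Ix" "y : carrier (F v)" "be = cls v y"
  using assms unfolding L_carrier by blast
 obtain w t s where w: "w : Ix" "t : T u w" "s : T v w" using dir[OF ux(1,4)] by blast
 show ?thesis
  by (rule that[OF w(1) tr_in[OF ux(1) w(1,2) ux(2)] tr_in[OF ux(4) w(1,3) ux(5)]])
   (simp_all add: ux cls_step[OF ux(1) w(1) ux(2) w(2)] cls_step[OF ux(4) w(1) ux(5) w(3)])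
qed

lemma mult_indep:
 assumes i: "u : Ix" "v : Ix" and x: "x : carrier (F u)" "y : carrier (F u)" "x' : carrier (F v)" "y' : carrier (F v)"
  and e: "cls u x = cls v x'" "cls u y = cls v y'"
 shows "cls u (x \<otimes>\<^bsub>F u\<^esub> y) = cls v (x' \<otimes>\<^bsub>F v\<^esub> y')"
proof -
 interpret Fu: comm_group "F u" by (rule grp[OF i(1)])
 interpret Fv: comm_group "F v" by (rule grp[OF i(2)])
 obtain w t s where w: "w : Ix" "t : T u w" "s : T v w" using dir[OF i] by blast
 obtain w1 c where c: "w1 : Ix" "c : T w w1" "c (t x) = c (s x')" using cls_eqD[OF e(1) i w(1) x(1,3) w(2,3)] by blast
 obtain t1 where t1: "t1 : T u w1" "\<forall>x\<in>carrier (F u). t1 x = c (t x)" using comp[OF i(1) w(1) c(1) w(2) c(2)] by blast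
 obtain s1 where s1: "s1 : T v w1" "\<forall>x\<in>carrier (F v). s1 x = c (s x)" using comp[OF i(2) w(1) c(1) w(3) c(2)] by blast
 obtain w2 d where d: "w2 : Ix" "d : T w1 w2" "d (t1 y) = d (s1 y')" using cls_eqD[OF e(2) i c(1) x(2,4) t1(1) s1(1)] by blast
 note h = hom_mult[OF hm[OF i(1) c(1) t1(1)] x(1,2)] hom_mult[OF hm[OF i(2) c(1) s1(1)] x(3,4)]
 note mt = tr_in[OF i(1) c(1) t1(1)] and ms = tr_in[OF i(2) c(1) s1(1)]
 have xy: "x \<otimes>\<^bsub>F u\<^esub> y : carrier (F u)" "x' \<otimes>\<^bsub>F v\<^esub> y' : carrier (F v)" using x by simp_all
 have "t1 x = s1 x'" using c(3) t1(2) s1(2) x by simp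
 then have "d (t1 (x \<otimes>\<^bsub>F u\<^esub> y)) = d (s1 (x' \<otimes>\<^bsub>F v\<^esub> y'))"
  unfolding h hom_mult[OF hm[OF c(1) d(1,2)] mt[OF x(1)] mt[OF x(2)]] hom_mult[OF hm[OF c(1) d(1,2)] ms[OF x(3)] ms[OF x(4)]]
  using d(3) by simp
 then have "cls w1 (t1 (x \<otimes>\<^bsub>F u\<^esub> y)) = cls w1 (s1 (x' \<otimes>\<^bsub>F v\<^esub> y'))"
  using cls_step[OF c(1) d(1) mt[OF xy(1)] d(2)] cls_step[OF c(1) d(1) ms[OF xy(2)] d(2)] by simp
 then show ?thesis using cls_step[OF i(1) c(1) xy(1) t1(1)] cls_step[OF i(2) c(1) xy(2) s1(1)] by simp
qed

lemma L_mult: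
 assumes "u : Ix" "x : carrier (F u)" "y : carrier (F u)"
 shows "cls u x \<otimes>\<^bsub>L\<^esub> cls u y = cls u (x \<otimes>\<^bsub>F u\<^esub> y)"
proof -
 have "cls w (x' \<otimes>\<^bsub>F w\<^esub> y') = cls u (x \<otimes>\<^bsub>F u\<^esub> y)" if "(w, x') : cls u x" "(w, y') : cls u y" for w x' y'
 proof (rule mult_indep)
  show "cls w x' = cls u x" "cls w y' = cls u y" "w : Ix" "x' : carrier (F w)" "y' : carrier (F w)"
   using that cls_eq unfolding in_cls by blast+
 qed (use assms in auto)
 moreover have "(u, x) : cls u x" "(u, y) : cls u y" unfolding in_cls using assms meet_refl by auto
 ultimately have "{cls w (x' \<otimes>\<^bsub>F w\<^esub> y') | w x' y'. (w, x') : cls u x & (w, y') : cls u y} = {cls u (x \<otimes>\<^bsub>F u\<^esub> y)}" by blast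
 then show ?thesis unfolding colim_group_def by simp
qed

lemma L_one:
 assumes "u : Ix"
 shows "\<one>\<^bsub>L\<^esub> = cls u \<one>\<^bsub>F u\<^esub>"
proof -
 have "cls v \<one>\<^bsub>F v\<^esub> = cls u \<one>\<^bsub>F u\<^esub>" if v: "v : Ix" for v
 proof -
  interpret Fu: comm_group "F u" by (rule grp[OF assms])
  interpret Fv: comm_group "F v" by (rule grp[OF v])
  obtain w t s where w: "w : Ix" "t : T u w" "s : T v w" using dir[OF assms v] by blast
  interpret Fw: comm_group "F w" by (rule grp[OF w(1)])
  have "t \<one>\<^bsub>F u\<^esub> = \<one>\<^bsub>F w\<^esub>" "s \<one>\<^bsub>F v\<^esub> = \<one>\<^bsub>F w\<^esub>"
   using hom_one[OF hm[OF assms w(1,2)]] hom_one[OF hm[OF v w(1,3)]] Fu.is_group Fv.is_group Fw.is_group by auto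
  then show ?thesis using cls_step[OF assms w(1) Fu.one_closed w(2)] cls_step[OF v w(1) Fv.one_closed w(3)] by simp
 qed
 then have "(\<Union>v\<in>Ix. cls v \<one>\<^bsub>F v\<^esub>) = (\<Union>v\<in>Ix. cls u \<one>\<^bsub>F u\<^esub>)" by (intro SUP_cong refl)
 then show ?thesis using ne by (simp add: colim_group_def)
qed

theorem colim_comm_group: "comm_group L"
proof (rule comm_groupI)
 obtain u0 where u0: "u0 : Ix" using ne by blast
 interpret F0: comm_group "F u0" by (rule grp[OF u0])
 show "\<one>\<^bsub>L\<^esub> : carrier L" unfolding L_one[OF u0] L_carrier using u0 by blast
 fix al be assume a: "al : carrier L" and b: "be : carrier L"
 obtain w x y where w: "w : Ix" "x : carrier (F w)" "y : carrier (F w)" "al = cls w x" "be = cls w y"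
  using common[OF a b] .
 interpret Fw: comm_group "F w" by (rule grp[OF w(1)])
 note ml = L_mult[OF w(1)]
 show ab: "al \<otimes>\<^bsub>L\<^esub> be : carrier L" unfolding w(4,5) ml[OF w(2,3)] L_carrier using w Fw.m_closed by blast
 show "al \<otimes>\<^bsub>L\<^esub> be = be \<otimes>\<^bsub>L\<^esub> al" unfolding w(4,5) using w by (simp add: ml Fw.m_comm)
 show "\<one>\<^bsub>L\<^esub> \<otimes>\<^bsub>L\<^esub> al = al" unfolding w(4) L_one[OF w(1)] using w by (simp add: ml)
 show "\<exists>be\<in>carrier L. be \<otimes>\<^bsub>L\<^esub> al = \<one>\<^bsub>L\<^esub>"
 proof
  show "cls w (inv\<^bsub>F w\<^esub> x) \<otimes>\<^bsub>L\<^esub> al = \<one>\<^bsub>L\<^esub>" unfolding w(4) L_one[OF w(1)] using w by (simp add: ml)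
  show "cls w (inv\<^bsub>F w\<^esub> x) : carrier L" unfolding L_carrier using w by auto
 qed
 fix ga assume c: "ga : carrier L"
 obtain v z where v: "v : Ix" "z : carrier (F v)" "ga = cls v z" using c unfolding L_carrier by blast
 obtain m t s where m: "m : Ix" "t : T w m" "s : T v m" using dir[OF w(1) v(1)] by blast
 interpret Fm: comm_group "F m" by (rule grp[OF m(1)])
 have r: "al = cls m (t x)" "be = cls m (t y)" "ga = cls m (s z)" "t x : carrier (F m)" "t y : carrier (F m)" "s z : carrier (F m)"
  using w v m by (simp_all add: cls_step tr_in)
 show "al \<otimes>\<^bsub>L\<^esub> be \<otimes>\<^bsub>L\<^esub> ga = al \<otimes>\<^bsub>L\<^esub> (be \<otimes>\<^bsub>L\<^esub> ga)"
  unfolding r(1-3) using r(4-6) by (simp add: L_mult[OF m(1)] Fm.m_assoc)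
qed

end

text \<open>Comparison of two direct systems, the second of which only sees subgroups \<open>Lj j\<close> of the
 groups of the first. The limits agree if every element of the first system gets into one of these
 subgroups, and if their indices are cofinal among those of the first system. On the subgroups all
 parallel transition maps between indices of the second system are equal.\<close>

locale colim_comparison = X: dirsys Ix F T
 for Ix :: "'u set" and F :: "'u => 'h monoid" and T :: "'u => 'u => ('h => 'h) set" +
 fixes Jx :: "'v set" and K :: "'v => 'k monoid" and Q :: "'v => 'v => ('k => 'k) set"
  and p :: "'v => 'u" and Lj :: "'v => 'h set" and ph :: "'v => 'h => 'k"
 assumes K: "j : Jx ==> comm_group (K j)"
  and p: "j : Jx ==> p j : Ix"
  and sub: "j : Jx ==> subgroup (Lj j) (F (p j))"
  and iso: "j : Jx ==> ph j : Group.iso ((F (p j))\<lparr>carrier := Lj j\<rparr>) (K j)"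
  and natural: "j : Jx ==> j' : Jx ==> q : Q j j' ==>
   \<exists>t\<in>T (p j) (p j'). \<forall>x\<in>Lj j. t x : Lj j' & q (ph j x) = ph j' (t x)"
  and J_ne: "Jx ~= {}"
  and J_dir: "j : Jx ==> j' : Jx ==> \<exists>k\<in>Jx. Q j k ~= {} & Q j' k ~= {}"
  and J_trans: "j : Jx ==> j' : Jx ==> k : Jx ==> Q j j' ~= {} ==> Q j' k ~= {} ==> Q j k ~= {}"
  and J_par: "j : Jx ==> j' : Jx ==> Q j j' ~= {} ==> t : T (p j) (p j') ==> t' : T (p j) (p j') ==> x : Lj j ==>
   t x = t' x"
  and reach: "u : Ix ==> x : carrier (F u) ==> \<exists>j\<in>Jx. \<exists>t\<in>T u (p j). t x : Lj j"
  and cofinal: "j : Jx ==> v : Ix ==> T (p j) v ~= {} ==> \<exists>k\<in>Jx. Q j k ~= {} & T v (p k) ~= {}"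
begin

lemma Lj_in: "j : Jx ==> x : Lj j ==> x : carrier (F (p j))"
 using sub subgroup.mem_carrier by fast

lemma phi_surj: "j : Jx ==> y : carrier (K j) ==> \<exists>x\<in>Lj j. y = ph j x"
 using iso[of j] unfolding Group.iso_def bij_betw_def by auto

lemma phi_in: "j : Jx ==> x : Lj j ==> ph j x : carrier (K j)"
 using iso[of j] unfolding Group.iso_def bij_betw_def by auto

lemma phi_mult: "j : Jx ==> x : Lj j ==> y : Lj j ==> ph j (x \<otimes>\<^bsub>F (p j)\<^esub> y) = ph j x \<otimes>\<^bsub>K j\<^esub> ph j y"
 using iso[of j] unfolding Group.iso_def hom_def by auto

lemma Q_tr:
 assumes "j : Jx" "j' : Jx" "q : Q j j'" "t : T (p j) (p j')" "x : Lj j"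
 shows "t x : Lj j' & q (ph j x) = ph j' (t x)"
proof -
 obtain s where s: "s : T (p j) (p j')" "s x : Lj j'" "q (ph j x) = ph j' (s x)" using natural[OF assms(1-3)] assms(5) by blast
 moreover have "t x = s x" using J_par[OF assms(1,2) _ assms(4) s(1) assms(5)] assms(3) by blast
 ultimately show ?thesis by simp
qed

sublocale Y: dirsys Jx K Q
proof (rule dirsys.intro)
 show "j : Jx ==> j' : Jx ==> \<exists>k\<in>Jx. Q j k ~= {} & Q j' k ~= {}" for j j' by (rule J_dir)
 fix j j' t assume j: "j : Jx" "j' : Jx" and t: "t : Q j j'"
 obtain r where r: "r : T (p j) (p j')" using natural[OF j t] by blast
 note R = Q_tr[OF j t r]
 show "t : hom (K j) (K j')"
 proof (rule homI)
  fix x y assume "x : carrier (K j)" "y : carrier (K j)"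
  then obtain x' y' where xy: "x' : Lj j" "x = ph j x'" "y' : Lj j" "y = ph j y'" using phi_surj[OF j(1)] by blast
  show "t x : carrier (K j')" using R xy phi_in[OF j(2)] by metis
  have m: "x' \<otimes>\<^bsub>F (p j)\<^esub> y' : Lj j" using subgroup.m_closed[OF sub[OF j(1)]] xy by blast
  have "r (x' \<otimes>\<^bsub>F (p j)\<^esub> y') = r x' \<otimes>\<^bsub>F (p j')\<^esub> r y'"
   using hom_mult[OF X.hm[OF p[OF j(1)] p[OF j(2)] r]] Lj_in[OF j(1)] xy by blast
  then show "t (x \<otimes>\<^bsub>K j\<^esub> y) = t x \<otimes>\<^bsub>K j'\<^esub> t y"
   using R m xy phi_mult[OF j(1)] phi_mult[OF j(2)] by metis
 qed
 fix k s assume k: "k : Jx" and s: "s : Q j' k"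
 obtain r' where r': "r' : T (p j') (p k)" using natural[OF j(2) k s] by blast
 obtain h where h: "h : T (p j) (p k)" "\<forall>x\<in>carrier (F (p j)). h x = r' (r x)"
  using X.comp[OF p[OF j(1)] p[OF j(2)] p[OF k] r r'] by blast
 obtain q where q: "q : Q j k" using J_trans[OF j k] t s by blast
 have "q (ph j x) = s (t (ph j x))" if "x : Lj j" for x
  using Q_tr[OF j(1) k q h(1) that] Q_tr[OF j(2) k s r', of "r x"] R[OF that] h(2) Lj_in[OF j(1) that] by simp
 then show "\<exists>r\<in>Q j k. \<forall>x\<in>carrier (K j). r x = s (t x)" using q phi_surj[OF j(1)] by metis
next
 fix j j' t t' x assume j: "j : Jx" "j' : Jx" and t: "t : Q j j'" "t' : Q j j'" and x: "x : carrier (K j)"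
 obtain r where r: "r : T (p j) (p j')" using natural[OF j t(1)] by blast
 obtain y where "y : Lj j" "x = ph j y" using phi_surj[OF j(1) x] by blast
 then have "t x = t' x" using Q_tr[OF j _ r] t by metis
 then show "\<exists>w\<in>Jx. \<exists>s\<in>Q j' w. s (t x) = s (t' x)" using J_dir[OF j(2,2)] by auto
qed (fact K J_ne)+

text \<open>In the direction from left to right, elements that meet in the first system at an index outside
 the image of \<open>p\<close> meet again at a cofinal index; there the composite transition map
 agrees with one that comes from the second system.\<close>

lemma cls_compare:
 assumes j: "j : Jx" "k : Jx" and x: "x : Lj j" "y : Lj k"
 shows "X.cls (p j) x = X.cls (p k) y \<longleftrightarrow> Y.cls j (ph j x) = Y.cls k (ph k y)"
proof -
 obtain m a b where m: "m : Jx" "a : Q j m" "b : Q k m" using J_dir[OF j] by blast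
 obtain t where t: "t : T (p j) (p m)" using natural[OF j(1) m(1,2)] by blast
 obtain s where s: "s : T (p k) (p m)" using natural[OF j(2) m(1,3)] by blast
 note tx = Q_tr[OF j(1) m(1,2) t x(1)] and sy = Q_tr[OF j(2) m(1,3) s x(2)]
 define x' where "x' = t x" define y' where "y' = s y"
 have xy: "x' : Lj m" "y' : Lj m" "a (ph j x) = ph m x'" "b (ph k y) = ph m y'" using tx sy unfolding x'_def y'_def by auto
 have e: "X.cls (p m) x' = X.cls (p j) x" "X.cls (p m) y' = X.cls (p k) y"
  unfolding x'_def y'_def using X.cls_step p j m(1) t s Lj_in x by simp_all
 have e': "Y.cls m (ph m x') = Y.cls j (ph j x)" "Y.cls m (ph m y') = Y.cls k (ph k y)"
  unfolding xy(3,4)[symmetric] using Y.cls_step j m phi_in x by simp_all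
 have fwd: "X.cls (p m) x' = X.cls (p m) y' ==> Y.cls m (ph m x') = Y.cls m (ph m y')"
 proof -
  assume eq: "X.cls (p m) x' = X.cls (p m) y'"
  note pm = p[OF m(1)] and lx = Lj_in[OF m(1) xy(1)] and ly = Lj_in[OF m(1) xy(2)]
  obtain u c where u: "u : Ix" "c : T (p m) u" "c x' = c y'"
  proof -
   obtain w t0 where w: "w : Ix" "t0 : T (p m) w" using X.dir[OF pm pm] by blast
   obtain u c where u: "u : Ix" "c : T w u" "c (t0 x') = c (t0 y')" using X.cls_eqD[OF eq pm pm w(1) lx ly w(2,2)] by blast
   obtain d where "d : T (p m) u" "\<forall>x\<in>carrier (F (p m)). d x = c (t0 x)" using X.comp[OF pm w(1) u(1) w(2) u(2)] by blast
   then show thesis using that[of u d] u lx ly by simp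
  qed
  obtain l q d where l: "l : Jx" "q : Q m l" "d : T u (p l)" using cofinal[OF m(1) u(1)] u(2) by blast
  obtain h where h: "h : T (p m) (p l)" "\<forall>x\<in>carrier (F (p m)). h x = d (c x)" using X.comp[OF pm u(1) p[OF l(1)] u(2) l(3)] by blast
  have "q (ph m x') = q (ph m y')"
   using Q_tr[OF m(1) l(1,2) h(1)] xy(1,2) h(2) u(3) lx ly by simp
  then show "Y.cls m (ph m x') = Y.cls m (ph m y')"
   using Y.cls_step[OF m(1) l(1) phi_in[OF m(1) xy(1)] l(2)] Y.cls_step[OF m(1) l(1) phi_in[OF m(1) xy(2)] l(2)] by simp
 qed
 have bwd: "Y.cls m (ph m x') = Y.cls m (ph m y') ==> X.cls (p m) x' = X.cls (p m) y'"
 proof -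
  assume eq: "Y.cls m (ph m x') = Y.cls m (ph m y')"
  note px = phi_in[OF m(1) xy(1)] and py = phi_in[OF m(1) xy(2)]
  obtain w q where w: "w : Jx" "q : Q m w" using J_dir[OF m(1,1)] by blast
  obtain l c where l: "l : Jx" "c : Q w l" "c (q (ph m x')) = c (q (ph m y'))"
   using Y.cls_eqD[OF eq m(1,1) w(1) px py w(2,2)] by blast
  obtain d where d: "d : Q m l" "\<forall>x\<in>carrier (K m). d x = c (q x)" using Y.comp[OF m(1) w(1) l(1) w(2) l(2)] by blast
  obtain r where r: "r : T (p m) (p l)" using natural[OF m(1) l(1) d(1)] by blast
  note R = Q_tr[OF m(1) l(1) d(1) r]
  have "ph l (r x') = ph l (r y')" using R[OF xy(1)] R[OF xy(2)] d(2) l(3) px py by simp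
  then have "r x' = r y'" using iso[OF l(1)] R[OF xy(1)] R[OF xy(2)] unfolding Group.iso_def bij_betw_def inj_on_def by auto
  then show "X.cls (p m) x' = X.cls (p m) y'"
   using X.cls_step[OF p[OF m(1)] p[OF l(1)] _ r] Lj_in[OF m(1)] xy(1,2) by metis
 qed
 show ?thesis using fwd bwd e e' by metis
qed

theorem comparison_iso:
 "\<exists>\<Psi>\<in>Group.iso X.L Y.L. \<forall>j\<in>Jx. \<forall>x\<in>Lj j. \<Psi> (X.cls (p j) x) = Y.cls j (ph j x)"
proof -
 define \<Psi> where "\<Psi> al = (THE be. \<exists>j\<in>Jx. \<exists>x\<in>Lj j. al = X.cls (p j) x & be = Y.cls j (ph j x))" for al
 have val: "\<Psi> (X.cls (p j) x) = Y.cls j (ph j x)" if "j : Jx" "x : Lj j" for j x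
  unfolding \<Psi>_def using that cls_compare by (intro the_equality) blast+
 have rep: "\<exists>j\<in>Jx. \<exists>x\<in>Lj j. al = X.cls (p j) x" if a: "al : carrier X.L" for al
 proof -
  obtain u x where u: "u : Ix" "x : carrier (F u)" "al = X.cls u x" using a unfolding X.L_carrier by blast
  obtain j t where j: "j : Jx" "t : T u (p j)" "t x : Lj j" using reach[OF u(1,2)] by blast
  have "al = X.cls (p j) (t x)" using X.cls_step[OF u(1) p[OF j(1)] u(2) j(2)] u(3) by simp
  then show ?thesis using j by blast
 qed
 have "\<Psi> : hom X.L Y.L"
 proof (rule homI)
  fix al be assume a: "al : carrier X.L" and b: "be : carrier X.L"
  obtain j x where j: "j : Jx" "x : Lj j" "al = X.cls (p j) x" using rep[OF a] by blast
  obtain k y where k: "k : Jx" "y : Lj k" "be = X.cls (p k) y" using rep[OF b] by blast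
  obtain m q q' where m: "m : Jx" "q : Q j m" "q' : Q k m" using J_dir[OF j(1) k(1)] by blast
  obtain t where t: "t : T (p j) (p m)" using natural[OF j(1) m(1,2)] by blast
  obtain s where s: "s : T (p k) (p m)" using natural[OF k(1) m(1,3)] by blast
  have l: "t x : Lj m" "s y : Lj m" using Q_tr[OF j(1) m(1,2) t j(2)] Q_tr[OF k(1) m(1,3) s k(2)] by auto
  have e: "al = X.cls (p m) (t x)" "be = X.cls (p m) (s y)"
   using X.cls_step[OF p[OF j(1)] p[OF m(1)] Lj_in[OF j(1,2)] t] X.cls_step[OF p[OF k(1)] p[OF m(1)] Lj_in[OF k(1,2)] s] j k by auto
  have ml: "t x \<otimes>\<^bsub>F (p m)\<^esub> s y : Lj m" using subgroup.m_closed[OF sub[OF m(1)] l] .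
  show "\<Psi> al : carrier Y.L" unfolding j(3) val[OF j(1,2)] Y.L_carrier using j phi_in by blast
  show "\<Psi> (al \<otimes>\<^bsub>X.L\<^esub> be) = \<Psi> al \<otimes>\<^bsub>Y.L\<^esub> \<Psi> be"
   unfolding e using l ml m(1)
   by (simp add: X.L_mult[OF p[OF m(1)]] Lj_in val Y.L_mult[OF m(1)] phi_in phi_mult)
 qed
 moreover have "bij_betw \<Psi> (carrier X.L) (carrier Y.L)"
 proof (rule bij_betwI')
  show "(\<Psi> al = \<Psi> be) = (al = be)" if "al : carrier X.L" "be : carrier X.L" for al be
   using rep[OF that(1)] rep[OF that(2)] val cls_compare by metis
  show "\<Psi> al : carrier Y.L" if "al : carrier X.L" for al
   using calculation that by (rule hom_in_carrier)
  show "\<exists>al\<in>carrier X.L. be = \<Psi> al" if b: "be : carrier Y.L" for be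
  proof -
   obtain j y where j: "j : Jx" "y : carrier (K j)" "be = Y.cls j y" using b unfolding Y.L_carrier by blast
   obtain x where x: "x : Lj j" "y = ph j x" using phi_surj[OF j(1,2)] by blast
   have "X.cls (p j) x : carrier X.L" unfolding X.L_carrier using p[OF j(1)] Lj_in[OF j(1) x(1)] by blast
   then show ?thesis using val[OF j(1) x(1)] j(3) x(2) by blast
  qed
 qed
 ultimately show ?thesis using val unfolding Group.iso_def by blast
qed

end

section \<open>Pull-back of classes of extensions\<close>

context pullback
begin

text \<open>The pull-back presents the pulled back factor set, so its class depends on the class only.\<close>

lemma class_pull:
 assumes cov: "gcover H Om V" and P: "class_presented H B Om V P F" and X: "X : P"
 shows "class_presented K C Om (\<lambda>w. {k : Ar K. f k : V w}) (\<Union>X\<in>P. ext_class K C (pbk X))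
   (\<lambda>w1 w2 w3 g h. un (src K h) (F w1 w2 w3 (f g) (f h)))"
  and "(\<Union>X\<in>P. ext_class K C (pbk X)) = ext_class K C (pbk X)"
proof -
 let ?V = "\<lambda>w. {k : Ar K. f k : V w}" and ?F = "\<lambda>w1 w2 w3 g h. un (src K h) (F w1 w2 w3 (f g) (f h))"
 have cov': "gcover K Om ?V" by (rule gcover_pull[OF cov])
 have pb: "extension K C (pbk Y) & (\<exists>sg. presents K C Om ?V (pbk Y) sg ?F)" if Y: "Y : P" for Y
 proof -
  note m = H.class_presented_member[OF P cov Y]
  obtain sg where s: "presents H B Om V Y sg F" using m(2) by blast
  have "extension K C (pbk Y)"
  proof (rule extension_pull[OF m(1)])
   fix h assume "h : Ar H"
   then obtain w where "w : Om" "h : V w" using gcoverD(1)[OF cov] by blast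
   then show "\<exists>W sg. openin (arr H) W & h : W & is_lifting H Y W sg"
    using gcoverD(2)[OF cov] presentsD(1)[OF s] by blast
  qed
  then show ?thesis using presents_pull[OF m(1) s] by blast
 qed
 interpret p: ext K C "pbk X" using pb[OF X] by unfold_locales blast
 have "factor_set K C Om ?V ?F" using pb[OF X] p.presents_factor_set by blast
 then obtain P' where P': "class_presented K C Om ?V P' ?F" using K.class_presented_exists[OF cov'] by blast
 have eq: "ext_class K C (pbk Y) = P'" if Y: "Y : P" for Y
 proof -
  obtain Z :: "('y, 'c, 'k, 'c \<times> 'k) extn" and ta where Z: "extension K C Z" "presents K C Om ?V Z ta ?F" "P' = ext_class K C Z"
   using P' unfolding class_presented_def by blast
  obtain sg where s: "extension K C (pbk Y)" "presents K C Om ?V (pbk Y) sg ?F" using pb[OF Y] by blast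
  show ?thesis unfolding Z(3)
   by (rule K.ext_class_eqI[OF presents_imp_equiv[OF K.H.tg K.md cov' s Z(1,2)] presents_imp_equiv[OF K.H.tg K.md cov' Z(1,2) s]])
 qed
 then have "(\<Union>X\<in>P. ext_class K C (pbk X)) = P'" using X by auto
 then show "class_presented K C Om ?V (\<Union>X\<in>P. ext_class K C (pbk X)) ?F"
  "(\<Union>X\<in>P. ext_class K C (pbk X)) = ext_class K C (pbk X)" using P' eq[OF X] by simp_all
qed

end

definition amap :: "('j => 'i) => 'j \<times> 'g \<times> 'j => 'i \<times> 'g \<times> 'i" where
 "amap th p = (th (fst p), fst (snd p), th (snd (snd p)))"

context nerve_module
begin

lemma cover_ext_any: "cover_ext G A"
 using H.tg md by unfold_locales

lemma refines_pullback: "refines th D C ==> pullback (GC C) (AC C) (GC D) (AC D)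
   (\<lambda>(j, x). (th j, x)) (amap th) (\<lambda>(j, a). (th j, a)) (\<lambda>y b. (fst y, snd b))"
 using refinement_pullback[OF H.tg md] by (simp add: amap_def[abs_def] split_beta')

lemma ext_pull_def': "EP th D P = (\<Union>X\<in>P. ext_class (GC D) (AC D)
  (pull_ext (GC D) (AC D) (\<lambda>(j, x). (th j, x)) (amap th) (\<lambda>(j, a). (th j, a)) X))"
 unfolding ext_pull_def Let_def by (simp add: amap_def[abs_def] split_beta')

text \<open>The factor set of a pull-back.\<close>

definition fpull :: "('j => 'i) => ('w => 'w => 'w => 'i \<times> 'g \<times> 'i => 'i \<times> 'g \<times> 'i => 'i \<times> 'a)
  => 'w => 'w => 'w => 'j \<times> 'g \<times> 'j => 'j \<times> 'g \<times> 'j => 'j \<times> 'a" where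
 "fpull th F = (\<lambda>w1 w2 w3 g h. (snd (snd h), snd (F w1 w2 w3 (amap th g) (amap th h))))"

lemma fpull_alt: "(\<lambda>w1 w2 w3 g h. (fst (src (GC D) h), snd (F w1 w2 w3 (amap th g) (amap th h)))) = fpull th F"
 by (simp add: fpull_def cover_gpd_sel)

lemma ext_pull_presented:
 assumes r: "refines th D C" and cov: "gcover (GC C) Om V"
  and P: "class_presented (GC C) (AC C) Om V P F"
 shows "class_presented (GC D) (AC D) Om (\<lambda>w. {k : Ar (GC D). amap th k : V w})
   (EP th D P) (fpull th F)"
  and "X : P ==> EP th D P = ext_class (GC D) (AC D)
   (pull_ext (GC D) (AC D) (\<lambda>(j, x). (th j, x)) (amap th) (\<lambda>(j, a). (th j, a)) X)"
proof -
 interpret pullback "GC C" "AC C" "GC D" "AC D"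
   "\<lambda>(j, x). (th j, x)" "amap th" "\<lambda>(j, a). (th j, a)" "\<lambda>y b. (fst y, snd b)" by (rule refines_pullback[OF r])
 obtain Y where "Y : P" using H.class_presented_nonempty[OF P] by blast
 from class_pull(1)[OF cov P this]
 show "class_presented (GC D) (AC D) Om (\<lambda>w. {k : Ar (GC D). amap th k : V w})
   (EP th D P) (fpull th F)" unfolding ext_pull_def' fpull_alt .
 assume "X : P"
 from class_pull(2)[OF cov P this]
 show "EP th D P = ext_class (GC D) (AC D)
   (pull_ext (GC D) (AC D) (\<lambda>(j, x). (th j, x)) (amap th) (\<lambda>(j, a). (th j, a)) X)"
  unfolding ext_pull_def' .
qed

lemma pull_cyl_presented:
 assumes r: "refines th D C" and W: "nbhds G W"
  and P: "class_presented (GC C) (AC C) (Ar G) (cyl G C W) P F"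
 shows "class_presented (GC D) (AC D) (Ar G) (cyl G D W) (EP th D P) (fpull th F)"
proof -
 interpret C: cover_ext G A C by (rule cover_ext_any)
 interpret p: pullback "GC C" "AC C" "GC D" "AC D"
   "\<lambda>(j, x). (th j, x)" "amap th" "\<lambda>(j, a). (th j, a)" "\<lambda>y b. (fst y, snd b)" by (rule refines_pullback[OF r])
 have "{k : Ar (GC D). amap th k : cyl G C W g} = cyl G D W g" for g
  unfolding cyl_def using p.f_in by (auto simp: amap_def)
 then show ?thesis using ext_pull_presented(1)[OF r C.gcover_cyl[OF W] P] by simp
qed

lemma cyl_unique:
 assumes "nbhds G W" "class_presented (GC C) (AC C) (Ar G) (cyl G C W) P F"
  "class_presented (GC C) (AC C) (Ar G) (cyl G C W) Q F"
 shows "P = Q"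
proof -
 interpret C: cover_ext G A C by (rule cover_ext_any)
 show ?thesis by (rule C.class_presented_unique[OF C.gcover_cyl[OF assms(1)] assms(2,3)]) (simp add: feq_def)
qed

lemma ext_pull_in: "refines th D C ==> P : carrier (EG C) ==> EP th D P : carrier (EG D)"
 unfolding cover_ext.ext_group_carrier[OF cover_ext_any] using pull_cyl_presented by blast

lemma ext_pull_hom:
 assumes r: "refines th D C"
 shows "EP th D : hom (EG C) (EG D)"
proof (rule homI)
 interpret C: cover_ext G A C by (rule cover_ext_any)
 interpret D: cover_ext G A D by (rule cover_ext_any)
 fix P Q assume PQ: "P : carrier (EG C)" "Q : carrier (EG C)"
 show "EP th D P : carrier (EG D)" by (rule ext_pull_in[OF r PQ(1)])
 obtain W f1 f2 where W: "nbhds G W" "class_presented (GC C) (AC C) (Ar G) (cyl G C W) P f1"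
  "class_presented (GC C) (AC C) (Ar G) (cyl G C W) Q f2"
  using C.common_presentation[OF PQ PQ(2)] by blast
 have "fpull th (fadd (AC C) f1 f2) = fadd (AC D) (fpull th f1) (fpull th f2)"
  by (simp add: fpull_def fadd_def cover_mod_sel)
 then show "EP th D (P \<otimes>\<^bsub>EG C\<^esub> Q) = EP th D P \<otimes>\<^bsub>EG D\<^esub> EP th D Q"
  using pull_cyl_presented[OF r W(1) C.mult_presented[OF C.gcover_cyl[OF W(1)] W(2,3)]]
   D.mult_presented[OF D.gcover_cyl[OF W(1)] pull_cyl_presented[OF r W(1,2)] pull_cyl_presented[OF r W(1,3)]]
   cyl_unique[OF W(1)] by metis
qed

lemma refines_comp: "refines th D C ==> refines th' D' D ==> refines (\<lambda>j. th (th' j)) D' C"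
 unfolding refines_def by blast

lemma ext_pull_comp:
 assumes r: "refines th D C" "refines th' D' D" and P: "P : carrier (EG C)"
 shows "EP th' D' (EP th D P) = EP (\<lambda>j. th (th' j)) D' P"
proof -
 obtain W f where W: "nbhds G W" "class_presented (GC C) (AC C) (Ar G) (cyl G C W) P f"
  using P unfolding cover_ext.ext_group_carrier[OF cover_ext_any] by blast
 have "fpull th' (fpull th f) = fpull (\<lambda>j. th (th' j)) f" by (simp add: fpull_def amap_def)
 then show ?thesis
  using cyl_unique[OF W(1)] pull_cyl_presented[OF r(2) W(1) pull_cyl_presented[OF r(1) W]]
   pull_cyl_presented[OF refines_comp[OF r] W] by metis
qed

text \<open>If \<open>X\<close> lifts the arrows \<open>(th' j, 1, th j)\<close> continuously by \<open>et\<close>, then conjugation with \<open>et\<close> makes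
 liftings for the pull-back along \<open>th'\<close> out of those for the pull-back along \<open>th\<close>, with the same
 factor set: \<open>et\<close> cancels in products, and it commutes with the coefficients because units act
 trivially.\<close>

lemma parallel_pullbacks:
 assumes r: "refines th D C" "refines th' D C" and P: "P : carrier (EG C)" "X : P"
  and s: "\<And>j. j : fst D ==> is_lifting (GC C) X (R j) (s j)"
   "\<And>j x. j : fst D ==> x : Ob G ==> x : snd D j ==> (th' j, idn G x, th j) : R j"
 shows "EP th D P = EP th' D P"
proof -
 interpret C: cover_ext G A C by (rule cover_ext_any)
 interpret U: pullback "GC C" "AC C" "GC D" "AC D"
   "\<lambda>(j, x). (th j, x)" "amap th" "\<lambda>(j, a). (th j, a)" "\<lambda>y b. (fst y, snd b)" by (rule refines_pullback[OF r(1)])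
 interpret V: pullback "GC C" "AC C" "GC D" "AC D"
   "\<lambda>(j, x). (th' j, x)" "amap th'" "\<lambda>(j, a). (th' j, a)" "\<lambda>y b. (fst y, snd b)" by (rule refines_pullback[OF r(2)])
 obtain W F where W: "nbhds G W" "class_presented (GC C) (AC C) (Ar G) (cyl G C W) P F"
  using P(1) unfolding C.ext_group_carrier by blast
 note cov = C.gcover_cyl[OF W(1)]
 note m = C.class_presented_member[OF W(2) cov P(2)]
 obtain sg where sg: "presents (GC C) (AC C) (Ar G) (cyl G C W) X sg F" using m(2) by blast
 interpret X: ext "GC C" "AC C" X using m(1) by unfold_locales
 let ?D = "GC D" and ?E = "tot X"
 let ?V = "\<lambda>w. {k : Ar ?D. amap th k : cyl G C W w}"
 define et where "et y = s (fst y) (th' (fst y), idn G (snd y), th (fst y))" for y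
 have loop: "(th' (fst y), idn G (snd y), th (fst y)) : Ar (GC C)" "(th' (fst y), idn G (snd y), th (fst y)) : R (fst y)" if "y : Ob ?D" for y
  using that r s(2)[of "fst y" "snd y"] unfolding Ob_cover Ar_cover refines_def by auto
 have eta: "et y : Ar ?E" "prj X (et y) = (th' (fst y), idn G (snd y), th (fst y))"
  "src ?E (et y) = (th (fst y), snd y)" "rng ?E (et y) = (th' (fst y), snd y)" if y: "y : Ob ?D" for y
  using X.liftD[OF s(1) loop[OF y]] y unfolding et_def Ob_cover by (auto simp: cover_gpd_sel)
 have eta_cont: "cts (obj ?D) (arr ?E) et"
 proof (rule continuous_map_local)
  fix y0 assume y0: "y0 : Ob ?D"
  let ?N = "{y : Ob ?D. fst y : {fst y0}}"
  note id = cont_id'[of "obj ?D", unfolded cover_obj_cont]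
  have j: "fst y0 : fst D" using y0 unfolding Ob_cover by simp
  have "openin (obj ?D) ?N"
   by (rule openin_preimage[of _ "dsc (fst D)"]) (use id j in auto)
  moreover have "cts (sbt (obj ?D) ?N) (arr ?E) (\<lambda>y. s (fst y0) (th' (fst y0), idn G (snd y), th (fst y0)))"
  proof (rule cont_lift[OF s(1)[OF j]])
   have "cts (sbt (obj ?D) ?N) (arr G) (\<lambda>y. idn G (snd y))"
    by (rule H.cont_idn) (use id in \<open>blast intro: continuous_map_from_subtopology\<close>)
   moreover have "th (fst y0) : fst C" "th' (fst y0) : fst C" using r j unfolding refines_def by auto
   ultimately show "cts (sbt (obj ?D) ?N) (arr (GC C)) (\<lambda>y. (th' (fst y0), idn G (snd y), th (fst y0)))"
    unfolding cover_arr_cont using loop(1) by (auto simp: Ar_cover)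
   show "(th' (fst y0), idn G (snd y), th (fst y0)) : R (fst y0)" if "y : pts (sbt (obj ?D) ?N)" for y
    using loop(2)[of y] that by simp
  qed
  then have "cts (sbt (obj ?D) ?N) (arr ?E) et" by (rule continuous_map_eq) (auto simp: et_def)
  ultimately show "\<exists>N. openin (obj ?D) N & y0 : N & cts (sbt (obj ?D) N) (arr ?E) et" using y0 by blast
 qed
 have ends: "src (GC C) (amap th k) = (th (fst (src ?D k)), snd (src ?D k))"
  "rng (GC C) (amap th k) = (th (fst (rng ?D k)), snd (rng ?D k))" for k
  by (simp_all add: amap_def cover_gpd_sel)
 define t where "t w k = cmp ?E (et (rng ?D k)) (cmp ?E (sg w (amap th k)) (ginv ?E (et (src ?D k))))" for w k
 have sl: "sg w (amap th k) : Ar ?E" "prj X (sg w (amap th k)) = amap th k" "src ?E (sg w (amap th k)) = (th (fst (src ?D k)), snd (src ?D k))"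
  "rng ?E (sg w (amap th k)) = (th (fst (rng ?D k)), snd (rng ?D k))" if "w : Ar G" "k : ?V w" for w k
  using X.liftD[OF presentsD(1)[OF sg that(1)], of "amap th k"] that(2) by (simp_all add: ends)
 have t: "t w k : Ar ?E" "prj X (t w k) = amap th' k" if w: "w : Ar G" "k : ?V w" for w k
 proof -
  have k: "k : Ar ?D" using w by simp
  note e = eta[OF U.K.H.src_in[OF k]] eta[OF U.K.H.rng_in[OF k]] and g = sl[OF w]
  show "t w k : Ar ?E" unfolding t_def using e g by simp
  show "prj X (t w k) = amap th' k"
   unfolding t_def using e g k unfolding Ar_cover by (simp add: cover_gpd_sel amap_def)
 qed
 have s2: "presents ?D (AC D) (Ar G) ?V (V.pbk X) (\<lambda>w k. (t w k, k)) (fpull th F)"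
  unfolding presents_def
 proof (intro conjI ballI allI impI)
  fix w assume w: "w : Ar G"
  let ?T = "sbt (arr ?D) (?V w)"
  have id: "cts ?T (arr ?D) (\<lambda>k. k)" by (rule cont_id_sub)
  have T: "k : ?V w" if "k : pts ?T" for k using that by auto
  have Tk: "k : Ar ?D" if "k : pts ?T" for k using that by auto
  have c: "cts ?T (arr ?E) (\<lambda>k. et (rng ?D k))" "cts ?T (arr ?E) (\<lambda>k. et (src ?D k))"
   using continuous_map_compose[OF U.K.H.cont_rng[OF id] eta_cont] continuous_map_compose[OF U.K.H.cont_src[OF id] eta_cont]
   by (simp_all add: o_def)
  have "cts ?T (arr ?E) (\<lambda>k. sg w (amap th k))"
   by (rule cont_lift[OF presentsD(1)[OF sg w] U.cont_f[OF id]]) (use T in auto)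
  then have "cts ?T (arr ?E) (t w)"
   unfolding t_def[abs_def]
  proof (intro X.E.cont_cmp c X.E.cont_ginv)
   fix k assume "k : pts ?T"
   then show "src ?E (sg w (amap th k)) = rng ?E (ginv ?E (et (src ?D k)))"
    "src ?E (et (rng ?D k)) = rng ?E (cmp ?E (sg w (amap th k)) (ginv ?E (et (src ?D k))))"
    using sl[OF w T] eta[OF U.K.H.src_in[OF Tk]] eta[OF U.K.H.rng_in[OF Tk]] by simp_all
  qed
  then show "is_lifting ?D (V.pbk X) (?V w) (\<lambda>k. (t w k, k))"
   unfolding is_lifting_def V.pull_sel using id t[OF w]
   by (auto simp: continuous_map_in_subtopology continuous_map_pairedI)
 next
  fix w1 w2 w3 g h assume w: "w1 : Ar G" "w2 : Ar G" "w3 : Ar G" and d: "(g, h) : fdom ?D ?V w1 w2 w3"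
  have gh: "g : Ar ?D" "h : Ar ?D" "src ?D g = rng ?D h" "g : ?V w1" "h : ?V w2" "cmp ?D g h : ?V w3"
   using fdomD[OF d] by auto
  have ac: "amap th (cmp ?D g h) = cmp (GC C) (amap th g) (amap th h)" by (rule U.f_cmp[OF gh(1-3)])
  have d': "(amap th g, amap th h) : fdom (GC C) (cyl G C W) w1 w2 w3"
   unfolding fdom_def using gh ac by (simp add: ends)
  note pr = presentsD(2)[OF sg w d']
  let ?f = "F w1 w2 w3 (amap th g) (amap th h)"
  have f: "?f : Ar (AC C)" "src (AC C) ?f = src (GC C) (amap th h)" using pr by auto
  then have ff: "fst ?f = th (snd (snd h))" "src A (snd ?f) = src G (fst (snd h))"
   by (simp_all add: cover_mod_sel cover_gpd_sel amap_def)
  have h: "src G (fst (snd h)) : snd D (snd (snd h))" "snd (snd h) : fst D" "fst (snd h) : Ar G"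
   using gh(2) unfolding Ar_cover by auto
  show "fpull th F w1 w2 w3 g h : Ar (AC D)" "src (AC D) (fpull th F w1 w2 w3 g h) = src ?D h"
   using f(1) ff h unfolding Ar_cover_mod by (auto simp: fpull_def cover_mod_sel cover_gpd_sel)
  have o: "src ?D h : Ob ?D" "src ?D g : Ob ?D" "rng ?D g : Ob ?D" "rng ?D h : Ob ?D" "src ?D (cmp ?D g h) = src ?D h" "rng ?D (cmp ?D g h) = rng ?D g"
   using gh by simp_all
  note eh = eta[OF o(1)] and em = eta[OF o(2)] and eg = eta[OF o(3)]
  note s1 = sl[OF w(1) gh(4)] and s2 = sl[OF w(2) gh(5)] and s3 = sl[OF w(3) gh(6)]
  let ?a = "sg w1 (amap th g)" and ?b = "sg w2 (amap th h)" and ?c = "sg w3 (amap th (cmp ?D g h))"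
  let ?x = "et (rng ?D g)" and ?y = "et (src ?D h)"
  let ?f' = "(th' (snd (snd h)), snd ?f)"
  have f': "?f' : Ar (AC C)" "src (AC C) ?f' = src ?E (ginv ?E ?y)"
   using r(2) f(1) ff h eh unfolding refines_def Ar_cover_mod by (auto simp: cover_mod_sel cover_gpd_sel)
  have fe: "src (AC C) ?f = src ?E ?c" using f(2) s3 o by (simp add: ends)
  have "act (AC C) (ginv (GC C) (prj X (ginv ?E ?y))) ?f = ?f'"
   using eh f(1) ff h unfolding Ar_cover_mod by (simp add: cover_mod_sel cover_gpd_sel)
  then have mv: "cmp ?E (inc X ?f) (ginv ?E ?y) = cmp ?E (ginv ?E ?y) (inc X ?f')"
   using X.move_i[of "ginv ?E ?y" ?f] eh f(1) fe s3 o by simp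
  have "cmp ?E (t w1 g) (t w2 h) = cmp ?E ?x (cmp ?E (cmp ?E ?a ?b) (ginv ?E ?y))"
   unfolding t_def gh(3) using eh em eg s1 s2 gh(3) by simp
  also have "\<dots> = cmp ?E ?x (cmp ?E (cmp ?E ?c (inc X ?f)) (ginv ?E ?y))" using pr ac by simp
  also have "\<dots> = cmp ?E ?x (cmp ?E ?c (cmp ?E (inc X ?f) (ginv ?E ?y)))" using eh eg s3 f(1) fe o by simp
  also have "\<dots> = cmp ?E (t w3 (cmp ?D g h)) (inc X ?f')"
   unfolding t_def mv using eh eg s3 f' o by simp
  finally have "cmp ?E (t w1 g) (t w2 h) = cmp ?E (t w3 (cmp ?D g h)) (inc X ?f')" .
  moreover have "cmp ?D (cmp ?D g h) (idn ?D (src ?D h)) = cmp ?D g h" using gh o by simp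
  ultimately show "cmp (tot (V.pbk X)) (t w1 g, g) (t w2 h, h) =
   cmp (tot (V.pbk X)) (t w3 (cmp ?D g h), cmp ?D g h) (inc (V.pbk X) (fpull th F w1 w2 w3 g h))"
   unfolding V.pull_sel by (simp add: fpull_def cover_mod_sel cover_gpd_sel ff(2))
 qed
 have s1: "presents ?D (AC D) (Ar G) ?V (U.pbk X) (\<lambda>w k. (sg w (amap th k), k)) (fpull th F)"
  using U.presents_pull[OF m(1) sg] unfolding fpull_alt .
 have split: "\<exists>W sg. openin (arr (GC C)) W & h : W & is_lifting (GC C) X W sg" if "h : Ar (GC C)" for h
  using gcoverD[OF cov] presentsD(1)[OF sg] that by blast
 note e1 = U.extension_pull[OF m(1) split] and e2 = V.extension_pull[OF m(1) split]
 have cov': "gcover ?D (Ar G) ?V" by (rule U.gcover_pull[OF cov])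
 show ?thesis
  unfolding ext_pull_presented(2)[OF r(1) cov W(2) P(2)] ext_pull_presented(2)[OF r(2) cov W(2) P(2)]
  by (rule U.K.ext_class_eqI[OF presents_imp_equiv[OF U.K.H.tg U.K.md cov' e1 s1 e2 s2] presents_imp_equiv[OF U.K.H.tg U.K.md cov' e2 s2 e1 s1]])
qed

end

section \<open>Covers indexed by points\<close>

lemma Delta_hom_Pi: "f : Delta_hom k n ==> f : {..k} \<rightarrow> {..n}"
 unfolding Delta_hom_def by (auto simp: PiE_def)

lemma Delta_hom_finite: "finite (Delta_hom k n)"
 by (rule finite_subset[of _ "{..k} \<rightarrow>\<^sub>E {..n}"]) (auto simp: Delta_hom_def finite_PiE)

lemma Delta_hom_comp: "f : Delta_hom k l ==> g : Delta_hom l n ==> compose {..k} g f : Delta_hom k n"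
 unfolding Delta_hom_def by (auto simp: mono_on_def compose_def PiE_def Pi_def)

context nerve_module
begin

lemma smap_compose:
 assumes "z : NT n" "f : Delta_hom k l" "g : Delta_hom l n"
 shows "smap M k n (compose {..k} g f) z = smap M k l f (smap M l n g z)"
 unfolding smap_comp[OF assms(1) Delta_hom_Pi[OF assms(3)] Delta_hom_Pi[OF assms(2)]]
 by (rule smap_cong) (simp add: compose_def)

text \<open>Given a neighbourhood of every point, the points themselves can serve as indices of a finer
 cover, on which the simplicial maps act as they do on points. The set belonging to \<open>z\<close> consists of
 the points whose images under all simplicial maps are close to those of \<open>z\<close>.\<close>

lemma point_scover:
 fixes e :: "('x \<times> (nat => 'g)) set => 'i"
 assumes e: "inj e" and B: "\<And>n z. z : NT n ==> openin (N n) (B n z) & z : B n z"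
 shows "\<exists>(V :: ('x, 'g, 'i) ncov) xi. V : cech_covers M 2 &
  (\<forall>n. \<forall>j\<in>fst (V n). xi j : NT n & snd (V n) j \<subseteq> B n (xi j))"
proof -
 define idx where "idx z = e {z}" for z
 define xi where "xi = the_inv idx"
 have x: "xi (idx z) = z" for z unfolding xi_def idx_def by (rule the_inv_f_f) (use e in \<open>auto simp: inj_def\<close>)
 define B' where "B' n z = {y : NT n. (\<forall>k\<le>3. \<forall>f\<in>Delta_hom k n. smap M k n f y : B k (smap M k n f z)) & y : B n z}" for n z
 define V where "V n = (idx ` NT n, \<lambda>i. B' n (xi i))" for n
 have op: "openin (N n) (B' n z)" if z: "z : NT n" for n z
 proof -
  have "B' n z = ((\<Inter>p\<in>(SIGMA k:{..3}. Delta_hom k n).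
    {y : NT n. smap M (fst p) n (snd p) y : B (fst p) (smap M (fst p) n (snd p) z)}) \<inter> NT n) \<inter> B n z"
   unfolding B'_def by auto
  moreover have "openin (N n) {y : NT n. smap M (fst p) n (snd p) y : B (fst p) (smap M (fst p) n (snd p) z)}"
   if p: "p : (SIGMA k:{..3}. Delta_hom k n)" for p
  proof -
   have f: "snd p : {..fst p} \<rightarrow> {..n}" using p Delta_hom_Pi[of "snd p" "fst p" n] by auto
   show ?thesis by (rule openin_preimage[OF cont_smap[OF f]]) (use B[OF smap_in[OF z f]] in blast)
  qed
  ultimately show ?thesis using B[OF z] Delta_hom_finite by (auto intro!: openin_Int openin_INT)
 qed
 have self: "z : B' n z" if z: "z : NT n" for n z
  unfolding B'_def using z B[OF z] B[OF smap_in[OF z Delta_hom_Pi]] by blast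
 have "osc V"
  unfolding open_scover_def open_cover_def V_def
 proof (intro allI conjI)
  fix n
  have s: "B' n z \<subseteq> NT n" for z unfolding B'_def by blast
  show "\<forall>i\<in>fst (idx ` NT n, \<lambda>i. B' n (xi i)). openin (N n) (snd (idx ` NT n, \<lambda>i. B' n (xi i)) i)"
   using op by (auto simp: x)
  show "(\<Union>i\<in>fst (idx ` NT n, \<lambda>i. B' n (xi i)). snd (idx ` NT n, \<lambda>i. B' n (xi i)) i) = NT n"
   using s self by (auto simp: x)
 qed
 moreover have "admits_simplicial M 3 V"
  unfolding admits_simplicial_def
 proof (intro exI[of _ "\<lambda>k n f i. idx (smap M k n f (xi i))"] conjI allI impI ballI)
  fix k n f i assume kn: "k <= (3::nat)" "n <= (3::nat)" and f: "f : Delta_hom k n" and "i : fst (V n)"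
  then obtain z where z: "z : NT n" "i = idx z" unfolding V_def by auto
  show "idx (smap M k n f (xi i)) : fst (V k)" unfolding V_def z(2) x using smap_in[OF z(1) Delta_hom_Pi[OF f]] by simp
  have "smap M k n f y : B' k (smap M k n f z)" if y: "y : B' n z" for y
  proof -
   have yt: "y : NT n" using y unfolding B'_def by blast
   have "smap M l k g (smap M k n f y) : B l (smap M l k g (smap M k n f z))" if "l <= 3" "g : Delta_hom l k" for l g
    using y that Delta_hom_comp[OF that(2) f] smap_compose[OF yt that(2) f] smap_compose[OF z(1) that(2) f]
    unfolding B'_def by (metis (mono_tags, lifting) mem_Collect_eq)
   then show ?thesis using y kn f smap_in[OF yt Delta_hom_Pi[OF f]] unfolding B'_def by simp
  qed
  then show "smap M k n f ` snd (V n) i \<subseteq> snd (V k) (idx (smap M k n f (xi i)))"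
   unfolding V_def z(2) by (auto simp: x)
 next
  fix n i assume "i : fst (V n)"
  then obtain z where "z : NT n" "i = idx z" unfolding V_def by auto
  then show "idx (smap M n n (\<lambda>j\<in>{..n}. j) (xi i)) = i" using smap_id[of z n] by (simp add: x)
 next
  fix k l n f g i assume fg: "f : Delta_hom k l" "g : Delta_hom l n" and "i : fst (V n)"
  then obtain z where "z : NT n" "i = idx z" unfolding V_def by auto
  then show "idx (smap M k n (compose {..k} g f) (xi i)) = idx (smap M k l f (xi (idx (smap M l n g (xi i)))))"
   using smap_compose[OF _ fg] by (simp add: x)
 qed
 ultimately have "V : cech_covers M 2" unfolding cech_covers_def by (intro CollectI conjI exI[of _ 3]) simp_all
 moreover have "xi j : NT n & snd (V n) j \<subseteq> B n (xi j)" if j: "j : fst (V n)" for n j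
  using j unfolding V_def B'_def by (auto simp: x)
 ultimately show ?thesis by blast
qed

lemma base_open_cover:
 assumes U: "osc U"
 shows "open_cover (obj G) (base_cover U)"
 unfolding open_cover_def
proof
 have c: "cts (obj G) (N 0) pt0"
  unfolding pt0_def[abs_def] by (rule into_N) (use pt_in(1) in \<open>auto simp: pt0_def\<close>)
 have s: "snd (base_cover U) i = {x : Ob G. pt0 x : snd (U 0) i}" if i: "i : fst (U 0)" for i
 proof -
  have "fst z : Ob G" if "z : snd (U 0) i" for z using scoverD(3)[OF U i] that unfolding topspace_N[symmetric] by (auto simp: topspace_N)
  then have "snd (base_cover U) i \<subseteq> Ob G" unfolding base_cover_sel by blast
  then show ?thesis using base_mem[OF U i] by blast
 qed
 show "\<forall>i\<in>fst (base_cover U). openin (obj G) (snd (base_cover U) i)"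
  unfolding base_cover_sel(1) using s openin_preimage[OF c scoverD(1)[OF U]] by simp
 show "(\<Union>i\<in>fst (base_cover U). snd (base_cover U) i) = Ob G"
  unfolding base_cover_sel(1) using s scoverD(2)[OF U pt_in(1)] by auto
qed

lemma cech_coversD: "U : cech_covers M 2 ==> osc U"
 unfolding cech_covers_def by blast

lemma point_cover:
 fixes e :: "('x \<times> (nat => 'g)) set => 'i"
 assumes e: "inj e" and B: "\<And>x. x : Ob G ==> openin (obj G) (B x) & x : B x"
 shows "\<exists>(D :: ('x, 'i) cov) xi. open_cover (obj G) D & (\<forall>j\<in>fst D. xi j : Ob G & snd D j \<subseteq> B (xi j))"
proof -
 let ?B = "\<lambda>n z. if n = 0 then {y : NT n. fst y : B (fst z)} else NT n"
 have "openin (N n) (?B n z) & z : ?B n z" if z: "z : NT n" for n z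
 proof -
  have "fst z : Ob G" using z by (simp add: topspace_N)
  then show ?thesis using B[of "fst z"] z openin_preimage[OF cont_fst_N[of n], of "B (fst z)"] by auto
 qed
 from point_scover[OF e, of ?B, OF this]
 obtain V :: "('x, 'g, 'i) ncov" and xi where V: "V : cech_covers M 2"
  "\<And>n j. j : fst (V n) ==> xi j : NT n & snd (V n) j \<subseteq> ?B n (xi j)" by blast
 have "fst (xi j) : Ob G & snd (base_cover V) j \<subseteq> B (fst (xi j))" if "j : fst (V 0)" for j
  using V(2)[OF that] unfolding base_cover_sel by (auto simp: topspace_N)
 then show ?thesis
  using base_open_cover[OF cech_coversD[OF V(1)]]
  by (intro exI[of _ "base_cover V"] exI[of _ "\<lambda>j. fst (xi j)"]) (simp add: base_cover_sel(1))
qed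

section \<open>The direct system of extension groups\<close>

lemma open_coverD:
 assumes "open_cover T C"
 shows "i : fst C ==> openin T (snd C i)" "x : pts T ==> \<exists>i\<in>fst C. x : snd C i"
 using assms unfolding open_cover_def by blast+

text \<open>Parallel refinements \<open>th, th'\<close> induce the same map on the class of \<open>X\<close> after a refinement so
 fine that over each of its sets the arrows \<open>(th' j, 1, th j)\<close> lift to \<open>X\<close>; such a refinement exists
 because \<open>X\<close> is locally split near the units.\<close>

lemma Ext_dirsys:
 fixes e :: "('x \<times> (nat => 'g)) set => 'i"
 assumes e: "inj e"
 shows "dirsys {C :: ('x, 'i) cov. open_cover (obj G) C} (EG) (ET)"
proof (rule dirsys.intro)
 fix C :: "('x, 'i) cov"
 show "comm_group (EG C)" by (rule cover_ext.ext_group_comm_group[OF cover_ext_any])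
next
 fix C D :: "('x, 'i) cov" and t assume "t : ET C D"
 then show "t : hom (EG C) (EG D)" unfolding ext_trans_def using ext_pull_hom by blast
next
 have "openin (obj G) (Ob G) & x : Ob G" if "x : Ob G" for x using that by simp
 from point_cover[OF e, of "\<lambda>_. Ob G", OF this] show "{C :: ('x, 'i) cov. open_cover (obj G) C} ~= {}" by blast
next
 fix C D :: "('x, 'i) cov" assume "C : {C. open_cover (obj G) C}" "D : {C. open_cover (obj G) C}"
 then have CD: "open_cover (obj G) C" "open_cover (obj G) D" by auto
 obtain c where c: "\<And>x. x : Ob G ==> c x : fst C & x : snd C (c x)" using open_coverD(2)[OF CD(1)] by metis
 obtain d where d: "\<And>x. x : Ob G ==> d x : fst D & x : snd D (d x)" using open_coverD(2)[OF CD(2)] by metis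
 have "openin (obj G) (snd C (c x) \<inter> snd D (d x)) & x : snd C (c x) \<inter> snd D (d x)" if "x : Ob G" for x
  using c[OF that] d[OF that] open_coverD(1)[OF CD(1)] open_coverD(1)[OF CD(2)] by blast
 from point_cover[OF e, of "\<lambda>x. snd C (c x) \<inter> snd D (d x)", OF this]
 obtain D' :: "('x, 'i) cov" and xi where D': "open_cover (obj G) D'"
  "\<And>j. j : fst D' ==> xi j : Ob G & snd D' j \<subseteq> snd C (c (xi j)) \<inter> snd D (d (xi j))" by blast
 then have "refines (\<lambda>j. c (xi j)) D' C" "refines (\<lambda>j. d (xi j)) D' D" using c d unfolding refines_def by blast+
 then show "\<exists>D'\<in>{C. open_cover (obj G) C}. ET C D' ~= {} & ET D D' ~= {}"
  unfolding ext_trans_def using D'(1) by blast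
next
 fix C D D' :: "('x, 'i) cov" and t s assume "t : ET C D" "s : ET D D'"
 then obtain th th' where r: "refines th D C" "t = EP th D" "refines th' D' D" "s = EP th' D'"
  unfolding ext_trans_def by blast
 have "EP (\<lambda>j. th (th' j)) D' : ET C D'"
  unfolding ext_trans_def using refines_comp[OF r(1,3)] by blast
 then show "\<exists>r\<in>ET C D'. \<forall>x\<in>carrier (EG C). r x = s (t x)"
  unfolding r(2,4) using ext_pull_comp[OF r(1,3)] by (intro bexI) auto
next
 fix C D :: "('x, 'i) cov" and t t' P
 assume D: "D : {C. open_cover (obj G) C}" and t: "t : ET C D" "t' : ET C D"
  and P: "P : carrier (EG C)"
 obtain th th' where r: "refines th D C" "t = EP th D" "refines th' D C" "t' = EP th' D"
  using t unfolding ext_trans_def by blast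
 interpret C: cover_ext G A C by (rule cover_ext_any)
 obtain W f where W: "nbhds G W" "class_presented (GC C) (AC C) (Ar G) (cyl G C W) P f"
  using P unfolding C.ext_group_carrier by blast
 note cov = C.gcover_cyl[OF W(1)]
 obtain X where X: "X : P" using C.class_presented_nonempty[OF W(2)] by blast
 obtain sg where s: "presents (GC C) (AC C) (Ar G) (cyl G C W) X sg f"
  using C.class_presented_member(2)[OF W(2) cov X] by blast
 have Dc: "open_cover (obj G) D" using D by simp
 obtain d where d: "\<And>x. x : Ob G ==> d x : fst D & x : snd D (d x)" using open_coverD(2)[OF Dc] by metis
 let ?B = "\<lambda>x. snd D (d x) \<inter> {y : Ob G. idn G y : W (idn G x)}"
 have "openin (obj G) (?B x) & x : ?B x" if x: "x : Ob G" for x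
 proof -
  have w: "openin (arr G) (W (idn G x))" "idn G x : W (idn G x)" using W(1) x unfolding nbhds_def by auto
  have "openin (obj G) {y : Ob G. idn G y : W (idn G x)}" by (rule openin_preimage[OF H.cont_idn[OF cont_id'] w(1)])
  then show ?thesis using d[OF x] x w(2) open_coverD(1)[OF Dc] by auto
 qed
 from point_cover[OF e, of ?B, OF this]
 obtain D' :: "('x, 'i) cov" and xi where D': "open_cover (obj G) D'" "\<And>j. j : fst D' ==> xi j : Ob G & snd D' j \<subseteq> ?B (xi j)" by blast
 let ?rh = "\<lambda>j. d (xi j)"
 have q: "refines ?rh D' D" using D'(2) d unfolding refines_def by blast
 have "EP (\<lambda>j. th (?rh j)) D' P = EP (\<lambda>j. th' (?rh j)) D' P"
 proof (rule parallel_pullbacks[OF refines_comp[OF r(1) q] refines_comp[OF r(3) q] P X])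
  fix j assume j: "j : fst D'"
  then show "is_lifting (GC C) X (cyl G C W (idn G (xi j))) (sg (idn G (xi j)))"
   using presentsD(1)[OF s] D'(2) by simp
  fix x assume x: "x : Ob G" "x : snd D' j"
  then have "x : ?B (xi j)" "?rh j : fst D" using D'(2)[OF j] d by blast+
  then show "(th' (?rh j), idn G x, th (?rh j)) : cyl G C W (idn G (xi j))"
   using r(1,3) x unfolding cyl_def refines_def by (auto simp: Ar_cover)
 qed
 then have "EP ?rh D' (t P) = EP ?rh D' (t' P)"
  unfolding r(2,4) ext_pull_comp[OF r(1) q P] ext_pull_comp[OF r(3) q P] .
 moreover have "EP ?rh D' : ET D D'" unfolding ext_trans_def using q by blast
 ultimately show "\<exists>D'\<in>{C. open_cover (obj G) C}. \<exists>s\<in>ET D D'. s (t P) = s (t' P)" using D'(1) by blast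
qed

section \<open>Refinement of covers of the nerve\<close>

lemma Phi_member:
 assumes U: "osc U" and P: "P : EL U" and c: "c : Phi U P"
 shows "Ucls U P (fc U c)" "c : carrier (ZZ U 2)"
proof -
 interpret C: cover_ext G A "base_cover U" by (rule cover_ext_base)
 obtain f where f: "Ucls U P f"
  using P ext_lifting_presented[OF U] by blast
 obtain X sg where X: "X : P" "LF U X sg" "IC U X sg c" using c unfolding Phi_def by blast
 show "Ucls U P (fc U c)"
  unfolding class_presented_def
  using C.class_presented_member[OF f gcover_edge[OF U] X(1)] cocycle_imp_presents[OF U X(2,3)] by blast
 show "c : carrier (ZZ U 2)" using X(3) unfolding is_ext_cocycle_alt by blast
qed

text \<open>Indices of the refined cover, seen in the coarser one.\<close>

definition lamr :: "(nat => 'j => 'i) => nat => (nat set => 'j) => nat set => 'i" where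
 "lamr th n ka = (\<lambda>s\<in>faces n. th (sdim s) (ka s))"

context
 fixes th :: "nat => 'j => 'i" and U V
 assumes r: "\<And>m. refines (th m) (V m) (U m)" and U: "osc U" and V: "osc V"
begin

lemma lamr_in: "ka : Lam V n ==> lamr th n ka : Lam U n"
 using r unfolding Lam_def lamr_def refines_def by (auto simp: PiE_iff)

lemma Ulam_lamr: "ka : Lam V n ==> z : UL V n ka ==> z : UL U n (lamr th n ka)"
 using r unfolding Ulam_def Lam_def refines_def by (auto simp: PiE_iff lamr_def) blast

lemma refines_base: "refines (th 0) (base_cover V) (base_cover U)"
 using r[of 0] unfolding refines_def base_cover_sel by blast

lemma edge_set_lamr: "ka : Lam V 1 ==> ES V ka \<subseteq> {k : Ar (CH V). amap (th 0) k : ES U (lamr th 1 ka)}"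
proof
 fix p assume k: "ka : Lam V 1" and p: "p : ES V ka"
 have "fst (snd p) : Ar G" "p = (ka {0}, fst (snd p), ka {Suc 0})" "pt1 (fst (snd p)) : UL V 1 ka"
  using p unfolding edge_set_iff by blast+
 moreover have "lamr th 1 ka {0} = th 0 (ka {0})" "lamr th 1 ka {Suc 0} = th 0 (ka {Suc 0})" by (simp_all add: lamr_def)
 ultimately have "amap (th 0) p : ES U (lamr th 1 ka)"
  unfolding edge_set_iff amap_def using Ulam_lamr[OF k] by (metis fst_conv snd_conv)
 then show "p : {k : Ar (CH V). amap (th 0) k : ES U (lamr th 1 ka)}" using edge_set_sub[OF V k] p by blast
qed

lemma edge_lamr:
 assumes "ka : Lam V 2" "i < j" "j <= 2"
 shows "lamr th 1 (edge i j ka) = edge i j (lamr th 2 ka)"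
proof (rule Lam_1_eqI[OF lamr_in[OF Lam_edge[OF assms]] Lam_edge[OF lamr_in[OF assms(1)] assms(2,3)]])
 show "lamr th 1 (edge i j ka) {0, Suc 0} = edge i j (lamr th 2 ka) {0, Suc 0}"
  using assms sdim_pair[of 0 "Suc 0"] sdim_pair[of i j] by (simp add: lamr_def)
qed (use assms in \<open>simp_all add: lamr_def\<close>)

lemma arw_lamr: "i <= n ==> j <= n ==> amap (th 0) (arw ka z i j) = arw (lamr th n ka) z i j"
 by (simp add: arw_def amap_def lamr_def)

text \<open>Restriction acts trivially on coefficients, and it sends edges to edges.\<close>

lemma cochain_pull_cval:
 assumes c: "c : carrier (ZZ U 2)"
 shows "cochain_pull M S th U V 2 c = cval V (\<lambda>w1 w2 w3. fpull (th 0) (fc U c) (lamr th 1 w1) (lamr th 1 w2) (lamr th 1 w3))"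
 unfolding cochain_pull_def cval_def Let_def pull_mod lamr_def[symmetric]
proof (intro restrict_ext)
 fix ka z assume k: "ka : Lam V 2" and z: "z : UL V 2 ka"
 let ?mu = "lamr th 2 ka"
 have m: "?mu : Lam U 2" "z : UL U 2 ?mu" using lamr_in[OF k] Ulam_lamr[OF k z] by auto
 have zt: "z : NT 2" using z Ulam_sub by blast
 have cc: "c : carrier (CC U 2)" using c unfolding cocycles_carrier by blast
 note sc = sec_D[OF Ulam_sub cochain_at[OF cc m(1)] m(2)]
 have "act A (gap z 2 ((\<lambda>j\<in>{..2}. j) 2)) (c ?mu (smap M 2 2 (\<lambda>j\<in>{..2}. j) z)) = c ?mu z"
  using smap_id[OF zt, of "\<lambda>j\<in>{..2}. j"] sc vertex_in[OF zt, of 2] by simp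
 also have "\<dots> = snd (fval (fc U c) ?mu z)"
  using fc_eq[OF U c m] by simp
 also have "\<dots> = snd (fpull (th 0) (fc U c) (lamr th 1 (edge 0 1 ka)) (lamr th 1 (edge 1 2 ka)) (lamr th 1 (edge 0 2 ka))
   (arw ka z 0 1) (arw ka z 1 2))"
  unfolding fpull_def using edge_lamr[OF k, of 0 1] edge_lamr[OF k, of 1 2] edge_lamr[OF k, of 0 2]
  by (simp add: arw_lamr[where n = 2])
 finally show "act A (gap z 2 ((\<lambda>j\<in>{..2}. j) 2)) (c ?mu (smap M 2 2 (\<lambda>j\<in>{..2}. j) z)) =
  snd (fpull (th 0) (fc U c) (lamr th 1 (edge 0 1 ka)) (lamr th 1 (edge 1 2 ka)) (lamr th 1 (edge 0 2 ka)) (arw ka z 0 1) (arw ka z 1 2))" .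
qed

lemma Phi_natural:
 assumes P: "P : EL U"
 shows "EP (th 0) (base_cover V) P : EL V"
  "(\<Union>c\<in>Phi U P. CL V 2 (cochain_pull M S th U V 2 c)) = Phi V (EP (th 0) (base_cover V) P)"
proof -
 interpret C: cover_ext G A "base_cover V" by (rule cover_ext_base)
 let ?P = "EP (th 0) (base_cover V) P"
 have pr: "Ucls V ?P
   (\<lambda>w1 w2 w3. fpull (th 0) f (lamr th 1 w1) (lamr th 1 w2) (lamr th 1 w3))"
  if f: "Ucls U P f" for f
  by (rule C.class_presented_mono[OF ext_pull_presented(1)[OF refines_base gcover_edge[OF U] f]])
   (use lamr_in edge_set_lamr in blast)
 obtain f where f: "Ucls U P f"
  using P ext_lifting_presented[OF U] by blast
 show "?P : EL V" unfolding ext_lifting_presented[OF V] using pr[OF f] by blast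
 have "CL V 2 (cochain_pull M S th U V 2 c) = Phi V ?P" if c: "c : Phi U P" for c
  using Phi_presented(1)[OF V pr[OF Phi_member(1)[OF U P c]]] cochain_pull_cval[OF Phi_member(2)[OF U P c]] by simp
 moreover have "Phi U P ~= {}"
 proof -
  interpret Z: comm_group "ZZ U 2" by (rule cocycles_group)
  show ?thesis
   unfolding Phi_presented(1)[OF U f] cohom_class_def
   using Z.rcos_self[OF Phi_presented(2)[OF U f] coboundaries_subgroup[OF U]] by blast
 qed
 ultimately show "(\<Union>c\<in>Phi U P. CL V 2 (cochain_pull M S th U V 2 c)) = Phi V ?P" by simp
qed

end

text \<open>If \<open>V\<close> is simplicial and refines \<open>U\<close>, then the degenerate edges of \<open>V\<close> provide indices of \<open>U\<close>
 over which the unit arrows \<open>(rh' j, 1, rh j)\<close> lift. Hence all refinement maps of base covers agree on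
 \<open>ext_lifting\<close>.\<close>

lemma simplicial_parallel:
 assumes U: "osc U" and V: "V : cech_covers M 2" and r: "\<And>m. refines (th m) (V m) (U m)"
  and q: "refines rh (base_cover V) (base_cover U)" "refines rh' (base_cover V) (base_cover U)"
  and P: "P : EL U"
 shows "EP rh (base_cover V) P = EP rh' (base_cover V) P"
proof -
 obtain X sg where X: "X : P" "LF U X sg" and Pc: "P : carrier (EG (base_cover U))"
  using P unfolding ext_lifting_def by blast
 have Vo: "osc V" by (rule cech_coversD[OF V])
 obtain K where "K >= 2 + 1" "admits_simplicial M K V" using V unfolding cech_covers_def by blast
 then have K: "K >= 1" and ad: "admits_simplicial M K V" by auto
 obtain ta where t: "\<forall>k\<le>K. \<forall>n\<le>K. \<forall>f\<in>Delta_hom k n. \<forall>i\<in>fst (V n).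
   ta k n f i : fst (V k) & smap M k n f ` snd (V n) i \<subseteq> snd (V k) (ta k n f i)"
  using ad unfolding admits_simplicial_def by (elim exE conjE) (rule that)
 define d :: "nat => nat" where "d = (\<lambda>j\<in>{..1}. 0)"
 have d: "d : Delta_hom 1 0" unfolding d_def Delta_hom_def by (auto simp: mono_on_def)
 define e where "e j = th 1 (ta 1 0 d j)" for j
 have e: "e j : fst (U 1)" "x : Ob G ==> x : snd (base_cover V) j ==> pt1 (idn G x) : snd (U 1) (e j)" if j: "j : fst (V 0)" for j x
 proof -
  note t = t[rule_format, OF K le0 d j]
  show "e j : fst (U 1)" using t r[of 1] unfolding e_def refines_def by simp
  assume x: "x : Ob G" "x : snd (base_cover V) j"
  then have "pt0 x : snd (V 0) j" using base_mem[OF Vo j] by simp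
  moreover have "smap M 1 0 d (pt0 x) = pt1 (idn G x)"
   using smap_1[OF pt_in(1)[OF x(1)], of d] x(1) by (simp add: d_def pt0_def vertex.simps(1))
  ultimately have "pt1 (idn G x) : snd (V 1) (ta 1 0 d j)" using t by force
  then show "pt1 (idn G x) : snd (U 1) (e j)" using t r[of 1] unfolding e_def refines_def by auto
 qed
 let ?k = "\<lambda>j. kk (rh' j) (e j) (rh j)"
 show ?thesis
 proof (rule parallel_pullbacks[OF q Pc X(1)])
  fix j assume "j : fst (base_cover V)"
  then have j: "j : fst (V 0)" by (simp add: base_cover_sel)
  then have in0: "rh j : fst (U 0)" "rh' j : fst (U 0)" using q unfolding refines_def base_cover_sel by auto
  show "is_lifting (CH U) X (ES U (?k j)) (sg (?k j))"
   using X(2) kk_in[OF in0(2,1) e(1)[OF j]] unfolding is_lifting_family_def by blast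
  fix x assume x: "x : Ob G" "x : snd (base_cover V) j"
  have "(rh' j, idn G x, rh j) : Ar (CH U)"
   using q x j unfolding refines_def Ar_cover by (auto simp: base_cover_sel(1))
  from kk_edge_set[OF U this, of "e j"] show "(rh' j, idn G x, rh j) : ES U (?k j)" using e(2)[OF j x] by simp
 qed
qed

section \<open>Comparison of the direct limits\<close>

lemma refining_scover:
 fixes e :: "('x \<times> (nat => 'g)) set => 'i" and U :: "('x, 'g, 'i) ncov"
 assumes e: "inj e" and U: "osc U" and B: "\<And>n z. z : NT n ==> openin (N n) (B n z) & z : B n z"
 shows "\<exists>(V :: ('x, 'g, 'i) ncov) th xi. V : cech_covers M 2 & (\<forall>m. refines (th m) (V m) (U m)) &
  (\<forall>n. \<forall>j\<in>fst (V n). xi j : NT n & snd (V n) j \<subseteq> B n (xi j))"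
proof -
 have "\<forall>n z. \<exists>i. z : NT n --> i : fst (U n) & z : snd (U n) i" using scoverD(2)[OF U] by blast
 then obtain i where i: "\<And>n z. z : NT n ==> i n z : fst (U n) & z : snd (U n) (i n z)" by metis
 have "openin (N n) (B n z \<inter> snd (U n) (i n z)) & z : B n z \<inter> snd (U n) (i n z)" if z: "z : NT n" for n z
  using B[OF z] i[OF z] scoverD(1)[OF U] by blast
 from point_scover[OF e, of "\<lambda>n z. B n z \<inter> snd (U n) (i n z)", OF this]
 obtain V :: "('x, 'g, 'i) ncov" and xi where V: "V : cech_covers M 2"
  "\<And>n j. j : fst (V n) ==> xi j : NT n & snd (V n) j \<subseteq> B n (xi j) \<inter> snd (U n) (i n (xi j))" by blast
 have "refines (\<lambda>j. i m (xi j)) (V m) (U m)" for m unfolding refines_def using V(2) i by blast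
 then show ?thesis
  by (intro exI[of _ V] exI[of _ "\<lambda>m j. i m (xi j)"] exI[of _ xi]) (use V in \<open>simp add: V(2)\<close>)
qed

lemma cohom_trans_nonempty: "CT U V ~= {} \<longleftrightarrow> (\<exists>th. \<forall>m. refines (th m) (V m) (U m))"
 unfolding cohom_trans_def by auto

text \<open>Both cofinality conditions are met by point-indexed covers. For an extension the neighbourhoods
 of arrows are those over which it is split, so that it acquires liftings over the edges of the
 cover.\<close>

lemma comparison:
 fixes e :: "('x \<times> (nat => 'g)) set => 'i"
 assumes e: "inj e"
 shows "colim_comparison {C :: ('x, 'i) cov. open_cover (obj G) C} (EG) (ET)
  (cech_covers M 2) (\<lambda>U. cohomology M S U 2) (CT) base_cover (EL) Phi"
proof (rule colim_comparison.intro[OF Ext_dirsys[OF e]], rule colim_comparison_axioms.intro)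
 fix U :: "('x, 'g, 'i) ncov" assume "U : cech_covers M 2"
 then have U: "osc U" by (rule cech_coversD)
 show "comm_group (cohomology M S U 2)" by (rule cohomology_comm_group[OF U])
 show "base_cover U : {C. open_cover (obj G) C}" using base_open_cover[OF U] by simp
 show "subgroup (EL U) (EG (base_cover U))" by (rule ext_lifting_subgroup[OF U])
 show "Phi U : iso ((EG (base_cover U))\<lparr>carrier := EL U\<rparr>) (cohomology M S U 2)"
  by (rule Phi_iso[OF U])
next
 fix U V :: "('x, 'g, 'i) ncov" and q
 assume "U : cech_covers M 2" "V : cech_covers M 2" and q: "q : CT U V"
 then have UV: "osc U" "osc V" using cech_coversD by auto
 obtain th where th: "\<And>m. refines (th m) (V m) (U m)" "q = (\<lambda>X. \<Union>c\<in>X. CL V 2 (cochain_pull M S th U V 2 c))"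
  using q unfolding cohom_trans_def by blast
 have "EP (th 0) (base_cover V) : ET (base_cover U) (base_cover V)"
  unfolding ext_trans_def using refines_base[OF th(1) UV] by blast
 then show "\<exists>t\<in>ET (base_cover U) (base_cover V). \<forall>P\<in>EL U. t P : EL V & q (Phi U P) = Phi V (t P)"
  unfolding th(2) using Phi_natural[OF th(1) UV] by (intro bexI) auto
next
 have "openin (N n) (NT n) & z : NT n" if "z : NT n" for n z using that by simp
 from point_scover[OF e, of "\<lambda>n z. NT n", OF this]
 show "(cech_covers M 2 :: (('x, 'g, 'i) ncov) set) ~= {}" by blast
next
 fix U V :: "('x, 'g, 'i) ncov"
 assume "U : cech_covers M 2" "V : cech_covers M 2"
 then have UV: "osc U" "osc V" using cech_coversD by auto
 have "\<forall>n z. \<exists>i. z : NT n --> i : fst (V n) & z : snd (V n) i" using scoverD(2)[OF UV(2)] by blast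
 then obtain i where i: "\<And>n z. z : NT n ==> i n z : fst (V n) & z : snd (V n) (i n z)" by metis
 have nb: "openin (N n) (snd (V n) (i n z)) & z : snd (V n) (i n z)" if z: "z : NT n" for n z
  using i[OF z] scoverD(1)[OF UV(2)] by blast
 obtain W :: "('x, 'g, 'i) ncov" and th xi where W: "W : cech_covers M 2" "\<forall>m. refines (th m) (W m) (U m)"
  "\<And>n j. j : fst (W n) ==> xi j : NT n & snd (W n) j \<subseteq> snd (V n) (i n (xi j))"
  using refining_scover[OF e UV(1), of "\<lambda>n z. snd (V n) (i n z)", OF nb] by blast
 have "refines (\<lambda>j. i m (xi j)) (W m) (V m)" for m unfolding refines_def using W(3) i by blast
 then have "\<exists>th. \<forall>m. refines (th m) (W m) (V m)" by (intro exI[of _ "\<lambda>m j. i m (xi j)"]) simp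
 moreover have "\<exists>th. \<forall>m. refines (th m) (W m) (U m)" using W(2) by (rule exI[of _ th])
 ultimately show "\<exists>W\<in>cech_covers M 2. CT U W ~= {} & CT V W ~= {}"
  unfolding cohom_trans_nonempty using W(1) by blast
next
 fix U V W :: "('x, 'g, 'i) ncov"
 assume "CT U V ~= {}" "CT V W ~= {}"
 then obtain th th' where "\<forall>m. refines (th m) (V m) (U m)" "\<forall>m. refines (th' m) (W m) (V m)" unfolding cohom_trans_nonempty by (elim exE)
 then have "refines (\<lambda>j. th m (th' m j)) (W m) (U m)" for m using refines_comp by blast
 then show "CT U W ~= {}"
  unfolding cohom_trans_nonempty by (intro exI[of _ "\<lambda>m j. th m (th' m j)"]) simp
next
 fix U V :: "('x, 'g, 'i) ncov" and t t' P
 assume U: "U : cech_covers M 2" and V: "V : cech_covers M 2" and q: "CT U V ~= {}"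
  and t: "t : ET (base_cover U) (base_cover V)" "t' : ET (base_cover U) (base_cover V)"
  and P: "P : EL U"
 obtain th where "\<forall>m. refines (th m) (V m) (U m)" using q unfolding cohom_trans_nonempty by (elim exE)
 then have th: "refines (th m) (V m) (U m)" for m by (rule spec)
 show "t P = t' P" using t simplicial_parallel[OF cech_coversD[OF U] V th _ _ P] unfolding ext_trans_def by blast
next
 fix C :: "('x, 'i) cov" and P assume "C : {C. open_cover (obj G) C}" and P: "P : carrier (EG C)"
 then have C: "open_cover (obj G) C" by simp
 obtain W f where W: "nbhds G W" "class_presented (GC C) (AC C) (Ar G) (cyl G C W) P f"
  using P unfolding cover_ext.ext_group_carrier[OF cover_ext_any] by blast
 obtain c where c: "\<And>x. x : Ob G ==> c x : fst C & x : snd C (c x)" using open_coverD(2)[OF C] by metis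
 let ?B = "\<lambda>n z. if n = 0 then {y : NT n. fst y : snd C (c (fst z))}
   else if n = 1 then {y : NT n. snd y 1 : W (snd z 1)} else NT n"
 have "openin (N n) (?B n z) & z : ?B n z" if z: "z : NT n" for n z
 proof -
  have x: "fst z : Ob G" using z by (simp add: topspace_N)
  have "openin (N n) {y : NT n. fst y : snd C (c (fst z))}"
   by (rule openin_preimage[OF cont_fst_N]) (use c[OF x] open_coverD(1)[OF C] in blast)
  moreover have "openin (N n) {y : NT n. snd y 1 : W (snd z 1)} & snd z 1 : W (snd z 1)" if n: "n = 1"
  proof
   have "snd z 1 : Ar G" using snd_N[OF z, of 1] n by simp
   then have w: "openin (arr G) (W (snd z 1))" "snd z 1 : W (snd z 1)" using W(1) unfolding nbhds_def by auto
   show "openin (N n) {y : NT n. snd y 1 : W (snd z 1)}"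
    by (rule openin_preimage[OF cont_snd_N w(1)]) (simp add: n)
   show "snd z 1 : W (snd z 1)" by (rule w(2))
  qed
  ultimately show ?thesis using c[OF x] z by auto
 qed
 from point_scover[OF e, of ?B, OF this]
 obtain V :: "('x, 'g, 'i) ncov" and xi where V: "V : cech_covers M 2"
  "\<And>n j. j : fst (V n) ==> xi j : NT n & snd (V n) j \<subseteq> ?B n (xi j)" by blast
 note Vo = cech_coversD[OF V(1)]
 let ?rh = "\<lambda>j. c (fst (xi j))"
 have q: "refines ?rh (base_cover V) C"
  unfolding refines_def base_cover_sel
 proof (intro ballI conjI subsetI)
  fix j assume j: "j : fst (V 0)"
  show "?rh j : fst C" using V(2)[OF j] c by (simp add: topspace_N)
  show "x : snd C (?rh j)" if "x : fst ` snd (V 0) j" for x using V(2)[OF j] that by auto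
 qed
 interpret D: cover_ext G A "base_cover V" by (rule cover_ext_any)
 have "Ucls V (EP ?rh (base_cover V) P)
   (\<lambda>w1 w2 w3. fpull ?rh f (snd (xi (w1 {0, Suc 0})) 1) (snd (xi (w2 {0, Suc 0})) 1) (snd (xi (w3 {0, Suc 0})) 1))"
 proof (rule D.class_presented_mono[OF pull_cyl_presented[OF q W], of "Lam V 1" "\<lambda>w. snd (xi (w {0, Suc 0})) 1"])
  fix ka assume k: "ka : Lam V 1"
  then have j: "ka {0, Suc 0} : fst (V 1)" using Lam_1_in by blast
  have "ES V ka \<subseteq> cyl G (base_cover V) W (snd (xi (ka {0, Suc 0})) 1)"
  proof
   fix p assume p: "p : ES V ka"
   then have "pt1 (fst (snd p)) : snd (V 1) (ka {0, Suc 0})" using edge_setD by blast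
   then have "snd (pt1 (fst (snd p))) 1 : W (snd (xi (ka {0, Suc 0})) 1)" using V(2)[OF j] by auto
   then show "p : cyl G (base_cover V) W (snd (xi (ka {0, Suc 0})) 1)"
    unfolding cyl_def using edge_set_sub[OF Vo k] p by (auto simp: pt1_def)
  qed
  then show "snd (xi (ka {0, Suc 0})) 1 : Ar G & ES V ka \<subseteq> cyl G (base_cover V) W (snd (xi (ka {0, Suc 0})) 1)"
   using V(2)[OF j] snd_N[of "xi (ka {0, Suc 0})" 1 1] by simp
 qed
 then have "EP ?rh (base_cover V) P : EL V" using ext_lifting_presented[OF Vo] by blast
 moreover have "EP ?rh (base_cover V) : ET C (base_cover V)" unfolding ext_trans_def using q by blast
 ultimately show "\<exists>V\<in>cech_covers M 2. \<exists>t\<in>ET C (base_cover V). t P : EL V" using V(1) by blast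
next
 fix U :: "('x, 'g, 'i) ncov" and C :: "('x, 'i) cov"
 assume U: "U : cech_covers M 2" and "C : {C. open_cover (obj G) C}"
 then have C: "open_cover (obj G) C" by simp
 obtain c where c: "\<And>x. x : Ob G ==> c x : fst C & x : snd C (c x)" using open_coverD(2)[OF C] by metis
 let ?B = "\<lambda>n z. {y : NT n. fst y : snd C (c (fst z))}"
 have nb: "openin (N n) (?B n z) & z : ?B n z" if z: "z : NT n" for n z
 proof -
  have x: "fst z : Ob G" using z by (simp add: topspace_N)
  have "openin (N n) (?B n z)"
   by (rule openin_preimage[OF cont_fst_N]) (use c[OF x] open_coverD(1)[OF C] in blast)
  then show ?thesis using c[OF x] z by simp
 qed
 obtain V :: "('x, 'g, 'i) ncov" and th xi where V: "V : cech_covers M 2" "\<forall>m. refines (th m) (V m) (U m)"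
  "\<And>n j. j : fst (V n) ==> xi j : NT n & snd (V n) j \<subseteq> ?B n (xi j)"
  using refining_scover[OF e cech_coversD[OF U], of ?B, OF nb] by blast
 have "refines (\<lambda>j. c (fst (xi j))) (base_cover V) C"
  unfolding refines_def base_cover_sel
 proof (intro ballI conjI subsetI)
  fix j assume j: "j : fst (V 0)"
  show "c (fst (xi j)) : fst C" using V(3)[OF j] c by (simp add: topspace_N)
  show "x : snd C (c (fst (xi j)))" if "x : fst ` snd (V 0) j" for x using V(3)[OF j] that by auto
 qed
 then have "ET C (base_cover V) ~= {}" unfolding ext_trans_def by blast
 moreover have "\<exists>th. \<forall>m. refines (th m) (V m) (U m)" using V(2) by (rule exI[of _ th])
 ultimately show "\<exists>V\<in>cech_covers M 2. CT U V ~= {} & ET C (base_cover V) ~= {}"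
  unfolding cohom_trans_nonempty using V(1) by blast
qed

end

theorem proposition5p6:
  fixes G :: "('x, 'g) topgpd" and A :: "('x, 'a, 'g) gmod"
  assumes "topological_groupoid G" and "G_module G A"
  shows "\<exists>\<Phi> :: (nat \<Rightarrow> ('x \<times> (nat \<Rightarrow> 'g), 'i) cov) \<Rightarrow> ('x, 'a, 'g, 'i) cover_extn set
                \<Rightarrow> ((nat set \<Rightarrow> 'i) \<Rightarrow> 'x \<times> (nat \<Rightarrow> 'g) \<Rightarrow> 'a) set.
    (\<forall>U. open_scover (nerve G) U \<longrightarrow>
       comm_group (ext_group G A (base_cover U)) \<and>
       subgroup (ext_lifting G A U) (ext_group G A (base_cover U)) \<and>
       comm_group (cohomology (nerve G) (mod_sheaf G A) U 2) \<and>
       \<Phi> U \<in> iso ((ext_group G A (base_cover U))\<lparr>carrier := ext_lifting G A U\<rparr>)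
                 (cohomology (nerve G) (mod_sheaf G A) U 2) \<and>
       (\<forall>P\<in>ext_lifting G A U. \<forall>X\<in>P. \<forall>\<sigma>. is_lifting_family G U X \<sigma> \<longrightarrow>
          (\<exists>c. is_ext_cocycle G A U X \<sigma> c \<and>
               \<Phi> U P = cohom_class (nerve G) (mod_sheaf G A) U 2 c))) \<and>
    (infinite (UNIV :: 'i set) \<and> (\<exists>e :: ('x \<times> (nat \<Rightarrow> 'g)) set \<Rightarrow> 'i. inj e) \<longrightarrow>
       comm_group (Ext_group G A :: (('x, 'i) cov \<times> ('x, 'a, 'g, 'i) cover_extn set) set monoid) \<and>
       comm_group (cech_group (nerve G) (mod_sheaf G A) 2 ::
         ((nat \<Rightarrow> ('x \<times> (nat \<Rightarrow> 'g), 'i) cov) \<times>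
          ((nat set \<Rightarrow> 'i) \<Rightarrow> 'x \<times> (nat \<Rightarrow> 'g) \<Rightarrow> 'a) set) set monoid) \<and>
       (\<exists>\<Psi> \<in> iso (Ext_group G A) (cech_group (nerve G) (mod_sheaf G A) 2).
          \<forall>U\<in>cech_covers (nerve G) 2. \<forall>P\<in>ext_lifting G A U.
            \<Psi> (Ext_class G A (base_cover U) P) =
              cech_class (nerve G) (mod_sheaf G A) 2 U (\<Phi> U P)))"
proof -
 interpret nerve_module G A using assms by unfold_locales
 show ?thesis
 proof (intro exI[of _ Phi] conjI allI impI)
  fix U :: "('x, 'g, 'i) ncov" assume U: "osc U"
  show "comm_group (EG (base_cover U))" by (rule cover_ext.ext_group_comm_group[OF cover_ext_any])
  show "subgroup (EL U) (EG (base_cover U))" by (rule ext_lifting_subgroup[OF U])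
  show "comm_group (cohomology M S U 2)" by (rule cohomology_comm_group[OF U])
  show "Phi U : iso ((EG (base_cover U))\<lparr>carrier := EL U\<rparr>) (cohomology M S U 2)"
   by (rule Phi_iso[OF U])
  show "\<forall>P\<in>EL U. \<forall>X\<in>P. \<forall>sg. LF U X sg -->
   (\<exists>c. IC U X sg c & Phi U P = CL U 2 c)"
   using Phi_canonical[OF U] by blast
 next
  assume "infinite (UNIV :: 'i set) & (\<exists>e :: ('x \<times> (nat => 'g)) set => 'i. inj e)"
  then obtain e :: "('x \<times> (nat => 'g)) set => 'i" where e: "inj e" by blast
  interpret c: colim_comparison "{C :: ('x, 'i) cov. open_cover (obj G) C}" "EG" "ET"
   "cech_covers M 2" "\<lambda>U. cohomology M S U 2" "CT" base_cover "EL" Phi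
   by (rule comparison[OF e])
  show "comm_group (Ext_group G A :: (('x, 'i) cov \<times> ('x, 'a, 'g, 'i) cover_extn set) set monoid)"
   unfolding Ext_group_def by (rule c.X.colim_comm_group)
  show "comm_group (cech_group M S 2 :: ((('x, 'g, 'i) ncov) \<times>
     ((nat set => 'i) => 'x \<times> (nat => 'g) => 'a) set) set monoid)"
   unfolding cech_group_def by (rule c.Y.colim_comm_group)
  show "\<exists>\<Psi> \<in> iso (Ext_group G A) (cech_group M S 2). \<forall>U\<in>(cech_covers M 2 :: (('x, 'g, 'i) ncov) set). \<forall>P\<in>EL U.
   \<Psi> (Ext_class G A (base_cover U) P) = cech_class M S 2 U (Phi U P)"
   unfolding Ext_group_def cech_group_def Ext_class_def cech_class_def by (rule c.comparison_iso)
 qed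
qed

end
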